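(* Let $M\subset\mathbb{C}^{n+1}$, $n\ge3$, be a real smooth hypersurface and $p_0\in M$, and suppose the Levi form of $M$ at $p_0$ has rank $n-1$ and is semidefinite. Then there are local holomorphic coordinates $(z,w)\in\mathbb{C}^n\times\mathbb{C}$ near $p_0$, vanishing at $p_0$, in which $M$ is defined by precisely one of the following (with exactly one admissible $\lambda$), where $F(z,\bar z,\operatorname{Re}w)$ is a smooth real function of weighted order $O(4)$: (i) for $\lambda=(1,\lambda_2,\dots,\lambda_{n-2},0)$ with $1\ge\lambda_2\ge\dots\ge\lambda_{n-2}\ge0$, or $\lambda=0$: $\operatorname{Im} w=\sum_{k=1}^{n-1}|z^k|^2+2\operatorname{Re}\big(\bar z^n(\sum_{k=1}^{n-1}\lambda_k(z^k)^2+2z^{n-1}z^n)\big)+F$; (ii) for $\lambda=(1,\lambda_2,\dots,\lambda_{n-1})$ with $1\ge\lambda_2\ge\dots\ge\lambda_{n-1}\ge0$, or $\lambda=0$: $\operatorname{Im} w=\sum_{k=1}^{n-1}|z^k|^2+2\operatorname{Re}\big(\bar z^n\sum_{k=1}^{n-1}\lambda_k(z^k)^2\big)+F$; (iii) for $\lambda=(1,\lambda_2,\dots,\lambda_{n-1})$ with $1\ge\lambda_2\ge\dots\ge\lambda_{n-1}\ge0$, or $\lambda=0$: $\operatorname{Im} w=\sum_{k=1}^{n-1}|z^k|^2+2\operatorname{Re}\big(\bar z^n(\sum_{k=1}^{n-1}\lambda_k(z^k)^2+(z^n)^2)\big)+F$. For $n=2$ the same holds with the modifications: in (i) only $\lambda=0$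 is allowed; in (ii) and (iii) $\lambda\in\{0,1\}$.
   Context: Semidefinite: all nonzero eigenvalues of the Levi form have the same sign. Weights: $z,\bar z$ weight one, $w,\operatorname{Re}w$ weight two; $O(4)$ means the Taylor series at $0$ contains only terms of weighted degree $\ge4$. *)

theory Defs
  imports "HOL-Analysis.Analysis"
begin

definition cmul :: "complex \<Rightarrow> (complex^'n) \<times> complex \<Rightarrow> (complex^'n) \<times> complex" where
  "cmul c q = ((\<chi> j. c * (fst q) $ j), c * snd q)"

definition ddir :: "'a::real_normed_vector \<Rightarrow> ('a \<Rightarrow> 'b::real_normed_vector) \<Rightarrow> 'a \<Rightarrow> 'b" where
  "ddir v f x = frechet_derivative f (at x) v"

fun pderivs :: "'a::real_normed_vector list \<Rightarrow> ('a \<Rightarrow> 'b::real_normed_vector) \<Rightarrow> 'a \<Rightarrow> 'b" where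
  "pderivs [] f = f"
| "pderivs (v # vs) f = ddir v (pderivs vs f)"

definition smooth_on :: "'a::euclidean_space set \<Rightarrow> ('a \<Rightarrow> 'b::real_normed_vector) \<Rightarrow> bool" where
  "smooth_on S f \<longleftrightarrow> (\<forall>vs. set vs \<subseteq> Basis \<longrightarrow> pderivs vs f differentiable_on S)"

definition local_defining_fn ::
  "((complex^'n) \<times> complex) set \<Rightarrow> ((complex^'n) \<times> complex) \<Rightarrow> ((complex^'n) \<times> complex) set
   \<Rightarrow> ((complex^'n) \<times> complex \<Rightarrow> real) \<Rightarrow> bool" where
  "local_defining_fn M p U \<rho> \<longleftrightarrow> open U \<and> p \<in> U \<and> smooth_on U \<rho> \<and>
     (\<forall>q\<in>U. frechet_derivative \<rho> (at q) \<noteq> (\<lambda>v. 0)) \<and>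
     M \<inter> U = {q\<in>U. \<rho> q = 0}"

definition real_hypersurface :: "((complex^'n) \<times> complex) set \<Rightarrow> bool" where
  "real_hypersurface M \<longleftrightarrow> (\<forall>p\<in>M. \<exists>U \<rho>. local_defining_fn M p U \<rho>)"

text \<open>Complex tangent space and Levi form (Hermitian form \<open>\<Sum> \<rho>_{j k-bar} v_j conj(u_k)\<close>,
  written via the real Hessian B of \<rho>).\<close>
definition cplx_tangent :: "((complex^'n) \<times> complex \<Rightarrow> real) \<Rightarrow> (complex^'n) \<times> complex
   \<Rightarrow> ((complex^'n) \<times> complex) set" where
  "cplx_tangent \<rho> p = {v. frechet_derivative \<rho> (at p) v = 0 \<and>
                          frechet_derivative \<rho> (at p) (cmul \<i> v) = 0}"

definition hess :: "((complex^'n) \<times> complex \<Rightarrow> real) \<Rightarrow> (complex^'n) \<times> complex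
   \<Rightarrow> (complex^'n) \<times> complex \<Rightarrow> (complex^'n) \<times> complex \<Rightarrow> real" where
  "hess \<rho> p u v = frechet_derivative (\<lambda>q. frechet_derivative \<rho> (at q) v) (at p) u"

definition levi_form :: "((complex^'n) \<times> complex \<Rightarrow> real) \<Rightarrow> (complex^'n) \<times> complex
   \<Rightarrow> (complex^'n) \<times> complex \<Rightarrow> (complex^'n) \<times> complex \<Rightarrow> complex" where
  "levi_form \<rho> p v u =
     Complex ((hess \<rho> p v u + hess \<rho> p (cmul \<i> v) (cmul \<i> u)) / 4)
             ((hess \<rho> p v (cmul \<i> u) - hess \<rho> p (cmul \<i> v) u) / 4)"

text \<open>Complex rank of the Levi form on the complex tangent space H:
  dim_C H - dim_C(kernel), computed from real dimensions (complex dim = real dim / 2).\<close>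
definition levi_rank :: "((complex^'n) \<times> complex \<Rightarrow> real) \<Rightarrow> (complex^'n) \<times> complex \<Rightarrow> nat" where
  "levi_rank \<rho> p =
     (let H = cplx_tangent \<rho> p;
          K = {v\<in>H. \<forall>u\<in>H. levi_form \<rho> p v u = 0}
      in (dim H - dim K) div 2)"

definition levi_semidefinite :: "((complex^'n) \<times> complex \<Rightarrow> real) \<Rightarrow> (complex^'n) \<times> complex \<Rightarrow> bool" where
  "levi_semidefinite \<rho> p \<longleftrightarrow>
     (\<forall>v\<in>cplx_tangent \<rho> p. Re (levi_form \<rho> p v v) \<ge> 0) \<or>
     (\<forall>v\<in>cplx_tangent \<rho> p. Re (levi_form \<rho> p v v) \<le> 0)"

definition holo_on :: "((complex^'n) \<times> complex) set \<Rightarrow> ((complex^'n) \<times> complex \<Rightarrow> (complex^'n) \<times> complex) \<Rightarrow> bool" where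
  "holo_on U \<Phi> \<longleftrightarrow> (\<forall>x\<in>U. \<exists>D. (\<Phi> has_derivative D) (at x) \<and> (\<forall>v. D (cmul \<i> v) = cmul \<i> (D v)))"

definition biholo :: "((complex^'n) \<times> complex \<Rightarrow> (complex^'n) \<times> complex) \<Rightarrow> ((complex^'n) \<times> complex) set
   \<Rightarrow> ((complex^'n) \<times> complex) set \<Rightarrow> bool" where
  "biholo \<Phi> U V \<longleftrightarrow> open U \<and> open V \<and> holo_on U \<Phi> \<and> \<Phi> ` U = V \<and> inj_on \<Phi> U \<and>
     (\<exists>\<Psi>. holo_on V \<Psi> \<and> (\<forall>x\<in>U. \<Psi> (\<Phi> x) = x))"

text \<open>Weights: the real coordinates of z have weight 1, Re w has weight 2.
  F has weighted order \<ge> 4: every Taylor coefficient at 0 of weighted degree < 4 vanishes.\<close>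
definition wt :: "(complex^'n) \<times> real \<Rightarrow> nat" where
  "wt b = (if fst b = 0 then 2 else 1)"

definition weighted_order_ge4 :: "((complex^'n) \<times> real \<Rightarrow> real) \<Rightarrow> bool" where
  "weighted_order_ge4 F \<longleftrightarrow>
     (\<forall>vs. set vs \<subseteq> Basis \<longrightarrow> sum_list (map wt vs) < 4 \<longrightarrow> pderivs vs F 0 = 0)"

definition zidx :: "nat \<Rightarrow> 'n::finite" where
  "zidx = (SOME e. bij_betw e {1..CARD('n)} (UNIV :: 'n set))"

definition zc :: "complex^'n \<Rightarrow> nat \<Rightarrow> complex" where
  "zc z k = z $ zidx k"

datatype nf_case = Case_i | Case_ii | Case_iii

text \<open>Admissible \<lambda> (indices 1..n-1, zero elsewhere).  For n = 2 this literally gives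
  \<lambda> = 0 in case (i) and \<lambda> \<in> {0,1} in cases (ii),(iii).\<close>
definition admissible :: "nat \<Rightarrow> nf_case \<Rightarrow> (nat \<Rightarrow> real) \<Rightarrow> bool" where
  "admissible n c lam \<longleftrightarrow> (\<forall>k. k \<notin> {1..n-1} \<longrightarrow> lam k = 0) \<and>
     (lam = (\<lambda>k. 0) \<or>
      (lam 1 = 1 \<and> (\<forall>j k. 1 \<le> j \<longrightarrow> j \<le> k \<longrightarrow> k \<le> n - 1 \<longrightarrow> lam k \<le> lam j) \<and> lam (n-1) \<ge> 0 \<and>
       (c = Case_i \<longrightarrow> lam (n-1) = 0)))"

definition nf_rhs :: "nat \<Rightarrow> nf_case \<Rightarrow> (nat \<Rightarrow> real) \<Rightarrow> complex^'n \<Rightarrow> complex" where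
  "nf_rhs n c lam z =
     (\<Sum>k=1..n-1. of_real (lam k) * (zc z k)^2) +
     (case c of Case_i \<Rightarrow> 2 * zc z (n-1) * zc z n
              | Case_ii \<Rightarrow> 0
              | Case_iii \<Rightarrow> (zc z n)^2)"

definition normal_form_eq :: "nat \<Rightarrow> nf_case \<Rightarrow> (nat \<Rightarrow> real) \<Rightarrow> ((complex^'n) \<times> real \<Rightarrow> real)
   \<Rightarrow> (complex^'n) \<times> complex \<Rightarrow> bool" where
  "normal_form_eq n c lam F q \<longleftrightarrow>
     Im (snd q) = (\<Sum>k=1..n-1. (cmod (zc (fst q) k))^2)
                  + 2 * Re (cnj (zc (fst q) n) * nf_rhs n c lam (fst q))
                  + F (fst q, Re (snd q))"

definition has_normal_form :: "((complex^'n) \<times> complex) set \<Rightarrow> (complex^'n) \<times> complex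
   \<Rightarrow> nf_case \<Rightarrow> (nat \<Rightarrow> real) \<Rightarrow> bool" where
  "has_normal_form M p0 c lam \<longleftrightarrow>
     (\<exists>U V \<Phi> W F. p0 \<in> U \<and> biholo \<Phi> U V \<and> \<Phi> p0 = 0 \<and>
        open W \<and> 0 \<in> W \<and> smooth_on W F \<and> weighted_order_ge4 F \<and>
        (\<forall>q\<in>V. (fst q, Re (snd q)) \<in> W) \<and>
        \<Phi> ` (M \<inter> U) = {q\<in>V. normal_form_eq CARD('n) c lam F q})"

end

theory Submission
  imports Defs "HOL-Complex_Analysis.Complex_Analysis"
begin

text \<open>Give the coordinates of \<open>z\<close> weight one and \<open>w\<close> weight two.  After the Levi form has been
  diagonalised, a polynomial change of coordinates removes every term of weighted degree three
  except the part of bidegree (2,1) that contains the conjugate of \<open>z\<^sup>n\<close>, where \<open>z\<^sup>n\<close> spans the Levi kernel.  What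
  remains is a complex quadratic form \<open>Q\<close> on the complex tangent space.  Linear changes of coordinates
  act on \<open>Q\<close> by unitary maps of \<open>(z\<^sup>1, \<dots>, z\<^sup>n\<^sup>-\<^sup>1)\<close>, by shears of \<open>z\<^sup>n\<close> and by scalings, so Takagi's
  factorisation together with completion of squares brings \<open>Q\<close> to one of the three normal forms.

  Conversely, a biholomorphic map between two normal forms is expanded along real curves inside the first
  hypersurface.  Comparing the terms of weighted degree at most three shows that its differential
  intertwines the two quadratic forms in exactly this way.  The three cases are then told apart by the
  behaviour of \<open>Q\<close> on the Levi kernel, and \<open>\<lambda>\<close> is the list of singular values of \<open>Q\<close> up to
  a common positive factor.\<close>

section \<open>Smooth functions\<close>

text \<open>A quadratic change of z^k adds to the equation twice the real part of that quadratic
  times conj(z^k), but only for k < n. Along the Levi kernel nothing is gained, and so the (2,1)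
  terms with conj(z^n) survive. Admissible coordinates are only required to be complex
  differentiable with complex differentiable inverse, and the two halves need different calculus.
  Existence builds one explicit polynomial map and tests it along the curves t -> (t z, t^2 u), on
  which the order in t is the weighted degree. Uniqueness faces an arbitrary biholomorphic map,
  whose expansion comes from Cauchy estimates in one variable on complex lines. There the bidegrees
  are separated by replacing z by eta z with complex eta: (3,0) terms scale by eta^3, (2,1) terms by
  |eta|^2 eta. The Levi kernel vector may be rescaled by alpha, the other frame vectors by s, and w
  by r = s^2. These parameters set lambda_1 and the coefficient of the term in z^n to their normal
  values.\<close>

lemma has_derivative_ddir:
  "f differentiable (at x) \<Longrightarrow> (f has_derivative (\<lambda>v. ddir v f x)) (at x)"
  unfolding ddir_def by (simp add: frechet_derivative_works[symmetric])

lemma ddir_eqI: "(f has_derivative D) (at x) \<Longrightarrow> ddir v f x = D v"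
  unfolding ddir_def by (simp add: frechet_derivative_at[symmetric])

lemma differentiable_onD_open:
  "f differentiable_on S \<Longrightarrow> open S \<Longrightarrow> x \<in> S \<Longrightarrow> f differentiable (at x)"
  by (simp add: differentiable_on_eq_differentiable_at)

lemma ddir_cong:
  assumes "open S" "y \<in> S" "\<And>x. x \<in> S \<Longrightarrow> f x = g x"
  shows "ddir v f y = ddir v g y"
proof -
  have "(f has_derivative D) (at y) \<longleftrightarrow> (g has_derivative D) (at y)" for D
    using has_derivative_transform_within_open[of f D y UNIV S g]
      has_derivative_transform_within_open[of g D y UNIV S f] assms by auto
  then show ?thesis by (simp add: ddir_def frechet_derivative_def)
qed

lemma differentiable_on_cong_open:
  assumes "open S" "\<And>x. x \<in> S \<Longrightarrow> f x = g x" "f differentiable_on S"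
  shows "g differentiable_on S"
  using assms by (metis (no_types, lifting) differentiable_on_def differentiable_transform_within zero_less_one)

lemma ddir_linear:
  assumes "f differentiable (at x)"
  shows "linear (\<lambda>v. ddir v f x)"
  using has_derivative_ddir[OF assms] has_derivative_linear by blast

lemma ddir_add:
  assumes "f differentiable (at x)"
  shows "ddir (u + v) f x = ddir u f x + ddir v f x"
  using linear_add[OF ddir_linear[OF assms]] .

lemma ddir_scale:
  assumes "f differentiable (at x)"
  shows "ddir (c *\<^sub>R u) f x = c *\<^sub>R ddir u f x"
  using linear_cmul[OF ddir_linear[OF assms]] .

lemma ddir_basis_expansion:
  fixes f :: "'a::euclidean_space \<Rightarrow> 'b::real_normed_vector"
  assumes "f differentiable (at x)"
  shows "ddir v f x = (\<Sum>b\<in>Basis. (v \<bullet> b) *\<^sub>R ddir b f x)"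
proof -
  have "ddir v f x = ddir (\<Sum>b\<in>Basis. (v \<bullet> b) *\<^sub>R b) f x" by (simp add: euclidean_representation)
  also have "\<dots> = (\<Sum>b\<in>Basis. (v \<bullet> b) *\<^sub>R ddir b f x)"
    using linear_sum[OF ddir_linear[OF assms], of "\<lambda>b. (v \<bullet> b) *\<^sub>R b" Basis] by (simp add: ddir_scale[OF assms])
  finally show ?thesis .
qed

text \<open>Off by one with respect to the usual convention: all partial derivatives of order at most \<open>k\<close>
  are required to be differentiable.\<close>

fun Ck :: "nat \<Rightarrow> 'a::euclidean_space set \<Rightarrow> ('a \<Rightarrow> 'b::real_normed_vector) \<Rightarrow> bool" where
  "Ck 0 S f \<longleftrightarrow> f differentiable_on S"
| "Ck (Suc k) S f \<longleftrightarrow> f differentiable_on S \<and> (\<forall>b\<in>Basis. Ck k S (ddir b f))"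

lemma pderivs_append: "pderivs (vs @ ws) f = pderivs vs (pderivs ws f)"
  by (induction vs) auto

lemma Ck_iff_pderivs:
  "Ck k S f \<longleftrightarrow> (\<forall>vs. set vs \<subseteq> Basis \<and> length vs \<le> k \<longrightarrow> pderivs vs f differentiable_on S)"
proof (induction k arbitrary: f)
  case 0
  then show ?case by simp
next
  case (Suc k)
  show ?case
  proof
    assume L: "Ck (Suc k) S f"
    show "\<forall>vs. set vs \<subseteq> Basis \<and> length vs \<le> Suc k \<longrightarrow> pderivs vs f differentiable_on S"
    proof (intro allI impI)
      fix vs :: "'a list" assume vs: "set vs \<subseteq> Basis \<and> length vs \<le> Suc k"
      show "pderivs vs f differentiable_on S"
      proof (cases vs rule: rev_cases)
        case Nil then show ?thesis using L by simp
      next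
        case (snoc ws b)
        then show ?thesis using L vs Suc.IH[of "ddir b f"] by (auto simp: pderivs_append)
      qed
    qed
  next
    assume R: "\<forall>vs. set vs \<subseteq> Basis \<and> length vs \<le> Suc k \<longrightarrow> pderivs vs f differentiable_on S"
    have "f differentiable_on S" using R[rule_format, of "[]"] by simp
    moreover have "pderivs vs (ddir b f) differentiable_on S"
      if "b \<in> Basis" "set vs \<subseteq> Basis" "length vs \<le> k" for vs b
      using R[rule_format, of "vs @ [b]"] that by (simp add: pderivs_append)
    ultimately show "Ck (Suc k) S f" using Suc.IH by simp
  qed
qed

lemma smooth_on_iff_Ck: "smooth_on S f \<longleftrightarrow> (\<forall>k. Ck k S f)"
  unfolding smooth_on_def Ck_iff_pderivs by blast

lemma Ck_differentiable: "Ck k S f \<Longrightarrow> f differentiable_on S"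
  by (cases k) auto

lemma Ck_SucD: "Ck (Suc k) S f \<Longrightarrow> Ck k S f"
  unfolding Ck_iff_pderivs by auto

lemma Ck_subset: "Ck k S f \<Longrightarrow> T \<subseteq> S \<Longrightarrow> Ck k T f"
  unfolding Ck_iff_pderivs using differentiable_on_subset by blast

lemma Ck_cong:
  assumes "open S" "\<And>x. x \<in> S \<Longrightarrow> f x = g x" "Ck k S f"
  shows "Ck k S g"
  using assms(2,3)
proof (induction k arbitrary: f g)
  case 0
  then show ?case using differentiable_on_cong_open[OF assms(1)] by (metis Ck.simps(1))
next
  case (Suc k)
  have "Ck k S (ddir b g)" if "b \<in> Basis" for b
    using Suc.IH[of "ddir b f" "ddir b g"] ddir_cong[OF assms(1)] Suc.prems that by (metis Ck.simps(2))
  moreover have "g differentiable_on S"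
    using differentiable_on_cong_open[OF assms(1)] Suc.prems by (metis Ck.simps(2))
  ultimately show ?case by simp
qed

lemma Ck_SucI:
  assumes "open S" "\<And>x. x \<in> S \<Longrightarrow> (f has_derivative D x) (at x)"
    "\<And>b. b \<in> Basis \<Longrightarrow> Ck k S (\<lambda>x. D x b)"
  shows "Ck (Suc k) S f"
proof -
  have "f differentiable_on S"
    using assms(1,2) by (metis differentiable_on_eq_differentiable_at differentiable_def)
  moreover have "Ck k S (ddir b f)" if "b \<in> Basis" for b
    by (rule Ck_cong[OF assms(1) _ assms(3)[OF that]]) (simp add: ddir_eqI[OF assms(2)])
  ultimately show ?thesis by simp
qed

lemma Ck_ddirD: "Ck (Suc k) S f \<Longrightarrow> b \<in> Basis \<Longrightarrow> Ck k S (ddir b f)"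
  by simp

lemma Ck_has_derivative:
  "Ck k S f \<Longrightarrow> open S \<Longrightarrow> x \<in> S \<Longrightarrow> (f has_derivative (\<lambda>v. ddir v f x)) (at x)"
  by (blast intro: Ck_differentiable differentiable_onD_open has_derivative_ddir)

lemma Ck_const: "Ck k S (\<lambda>x. c)"
proof (induction k arbitrary: c)
  case (Suc k)
  have "ddir b (\<lambda>x::'a. c) = (\<lambda>x. 0)" for b
    by (intro ext, rule ddir_eqI, rule has_derivative_const)
  then show ?case using Suc by simp
qed simp

lemma Ck_linear:
  assumes "bounded_linear f" shows "Ck k S f"
proof (cases k)
  case 0
  then show ?thesis
    using assms bounded_linear_imp_differentiable_on by auto
next
  case (Suc m)
  have "ddir b f = (\<lambda>x. f b)" for b
    using bounded_linear_imp_has_derivative[OF assms] by (auto intro: ddir_eqI)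
  then show ?thesis using Suc assms bounded_linear_imp_differentiable_on by (auto simp: Ck_const)
qed

lemma Ck_add:
  assumes "open S" "Ck k S f" "Ck k S g" shows "Ck k S (\<lambda>x. f x + g x)"
  using assms(2,3)
proof (induction k arbitrary: f g)
  case (Suc k)
  then show ?case
    by (intro Ck_SucI[OF assms(1), where D = "\<lambda>x v. ddir v f x + ddir v g x"] has_derivative_add
        Ck_has_derivative[OF Suc.prems(1) assms(1)] Ck_has_derivative[OF Suc.prems(2) assms(1)]) simp_all
qed simp

lemma Ck_bilinear:
  assumes "bounded_bilinear pr" "open S" "Ck k S f" "Ck k S g"
  shows "Ck k S (\<lambda>x. pr (f x) (g x))"
  using assms(3,4)
proof (induction k arbitrary: f g)
  case 0
  interpret bounded_bilinear pr by fact
  show ?case using 0 FDERIV assms(2) unfolding Ck.simps differentiable_on_eq_differentiable_at[OF assms(2)]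
    differentiable_def by blast
next
  case (Suc k)
  interpret bounded_bilinear pr by fact
  show ?case
  proof (rule Ck_SucI[OF assms(2), where D = "\<lambda>x v. pr (f x) (ddir v g x) + pr (ddir v f x) (g x)"])
    show "((\<lambda>x. pr (f x) (g x)) has_derivative
       (\<lambda>v. pr (f x) (ddir v g x) + pr (ddir v f x) (g x))) (at x)" if "x \<in> S" for x
      by (intro FDERIV Ck_has_derivative[OF Suc.prems(1) assms(2) that]
          Ck_has_derivative[OF Suc.prems(2) assms(2) that])
  next
    show "Ck k S (\<lambda>x. pr (f x) (ddir b g x) + pr (ddir b f x) (g x))" if b: "b \<in> Basis" for b
      by (intro Ck_add assms(2) Suc.IH Ck_SucD[OF Suc.prems(1)] Ck_SucD[OF Suc.prems(2)]
          Ck_ddirD[OF Suc.prems(1) b] Ck_ddirD[OF Suc.prems(2) b])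
  qed
qed

lemma Ck_linear_comp:
  assumes "bounded_linear h" "open S" "Ck k S f"
  shows "Ck k S (\<lambda>x. h (f x))"
  using assms(3)
proof (induction k arbitrary: f)
  case 0
  interpret bounded_linear h by fact
  show ?case using 0 has_derivative assms(2)
    unfolding Ck.simps differentiable_on_eq_differentiable_at[OF assms(2)] differentiable_def by blast
next
  case (Suc k)
  interpret bounded_linear h by fact
  show ?case
    by (rule Ck_SucI[OF assms(2), where D = "\<lambda>x v. h (ddir v f x)"])
      (rule has_derivative Suc.IH Ck_has_derivative[OF Suc.prems assms(2)] Ck_ddirD[OF Suc.prems] | assumption)+
qed

lemma Ck_sum:
  assumes "open S" "\<And>i. i \<in> I \<Longrightarrow> Ck k S (f i)" shows "Ck k S (\<lambda>x. \<Sum>i\<in>I. f i x)"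
  using assms(2)
  by (induction I rule: infinite_finite_induct) (auto intro!: Ck_const Ck_add assms(1))

text \<open>The chain rule is written in coordinates of the middle space, so that the derivative is
  a finite sum of products of \<open>ddir b g\<close> with \<open>ddir i f\<close> composed with
  \<open>g\<close>. The induction varies \<open>f\<close> and keeps \<open>g\<close>.\<close>

lemma Ck_compose:
  fixes f :: "'b::euclidean_space \<Rightarrow> 'c::real_normed_vector" and g :: "'a::euclidean_space \<Rightarrow> 'b"
  assumes "open S" "open T" "g ` S \<subseteq> T" "Ck k T f" "Ck k S g"
  shows "Ck k S (\<lambda>x. f (g x))"
  using assms(4,5)
proof (induction k arbitrary: f)
  case 0
  have "(\<lambda>x. f (g x)) differentiable (at x)" if x: "x \<in> S" for x
    using differentiable_chain_at[of g x f] differentiable_onD_open[of g S x] differentiable_onD_open[of f T "g x"]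
      assms(1-3) 0 x by (auto simp: o_def)
  then show ?case using differentiable_on_eq_differentiable_at[OF assms(1)] by auto
next
  case (Suc k)
  have der: "((\<lambda>x. f (g x)) has_derivative (\<lambda>v. \<Sum>i\<in>Basis. (ddir v g x \<bullet> i) *\<^sub>R ddir i f (g x))) (at x)"
    if x: "x \<in> S" for x
  proof -
    have gx: "g x \<in> T" using assms(3) x by auto
    have "f differentiable (at (g x))" using Suc.prems(1) gx assms(2) Ck_differentiable differentiable_onD_open by blast
    then have *: "(\<lambda>w. ddir w f (g x)) = (\<lambda>w. \<Sum>i\<in>Basis. (w \<bullet> i) *\<^sub>R ddir i f (g x))"
      by (intro ext) (rule ddir_basis_expansion)
    show ?thesis
      using diff_chain_at[OF Ck_has_derivative[OF Suc.prems(2) assms(1) x]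
          Ck_has_derivative[OF Suc.prems(1) assms(2) gx, unfolded *]]
      by (simp only: o_def)
  qed
  show ?case
  proof (rule Ck_SucI[OF assms(1) der])
    fix b :: 'a assume b: "b \<in> Basis"
    show "Ck k S (\<lambda>x. \<Sum>i\<in>Basis. (ddir b g x \<bullet> i) *\<^sub>R ddir i f (g x))"
    proof (rule Ck_sum[OF assms(1)], rule Ck_bilinear[OF bounded_bilinear_scaleR assms(1)])
      fix i :: 'b assume i: "i \<in> Basis"
      show "Ck k S (\<lambda>x. ddir b g x \<bullet> i)"
        by (rule Ck_linear_comp[OF bounded_linear_inner_left assms(1) Ck_ddirD[OF Suc.prems(2) b]])
      show "Ck k S (\<lambda>x. ddir i f (g x))"
        by (rule Suc.IH[OF Ck_ddirD[OF Suc.prems(1) i] Ck_SucD[OF Suc.prems(2)]])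
    qed
  qed auto
qed

lemma Ck_inverse:
  fixes f :: "'a::euclidean_space \<Rightarrow> real"
  assumes "open S" "\<And>x. x \<in> S \<Longrightarrow> f x \<noteq> 0" "Ck k S f"
  shows "Ck k S (\<lambda>x. inverse (f x))"
  using assms(3)
proof (induction k)
  case 0
  then show ?case
    by (simp add: assms(2) differentiable_on_def differentiable_inverse)
next
  case (Suc k)
  have IH: "Ck k S (\<lambda>x. inverse (f x))" using Suc Ck_SucD by blast
  note mult = Ck_bilinear[OF bounded_bilinear_mult assms(1)]
  show ?case
  proof (rule Ck_SucI[OF assms(1), where D = "\<lambda>x v. - (inverse (f x) * ddir v f x * inverse (f x))"])
    show "((\<lambda>x. inverse (f x)) has_derivative (\<lambda>v. - (inverse (f x) * ddir v f x * inverse (f x)))) (at x)"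
      if "x \<in> S" for x
      by (rule Deriv.has_derivative_inverse[OF assms(2)[OF that] Ck_has_derivative[OF Suc.prems assms(1) that]])
    show "Ck k S (\<lambda>x. - (inverse (f x) * ddir b f x * inverse (f x)))" if "b \<in> Basis" for b
      by (rule Ck_linear_comp[OF bounded_linear_minus[OF bounded_linear_ident] assms(1)])
        (rule mult[OF mult[OF IH Ck_ddirD[OF Suc.prems that]] IH])
  qed
qed

lemma smooth_on_subset: "smooth_on S f \<Longrightarrow> T \<subseteq> S \<Longrightarrow> smooth_on T f"
  unfolding smooth_on_iff_Ck using Ck_subset by blast

lemma smooth_on_differentiable: "smooth_on S f \<Longrightarrow> open S \<Longrightarrow> x \<in> S \<Longrightarrow> f differentiable (at x)"
  unfolding smooth_on_iff_Ck using Ck_differentiable differentiable_onD_open by blast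

lemma smooth_on_continuous: "smooth_on S f \<Longrightarrow> open S \<Longrightarrow> continuous_on S f"
  unfolding smooth_on_iff_Ck using Ck_differentiable differentiable_imp_continuous_on by blast

lemma smooth_on_ddir:
  assumes "smooth_on S f" "open S" shows "smooth_on S (ddir v f)"
proof -
  have *: "Ck k S (\<lambda>x. \<Sum>b\<in>Basis. (v \<bullet> b) *\<^sub>R ddir b f x)" for k
    using assms(1) unfolding smooth_on_iff_Ck
    by (intro Ck_sum Ck_linear_comp[OF bounded_linear_scaleR_right] assms(2) Ck_ddirD[of k]) auto
  show ?thesis
    unfolding smooth_on_iff_Ck
    by (intro allI Ck_cong[OF assms(2) _ *] ddir_basis_expansion[symmetric] smooth_on_differentiable[OF assms])
qed

section \<open>Restriction to lines, symmetry of mixed derivatives and Taylor's formula\<close>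

lemma line_has_derivative:
  fixes f :: "'a::euclidean_space \<Rightarrow> real"
  assumes "f differentiable (at (a + s *\<^sub>R u))"
  shows "((\<lambda>s. f (a + s *\<^sub>R u)) has_real_derivative ddir u f (a + s *\<^sub>R u)) (at s)"
proof -
  have "((\<lambda>s. a + s *\<^sub>R u) has_derivative (\<lambda>h. h *\<^sub>R u)) (at s)"
    by (auto intro!: derivative_eq_intros)
  from diff_chain_at[OF this has_derivative_ddir[OF assms]]
  have "((\<lambda>s. f (a + s *\<^sub>R u)) has_derivative (\<lambda>h. ddir (h *\<^sub>R u) f (a + s *\<^sub>R u))) (at s)"
    by (simp add: o_def)
  then show ?thesis
    unfolding has_field_derivative_def ddir_scale[OF assms]
    by (rule has_derivative_eq_rhs) (auto simp: mult.commute)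
qed

text \<open>Two applications of the mean value theorem, along \<open>u\<close> and then along
  \<open>v\<close>. The second difference is symmetric in \<open>u\<close> and \<open>v\<close>
  whereas the derivative on the right is not visibly so, which is what \<open>ddir_commute\<close>
  exploits.\<close>

lemma second_difference_mvt:
  fixes f :: "'a::euclidean_space \<Rightarrow> real"
  assumes sm: "smooth_on S f" and S: "open S" and b: "ball x d \<subseteq> S" and t: "t > 0" "t * (norm u + norm v) < d"
  shows "\<exists>\<xi>. norm (\<xi> - x) \<le> t * (norm u + norm v) \<and>
     f (x + t *\<^sub>R u + t *\<^sub>R v) - f (x + t *\<^sub>R u) - f (x + t *\<^sub>R v) + f x = t^2 * ddir v (ddir u f) \<xi>"
proof -
  have inS: "x + a *\<^sub>R u + c *\<^sub>R v \<in> S" and nrm: "norm (x + a *\<^sub>R u + c *\<^sub>R v - x) \<le> t * (norm u + norm v)"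
    if "0 \<le> a" "a \<le> t" "0 \<le> c" "c \<le> t" for a c
  proof -
    have "norm (a *\<^sub>R u + c *\<^sub>R v) \<le> norm (a *\<^sub>R u) + norm (c *\<^sub>R v)" by (rule norm_triangle_ineq)
    also have "\<dots> \<le> t * norm u + t * norm v" using that by (auto intro!: add_mono mult_right_mono)
    finally have *: "norm (a *\<^sub>R u + c *\<^sub>R v) \<le> t * (norm u + norm v)" by (simp add: algebra_simps)
    then show "norm (x + a *\<^sub>R u + c *\<^sub>R v - x) \<le> t * (norm u + norm v)" by (simp add: add.assoc)
    have "dist x (x + a *\<^sub>R u + c *\<^sub>R v) = norm (a *\<^sub>R u + c *\<^sub>R v)"
      by (simp add: dist_norm add.assoc flip: norm_minus_cancel[of "a *\<^sub>R u + c *\<^sub>R v"])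
    with * t(2) b show "x + a *\<^sub>R u + c *\<^sub>R v \<in> S" by (auto simp: subset_iff)
  qed
  let ?\<phi> = "\<lambda>s. f (x + t *\<^sub>R v + s *\<^sub>R u) - f (x + s *\<^sub>R u)"
  have d1: "(?\<phi> has_real_derivative ddir u f (x + t *\<^sub>R v + s *\<^sub>R u) - ddir u f (x + s *\<^sub>R u)) (at s)"
    if "0 \<le> s" "s \<le> t" for s
    using inS[of s t] inS[of s 0] that t(1)
    by (intro DERIV_diff line_has_derivative smooth_on_differentiable[OF sm S]) (auto simp: add_ac)
  obtain s0 where s0: "0 < s0" "s0 < t"
    "?\<phi> t - ?\<phi> 0 = (t - 0) * (ddir u f (x + t *\<^sub>R v + s0 *\<^sub>R u) - ddir u f (x + s0 *\<^sub>R u))"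
    using MVT2[OF t(1), of ?\<phi> "\<lambda>s. ddir u f (x + t *\<^sub>R v + s *\<^sub>R u) - ddir u f (x + s *\<^sub>R u)"] d1 by blast
  let ?\<psi> = "\<lambda>s. ddir u f (x + s0 *\<^sub>R u + s *\<^sub>R v)"
  have d2: "(?\<psi> has_real_derivative ddir v (ddir u f) (x + s0 *\<^sub>R u + s *\<^sub>R v)) (at s)"
    if "0 \<le> s" "s \<le> t" for s
    using inS[of s0 s] that s0
    by (intro line_has_derivative smooth_on_differentiable[OF smooth_on_ddir[OF sm S] S]) auto
  obtain s1 where s1: "0 < s1" "s1 < t"
    "?\<psi> t - ?\<psi> 0 = (t - 0) * ddir v (ddir u f) (x + s0 *\<^sub>R u + s1 *\<^sub>R v)"
    using MVT2[OF t(1), of ?\<psi> "\<lambda>s. ddir v (ddir u f) (x + s0 *\<^sub>R u + s *\<^sub>R v)"] d2 by blast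
  show ?thesis
  proof (intro exI[of _ "x + s0 *\<^sub>R u + s1 *\<^sub>R v"] conjI)
    show "norm (x + s0 *\<^sub>R u + s1 *\<^sub>R v - x) \<le> t * (norm u + norm v)"
      using nrm[of s0 s1] s0 s1 by simp
    show "f (x + t *\<^sub>R u + t *\<^sub>R v) - f (x + t *\<^sub>R u) - f (x + t *\<^sub>R v) + f x
        = t^2 * ddir v (ddir u f) (x + s0 *\<^sub>R u + s1 *\<^sub>R v)"
      using s0(3) s1(3) by (simp add: power2_eq_square algebra_simps)
  qed
qed

text \<open>One and the same second difference, divided by t^2, is a value of either mixed
  derivative at points that tend to \<open>x\<close>, and both mixed derivatives are
  continuous.\<close>

lemma ddir_commute:
  fixes f :: "'a::euclidean_space \<Rightarrow> real"
  assumes sm: "smooth_on S f" and S: "open S" and x: "x \<in> S"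
  shows "ddir u (ddir v f) x = ddir v (ddir u f) x"
proof (rule ccontr)
  let ?A = "ddir u (ddir v f)" and ?B = "ddir v (ddir u f)"
  assume ne: "?A x \<noteq> ?B x"
  \<comment> \<open>Half the gap: two values that lie within \<open>e\<close> of the two different
    limits cannot coincide.\<close>
  define e where "e = \<bar>?A x - ?B x\<bar> / 2"
  have e: "e > 0" using ne by (simp add: e_def)
  have "isCont ?A x" "isCont ?B x"
    using smooth_on_continuous[OF smooth_on_ddir[OF smooth_on_ddir[OF sm S] S] S] S x
    by (auto simp: continuous_on_eq_continuous_at)
  then obtain d1 d2 where d: "d1 > 0" "\<And>y. dist y x < d1 \<Longrightarrow> dist (?A y) (?A x) < e"
    "d2 > 0" "\<And>y. dist y x < d2 \<Longrightarrow> dist (?B y) (?B x) < e"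
    using e unfolding continuous_at_eps_delta by blast
  obtain d3 where d3: "d3 > 0" "ball x d3 \<subseteq> S" using S x open_contains_ball by blast
  define D where "D = min d1 (min d2 d3)"
  have D: "D > 0" using d d3 by (simp add: D_def)
  define t where "t = D / (2 * (norm u + norm v + 1))"
  have np: "norm u + norm v + 1 > 0" by (simp add: add_nonneg_pos)
  have t: "t > 0" using D np by (simp add: t_def)
  have "t * (norm u + norm v) \<le> t * (norm u + norm v + 1)" using t by simp
  also have "\<dots> = D / 2" using np by (simp add: t_def field_simps)
  finally have tD: "t * (norm u + norm v) < D" using D by simp
  have bD: "ball x D \<subseteq> S" using d3 by (auto simp: D_def)
  obtain \<xi>1 where x1: "norm (\<xi>1 - x) \<le> t * (norm u + norm v)"
     "f (x + t *\<^sub>R u + t *\<^sub>R v) - f (x + t *\<^sub>R u) - f (x + t *\<^sub>R v) + f x = t^2 * ?B \<xi>1"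
    using second_difference_mvt[OF sm S bD t tD] by blast
  obtain \<xi>2 where x2: "norm (\<xi>2 - x) \<le> t * (norm v + norm u)"
     "f (x + t *\<^sub>R v + t *\<^sub>R u) - f (x + t *\<^sub>R v) - f (x + t *\<^sub>R u) + f x = t^2 * ?A \<xi>2"
    using second_difference_mvt[OF sm S bD t, of v u] tD by (auto simp: add.commute)
  have "t^2 * ?B \<xi>1 = t^2 * ?A \<xi>2" using x1(2) x2(2) by (simp add: algebra_simps)
  then have AB: "?B \<xi>1 = ?A \<xi>2" using t by simp
  have "dist (?B \<xi>1) (?B x) < e" using d(4)[of \<xi>1] x1(1) tD by (auto simp: D_def dist_norm)
  moreover have "dist (?A \<xi>2) (?A x) < e"
    using d(2)[of \<xi>2] x2(1) tD by (auto simp: D_def dist_norm add.commute)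
  ultimately show False using AB unfolding e_def dist_real_def by (smt (verit) field_sum_of_halves)
qed

lemma ddir_ddir_add:
  fixes f :: "'a::euclidean_space \<Rightarrow> 'b::real_normed_vector"
  assumes sm: "smooth_on S f" and S: "open S" and x: "x \<in> S"
  shows "ddir u (ddir (v + w) f) x = ddir u (ddir v f) x + ddir u (ddir w f) x"
proof -
  have "ddir u (ddir (v + w) f) x = ddir u (\<lambda>y. ddir v f y + ddir w f y) x"
    by (rule ddir_cong[OF S x]) (simp add: ddir_add smooth_on_differentiable[OF sm S])
  also have "\<dots> = ddir u (ddir v f) x + ddir u (ddir w f) x"
    by (rule ddir_eqI) (intro has_derivative_add has_derivative_ddir smooth_on_differentiable[OF smooth_on_ddir[OF sm S] S x])
  finally show ?thesis .
qed

lemma ddir_ddir_scale: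
  fixes f :: "'a::euclidean_space \<Rightarrow> 'b::real_normed_vector"
  assumes sm: "smooth_on S f" and S: "open S" and x: "x \<in> S"
  shows "ddir u (ddir (c *\<^sub>R v) f) x = c *\<^sub>R ddir u (ddir v f) x"
proof -
  have "ddir u (ddir (c *\<^sub>R v) f) x = ddir u (\<lambda>y. c *\<^sub>R ddir v f y) x"
    by (rule ddir_cong[OF S x]) (simp add: ddir_scale smooth_on_differentiable[OF sm S])
  also have "\<dots> = c *\<^sub>R ddir u (ddir v f) x"
    by (rule ddir_eqI) (intro has_derivative_scaleR_right has_derivative_ddir smooth_on_differentiable[OF smooth_on_ddir[OF sm S] S x])
  finally show ?thesis .
qed

lemma ddir3_commute:
  fixes f :: "'a::euclidean_space \<Rightarrow> real"
  assumes sm: "smooth_on S f" and S: "open S" and x: "x \<in> S"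
  shows "ddir a (ddir u (ddir v f)) x = ddir a (ddir v (ddir u f)) x"
    by (rule ddir_cong[OF S x]) (rule ddir_commute[OF sm S])

lemma ddir3_linear:
  fixes f :: "'a::euclidean_space \<Rightarrow> real"
  assumes sm: "smooth_on S f" and S: "open S" and x: "x \<in> S"
  shows "linear (\<lambda>a. ddir a (ddir b (ddir c f)) x)" "linear (\<lambda>b. ddir a (ddir b (ddir c f)) x)"
    "linear (\<lambda>c. ddir a (ddir b (ddir c f)) x)"
proof -
  note s1 = smooth_on_ddir[OF sm S] and s2 = smooth_on_ddir[OF smooth_on_ddir[OF sm S] S]
  show "linear (\<lambda>a. ddir a (ddir b (ddir c f)) x)"
    by (rule ddir_linear[OF smooth_on_differentiable[OF s2 S x]])
  show l2: "linear (\<lambda>b. ddir a (ddir b (ddir c f)) x)" for a b c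
    by (rule linearI) (simp_all add: ddir_ddir_add[OF s1 S x] ddir_ddir_scale[OF s1 S x])
  show "linear (\<lambda>c. ddir a (ddir b (ddir c f)) x)"
    unfolding ddir3_commute[OF sm S x, of a b] by (rule l2)
qed

lemma ddir2_linear:
  fixes f :: "'a::euclidean_space \<Rightarrow> real"
  assumes sm: "smooth_on S f" and S: "open S" and x: "x \<in> S"
  shows "linear (\<lambda>a. ddir a (ddir b f) x)" "linear (\<lambda>b. ddir a (ddir b f) x)"
proof -
  show "linear (\<lambda>a. ddir a (ddir b f) x)"
    by (rule ddir_linear[OF smooth_on_differentiable[OF smooth_on_ddir[OF sm S] S x]])
  show "linear (\<lambda>b. ddir a (ddir b f) x)"
    by (rule linearI) (simp_all add: ddir_ddir_add[OF sm S x] ddir_ddir_scale[OF sm S x])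
qed

lemma linear_basis_expansion:
  fixes g :: "'a::euclidean_space \<Rightarrow> real"
  assumes "linear g" shows "g v = (\<Sum>b\<in>Basis. (v \<bullet> b) * g b)"
proof -
  have "g v = g (\<Sum>b\<in>Basis. (v \<bullet> b) *\<^sub>R b)" by (simp add: euclidean_representation)
  also have "\<dots> = (\<Sum>b\<in>Basis. (v \<bullet> b) * g b)" using assms by (simp add: linear_sum linear_cmul)
  finally show ?thesis .
qed

text \<open>Lagrange's remainder along the segment is the third derivative at an intermediate point.
  Replacing it by the value at \<open>p\<close> costs o(|x|^3), uniformly in the direction, because
  there are only finitely many third partial derivatives and all are continuous.\<close>

lemma taylor3:
  fixes f :: "'a::euclidean_space \<Rightarrow> real"
  assumes sm: "smooth_on S f" and S: "open S" and p: "p \<in> S" and e: "e > 0"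
  shows "\<exists>\<delta>>0. \<forall>x. norm x < \<delta> \<longrightarrow>
    \<bar>f (p + x) - (f p + ddir x f p + ddir x (ddir x f) p / 2 + ddir x (ddir x (ddir x f)) p / 6)\<bar> \<le> e * norm x ^ 3"
proof -
  let ?D = "\<lambda>a b c y. ddir a (ddir b (ddir c f)) y"
  let ?g = "\<lambda>y. \<Sum>a\<in>Basis. \<Sum>b\<in>Basis. \<Sum>c\<in>Basis. \<bar>?D a b c y - ?D a b c p\<bar>"
  note s1 = smooth_on_ddir[OF sm S] and s2 = smooth_on_ddir[OF smooth_on_ddir[OF sm S] S]
    and s3 = smooth_on_ddir[OF smooth_on_ddir[OF smooth_on_ddir[OF sm S] S] S]
  have "continuous_on S ?g"
    by (intro continuous_intros smooth_on_continuous[OF s3 S])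
  then have "isCont ?g p" using S p by (simp add: continuous_on_eq_continuous_at)
  then obtain d1 where d1: "d1 > 0" "\<And>y. dist y p < d1 \<Longrightarrow> dist (?g y) (?g p) < e"
    using e unfolding continuous_at_eps_delta by blast
  obtain d2 where d2: "d2 > 0" "ball p d2 \<subseteq> S" using S p open_contains_ball by blast
  have expand: "?D x x x y = (\<Sum>a\<in>Basis. \<Sum>b\<in>Basis. \<Sum>c\<in>Basis. (x \<bullet> a) * (x \<bullet> b) * (x \<bullet> c) * ?D a b c y)"
    if y: "y \<in> S" for x y
    by (subst linear_basis_expansion[OF ddir3_linear(1)[OF sm S y]],
        subst linear_basis_expansion[OF ddir3_linear(2)[OF sm S y]],
        subst linear_basis_expansion[OF ddir3_linear(3)[OF sm S y]])
      (simp add: sum_distrib_left mult.assoc)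
  \<comment> \<open>Expansion in the basis bounds the variation of the cubic form by |x|^3 times a
    function of \<open>y\<close> alone that is continuous and vanishes at \<open>p\<close>.\<close>
  have bound: "\<bar>?D x x x y - ?D x x x p\<bar> \<le> norm x ^ 3 * ?g y" if y: "y \<in> S" for x y
  proof -
    have "\<bar>?D x x x y - ?D x x x p\<bar> =
       \<bar>\<Sum>a\<in>Basis. \<Sum>b\<in>Basis. \<Sum>c\<in>Basis. (x \<bullet> a) * (x \<bullet> b) * (x \<bullet> c) * (?D a b c y - ?D a b c p)\<bar>"
      unfolding expand[OF y] expand[OF p] by (simp add: sum_subtractf right_diff_distrib)
    also have "\<dots> \<le> (\<Sum>a\<in>Basis. \<Sum>b\<in>Basis. \<Sum>c\<in>Basis. \<bar>(x \<bullet> a) * (x \<bullet> b) * (x \<bullet> c) * (?D a b c y - ?D a b c p)\<bar>)"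
      by (intro order_trans[OF sum_abs] sum_mono order_refl)
    also have "\<dots> \<le> (\<Sum>a\<in>Basis. \<Sum>b\<in>Basis. \<Sum>c\<in>Basis. norm x ^ 3 * \<bar>?D a b c y - ?D a b c p\<bar>)"
    proof (intro sum_mono)
      fix a b c :: 'a assume "a \<in> Basis" "b \<in> Basis" "c \<in> Basis"
      then have "\<bar>x \<bullet> a\<bar> * \<bar>x \<bullet> b\<bar> * \<bar>x \<bullet> c\<bar> \<le> norm x * norm x * norm x"
        by (intro mult_mono Basis_le_norm) auto
      then show "\<bar>(x \<bullet> a) * (x \<bullet> b) * (x \<bullet> c) * (?D a b c y - ?D a b c p)\<bar> \<le> norm x ^ 3 * \<bar>?D a b c y - ?D a b c p\<bar>"
        by (simp add: abs_mult power3_eq_cube mult_right_mono)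
    qed
    finally show ?thesis by (simp add: sum_distrib_left)
  qed
  show ?thesis
  proof (intro exI[of _ "min d1 d2"] conjI allI impI)
    show "min d1 d2 > 0" using d1 d2 by simp
    fix x :: 'a assume x: "norm x < min d1 d2"
    have inS: "p + t *\<^sub>R x \<in> S" "dist (p + t *\<^sub>R x) p < d1" if "0 \<le> t" "t \<le> 1" for t
    proof -
      have "norm (t *\<^sub>R x) \<le> norm x" using that by (simp add: mult_left_le_one_le)
      then show "p + t *\<^sub>R x \<in> S" "dist (p + t *\<^sub>R x) p < d1" using x d2 by (auto simp: dist_norm subset_iff)
    qed
    define diff where "diff m t = (if m = 0 then f (p + t *\<^sub>R x) else if m = 1 then ddir x f (p + t *\<^sub>R x)
       else if m = 2 then ddir x (ddir x f) (p + t *\<^sub>R x) else ?D x x x (p + t *\<^sub>R x))" for m :: nat and t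
    have "DERIV (diff m) t :> diff (Suc m) t" if "m < 3 \<and> 0 \<le> t \<and> t \<le> 1" for m t
    proof -
      have "m = 0 \<or> m = 1 \<or> m = 2" using that by auto
      then show ?thesis
        using line_has_derivative[OF smooth_on_differentiable[OF sm S inS(1)[of t]]]
           line_has_derivative[OF smooth_on_differentiable[OF s1 S inS(1)[of t]]]
           line_has_derivative[OF smooth_on_differentiable[OF s2 S inS(1)[of t]]] that
        unfolding diff_def by auto
    qed
    then obtain t where t: "0 < t" "t < 1" "diff 0 1 = (\<Sum>m<3. diff m 0 / fact m * 1 ^ m) + diff 3 t / fact 3 * 1 ^ 3"
      using Maclaurin[of 1 3 diff "diff 0"] by force
    then have "f (p + x) = f p + ddir x f p + ddir x (ddir x f) p / 2 + ?D x x x (p + t *\<^sub>R x) / 6"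
      by (simp add: diff_def eval_nat_numeral)
    then have "\<bar>f (p + x) - (f p + ddir x f p + ddir x (ddir x f) p / 2 + ?D x x x p / 6)\<bar>
       = \<bar>?D x x x (p + t *\<^sub>R x) - ?D x x x p\<bar> / 6" by (simp add: diff_divide_distrib[symmetric])
    also have "\<dots> \<le> \<bar>?D x x x (p + t *\<^sub>R x) - ?D x x x p\<bar>" by simp
    also have "\<dots> \<le> norm x ^ 3 * ?g (p + t *\<^sub>R x)" using bound inS t by simp
    also have "\<dots> \<le> norm x ^ 3 * e"
      using d1(2)[OF inS(2)[of t]] t by (intro mult_left_mono) (auto simp: dist_real_def)
    finally show "\<bar>f (p + x) - (f p + ddir x f p + ddir x (ddir x f) p / 2 + ?D x x x p / 6)\<bar> \<le> e * norm x ^ 3"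
      by (simp add: mult.commute)
  qed
qed

section \<open>Third-order expansions along curves\<close>

text \<open>An expansion with remainder o(t^3) for t decreasing to 0. Nothing is asked about
  derivatives of the curve, so that the notion also applies to curves inside maps known only to be
  complex differentiable.\<close>

definition jet3 :: "(real \<Rightarrow> 'a::real_normed_vector) \<Rightarrow> 'a \<Rightarrow> 'a \<Rightarrow> 'a \<Rightarrow> 'a \<Rightarrow> bool" where
  "jet3 f c0 c1 c2 c3 \<longleftrightarrow>
     (\<exists>r. (r \<longlongrightarrow> 0) (at_right 0) \<and>
       (\<forall>\<^sub>F t in at_right 0. f t = c0 + t *\<^sub>R c1 + t^2 *\<^sub>R c2 + t^3 *\<^sub>R c3 + t^3 *\<^sub>R r t))"

lemma jet3_eqs: "jet3 f c0 c1 c2 c3 \<Longrightarrow> c0 = d0 \<Longrightarrow> c1 = d1 \<Longrightarrow> c2 = d2 \<Longrightarrow> c3 = d3 \<Longrightarrow> jet3 f d0 d1 d2 d3"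
  by simp

lemma jet3_cong:
  assumes "jet3 f c0 c1 c2 c3" "\<forall>\<^sub>F t in at_right 0. f t = g t"
  shows "jet3 g c0 c1 c2 c3"
proof -
  obtain r where r: "(r \<longlongrightarrow> 0) (at_right 0)"
    "\<forall>\<^sub>F t in at_right 0. f t = c0 + t *\<^sub>R c1 + t^2 *\<^sub>R c2 + t^3 *\<^sub>R c3 + t^3 *\<^sub>R r t"
    using assms(1) unfolding jet3_def by blast
  have "\<forall>\<^sub>F t in at_right 0. g t = c0 + t *\<^sub>R c1 + t^2 *\<^sub>R c2 + t^3 *\<^sub>R c3 + t^3 *\<^sub>R r t"
    using r(2) assms(2) by eventually_elim simp
  then show ?thesis using r(1) unfolding jet3_def by blast
qed

lemma jet3_exact:
  assumes "\<And>t. f t = c0 + t *\<^sub>R c1 + t^2 *\<^sub>R c2 + t^3 *\<^sub>R c3"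
  shows "jet3 f c0 c1 c2 c3"
  unfolding jet3_def by (rule exI[of _ "\<lambda>t. 0"]) (simp add: assms)

lemma jet3_const: "jet3 (\<lambda>t. c) c 0 0 0"
  by (rule jet3_exact) simp

lemma tendsto_at_right_power: "((\<lambda>t::real. t ^ k) \<longlongrightarrow> 0 ^ k) (at_right 0)"
  by (intro tendsto_intros)

text \<open>The coefficients are peeled off one at a time: once the lower ones vanish, division by
  the next power of t exhibits the following one as a limit of terms that tend to 0.\<close>

lemma jet3_zeroD:
  assumes "jet3 f c0 c1 c2 c3" "((\<lambda>t. f t /\<^sub>R t^3) \<longlongrightarrow> 0) (at_right 0)"
  shows "c0 = 0 \<and> c1 = 0 \<and> c2 = 0 \<and> c3 = 0"
proof -
  obtain r where r: "(r \<longlongrightarrow> 0) (at_right 0)"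
    "\<forall>\<^sub>F t in at_right 0. f t = c0 + t *\<^sub>R c1 + t^2 *\<^sub>R c2 + t^3 *\<^sub>R c3 + t^3 *\<^sub>R r t"
    using assms(1) unfolding jet3_def by blast
  let ?h = "\<lambda>t. f t /\<^sub>R t^3 - r t"
  have h: "(?h \<longlongrightarrow> 0) (at_right 0)" using tendsto_diff[OF assms(2) r(1)] by simp
  have pos: "\<forall>\<^sub>F t::real in at_right 0. t > 0" by (simp add: eventually_at_right_less)
  have lim: "((\<lambda>t. t ^ k *\<^sub>R ?h t) \<longlongrightarrow> 0) (at_right 0)" for k
    using tendsto_scaleR[OF tendsto_at_right_power[of k] h] by simp
  have lim2: "((\<lambda>t. t ^ Suc k *\<^sub>R c) \<longlongrightarrow> 0) (at_right 0)" for k and c :: 'a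
    using tendsto_scaleR[OF tendsto_at_right_power[of "Suc k"] tendsto_const[of c]] by simp
  have eqs: "\<forall>\<^sub>F t in at_right 0. t^3 *\<^sub>R ?h t = c0 + t *\<^sub>R c1 + t^2 *\<^sub>R c2 + t^3 *\<^sub>R c3"
    using r(2) pos by eventually_elim (simp add: scaleR_diff_right)
  have "((\<lambda>t. t^3 *\<^sub>R ?h t - (t^Suc 0 *\<^sub>R c1 + t^Suc 1 *\<^sub>R c2 + t^Suc 2 *\<^sub>R c3)) \<longlongrightarrow> 0 - (0 + 0 + 0)) (at_right 0)"
    by (intro tendsto_diff tendsto_add lim lim2)
  moreover have "\<forall>\<^sub>F t in at_right 0. t^3 *\<^sub>R ?h t - (t^Suc 0 *\<^sub>R c1 + t^Suc 1 *\<^sub>R c2 + t^Suc 2 *\<^sub>R c3) = c0"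
    using eqs by eventually_elim (simp add: eval_nat_numeral)
  ultimately have "((\<lambda>t::real. c0) \<longlongrightarrow> 0) (at_right 0)"
    using tendsto_cong by fastforce
  then have c0: "c0 = 0" by (simp add: tendsto_const_iff)
  have "((\<lambda>t. t^2 *\<^sub>R ?h t - (t^Suc 0 *\<^sub>R c2 + t^Suc 1 *\<^sub>R c3)) \<longlongrightarrow> 0 - (0 + 0)) (at_right 0)"
    by (intro tendsto_diff tendsto_add lim lim2)
  moreover have "\<forall>\<^sub>F t in at_right 0. t^2 *\<^sub>R ?h t - (t^Suc 0 *\<^sub>R c2 + t^Suc 1 *\<^sub>R c3) = c1"
    using eqs pos
  proof eventually_elim
    case (elim t)
    have "t *\<^sub>R (t^2 *\<^sub>R ?h t) = t *\<^sub>R (c1 + (t^Suc 0 *\<^sub>R c2 + t^Suc 1 *\<^sub>R c3))"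
      using elim(1) c0 by (simp add: algebra_simps eval_nat_numeral)
    then have "t^2 *\<^sub>R ?h t = c1 + (t^Suc 0 *\<^sub>R c2 + t^Suc 1 *\<^sub>R c3)" using elim(2) scaleR_cancel_left by (metis less_irrefl)
    then show ?case by simp
  qed
  ultimately have "((\<lambda>t::real. c1) \<longlongrightarrow> 0) (at_right 0)"
    using tendsto_cong by fastforce
  then have c1: "c1 = 0" by (simp add: tendsto_const_iff)
  have "((\<lambda>t. t^1 *\<^sub>R ?h t - (t^Suc 0 *\<^sub>R c3)) \<longlongrightarrow> 0 - 0) (at_right 0)"
    by (intro tendsto_diff tendsto_add lim lim2)
  moreover have "\<forall>\<^sub>F t in at_right 0. t^1 *\<^sub>R ?h t - t^Suc 0 *\<^sub>R c3 = c2"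
    using eqs pos
  proof eventually_elim
    case (elim t)
    have "t^2 *\<^sub>R (t^1 *\<^sub>R ?h t) = t^2 *\<^sub>R (c2 + t^Suc 0 *\<^sub>R c3)"
      using elim(1) c0 c1 by (simp add: algebra_simps eval_nat_numeral)
    then have "t^1 *\<^sub>R ?h t = c2 + t^Suc 0 *\<^sub>R c3" using elim(2) scaleR_cancel_left by (metis less_irrefl power_not_zero)
    then show ?case by simp
  qed
  ultimately have "((\<lambda>t::real. c2) \<longlongrightarrow> 0) (at_right 0)"
    using tendsto_cong by fastforce
  then have c2: "c2 = 0" by (simp add: tendsto_const_iff)
  have "\<forall>\<^sub>F t in at_right 0. ?h t = c3"
    using eqs pos
  proof eventually_elim
    case (elim t)
    have "t^3 *\<^sub>R (?h t) = t^3 *\<^sub>R c3" using elim(1) c0 c1 c2 by simp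
    then show ?case using elim(2) scaleR_cancel_left by (metis less_irrefl power_not_zero)
  qed
  then have "((\<lambda>t::real. c3) \<longlongrightarrow> 0) (at_right 0)"
    using tendsto_cong h by fastforce
  then have "c3 = 0" by (simp add: tendsto_const_iff)
  with c0 c1 c2 show ?thesis by simp
qed

lemma jet3_iff_smallo: "jet3 f 0 0 0 0 \<longleftrightarrow> ((\<lambda>t. f t /\<^sub>R t^3) \<longlongrightarrow> 0) (at_right 0)"
proof
  assume "jet3 f 0 0 0 0"
  then obtain r where r: "(r \<longlongrightarrow> 0) (at_right 0)" "\<forall>\<^sub>F t in at_right 0. f t = t^3 *\<^sub>R r t"
    unfolding jet3_def by auto
  have "\<forall>\<^sub>F t in at_right 0. r t = f t /\<^sub>R t^3"
    using r(2) eventually_at_right_less[of 0] by eventually_elim simp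
  then show "((\<lambda>t. f t /\<^sub>R t^3) \<longlongrightarrow> 0) (at_right 0)" using r(1) tendsto_cong by fastforce
next
  assume *: "((\<lambda>t. f t /\<^sub>R t^3) \<longlongrightarrow> 0) (at_right 0)"
  have "\<forall>\<^sub>F t in at_right 0. f t = 0 + t *\<^sub>R 0 + t^2 *\<^sub>R 0 + t^3 *\<^sub>R 0 + t^3 *\<^sub>R (f t /\<^sub>R t^3)"
    using eventually_at_right_less[of 0] by eventually_elim simp
  then show "jet3 f 0 0 0 0" using * unfolding jet3_def by blast
qed

lemma jet3_linear:
  assumes "bounded_linear h" "jet3 f c0 c1 c2 c3"
  shows "jet3 (\<lambda>t. h (f t)) (h c0) (h c1) (h c2) (h c3)"
proof -
  interpret bounded_linear h by fact
  obtain r where r: "(r \<longlongrightarrow> 0) (at_right 0)"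
    "\<forall>\<^sub>F t in at_right 0. f t = c0 + t *\<^sub>R c1 + t^2 *\<^sub>R c2 + t^3 *\<^sub>R c3 + t^3 *\<^sub>R r t"
    using assms(2) unfolding jet3_def by blast
  have "((\<lambda>t. h (r t)) \<longlongrightarrow> 0) (at_right 0)" using tendsto[OF r(1)] by (simp add: zero)
  moreover have "\<forall>\<^sub>F t in at_right 0. h (f t) = h c0 + t *\<^sub>R h c1 + t^2 *\<^sub>R h c2 + t^3 *\<^sub>R h c3 + t^3 *\<^sub>R h (r t)"
    using r(2) by eventually_elim (simp add: add scaleR)
  ultimately show ?thesis unfolding jet3_def by blast
qed

lemma jet3_add:
  assumes "jet3 f c0 c1 c2 c3" "jet3 g d0 d1 d2 d3"
  shows "jet3 (\<lambda>t. f t + g t) (c0 + d0) (c1 + d1) (c2 + d2) (c3 + d3)"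
proof -
  obtain r s where r: "(r \<longlongrightarrow> 0) (at_right 0)"
    "\<forall>\<^sub>F t in at_right 0. f t = c0 + t *\<^sub>R c1 + t^2 *\<^sub>R c2 + t^3 *\<^sub>R c3 + t^3 *\<^sub>R r t"
    and s: "(s \<longlongrightarrow> 0) (at_right 0)"
    "\<forall>\<^sub>F t in at_right 0. g t = d0 + t *\<^sub>R d1 + t^2 *\<^sub>R d2 + t^3 *\<^sub>R d3 + t^3 *\<^sub>R s t"
    using assms unfolding jet3_def by blast
  have "((\<lambda>t. r t + s t) \<longlongrightarrow> 0) (at_right 0)" using tendsto_add[OF r(1) s(1)] by simp
  moreover have "\<forall>\<^sub>F t in at_right 0. f t + g t = (c0 + d0) + t *\<^sub>R (c1 + d1) + t^2 *\<^sub>R (c2 + d2)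
      + t^3 *\<^sub>R (c3 + d3) + t^3 *\<^sub>R (r t + s t)"
    using r(2) s(2) by eventually_elim (simp add: algebra_simps)
  ultimately show ?thesis unfolding jet3_def by blast
qed

lemma jet3_bilinear:
  assumes "bounded_bilinear pr" "jet3 f c0 c1 c2 c3" "jet3 g d0 d1 d2 d3"
  shows "jet3 (\<lambda>t. pr (f t) (g t)) (pr c0 d0) (pr c0 d1 + pr c1 d0) (pr c0 d2 + pr c1 d1 + pr c2 d0)
     (pr c0 d3 + pr c1 d2 + pr c2 d1 + pr c3 d0)"
proof -
  interpret bounded_bilinear pr by fact
  obtain r s where r: "(r \<longlongrightarrow> 0) (at_right 0)"
    "\<forall>\<^sub>F t in at_right 0. f t = c0 + t *\<^sub>R c1 + t^2 *\<^sub>R c2 + t^3 *\<^sub>R c3 + t^3 *\<^sub>R r t"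
    and s: "(s \<longlongrightarrow> 0) (at_right 0)"
    "\<forall>\<^sub>F t in at_right 0. g t = d0 + t *\<^sub>R d1 + t^2 *\<^sub>R d2 + t^3 *\<^sub>R d3 + t^3 *\<^sub>R s t"
    using assms(2,3) unfolding jet3_def by blast
  define P where "P t = c0 + t *\<^sub>R c1 + t^2 *\<^sub>R c2 + t^3 *\<^sub>R c3" for t :: real
  define Q where "Q t = d0 + t *\<^sub>R d1 + t^2 *\<^sub>R d2 + t^3 *\<^sub>R d3" for t :: real
  \<comment> \<open>Everything of order above three in the product, divided by t^3: first the
    products that involve a remainder, then the polynomial terms of degrees four to six.\<close>
  define R where "R t = pr (P t) (s t) + pr (r t) (Q t) + t^3 *\<^sub>R pr (r t) (s t)
      + (t *\<^sub>R (pr c1 d3 + pr c2 d2 + pr c3 d1) + t^2 *\<^sub>R (pr c2 d3 + pr c3 d2) + t^3 *\<^sub>R pr c3 d3)" for t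
  have P: "(P \<longlongrightarrow> P 0) (at_right 0)" and Q: "(Q \<longlongrightarrow> Q 0) (at_right 0)"
    unfolding P_def Q_def by (intro tendsto_intros)+
  have "(R \<longlongrightarrow> pr (P 0) 0 + pr 0 (Q 0) + 0^3 *\<^sub>R pr 0 0 +
     (0 *\<^sub>R (pr c1 d3 + pr c2 d2 + pr c3 d1) + 0^2 *\<^sub>R (pr c2 d3 + pr c3 d2) + 0^3 *\<^sub>R pr c3 d3)) (at_right 0)"
    unfolding R_def by (intro tendsto_intros tendsto P Q r(1) s(1))
  then have "(R \<longlongrightarrow> 0) (at_right 0)" by (simp add: zero_left zero_right)
  moreover have "\<forall>\<^sub>F t in at_right 0. pr (f t) (g t) = pr c0 d0 + t *\<^sub>R (pr c0 d1 + pr c1 d0)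
      + t^2 *\<^sub>R (pr c0 d2 + pr c1 d1 + pr c2 d0) + t^3 *\<^sub>R (pr c0 d3 + pr c1 d2 + pr c2 d1 + pr c3 d0) + t^3 *\<^sub>R R t"
    using r(2) s(2)
  proof eventually_elim
    case (elim t)
    have "pr (f t) (g t) = pr (P t) (Q t) + t^3 *\<^sub>R (pr (P t) (s t) + pr (r t) (Q t) + t^3 *\<^sub>R pr (r t) (s t))"
      unfolding elim[folded P_def Q_def] by (simp add: add_left add_right scaleR_left scaleR_right algebra_simps)
    moreover have "pr (P t) (Q t) = pr c0 d0 + t *\<^sub>R (pr c0 d1 + pr c1 d0)
      + t^2 *\<^sub>R (pr c0 d2 + pr c1 d1 + pr c2 d0) + t^3 *\<^sub>R (pr c0 d3 + pr c1 d2 + pr c2 d1 + pr c3 d0)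
      + t^3 *\<^sub>R (t *\<^sub>R (pr c1 d3 + pr c2 d2 + pr c3 d1) + t^2 *\<^sub>R (pr c2 d3 + pr c3 d2) + t^3 *\<^sub>R pr c3 d3)"
      unfolding P_def Q_def
      by (simp add: add_left add_right scaleR_left scaleR_right scaleR_add_right eval_nat_numeral mult.assoc add_ac)
    ultimately show ?case unfolding R_def by (simp add: algebra_simps)
  qed
  ultimately show ?thesis unfolding jet3_def by blast
qed

lemmas jet3_mult = jet3_bilinear[OF bounded_bilinear_mult]

lemma jet3_sum:
  assumes "\<And>i. i \<in> I \<Longrightarrow> jet3 (f i) (c0 i) (c1 i) (c2 i) (c3 i)"
  shows "jet3 (\<lambda>t. \<Sum>i\<in>I. f i t) (\<Sum>i\<in>I. c0 i) (\<Sum>i\<in>I. c1 i) (\<Sum>i\<in>I. c2 i) (\<Sum>i\<in>I. c3 i)"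
  using assms by (induction I rule: infinite_finite_induct) (auto intro!: jet3_const jet3_add)

lemma jet3_unique:
  assumes "jet3 f c0 c1 c2 c3" "jet3 f d0 d1 d2 d3"
  shows "c0 = d0 \<and> c1 = d1 \<and> c2 = d2 \<and> c3 = d3"
proof -
  have "jet3 (\<lambda>t. f t + - f t) (c0 + - d0) (c1 + - d1) (c2 + - d2) (c3 + - d3)"
    by (intro jet3_add jet3_linear[OF bounded_linear_minus[OF bounded_linear_ident]] assms)
  from jet3_zeroD[OF this] show ?thesis by simp
qed

lemma jet3_bounded:
  assumes "jet3 f 0 c1 c2 c3"
  shows "\<exists>C>0. \<forall>\<^sub>F t in at_right 0. norm (f t) \<le> C * t"
proof -
  obtain r where r: "(r \<longlongrightarrow> 0) (at_right 0)"
    "\<forall>\<^sub>F t in at_right 0. f t = t *\<^sub>R c1 + t^2 *\<^sub>R c2 + t^3 *\<^sub>R c3 + t^3 *\<^sub>R r t"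
    using assms unfolding jet3_def by auto
  have "((\<lambda>t. c1 + t *\<^sub>R c2 + t^2 *\<^sub>R c3 + t^2 *\<^sub>R r t) \<longlongrightarrow> c1 + 0 *\<^sub>R c2 + 0^2 *\<^sub>R c3 + 0^2 *\<^sub>R 0) (at_right 0)"
    by (intro tendsto_intros r(1))
  then have "((\<lambda>t. norm (c1 + t *\<^sub>R c2 + t^2 *\<^sub>R c3 + t^2 *\<^sub>R r t)) \<longlongrightarrow> norm c1) (at_right 0)"
    using tendsto_norm by fastforce
  then have ev: "\<forall>\<^sub>F t in at_right 0. norm (c1 + t *\<^sub>R c2 + t^2 *\<^sub>R c3 + t^2 *\<^sub>R r t) < norm c1 + 1"
    by (rule order_tendstoD) simp
  have "\<forall>\<^sub>F t in at_right 0. norm (f t) \<le> (norm c1 + 1) * t"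
    using ev r(2) eventually_at_right_less[of 0]
  proof eventually_elim
    case (elim t)
    have "f t = t *\<^sub>R (c1 + t *\<^sub>R c2 + t^2 *\<^sub>R c3 + t^2 *\<^sub>R r t)"
      using elim(2) by (simp add: algebra_simps eval_nat_numeral)
    then have "norm (f t) = t * norm (c1 + t *\<^sub>R c2 + t^2 *\<^sub>R c3 + t^2 *\<^sub>R r t)" using elim(3) by simp
    also have "\<dots> \<le> t * (norm c1 + 1)" using elim(1,3) by (intro mult_left_mono) auto
    finally show ?case by (simp add: mult.commute)
  qed
  then show ?thesis by (intro exI[of _ "norm c1 + 1"]) (simp add: add_nonneg_pos)
qed

lemma jet3_tendsto:
  assumes "jet3 f c0 c1 c2 c3" shows "(f \<longlongrightarrow> c0) (at_right 0)"
proof -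
  obtain r where r: "(r \<longlongrightarrow> 0) (at_right 0)"
    "\<forall>\<^sub>F t in at_right 0. f t = c0 + t *\<^sub>R c1 + t^2 *\<^sub>R c2 + t^3 *\<^sub>R c3 + t^3 *\<^sub>R r t"
    using assms unfolding jet3_def by auto
  have "((\<lambda>t. c0 + t *\<^sub>R c1 + t^2 *\<^sub>R c2 + t^3 *\<^sub>R c3 + t^3 *\<^sub>R r t) \<longlongrightarrow>
      c0 + 0 *\<^sub>R c1 + 0^2 *\<^sub>R c2 + 0^3 *\<^sub>R c3 + 0^3 *\<^sub>R 0) (at_right 0)"
    by (intro tendsto_intros r(1))
  then have *: "((\<lambda>t. c0 + t *\<^sub>R c1 + t^2 *\<^sub>R c2 + t^3 *\<^sub>R c3 + t^3 *\<^sub>R r t) \<longlongrightarrow> c0) (at_right 0)" by simp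
  show ?thesis by (rule Lim_transform_eventually[OF *]) (use r(2) in eventually_elim, simp)
qed

lemma jet3_bigo:
  assumes "C \<ge> 0" "\<forall>\<^sub>F t in at_right 0. norm (f t) \<le> C * t^4"
  shows "jet3 f 0 0 0 0"
  unfolding jet3_iff_smallo
proof (rule Lim_null_comparison)
  show "\<forall>\<^sub>F t in at_right 0. norm (f t /\<^sub>R t^3) \<le> C * t"
    using assms(2) eventually_at_right_less[of 0]
    by eventually_elim (simp add: field_simps eval_nat_numeral)
  show "((\<lambda>t. C * t) \<longlongrightarrow> 0) (at_right 0)"
    using tendsto_mult[OF tendsto_const[of C] tendsto_ident_at[of 0 "{0<..}"]] by simp
qed

text \<open>The curve is inserted in \<open>taylor3\<close>. The coefficient of the term with
  \<open>x1\<close> and \<open>x2\<close> is 1 rather than 1/2, because the two cross terms of the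
  symmetric second derivative coincide.\<close>

lemma jet3_smooth:
  fixes f :: "'a::euclidean_space \<Rightarrow> real"
  assumes sm: "smooth_on S f" and S: "open S" and p: "p \<in> S" and x: "jet3 x 0 x1 x2 x3"
  shows "jet3 (\<lambda>t. f (p + x t)) (f p) (ddir x1 f p) (ddir x2 f p + ddir x1 (ddir x1 f) p / 2)
     (ddir x3 f p + ddir x1 (ddir x2 f) p + ddir x1 (ddir x1 (ddir x1 f)) p / 6)"
proof -
  let ?D1 = "\<lambda>v. ddir v f p" and ?D2 = "\<lambda>u v. ddir u (ddir v f) p"
    and ?D3 = "\<lambda>u v w. ddir u (ddir v (ddir w f)) p"
  have l1: "linear ?D1" by (rule ddir_linear[OF smooth_on_differentiable[OF sm S p]])
  have j1: "jet3 (\<lambda>t. ?D1 (x t)) (?D1 0) (?D1 x1) (?D1 x2) (?D1 x3)"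
    by (rule jet3_linear[OF linear_conv_bounded_linear[THEN iffD1, OF l1] x])
  have b2: "bounded_bilinear ?D2"
    by (rule bilinear_conv_bounded_bilinear[THEN iffD1])
      (simp add: bilinear_def ddir2_linear[OF sm S p])
  have sym: "?D2 x2 x1 = ?D2 x1 x2" by (rule ddir_commute[OF sm S p])
  interpret b2: bounded_bilinear ?D2 by (rule b2)
  have j2: "jet3 (\<lambda>t. ?D2 (x t) (x t)) 0 0 (?D2 x1 x1) (2 * ?D2 x1 x2)"
    by (rule jet3_eqs[OF jet3_bilinear[OF b2 x x]]) (simp_all add: b2.zero_left b2.zero_right sym)
  have expand: "?D3 y y y = (\<Sum>a\<in>Basis. \<Sum>b\<in>Basis. \<Sum>c\<in>Basis. (y \<bullet> a) * ((y \<bullet> b) * ((y \<bullet> c) * ?D3 a b c)))" for y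
    by (subst linear_basis_expansion[OF ddir3_linear(1)[OF sm S p]],
        subst linear_basis_expansion[OF ddir3_linear(2)[OF sm S p]],
        subst linear_basis_expansion[OF ddir3_linear(3)[OF sm S p]])
      (simp add: sum_distrib_left mult.assoc)
  have ja: "jet3 (\<lambda>t. x t \<bullet> a) 0 (x1 \<bullet> a) (x2 \<bullet> a) (x3 \<bullet> a)" for a
    using jet3_linear[OF bounded_linear_inner_left x, of a] by simp
  have "jet3 (\<lambda>t. (x t \<bullet> a) * ((x t \<bullet> b) * ((x t \<bullet> c) * k))) 0 0 0 ((x1 \<bullet> a) * ((x1 \<bullet> b) * ((x1 \<bullet> c) * k)))" for a b c k
    by (rule jet3_eqs[OF jet3_mult[OF ja jet3_mult[OF ja jet3_mult[OF ja jet3_const]]]]) simp_all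
  then have j3: "jet3 (\<lambda>t. ?D3 (x t) (x t) (x t)) 0 0 0 (?D3 x1 x1 x1)"
    unfolding expand
    by (intro jet3_eqs[OF jet3_sum[OF jet3_sum[OF jet3_sum]]]) (assumption | simp)+
  have jr: "jet3 (\<lambda>t. f (p + x t) - (f p + ?D1 (x t) + ?D2 (x t) (x t) / 2 + ?D3 (x t) (x t) (x t) / 6)) 0 0 0 0"
    unfolding jet3_iff_smallo tendsto_iff
  proof (intro allI impI)
    fix e :: real assume e: "e > 0"
    obtain C where C: "C > 0" "\<forall>\<^sub>F t in at_right 0. norm (x t) \<le> C * t" using jet3_bounded[OF x] by blast
    \<comment> \<open>Chosen so that \<open>e'\<close> times (C t)^3 is half of e t^3.\<close>
    define e' where "e' = e / (2 * C^3)"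
    have e': "e' > 0" using e C by (simp add: e'_def)
    obtain \<delta> where \<delta>: "\<delta> > 0" "\<And>y. norm y < \<delta> \<Longrightarrow>
       \<bar>f (p + y) - (f p + ?D1 y + ?D2 y y / 2 + ?D3 y y y / 6)\<bar> \<le> e' * norm y ^ 3"
      using taylor3[OF sm S p e'] by blast
    have "\<forall>\<^sub>F t in at_right 0. norm (x t) < \<delta>"
      using tendsto_norm[OF jet3_tendsto[OF x]] \<delta>(1) by (intro order_tendstoD(2)) auto
    then show "\<forall>\<^sub>F t in at_right 0. dist ((f (p + x t) - (f p + ?D1 (x t) + ?D2 (x t) (x t) / 2 + ?D3 (x t) (x t) (x t) / 6)) /\<^sub>R t ^ 3) 0 < e"
      using C(2) eventually_at_right_less[of 0]
    proof eventually_elim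
      case (elim t)
      let ?y = "x t"
      have "\<bar>f (p + ?y) - (f p + ?D1 ?y + ?D2 ?y ?y / 2 + ?D3 ?y ?y ?y / 6)\<bar> \<le> e' * norm ?y ^ 3"
        by (rule \<delta>(2)[OF elim(1)])
      also have "\<dots> \<le> e' * (C * t) ^ 3" using elim e' by (intro mult_left_mono power_mono) auto
      also have "\<dots> = e / 2 * t^3" using C by (simp add: e'_def power_mult_distrib)
      also have "\<dots> < e * t^3" using e elim by simp
      finally show ?case using elim(3) by (simp add: field_simps)
    qed
  qed
  have "jet3 (\<lambda>t. (f p + (?D1 (x t) + (?D2 (x t) (x t) * (1/2) + ?D3 (x t) (x t) (x t) * (1/6)))) +
      (f (p + x t) - (f p + ?D1 (x t) + ?D2 (x t) (x t) / 2 + ?D3 (x t) (x t) (x t) / 6)))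
      (f p) (?D1 x1) (?D1 x2 + ?D2 x1 x1 / 2) (?D1 x3 + ?D2 x1 x2 + ?D3 x1 x1 x1 / 6)"
    by (rule jet3_eqs[OF jet3_add[OF jet3_add[OF jet3_const jet3_add[OF j1 jet3_add[OF
          jet3_linear[OF bounded_linear_mult_left j2] jet3_linear[OF bounded_linear_mult_left j3]]]] jr]])
      (simp_all add: linear_0[OF l1])
  then show ?thesis by (simp add: algebra_simps)
qed

section \<open>Weighted order in terms of curves\<close>

lemma weighted_order_ge4D:
  fixes F :: "(complex^'n) \<times> real \<Rightarrow> real"
  assumes w: "weighted_order_ge4 F" and sm: "smooth_on W F" and W: "open W" "0 \<in> W"
  shows "F 0 = 0" "ddir v F 0 = 0" "ddir (z, 0) (ddir v F) 0 = 0"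
    "ddir (z, 0) (ddir (z', 0) (ddir (z'', 0) F)) 0 = 0"
proof -
  note d1 = ddir_linear[OF smooth_on_differentiable[OF sm W]]
  note d2 = ddir2_linear[OF sm W]
  note d3 = ddir3_linear[OF sm W]
  have B: "(Basis :: ((complex^'n) \<times> real) set) = (\<lambda>u. (u, 0)) ` Basis \<union> {(0, 1)}"
    by (auto simp: Basis_prod_def)
  have wz: "wt (b, 0::real) = 1" if "b \<in> Basis" for b :: "complex^'n"
    using that nonzero_Basis by (auto simp: wt_def)
  have wu: "wt (0 :: complex^'n, 1::real) = 2" by (simp add: wt_def)
  have pd: "pderivs vs F 0 = 0" if "set vs \<subseteq> Basis" "sum_list (map wt vs) < 4" for vs
    using w that unfolding weighted_order_ge4_def by blast
  show "F 0 = 0" using pd[of "[]"] by simp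
  show e1: "ddir v F 0 = 0" for v
  proof -
    have "ddir b F 0 = 0" if "b \<in> Basis" for b
      using pd[of "[b]"] that wz wu unfolding B by (auto simp: wt_def)
    then show ?thesis by (subst linear_basis_expansion[OF d1]) simp
  qed
  have zexp: "(z, 0::real) \<bullet> b = 0 \<or> (\<exists>c\<in>Basis. b = (c, 0))" if "b \<in> Basis" for b :: "(complex^'n) \<times> real" and z
    using that unfolding B by auto
  have lin0: "g (z, 0) = 0" if "linear g" "\<And>b. b \<in> Basis \<Longrightarrow> g (b, 0) = 0" for g :: "(complex^'n) \<times> real \<Rightarrow> real" and z
  proof -
    have "((z, 0::real) \<bullet> b) * g b = 0" if "b \<in> Basis" for b
      using zexp[OF that, of z] \<open>\<And>b. b \<in> Basis \<Longrightarrow> g (b, 0) = 0\<close> by auto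
    then show ?thesis by (subst linear_basis_expansion[OF that(1)]) (rule sum.neutral, simp)
  qed
  show "ddir (z, 0) (ddir v F) 0 = 0"
  proof (rule lin0[OF d2(1)])
    fix b :: "complex^'n" assume b: "b \<in> Basis"
    have "ddir (b, 0) (ddir c F) 0 = 0" if c: "c \<in> Basis" for c
      using pd[of "[(b,0), c]"] b c wz wu unfolding B by auto
    then show "ddir (b, 0) (ddir v F) 0 = 0" by (subst linear_basis_expansion[OF d2(2)]) simp
  qed
  show "ddir (z, 0) (ddir (z', 0) (ddir (z'', 0) F)) 0 = 0"
  proof (rule lin0[OF d3(1)], rule lin0[OF d3(2)], rule lin0[OF d3(3)])
    fix a b c :: "complex^'n" assume "a \<in> Basis" "b \<in> Basis" "c \<in> Basis"
    then show "ddir (a, 0) (ddir (b, 0) (ddir (c, 0) F)) 0 = 0"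
      using pd[of "[(a,0), (b,0), (c,0)]"] wz unfolding B by auto
  qed
qed

text \<open>The velocity has no component along Re w, so that component starts at order t^2, as its
  weight demands. Every derivative that \<open>jet3_smooth\<close> then produces has weighted degree
  at most three.\<close>

lemma jet3_weighted_order_ge4:
  fixes F :: "(complex^'n) \<times> real \<Rightarrow> real"
  assumes w: "weighted_order_ge4 F" and sm: "smooth_on W F" and W: "open W" "0 \<in> W"
    and x: "jet3 x 0 (z1, 0) x2 x3"
  shows "jet3 (\<lambda>t. F (x t)) 0 0 0 0"
  using jet3_smooth[OF sm W x] by (simp add: weighted_order_ge4D[OF w sm W])

lemma symmetric_bilinear_zero:
  fixes B :: "'a::real_vector \<Rightarrow> 'a \<Rightarrow> real"
  assumes "\<And>x. linear (B x)" "\<And>y. linear (\<lambda>x. B x y)" "\<And>x y. B x y = B y x" "\<And>x. B x x = 0"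
  shows "B x y = 0"
proof -
  have "B (x + y) (x + y) = B x x + B x y + B y x + B y y"
    by (simp add: linear_add[OF assms(1)] linear_add[OF assms(2)])
  then show ?thesis using assms(3)[of x y] by (simp add: assms(4))
qed

text \<open>Polarisation: the expansions at x + y and x - y together isolate \<open>C x x y\<close>,
  and the bilinear case does the rest.\<close>

lemma symmetric_trilinear_zero:
  fixes C :: "'a::real_vector \<Rightarrow> 'a \<Rightarrow> 'a \<Rightarrow> real"
  assumes l: "\<And>y z. linear (\<lambda>x. C x y z)" "\<And>x z. linear (\<lambda>y. C x y z)" "\<And>x y. linear (C x y)"
    and s: "\<And>x y z. C x y z = C y x z" "\<And>x y z. C x y z = C x z y" and d: "\<And>x. C x x x = 0"
  shows "C x y z = 0"
proof -
  have *: "C x x y = 0" for x y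
  proof -
    have "C (x + y) (x + y) (x + y) = C x x x + 3 * C x x y + 3 * C x y y + C y y y"
      using s(1)[of y x x] s(2)[of x y x] s(1)[of y x y] s(2)[of y y x]
      by (simp add: linear_add[OF l(1)] linear_add[OF l(2)] linear_add[OF l(3)])
    moreover have "C (x + -y) (x + -y) (x + -y) = C x x x - 3 * C x x y + 3 * C x y y - C y y y"
      using s(1)[of y x x] s(2)[of x y x] s(1)[of y x y] s(2)[of y y x]
      by (simp add: linear_add[OF l(1)] linear_add[OF l(2)] linear_add[OF l(3)]
          linear_neg[OF l(1)] linear_neg[OF l(2)] linear_neg[OF l(3)] del: add_uminus_conv_diff)
    ultimately show ?thesis using d by simp
  qed
  show ?thesis
    by (rule symmetric_bilinear_zero[of "\<lambda>x y. C x y z"]) (rule l s(1) *)+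
qed

text \<open>Along (t z, t^2 u) the coefficient of t^k is the part of weighted degree k. Setting u or
  z to 0 separates the pure from the mixed derivatives, and polarisation passes from the diagonal to
  arbitrary basis vectors.\<close>

lemma weighted_order_ge4I:
  fixes F :: "(complex^'n) \<times> real \<Rightarrow> real"
  assumes sm: "smooth_on W F" and W: "open W" "0 \<in> W"
    and jets: "\<And>z u. jet3 (\<lambda>t. F (t *\<^sub>R z, t^2 * u)) 0 0 0 0"
  shows "weighted_order_ge4 F"
proof -
  note d1 = ddir_linear[OF smooth_on_differentiable[OF sm W]]
  note d2 = ddir2_linear[OF sm W]
  note d3 = ddir3_linear[OF sm W]
  have eqs: "F 0 = 0 \<and> ddir (z, 0) F 0 = 0 \<and> ddir (0, u) F 0 + ddir (z, 0) (ddir (z, 0) F) 0 / 2 = 0 \<and>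
     ddir (z, 0) (ddir (0, u) F) 0 + ddir (z, 0) (ddir (z, 0) (ddir (z, 0) F)) 0 / 6 = 0" for z u
  proof -
    have x: "jet3 (\<lambda>t. (t *\<^sub>R z, t^2 * u)) 0 (z, 0) (0, u) 0"
      by (rule jet3_exact) (simp add: zero_prod_def)
    show ?thesis using jet3_unique[OF jet3_smooth[OF sm W x, unfolded add_0_left] jets[of z u]] linear_0[OF d1] by simp
  qed
  have l: "linear (\<lambda>z. g (z, 0))" if "linear g" for g :: "(complex^'n) \<times> real \<Rightarrow> real"
    using that by (intro linearI) (metis add_Pair add_0_right linear_add, metis linear_cmul scaleR_Pair scaleR_zero_right)
  have u0: "((0, 0) :: (complex^'n) \<times> real) = 0" by (simp add: zero_prod_def)
  have zz: "ddir (z, 0) (ddir (z, 0) F) 0 = 0" for z using eqs[of z 0] linear_0[OF d1] u0 by simp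
  have e_u: "ddir (0, u) F 0 = 0" for u using eqs[of 0 u] linear_0[OF d1] zz by simp
  have zzz: "ddir (z, 0) (ddir (z, 0) (ddir (z, 0) F)) 0 = 0" for z
    using eqs[of z 0] linear_0[OF d2(2)] u0 by simp
  have zu: "ddir (z, 0) (ddir (0, u) F) 0 = 0" for z u using eqs[of z u] zzz by simp
  have zz': "ddir (z, 0) (ddir (z', 0) F) 0 = 0" for z z'
    by (rule symmetric_bilinear_zero[of "\<lambda>z z'. ddir (z, 0) (ddir (z', 0) F) 0"])
      (use l[OF d2(1)] l[OF d2(2)] zz ddir_commute[OF sm W] in auto)
  have zzz': "ddir (z, 0) (ddir (z', 0) (ddir (z'', 0) F)) 0 = 0" for z z' z''
    by (rule symmetric_trilinear_zero[of "\<lambda>z z' z''. ddir (z, 0) (ddir (z', 0) (ddir (z'', 0) F)) 0"])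
      (rule l[OF d3(1)] l[OF d3(2)] l[OF d3(3)] zzz ddir3_commute[OF sm W] ddir_commute[OF smooth_on_ddir[OF sm W(1)] W])+
  have B: "(Basis :: ((complex^'n) \<times> real) set) = (\<lambda>u. (u, 0)) ` Basis \<union> {(0, 1)}"
    by (auto simp: Basis_prod_def)
  have wcase: "(\<exists>z. v = (z, 0) \<and> wt v = 1) \<or> (\<exists>u. v = (0, u) \<and> wt v = 2)" if "v \<in> Basis" for v :: "(complex^'n) \<times> real"
    using that nonzero_Basis unfolding B by (auto simp: wt_def)
  have uz: "ddir (0, u) (ddir (z, 0) F) 0 = 0" for z u
    using zu ddir_commute[OF sm W] by metis
  show ?thesis
    unfolding weighted_order_ge4_def
  proof (intro allI impI)
    fix vs :: "((complex^'n) \<times> real) list" assume vs: "set vs \<subseteq> Basis" "sum_list (map wt vs) < 4"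
    have ge1: "wt v \<ge> 1" for v :: "(complex^'n) \<times> real" by (simp add: wt_def)
    have "length xs \<le> sum_list (map wt xs)" for xs :: "((complex^'n) \<times> real) list"
      by (induction xs) (auto, metis One_nat_def Suc_le_mono add.commute add_mono ge1 plus_1_eq_Suc)
    then have len: "length vs < 4" using vs(2) le_less_trans by blast
    then consider "vs = []" | a where "vs = [a]" | a b where "vs = [a, b]" | a b c where "vs = [a, b, c]"
      by (cases vs; cases "tl vs"; cases "tl (tl vs)"; cases "tl (tl (tl vs))") auto
    then show "pderivs vs F 0 = 0"
    proof cases
      case 1 then show ?thesis using eqs by simp
    next
      case 2 then show ?thesis using wcase[of a] vs eqs e_u by auto
    next
      case 3 then show ?thesis using wcase[of a] wcase[of b] vs zz' zu uz by auto
    next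
      case 4
      then have "wt a + (wt b + wt c) < 4" using vs by simp
      then have "wt a = 1" "wt b = 1" "wt c = 1" using ge1[of a] ge1[of b] ge1[of c] by linarith+
      then show ?thesis using wcase[of a] wcase[of b] wcase[of c] vs zzz' 4 by auto
    qed
  qed
qed

section \<open>Implicit functions and local biholomorphisms\<close>

text \<open>The derivative of the inverse is recorded as well, since \<open>local_biholo\<close>
  needs it to be complex linear. Continuity of the derivative as an operator follows from that of
  the finitely many partial derivatives.\<close>

lemma smooth_inverse_function:
  fixes f :: "'a::euclidean_space \<Rightarrow> 'a"
  assumes sm: "smooth_on N f" and N: "open N" "x0 \<in> N" and inj: "inj (\<lambda>v. ddir v f x0)"
  obtains U V g where "open U" "U \<subseteq> N" "x0 \<in> U" "open V" "f x0 \<in> V" "homeomorphism U V f g"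
    "\<And>y. y \<in> V \<Longrightarrow> (g has_derivative inv (\<lambda>v. ddir v f (g y))) (at y)"
    "\<And>y. y \<in> V \<Longrightarrow> bij (\<lambda>v. ddir v f (g y))"
proof -
  define f' where "f' x = Blinfun (\<lambda>v. ddir v f x)" for x
  have bl: "bounded_linear (\<lambda>v. ddir v f x)" if "x \<in> N" for x
    using ddir_linear[OF smooth_on_differentiable[OF sm N(1) that]] linear_conv_bounded_linear by blast
  have ap: "blinfun_apply (f' x) = (\<lambda>v. ddir v f x)" if "x \<in> N" for x
    unfolding f'_def by (simp add: bounded_linear_Blinfun_apply[OF bl[OF that]])
  have der: "(f has_derivative blinfun_apply (f' x)) (at x)" if "x \<in> N" for x
    unfolding ap[OF that] by (rule has_derivative_ddir[OF smooth_on_differentiable[OF sm N(1) that]])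
  have cont: "continuous_on N f'"
    unfolding continuous_on_def
  proof (intro ballI tendsto_componentwise1)
    fix x i :: 'a assume x: "x \<in> N" and "i \<in> Basis"
    have "((\<lambda>y. ddir i f y) \<longlongrightarrow> ddir i f x) (at x within N)"
      using smooth_on_continuous[OF smooth_on_ddir[OF sm N(1)] N(1), of i] x by (simp add: continuous_on_def)
    then show "((\<lambda>y. blinfun_apply (f' y) i) \<longlongrightarrow> blinfun_apply (f' x) i) (at x within N)"
      by (rule Lim_transform_within[OF _ zero_less_one, THEN tendsto_eq_rhs]) (simp_all add: ap x)
  qed
  obtain g0 where g0: "linear g0" "g0 \<circ> (\<lambda>v. ddir v f x0) = id"
    using linear_injective_left_inverse[OF bounded_linear.linear[OF bl[OF N(2)]] inj] by blast
  have "Blinfun g0 o\<^sub>L f' x0 = id_blinfun"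
    using g0 by (intro blinfun_eqI)
      (simp add: ap[OF N(2)] bounded_linear_Blinfun_apply linear_conv_bounded_linear[THEN iffD1] o_def fun_eq_iff)
  from inverse_function_theorem[OF N(1) der cont N(2) this]
  obtain U V g g' where *: "open U" "U \<subseteq> N" "x0 \<in> U" "open V" "f x0 \<in> V" "homeomorphism U V f g"
    "\<And>y. y \<in> V \<Longrightarrow> (g has_derivative (g' y)) (at y)"
    "\<And>y. y \<in> V \<Longrightarrow> g' y = inv (blinfun_apply (f'(g y)))"
    "\<And>y. y \<in> V \<Longrightarrow> bij (blinfun_apply (f'(g y)))" by blast
  have gN: "g y \<in> N" if "y \<in> V" for y
    using that *(2,6) unfolding homeomorphism_def by auto
  show ?thesis
    by (rule that[OF *(1-6)]) (use *(7-9) ap gN in auto)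
qed

text \<open>The map \<open>S\<close>, which sends (z, w) to (z, Re w + i rho), flattens the zero
  set; its local inverse over real w is the graph, at first only differentiable. Smoothness comes
  from \<open>dG\<close>, where the derivative of \<open>G\<close> is a smooth expression in
  \<open>G\<close> itself.\<close>

lemma smooth_implicit_function:
  fixes \<rho> :: "(complex^'n) \<times> complex \<Rightarrow> real"
  assumes sm0: "smooth_on N0 \<rho>" and N0: "open N0" "0 \<in> N0" and \<rho>0: "\<rho> 0 = 0" and nz: "ddir (0, \<i>) \<rho> 0 \<noteq> 0"
  obtains V W G where "open V" "0 \<in> V" "V \<subseteq> N0" "open W" "0 \<in> W" "smooth_on W G" "G 0 = 0"
    "\<And>q. q \<in> V \<Longrightarrow> (fst q, Re (snd q)) \<in> W"
    "\<And>q. q \<in> V \<Longrightarrow> \<rho> q = 0 \<longleftrightarrow> Im (snd q) = G (fst q, Re (snd q))"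
    "\<And>x. x \<in> W \<Longrightarrow> \<rho> (fst x, Complex (snd x) (G x)) = 0"
proof -
  \<comment> \<open>Shrunk so that the divisor in \<open>dG\<close> never vanishes.\<close>
  define N where "N = {q \<in> N0. ddir (0, \<i>) \<rho> q \<noteq> 0}"
  have N: "open N" "0 \<in> N"
  proof -
    have "open (N0 \<inter> (ddir (0, \<i>) \<rho>) -` (- {0}))"
      by (rule continuous_open_preimage[OF smooth_on_continuous[OF smooth_on_ddir[OF sm0 N0(1)] N0(1)] N0(1)]) auto
    moreover have "N = N0 \<inter> (ddir (0, \<i>) \<rho>) -` (- {0})" by (auto simp: N_def)
    ultimately show "open N" by simp
    show "0 \<in> N" using N0 nz by (simp add: N_def)
  qed
  have sm: "smooth_on N \<rho>" by (rule smooth_on_subset[OF sm0]) (auto simp: N_def)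
  define S where "S q = (fst q, of_real (Re (snd q)) + of_real (\<rho> q) * \<i>)" for q :: "(complex^'n) \<times> complex"
  have Ssm: "Ck k N S" for k
  proof -
    have "Ck k N (\<lambda>q. (fst q, of_real (Re (snd q))) + \<rho> q *\<^sub>R (0 :: complex^'n, \<i>))"
    proof (rule Ck_add[OF N(1)])
      show "Ck k N (\<lambda>q. (fst q :: complex^'n, complex_of_real (Re (snd q))))"
        by (rule Ck_linear) (intro bounded_linear_Pair bounded_linear_fst
            bounded_linear_compose[OF bounded_linear_of_real] bounded_linear_compose[OF bounded_linear_Re bounded_linear_snd])
      show "Ck k N (\<lambda>q. \<rho> q *\<^sub>R (0 :: complex^'n, \<i>))"
        using sm unfolding smooth_on_iff_Ck by (blast intro: Ck_linear_comp[OF bounded_linear_scaleR_left N(1)])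
    qed
    moreover have "S = (\<lambda>q. (fst q, of_real (Re (snd q))) + \<rho> q *\<^sub>R (0 :: complex^'n, \<i>))"
      by (auto simp: S_def fun_eq_iff scaleR_conv_of_real)
    ultimately show ?thesis by simp
  qed
  have dS: "ddir v S q = (fst v, of_real (Re (snd v)) + of_real (ddir v \<rho> q) * \<i>)" if "q \<in> N" for q v
    unfolding S_def
    by (rule ddir_eqI) (auto intro!: derivative_eq_intros has_derivative_ddir smooth_on_differentiable[OF sm N(1) that])
  have d\<rho>: "ddir (v + w) \<rho> q = ddir v \<rho> q + ddir w \<rho> q" "ddir (c *\<^sub>R v) \<rho> q = c * ddir v \<rho> q" if "q \<in> N" for v w q c
    using ddir_add ddir_scale smooth_on_differentiable[OF sm N(1) that] by force+
  have inj: "inj (\<lambda>v. ddir v S 0)"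
  proof -
    have "linear (\<lambda>v. ddir v S 0)" using ddir_linear differentiable_onD_open[OF Ck_differentiable[OF Ssm] N] by blast
    moreover have "v = 0" if "ddir v S 0 = 0" for v
    proof -
      have e: "(fst v, of_real (Re (snd v)) + of_real (ddir v \<rho> 0) * \<i>) = 0" using that dS[OF N(2)] by simp
      then have "fst v = 0" by (simp add: prod_eq_iff)
      moreover have "of_real (Re (snd v)) + of_real (ddir v \<rho> 0) * \<i> = 0" using e by (simp add: prod_eq_iff)
      then have 1: "Re (snd v) = 0" and 2: "ddir v \<rho> 0 = 0" by (simp_all add: complex_eq_iff)
      have v: "v = Im (snd v) *\<^sub>R (0, \<i>)" using \<open>fst v = 0\<close> 1 by (simp add: prod_eq_iff complex_eq_iff)
      have "Im (snd v) * ddir (0, \<i>) \<rho> 0 = 0" using 2 d\<rho>(2)[OF N(2), of "Im (snd v)" "(0, \<i>)"] v by simp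
      then show "v = 0" using v nz by (simp add: zero_prod_def)
    qed
    ultimately show ?thesis using linear_injective_0 by blast
  qed
  have S0: "S 0 = 0" using \<rho>0 by (simp add: S_def zero_prod_def)
  obtain U' V' g where g: "open U'" "U' \<subseteq> N" "0 \<in> U'" "open V'" "0 \<in> V'" "homeomorphism U' V' S g"
    "\<And>y. y \<in> V' \<Longrightarrow> g differentiable (at y)"
  proof -
    have "smooth_on N S" using Ssm smooth_on_iff_Ck by blast
    then show ?thesis
    proof (rule smooth_inverse_function[OF _ N inj])
      fix U V g
      assume *: "open U" "U \<subseteq> N" "0 \<in> U" "open V" "S 0 \<in> V" "homeomorphism U V S g"
        and der: "\<And>y. y \<in> V \<Longrightarrow> (g has_derivative inv (\<lambda>v. ddir v S (g y))) (at y)"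
      show ?thesis
        by (rule that[OF *(1-4) _ *(6)]) (use *(5) S0 differentiableI[OF der] in auto)
    qed
  qed
  define \<iota> where "\<iota> x = (fst x, complex_of_real (snd x))" for x :: "(complex^'n) \<times> real"
  have bl_\<iota>: "bounded_linear \<iota>" unfolding \<iota>_def
    by (intro bounded_linear_Pair bounded_linear_fst bounded_linear_compose[OF bounded_linear_of_real bounded_linear_snd])
  define W where "W = \<iota> -` V'"
  define G where "G x = Im (snd (g (\<iota> x)))" for x
  have W: "open W" "0 \<in> W"
  proof -
    show "open W" unfolding W_def
      by (rule open_vimage[OF g(4)]) (simp add: linear_continuous_on[OF bl_\<iota>])
    have "\<iota> 0 = 0" by (simp add: \<iota>_def zero_prod_def)
    then show "0 \<in> W" using g(5) by (simp add: W_def)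
  qed
  have gS: "g (S q) = q" if "q \<in> U'" for q using g(6) that by (simp add: homeomorphism_def)
  have Sg: "S (g y) = y" "g y \<in> U'" if "y \<in> V'" for y using g(6) that by (auto simp: homeomorphism_def)
  have graph: "g (\<iota> x) = (fst x, Complex (snd x) (G x))" "\<rho> (g (\<iota> x)) = 0" if "x \<in> W" for x
  proof -
    have "S (g (\<iota> x)) = \<iota> x" using Sg that by (simp add: W_def)
    then have *: "fst (g (\<iota> x)) = fst x" "of_real (Re (snd (g (\<iota> x)))) + of_real (\<rho> (g (\<iota> x))) * \<i> = (of_real (snd x) :: complex)"
      by (simp_all add: S_def \<iota>_def)
    then have "Re (snd (g (\<iota> x))) = snd x" and "\<rho> (g (\<iota> x)) = 0" by (simp_all add: complex_eq_iff)
    with * show "g (\<iota> x) = (fst x, Complex (snd x) (G x))" "\<rho> (g (\<iota> x)) = 0"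
      by (simp_all add: G_def prod_eq_iff complex_eq_iff)
  qed
  have inN: "(fst x, Complex (snd x) (G x)) \<in> N" if "x \<in> W" for x
    using graph(1)[OF that] Sg(2)[of "\<iota> x"] that g(2) by (auto simp: W_def)
  have gr: "(fst x, Complex (snd x) (G x)) = \<iota> x + G x *\<^sub>R (0, \<i>)" for x
    by (simp add: \<iota>_def prod_eq_iff complex_eq_iff)
  have Gd: "G differentiable (at x)" if "x \<in> W" for x
  proof -
    have "(\<lambda>x. g (\<iota> x)) differentiable (at x)"
      using differentiable_chain_at[of \<iota> x g] g(7) that bounded_linear_imp_differentiable[OF bl_\<iota>]
      by (auto simp: W_def o_def)
    from differentiable_chain_at[OF this, of "\<lambda>q. Im (snd q)"] show ?thesis
      unfolding G_def o_def
      by (simp add: bounded_linear_imp_differentiable bounded_linear_compose[OF bounded_linear_Im bounded_linear_snd])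
  qed
  let ?gr = "\<lambda>x. \<iota> x + G x *\<^sub>R (0, \<i>)"
  have grN: "?gr ` W \<subseteq> N" using inN gr by auto
  have dG: "ddir v G x = - (ddir (\<iota> v) \<rho> (?gr x) * inverse (ddir (0, \<i>) \<rho> (?gr x)))" if x: "x \<in> W" for x v
  proof -
    have xN: "?gr x \<in> N" using grN x by auto
    have "(?gr has_derivative (\<lambda>v. \<iota> v + ddir v G x *\<^sub>R (0, \<i>))) (at x)"
      by (intro has_derivative_add bounded_linear_imp_has_derivative[OF bl_\<iota>] has_derivative_scaleR_left
          has_derivative_ddir Gd x)
    from diff_chain_at[OF this has_derivative_ddir[OF smooth_on_differentiable[OF sm N(1) xN]]]
    have "ddir v (\<rho> \<circ> ?gr) x = ddir (\<iota> v + ddir v G x *\<^sub>R (0, \<i>)) \<rho> (?gr x)"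
      by (subst ddir_eqI) (auto simp: o_def)
    moreover have "ddir v (\<rho> \<circ> ?gr) x = ddir v (\<lambda>x. 0) x"
      by (rule ddir_cong[OF W(1) x]) (use graph gr in auto)
    moreover have "ddir v (\<lambda>x. 0::real) x = 0" by (rule ddir_eqI[OF has_derivative_const])
    ultimately have "ddir (\<iota> v) \<rho> (?gr x) + ddir v G x * ddir (0, \<i>) \<rho> (?gr x) = 0"
      by (simp only: d\<rho>[OF xN])
    moreover have "ddir (0, \<i>) \<rho> (?gr x) \<noteq> 0" using xN by (simp add: N_def)
    ultimately show ?thesis by (simp add: field_simps eq_neg_iff_add_eq_0)
  qed
  \<comment> \<open>Bootstrapping: if \<open>G\<close> is of class k, then so is the right-hand side
    of \<open>dG\<close>, and hence \<open>G\<close> is of class k + 1.\<close>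
  have GCk: "Ck k W G" for k
  proof (induction k)
    case 0
    then show ?case using Gd by (simp add: differentiable_on_eq_differentiable_at[OF W(1)])
  next
    case (Suc k)
    have grk: "Ck k W ?gr"
      by (intro Ck_add[OF W(1)] Ck_linear[OF bl_\<iota>] Ck_linear_comp[OF bounded_linear_scaleR_left W(1)] Suc)
    have dk: "Ck k W (\<lambda>x. ddir v \<rho> (?gr x))" for v
      by (rule Ck_compose[OF W(1) N(1) grN _ grk]) (use smooth_on_ddir[OF sm N(1)] smooth_on_iff_Ck in blast)
    show ?case
    proof (rule Ck_SucI[OF W(1), where D = "\<lambda>x v. - (ddir (\<iota> v) \<rho> (?gr x) * inverse (ddir (0, \<i>) \<rho> (?gr x)))"])
      show "(G has_derivative (\<lambda>v. - (ddir (\<iota> v) \<rho> (?gr x) * inverse (ddir (0, \<i>) \<rho> (?gr x))))) (at x)" if "x \<in> W" for x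
        by (rule has_derivative_eq_rhs[OF has_derivative_ddir[OF Gd[OF that]]]) (intro ext dG[OF that])
      show "Ck k W (\<lambda>x. - (ddir (\<iota> b) \<rho> (?gr x) * inverse (ddir (0, \<i>) \<rho> (?gr x))))" for b
        by (rule Ck_linear_comp[OF bounded_linear_minus[OF bounded_linear_ident] W(1)],
            rule Ck_bilinear[OF bounded_bilinear_mult W(1) dk Ck_inverse[OF W(1) _ dk]])
          (use grN in \<open>auto simp: N_def\<close>)
    qed
  qed
  have graph_iff: "\<rho> q = 0 \<longleftrightarrow> Im (snd q) = G (fst q, Re (snd q))" if q: "q \<in> U'" "(fst q, Re (snd q)) \<in> W" for q
  proof
    assume "\<rho> q = 0"
    then have "S q = \<iota> (fst q, Re (snd q))" by (simp add: S_def \<iota>_def)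
    then show "Im (snd q) = G (fst q, Re (snd q))" using gS[OF q(1)] by (simp add: G_def)
  next
    assume "Im (snd q) = G (fst q, Re (snd q))"
    then have "q = g (\<iota> (fst q, Re (snd q)))" using graph(1)[OF q(2)] by (simp add: prod_eq_iff complex_eq_iff)
    then show "\<rho> q = 0" using graph(2)[OF q(2)] by simp
  qed
  let ?V = "U' \<inter> (\<lambda>q. (fst q, Re (snd q))) -` W"
  have "open ?V"
    by (intro open_Int g(1) open_vimage W(1) continuous_intros)
  moreover have "0 \<in> ?V" using g(3) W(2) by (simp add: zero_prod_def)
  moreover have "G 0 = 0"
    using gS[OF g(3)] S0 bounded_linear.linear[OF bl_\<iota>] by (simp add: G_def linear_0)
  ultimately show ?thesis
    using g(2) W GCk graph_iff graph by (intro that[of ?V W G]) (auto simp: smooth_on_iff_Ck N_def)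
qed

section \<open>Complex scalars and local biholomorphisms\<close>

lemma bounded_bilinear_cmul: "bounded_bilinear (cmul :: complex \<Rightarrow> (complex^'n) \<times> complex \<Rightarrow> _)"
  by (rule bilinear_conv_bounded_bilinear[THEN iffD1])
    (auto simp: bilinear_def cmul_def vec_eq_iff algebra_simps scaleR_conv_of_real[where 'a=complex] intro!: linearI)

lemma cmul_simps [simp]: "cmul 1 x = x" "cmul 0 x = 0" "cmul c 0 = 0" "cmul a (cmul b x) = cmul (a * b) x"
  by (auto simp: cmul_def vec_eq_iff prod_eq_iff mult.assoc)

lemma cmul_add_left: "cmul (a + b) x = cmul a x + cmul b x"
  and cmul_add_right: "cmul a (x + y) = cmul a x + cmul a y"
  and cmul_minus_left: "cmul (- a) x = - cmul a x"
  and cmul_diff_left: "cmul (a - b) x = cmul a x - cmul b x"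
  by (auto simp: cmul_def vec_eq_iff prod_eq_iff algebra_simps)

lemma cmul_of_real: "cmul (of_real r) x = r *\<^sub>R x"
  by (auto simp: cmul_def vec_eq_iff prod_eq_iff scaleR_conv_of_real[where 'a=complex])

lemma cmul_scaleR: "cmul (t *\<^sub>R c) x = t *\<^sub>R cmul c x" "cmul c (t *\<^sub>R x) = t *\<^sub>R cmul c x"
  by (auto simp: cmul_def vec_eq_iff prod_eq_iff scaleR_conv_of_real[where 'a=complex] algebra_simps)

lemma cmul_sum_right: "cmul a (\<Sum>i\<in>I. f i) = (\<Sum>i\<in>I. cmul a (f i))"
  by (induction I rule: infinite_finite_induct) (auto simp: cmul_add_right)

lemma cmul_eq_0_iff: "cmul c x = 0 \<longleftrightarrow> c = 0 \<or> x = 0"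
  by (auto simp: cmul_def vec_eq_iff prod_eq_iff)

text \<open>\<open>\<Phi>\<close> is the local inverse of \<open>\<Theta>\<close>. Its derivative is
  the inverse of a complex linear bijection and therefore complex linear, which is the kind of
  holomorphy that \<open>biholo\<close> asks for.\<close>

lemma local_biholo:
  fixes \<Theta> :: "(complex^'n) \<times> complex \<Rightarrow> (complex^'n) \<times> complex"
  assumes sm: "smooth_on UNIV \<Theta>" and cl: "\<And>q v. ddir (cmul \<i> v) \<Theta> q = cmul \<i> (ddir v \<Theta> q)"
    and inj: "inj (\<lambda>v. ddir v \<Theta> 0)" and V: "open V" "0 \<in> V"
  obtains V' \<Phi> where "open V'" "0 \<in> V'" "V' \<subseteq> V" "biholo \<Phi> (\<Theta> ` V') V'" "\<And>q. q \<in> V' \<Longrightarrow> \<Phi> (\<Theta> q) = q"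
proof -
  obtain U1 V1 g where g: "open U1" "0 \<in> U1" "open V1" "\<Theta> 0 \<in> V1" "homeomorphism U1 V1 \<Theta> g"
    "\<And>y. y \<in> V1 \<Longrightarrow> (g has_derivative inv (\<lambda>v. ddir v \<Theta> (g y))) (at y)"
    "\<And>y. y \<in> V1 \<Longrightarrow> bij (\<lambda>v. ddir v \<Theta> (g y))"
    using smooth_inverse_function[OF sm open_UNIV UNIV_I inj] by metis
  define V' where "V' = U1 \<inter> V"
  have V': "open V'" "0 \<in> V'" "V' \<subseteq> V" "V' \<subseteq> U1" using g V by (auto simp: V'_def)
  have gT: "g (\<Theta> q) = q" "\<Theta> q \<in> V1" if "q \<in> V'" for q using g(5) that V' by (auto simp: homeomorphism_def)
  have im: "\<Theta> ` V' = V1 \<inter> g -` V'"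
    using g(5) V'(4) unfolding homeomorphism_def by (auto simp: image_iff)
  have oU: "open (\<Theta> ` V')"
    unfolding im using g(3,5) V'(1) by (auto intro: continuous_open_preimage simp: homeomorphism_def)
  have holg: "holo_on (\<Theta> ` V') g"
    unfolding holo_on_def
  proof (intro ballI exI conjI allI)
    fix x assume "x \<in> \<Theta> ` V'"
    then have x: "x \<in> V1" using im by auto
    let ?D = "\<lambda>v. ddir v \<Theta> (g x)"
    show "(g has_derivative inv ?D) (at x)" by (rule g(6)[OF x])
    fix v
    have b: "bij ?D" by (rule g(7)[OF x])
    have "?D (cmul \<i> (inv ?D v)) = cmul \<i> v" using surj_f_inv_f[OF bij_is_surj[OF b], of v] by (simp add: cl)
    then show "inv ?D (cmul \<i> v) = cmul \<i> (inv ?D v)" by (rule inv_f_eq[OF bij_is_inj[OF b]])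
  qed
  have holT: "holo_on V' \<Theta>"
    unfolding holo_on_def using has_derivative_ddir[OF smooth_on_differentiable[OF sm open_UNIV UNIV_I]] cl by blast
  have "g ` \<Theta> ` V' = V'" using gT(1) by force
  then have "biholo g (\<Theta> ` V') V'"
    unfolding biholo_def
    using oU V' holg holT gT by (intro conjI exI[of _ \<Theta>]) (auto simp: inj_on_def)
  then show ?thesis using that[of V' g] V' gT by blast
qed

text \<open>If the model graph Im w = P(z) satisfies the pulled-back equation up to o(t^3) on the
  weighted curves, then the true graph function differs from P by weighted order four: the
  derivative in the direction of Im w is nonzero, so any lower-order discrepancy would show in the
  equation.\<close>

lemma normal_form_of_jets:
  fixes \<rho> :: "(complex^'n) \<times> complex \<Rightarrow> real" and P :: "complex^'n \<Rightarrow> real"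
  assumes U0: "open U0" "p0 \<in> U0" and sm: "smooth_on U0 \<rho>" and M: "M \<inter> U0 = {q\<in>U0. \<rho> q = 0}" and \<rho>p: "\<rho> p0 = 0"
    and T: "smooth_on UNIV \<Theta>" "\<And>q v. ddir (cmul \<i> v) \<Theta> q = cmul \<i> (ddir v \<Theta> q)" "inj (\<lambda>v. ddir v \<Theta> 0)"
    and T0: "\<Theta> 0 = p0" and nz: "ddir (ddir (0, \<i>) \<Theta> 0) \<rho> p0 \<noteq> 0"
    and P: "smooth_on UNIV P" "P 0 = 0"
    and jets: "\<And>z u. jet3 (\<lambda>t. \<rho> (\<Theta> (t *\<^sub>R z, Complex (t^2 * u) (P (t *\<^sub>R z))))) 0 0 0 0"
  shows "\<exists>U V \<Phi> W F. p0 \<in> U \<and> biholo \<Phi> U V \<and> \<Phi> p0 = 0 \<and>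
        open W \<and> 0 \<in> W \<and> smooth_on W F \<and> weighted_order_ge4 F \<and>
        (\<forall>q\<in>V. (fst q, Re (snd q)) \<in> W) \<and>
        \<Phi> ` (M \<inter> U) = {q\<in>V. Im (snd q) = P (fst q) + F (fst q, Re (snd q))}"
proof -
  have T1: "Ck k UNIV \<Theta>" for k using T(1) smooth_on_iff_Ck by blast
  have Tc: "continuous_on UNIV \<Theta>" by (rule smooth_on_continuous[OF T(1) open_UNIV])
  define N where "N = \<Theta> -` U0"
  have N: "open N" "0 \<in> N" using open_vimage[OF U0(1) Tc] T0 U0(2) by (auto simp: N_def)
  define r where "r q = \<rho> (\<Theta> q)" for q
  have rsm: "smooth_on N r"
    unfolding smooth_on_iff_Ck r_def
  proof
    show "Ck k N (\<lambda>q. \<rho> (\<Theta> q))" for k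
      by (rule Ck_compose[OF N(1) U0(1) _ _ Ck_subset[OF T1 subset_UNIV]])
        (use sm in \<open>auto simp: N_def smooth_on_iff_Ck\<close>)
  qed
  have "(r has_derivative (\<lambda>v. ddir (ddir v \<Theta> 0) \<rho> p0)) (at 0)"
    using diff_chain_at[OF has_derivative_ddir[OF smooth_on_differentiable[OF T(1) open_UNIV UNIV_I]]
        has_derivative_ddir[OF smooth_on_differentiable[OF sm U0(1)]], of 0] T0 U0(2) by (simp add: r_def[abs_def] o_def)
  then have nz': "ddir (0, \<i>) r 0 \<noteq> 0" using nz by (simp add: ddir_eqI)
  have r0: "r 0 = 0" by (simp add: r_def T0 \<rho>p)
  obtain V W G where G: "open V" "0 \<in> V" "V \<subseteq> N" "open W" "0 \<in> W" "smooth_on W G" "G 0 = 0"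
    "\<And>q. q \<in> V \<Longrightarrow> (fst q, Re (snd q)) \<in> W"
    "\<And>q. q \<in> V \<Longrightarrow> r q = 0 \<longleftrightarrow> Im (snd q) = G (fst q, Re (snd q))"
    "\<And>x. x \<in> W \<Longrightarrow> r (fst x, Complex (snd x) (G x)) = 0"
    using smooth_implicit_function[OF rsm N r0 nz'] by blast
  define F where "F x = G x + - P (fst x)" for x
  have Fsm: "smooth_on W F"
    unfolding smooth_on_iff_Ck F_def
    by (intro allI Ck_add[OF G(4)] Ck_linear_comp[OF bounded_linear_minus[OF bounded_linear_ident] G(4)]
        Ck_compose[OF G(4) open_UNIV subset_UNIV _ Ck_linear[OF bounded_linear_fst]])
      (use G(6) P(1) smooth_on_iff_Ck in blast)+
  have d1: "ddir (v + w) r 0 = ddir v r 0 + ddir w r 0" "ddir (c *\<^sub>R v) r 0 = c * ddir v r 0" for v w c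
    using ddir_add ddir_scale smooth_on_differentiable[OF rsm N] by force+
  have w4: "weighted_order_ge4 F"
  proof (rule weighted_order_ge4I[OF Fsm G(4,5)])
    fix z :: "complex^'n" and u :: real
    have x: "jet3 (\<lambda>t. (t *\<^sub>R z, t^2 * u)) 0 (z, 0) (0, u) 0"
      by (rule jet3_exact) (simp add: zero_prod_def)
    from jet3_smooth[OF Fsm G(4,5) x] obtain a1 a2 a3 where Fj: "jet3 (\<lambda>t. F (t *\<^sub>R z, t^2 * u)) 0 a1 a2 a3"
      using G(7) P(2) by (auto simp: F_def)
    have x': "jet3 (\<lambda>t. t *\<^sub>R z) 0 z 0 0" by (rule jet3_exact) simp
    from jet3_smooth[OF P(1) open_UNIV UNIV_I x', of 0] obtain b1 b2 b3 where Pj: "jet3 (\<lambda>t. P (t *\<^sub>R z)) 0 b1 b2 b3"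
      using P(2) by auto
    let ?y = "\<lambda>t. (t *\<^sub>R z, Complex (t^2 * u) (P (t *\<^sub>R z)))"
    let ?y' = "\<lambda>t. ((t *\<^sub>R z, of_real (t^2 * u)) + P (t *\<^sub>R z) *\<^sub>R (0, \<i>)) :: (complex^'n) \<times> complex"
    have yy: "?y' = ?y" by (auto simp: fun_eq_iff complex_eq_iff)
    have y0: "jet3 (\<lambda>t. (t *\<^sub>R z, of_real (t^2 * u))) (0 :: (complex^'n) \<times> complex) (z, 0) (0, of_real u) 0"
      by (rule jet3_exact) (simp add: zero_prod_def scaleR_conv_of_real[where 'a=complex])
    have "jet3 ?y' (0 + 0 *\<^sub>R (0, \<i>)) ((z, 0) + b1 *\<^sub>R (0, \<i>)) ((0, of_real u) + b2 *\<^sub>R (0, \<i>)) (0 + b3 *\<^sub>R (0, \<i>))"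
      by (rule jet3_add[OF y0 jet3_linear[OF bounded_linear_scaleR_left Pj]])
    then obtain y1 y2 y3 where yj: "jet3 ?y 0 y1 y2 y3" unfolding yy scaleR_zero_left add_0_right by blast
    let ?x = "\<lambda>t. ?y t + F (t *\<^sub>R z, t^2 * u) *\<^sub>R (0, \<i>)"
    have xj: "jet3 ?x 0 (y1 + a1 *\<^sub>R (0, \<i>)) (y2 + a2 *\<^sub>R (0, \<i>)) (y3 + a3 *\<^sub>R (0, \<i>))"
      by (rule jet3_eqs[OF jet3_add[OF yj jet3_linear[OF bounded_linear_scaleR_left Fj]]])
        (simp_all only: scaleR_zero_left add_0_right)
    have xx: "?x t = (t *\<^sub>R z, Complex (t^2 * u) (G (t *\<^sub>R z, t^2 * u)))" for t
      by (simp add: F_def complex_eq_iff)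
    have "\<forall>\<^sub>F t in at_right 0. (t *\<^sub>R z, t^2 * u) \<in> W"
      by (rule topological_tendstoD[OF jet3_tendsto[OF x] G(4,5)])
    then have "\<forall>\<^sub>F t in at_right 0. 0 = r (?x t)"
      unfolding xx by eventually_elim (use G(10) in force)
    then have rx: "jet3 (\<lambda>t. r (?x t)) 0 0 0 0" by (rule jet3_cong[OF jet3_const])
    have ry: "jet3 (\<lambda>t. r (?y t)) 0 0 0 0" using jets[of z u] by (simp add: r_def)
    note ex = jet3_unique[OF jet3_smooth[OF rsm N xj, unfolded add_0_left] rx]
    note ey = jet3_unique[OF jet3_smooth[OF rsm N yj, unfolded add_0_left] ry]
    \<comment> \<open>The first-order parts of \<open>ex\<close> and \<open>ey\<close> differ by
      \<open>a1\<close> times a nonzero derivative. With \<open>a1\<close> gone the second-order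
      parts differ in the same way by \<open>a2\<close>, and then the third-order parts by
      \<open>a3\<close>.\<close>
    have a1: "a1 = 0" using ex ey nz' by (simp del: scaleR_Pair add: d1)
    have "a2 * ddir (0, \<i>) r 0 = 0" using ex ey unfolding a1 d1 scaleR_zero_left add_0_right by (elim conjE) linarith
    then have a2: "a2 = 0" using nz' by simp
    have "a3 * ddir (0, \<i>) r 0 = 0" using ex ey unfolding a1 a2 d1 scaleR_zero_left add_0_right by (elim conjE) linarith
    then have a3: "a3 = 0" using nz' by simp
    show "jet3 (\<lambda>t. F (t *\<^sub>R z, t^2 * u)) 0 0 0 0" using Fj a1 a2 a3 by simp
  qed
  obtain V' \<Phi> where V': "open V'" "0 \<in> V'" "V' \<subseteq> V" "biholo \<Phi> (\<Theta> ` V') V'" "\<And>q. q \<in> V' \<Longrightarrow> \<Phi> (\<Theta> q) = q"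
    using local_biholo[OF T G(1,2)] by blast
  have inM: "\<Theta> q \<in> M \<longleftrightarrow> Im (snd q) = P (fst q) + F (fst q, Re (snd q))" if "q \<in> V'" for q
  proof -
    have "\<Theta> q \<in> U0" using that V'(3) G(3) by (auto simp: N_def)
    then have "\<Theta> q \<in> M \<longleftrightarrow> r q = 0" using M by (auto simp: r_def)
    moreover have "q \<in> V" using that V'(3) by blast
    ultimately show ?thesis using G(9)[of q] by (simp add: F_def)
  qed
  have "\<Phi> ` (M \<inter> \<Theta> ` V') = {q\<in>V'. Im (snd q) = P (fst q) + F (fst q, Re (snd q))}"
  proof (intro set_eqI iffI)
    fix q assume "q \<in> \<Phi> ` (M \<inter> \<Theta> ` V')"
    then obtain q' where "q' \<in> V'" "\<Theta> q' \<in> M" "q = \<Phi> (\<Theta> q')" by auto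
    then show "q \<in> {q\<in>V'. Im (snd q) = P (fst q) + F (fst q, Re (snd q))}" using inM V'(5) by simp
  next
    fix q assume "q \<in> {q\<in>V'. Im (snd q) = P (fst q) + F (fst q, Re (snd q))}"
    then have "q \<in> V'" "\<Theta> q \<in> M" using inM by auto
    then show "q \<in> \<Phi> ` (M \<inter> \<Theta> ` V')" using V'(5) by (intro image_eqI[of _ _ "\<Theta> q"]) auto
  qed
  moreover have "\<Phi> p0 = 0" "p0 \<in> \<Theta> ` V'" using V'(2) V'(5)[OF V'(2)] T0 by auto
  ultimately show ?thesis
    using V' G(4,5,8) Fsm w4 by (intro exI[of _ "\<Theta> ` V'"] exI[of _ V'] exI[of _ \<Phi>] exI[of _ W] exI[of _ F]) auto
qed

section \<open>Complex linear and antilinear functionals\<close>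

lemma cmul_decompose: "cmul c x = Re c *\<^sub>R x + Im c *\<^sub>R cmul \<i> x"
proof -
  have "cmul c x = cmul (of_real (Re c) + of_real (Im c) * \<i>) x"
    by (metis complex_eq mult.commute)
  also have "\<dots> = Re c *\<^sub>R x + Im c *\<^sub>R cmul \<i> x"
    unfolding cmul_add_left cmul_simps(4)[symmetric] cmul_of_real ..
  finally show ?thesis .
qed

definition clin :: "((complex^'n) \<times> complex \<Rightarrow> complex) \<Rightarrow> bool" where
  "clin f \<longleftrightarrow> linear f \<and> (\<forall>x. f (cmul \<i> x) = \<i> * f x)"

definition alin :: "((complex^'n) \<times> complex \<Rightarrow> complex) \<Rightarrow> bool" where
  "alin f \<longleftrightarrow> linear f \<and> (\<forall>x. f (cmul \<i> x) = - \<i> * f x)"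

lemma clinD:
  assumes "clin f"
  shows "f (x + y) = f x + f y" "f (cmul c x) = c * f x" "f 0 = 0" "f (- x) = - f x" "f (x - y) = f x - f y"
    "f (t *\<^sub>R x) = of_real t * f x" "f (\<Sum>i\<in>I. g i) = (\<Sum>i\<in>I. f (g i))"
proof -
  have l: "linear f" and i: "f (cmul \<i> x) = \<i> * f x" for x using assms unfolding clin_def by blast+
  show "f (x + y) = f x + f y" "f 0 = 0" "f (- x) = - f x" "f (x - y) = f x - f y"
     "f (\<Sum>i\<in>I. g i) = (\<Sum>i\<in>I. f (g i))"
    using l by (auto simp: linear_add linear_0 linear_neg linear_diff linear_sum)
  show "f (t *\<^sub>R x) = of_real t * f x" using l by (simp add: linear_cmul scaleR_conv_of_real)
  show "f (cmul c x) = c * f x"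
    unfolding cmul_decompose[of c] linear_add[OF l] linear_cmul[OF l] i
    by (simp add: complex_eq_iff)
qed

lemma alinD:
  assumes "alin f"
  shows "f (x + y) = f x + f y" "f (cmul c x) = cnj c * f x" "f 0 = 0" "f (- x) = - f x" "f (x - y) = f x - f y"
    "f (t *\<^sub>R x) = of_real t * f x" "f (\<Sum>i\<in>I. g i) = (\<Sum>i\<in>I. f (g i))"
proof -
  have l: "linear f" and i: "f (cmul \<i> x) = - \<i> * f x" for x using assms unfolding alin_def by blast+
  show "f (x + y) = f x + f y" "f 0 = 0" "f (- x) = - f x" "f (x - y) = f x - f y"
     "f (\<Sum>i\<in>I. g i) = (\<Sum>i\<in>I. f (g i))"
    using l by (auto simp: linear_add linear_0 linear_neg linear_diff linear_sum)
  show "f (t *\<^sub>R x) = of_real t * f x" using l by (simp add: linear_cmul scaleR_conv_of_real)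
  show "f (cmul c x) = cnj c * f x"
    unfolding cmul_decompose[of c] linear_add[OF l] linear_cmul[OF l] i
    by (simp add: complex_eq_iff)
qed

lemma clinI: "linear f \<Longrightarrow> (\<And>x. f (cmul \<i> x) = \<i> * f x) \<Longrightarrow> clin f"
  and alinI: "linear f \<Longrightarrow> (\<And>x. f (cmul \<i> x) = - \<i> * f x) \<Longrightarrow> alin f"
  unfolding clin_def alin_def by blast+

lemma clin_add: assumes "clin f" "clin g" shows "clin (\<lambda>x. f x + g x)"
  by (intro clinI linearI)
    (simp_all add: clinD[OF assms(1)] clinD[OF assms(2)] scaleR_conv_of_real[where 'a=complex] algebra_simps)

lemma clin_cmult: assumes "clin f" shows "clin (\<lambda>x. c * f x)"
  by (intro clinI linearI) (simp_all add: clinD[OF assms] scaleR_conv_of_real[where 'a=complex] algebra_simps)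

lemma alin_add: assumes "alin f" "alin g" shows "alin (\<lambda>x. f x + g x)"
  by (intro alinI linearI)
    (simp_all add: alinD[OF assms(1)] alinD[OF assms(2)] scaleR_conv_of_real[where 'a=complex] algebra_simps)

lemma alin_cmult: assumes "alin f" shows "alin (\<lambda>x. c * f x)"
  by (intro alinI linearI) (simp_all add: alinD[OF assms] scaleR_conv_of_real[where 'a=complex] algebra_simps)

lemma clin_bounded_bilinear:
  fixes B :: "(complex^'n) \<times> complex \<Rightarrow> (complex^'n) \<times> complex \<Rightarrow> complex"
  assumes "\<And>y. clin (\<lambda>x. B x y)" "\<And>x. clin (B x)"
  shows "bounded_bilinear B"
  using assms by (intro bilinear_conv_bounded_bilinear[THEN iffD1]) (auto simp: bilinear_def clin_def)

section \<open>Holomorphic polynomial maps\<close>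

text \<open>Real smoothness is part of the definition: the maps built in the existence half are
  polynomials, for which it follows from the sum and product rules.\<close>

definition chol :: "((complex^'n) \<times> complex \<Rightarrow> complex) \<Rightarrow> bool" where
  "chol f \<longleftrightarrow> (\<forall>k. Ck k UNIV f) \<and> (\<forall>q v. ddir (cmul \<i> v) f q = \<i> * ddir v f q)"

definition cholE :: "((complex^'n) \<times> complex \<Rightarrow> (complex^'n) \<times> complex) \<Rightarrow> bool" where
  "cholE f \<longleftrightarrow> (\<forall>k. Ck k UNIV f) \<and> (\<forall>q v. ddir (cmul \<i> v) f q = cmul \<i> (ddir v f q))"

lemma chol_derivative: "chol f \<Longrightarrow> (f has_derivative (\<lambda>v. ddir v f q)) (at q)"
  unfolding chol_def using Ck_has_derivative by blast

lemma cholE_derivative: "cholE f \<Longrightarrow> (f has_derivative (\<lambda>v. ddir v f q)) (at q)"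
  unfolding cholE_def using Ck_has_derivative by blast

lemma chol_const: "chol (\<lambda>q. c)"
  unfolding chol_def by (simp add: Ck_const ddir_eqI[OF has_derivative_const])

lemma chol_clin: assumes "clin f" shows "chol f"
proof -
  have "bounded_linear f" using assms linear_conv_bounded_linear by (auto simp: clin_def)
  then show ?thesis unfolding chol_def
    using assms by (auto simp: Ck_linear ddir_eqI[OF bounded_linear_imp_has_derivative] clin_def)
qed

lemma chol_add: assumes "chol f" "chol g"
  shows "chol (\<lambda>q. f q + g q)" "ddir v (\<lambda>q. f q + g q) x = ddir v f x + ddir v g x"
proof -
  have d: "ddir v (\<lambda>q. f q + g q) q = ddir v f q + ddir v g q" for v q
    by (rule ddir_eqI) (intro has_derivative_add chol_derivative assms)
  then show "ddir v (\<lambda>q. f q + g q) x = ddir v f x + ddir v g x" .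
  show "chol (\<lambda>q. f q + g q)" using assms unfolding chol_def d by (auto simp: algebra_simps intro: Ck_add)
qed

lemma chol_mult: assumes "chol f" "chol g"
  shows "chol (\<lambda>q. f q * g q)" "ddir v (\<lambda>q. f q * g q) x = f x * ddir v g x + ddir v f x * g x"
proof -
  have d: "ddir v (\<lambda>q. f q * g q) q = f q * ddir v g q + ddir v f q * g q" for v q
    by (rule ddir_eqI) (intro has_derivative_mult chol_derivative assms)
  then show "ddir v (\<lambda>q. f q * g q) x = f x * ddir v g x + ddir v f x * g x" .
  show "chol (\<lambda>q. f q * g q)" using assms unfolding chol_def d
    by (auto simp: algebra_simps intro: Ck_bilinear[OF bounded_bilinear_mult])
qed

lemma chol_bilinear:
  assumes B: "\<And>y. clin (\<lambda>x. B x y)" "\<And>x. clin (B x)" and fg: "cholE f" "cholE g"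
  shows "chol (\<lambda>q. B (f q) (g q))" "ddir v (\<lambda>q. B (f q) (g q)) x = B (f x) (ddir v g x) + B (ddir v f x) (g x)"
proof -
  interpret B: bounded_bilinear B by (rule clin_bounded_bilinear[OF B])
  have d: "ddir v (\<lambda>q. B (f q) (g q)) q = B (f q) (ddir v g q) + B (ddir v f q) (g q)" for v q
    by (rule ddir_eqI) (intro B.FDERIV cholE_derivative fg)
  then show "ddir v (\<lambda>q. B (f q) (g q)) x = B (f x) (ddir v g x) + B (ddir v f x) (g x)" .
  show "chol (\<lambda>q. B (f q) (g q))"
    using fg unfolding chol_def cholE_def d
    by (auto simp: clinD[OF B(1)] clinD[OF B(2)] algebra_simps intro: Ck_bilinear[OF B.bounded_bilinear_axioms])
qed

lemma cholE_add: assumes "cholE f" "cholE g"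
  shows "cholE (\<lambda>q. f q + g q)" "ddir v (\<lambda>q. f q + g q) x = ddir v f x + ddir v g x"
proof -
  have d: "ddir v (\<lambda>q. f q + g q) q = ddir v f q + ddir v g q" for v q
    by (rule ddir_eqI) (intro has_derivative_add cholE_derivative assms)
  then show "ddir v (\<lambda>q. f q + g q) x = ddir v f x + ddir v g x" .
  show "cholE (\<lambda>q. f q + g q)" using assms unfolding cholE_def d by (auto simp: cmul_add_right intro: Ck_add)
qed

lemma cholE_const: "cholE (\<lambda>q. c)" "ddir v (\<lambda>q. c) x = 0"
  unfolding cholE_def by (simp_all add: Ck_const ddir_eqI[OF has_derivative_const])

lemma cholE_cmul: assumes "chol f"
  shows "cholE (\<lambda>q. cmul (f q) b)" "ddir v (\<lambda>q. cmul (f q) b) x = cmul (ddir v f x) b"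
proof -
  interpret bounded_bilinear cmul by (rule bounded_bilinear_cmul)
  have d: "ddir v (\<lambda>q. cmul (f q) b) q = cmul (ddir v f q) b" for v q
    by (rule ddir_eqI) (intro bounded_linear.has_derivative[OF bounded_linear_left] chol_derivative assms)
  then show "ddir v (\<lambda>q. cmul (f q) b) x = cmul (ddir v f x) b" .
  show "cholE (\<lambda>q. cmul (f q) b)" using assms unfolding cholE_def chol_def d
    by (auto intro: Ck_linear_comp[OF bounded_linear_left])
qed

lemma cholE_sum: assumes "\<And>i. i \<in> I \<Longrightarrow> cholE (f i)"
  shows "cholE (\<lambda>q. \<Sum>i\<in>I. f i q)" "ddir v (\<lambda>q. \<Sum>i\<in>I. f i q) x = (\<Sum>i\<in>I. ddir v (f i) x)"
proof -
  have "cholE (\<lambda>q. \<Sum>i\<in>I. f i q) \<and> ddir v (\<lambda>q. \<Sum>i\<in>I. f i q) x = (\<Sum>i\<in>I. ddir v (f i) x)"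
    using assms by (induction I rule: infinite_finite_induct) (auto simp: cholE_const cholE_add)
  then show "cholE (\<lambda>q. \<Sum>i\<in>I. f i q)" "ddir v (\<lambda>q. \<Sum>i\<in>I. f i q) x = (\<Sum>i\<in>I. ddir v (f i) x)" by auto
qed

lemma chol_sum: assumes "\<And>i. i \<in> I \<Longrightarrow> chol (f i)"
  shows "chol (\<lambda>q. \<Sum>i\<in>I. f i q)" "ddir v (\<lambda>q. \<Sum>i\<in>I. f i q) x = (\<Sum>i\<in>I. ddir v (f i) x)"
proof -
  have "chol (\<lambda>q. \<Sum>i\<in>I. f i q) \<and> ddir v (\<lambda>q. \<Sum>i\<in>I. f i q) x = (\<Sum>i\<in>I. ddir v (f i) x)"
    using assms
    by (induction I rule: infinite_finite_induct) (auto simp: chol_const chol_add ddir_eqI[OF has_derivative_const])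
  then show "chol (\<lambda>q. \<Sum>i\<in>I. f i q)" "ddir v (\<lambda>q. \<Sum>i\<in>I. f i q) x = (\<Sum>i\<in>I. ddir v (f i) x)" by auto
qed

section \<open>The third-order jet of a defining function\<close>

text \<open>The first three derivatives of a defining function at a point, treated as multilinear
  algebra. The normalisation of the transversal vector gives
  \<open>D1 (cmul c \<tau>) = - Im c\<close>, so that to first order the defining function is minus
  the imaginary part of the coefficient of \<open>\<tau>\<close>.\<close>

locale cubic_jet =
  fixes D1 :: "(complex^'n) \<times> complex \<Rightarrow> real"
    and D2 :: "(complex^'n) \<times> complex \<Rightarrow> (complex^'n) \<times> complex \<Rightarrow> real"
    and D3 :: "(complex^'n) \<times> complex \<Rightarrow> (complex^'n) \<times> complex \<Rightarrow> (complex^'n) \<times> complex \<Rightarrow> real"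
    and \<tau> :: "(complex^'n) \<times> complex"
  assumes lin1: "linear D1" and lin2: "\<And>y. linear (\<lambda>x. D2 x y)" and sym2: "\<And>x y. D2 x y = D2 y x"
    and lin3: "\<And>y z. linear (\<lambda>x. D3 x y z)" and sym3: "\<And>x y z. D3 x y z = D3 y x z" "\<And>x y z. D3 x y z = D3 x z y"
    and tau: "D1 \<tau> = 0" "D1 (cmul \<i> \<tau>) = - 1"
begin

lemma lin2': "linear (D2 x)" using lin2[of x] sym2[of x] by presburger

lemma lin3': "linear (\<lambda>y. D3 x y z)" using lin3[of x z] sym3(1)[of x] by presburger

lemma lin3'': "linear (\<lambda>z. D3 x y z)" using lin3'[of x y] sym3(2)[of x y] by presburger

lemmas D_simps = linear_add[OF lin1] linear_cmul[OF lin1] linear_neg[OF lin1] linear_0[OF lin1]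
  linear_add[OF lin2] linear_cmul[OF lin2] linear_neg[OF lin2] linear_0[OF lin2]
  linear_add[OF lin2'] linear_cmul[OF lin2'] linear_neg[OF lin2'] linear_0[OF lin2']
  linear_add[OF lin3] linear_cmul[OF lin3] linear_neg[OF lin3] linear_0[OF lin3]
  linear_add[OF lin3'] linear_cmul[OF lin3'] linear_neg[OF lin3'] linear_0[OF lin3']
  linear_add[OF lin3''] linear_cmul[OF lin3''] linear_neg[OF lin3''] linear_0[OF lin3'']

lemma ii: "cmul \<i> (cmul \<i> x) = - x" "cmul \<i> (t *\<^sub>R x) = t *\<^sub>R cmul \<i> x"
  by (auto simp: cmul_minus_left cmul_scaleR)

text \<open>This and the next three are \<open>D2\<close> and \<open>D3\<close>, extended complex
  linearly and evaluated at the (1,0) part (x - i J x)/2 in each holomorphic slot and at the (0,1)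
  part (x + i J x)/2 in each antiholomorphic one, where J is multiplication by i. The
  antiholomorphic slot is the last one in \<open>lev\<close> and \<open>c21\<close>.\<close>

definition lev where
  "lev v u = Complex ((D2 v u + D2 (cmul \<i> v) (cmul \<i> u)) / 4) ((D2 v (cmul \<i> u) - D2 (cmul \<i> v) u) / 4)"

definition csym where
  "csym v u = Complex ((D2 v u - D2 (cmul \<i> v) (cmul \<i> u)) / 4) (- (D2 v (cmul \<i> u) + D2 (cmul \<i> v) u) / 4)"

definition c30 where
  "c30 x y z = Complex
     (D3 x y z - D3 (cmul \<i> x) (cmul \<i> y) z - D3 (cmul \<i> x) y (cmul \<i> z) - D3 x (cmul \<i> y) (cmul \<i> z))
     (- D3 (cmul \<i> x) y z - D3 x (cmul \<i> y) z - D3 x y (cmul \<i> z) + D3 (cmul \<i> x) (cmul \<i> y) (cmul \<i> z)) / 8"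

definition c21 where
  "c21 x y z = Complex
     (D3 x y z - D3 (cmul \<i> x) (cmul \<i> y) z + D3 (cmul \<i> x) y (cmul \<i> z) + D3 x (cmul \<i> y) (cmul \<i> z))
     (- D3 (cmul \<i> x) y z - D3 x (cmul \<i> y) z + D3 x y (cmul \<i> z) - D3 (cmul \<i> x) (cmul \<i> y) (cmul \<i> z)) / 8"

lemma lev_clin: "clin (\<lambda>x. lev x y)" and lev_alin: "alin (lev x)"
  and csym_clin: "clin (\<lambda>x. csym x y)" "clin (csym x)"
  unfolding clin_def alin_def lev_def csym_def
  by (intro conjI allI linearI; simp add: complex_eq_iff D_simps ii cmul_add_right field_simps del: cmul_simps(4))+

lemma c30_clin: "clin (\<lambda>x. c30 x y z)" "clin (\<lambda>y. c30 x y z)" "clin (\<lambda>z. c30 x y z)"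
  unfolding clin_def c30_def
  by (intro conjI allI linearI; simp add: complex_eq_iff D_simps ii cmul_add_right field_simps del: cmul_simps(4))+

lemma c21_clin: "clin (\<lambda>x. c21 x y z)" "clin (\<lambda>y. c21 x y z)" and c21_alin: "alin (\<lambda>z. c21 x y z)"
  unfolding clin_def alin_def c21_def
  by (intro conjI allI linearI; simp add: complex_eq_iff D_simps ii cmul_add_right field_simps del: cmul_simps(4))+

lemma lev_cnj: "lev y x = cnj (lev x y)"
  unfolding lev_def using sym2[of y x] sym2[of y "cmul \<i> x"] sym2[of "cmul \<i> y" x] sym2[of "cmul \<i> y" "cmul \<i> x"]
  by (simp add: complex_eq_iff field_simps)

lemma csym_commute: "csym y x = csym x y"
  unfolding csym_def using sym2[of y x] sym2[of y "cmul \<i> x"] sym2[of "cmul \<i> y" x] sym2[of "cmul \<i> y" "cmul \<i> x"]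
  by (simp add: complex_eq_iff)

lemma c21_commute: "c21 y x z = c21 x y z"
  unfolding c21_def using sym3(1)[of y x] sym3(1)[of "cmul \<i> y" x] sym3(1)[of y "cmul \<i> x"] sym3(1)[of "cmul \<i> y" "cmul \<i> x"]
  by (simp add: complex_eq_iff)

lemma D2_split: "D2 x y = 2 * Re (lev x y) + 2 * Re (csym x y)"
  unfolding lev_def csym_def by (simp add: field_simps)

lemma Im_lev: "Im (lev x x) = 0"
  unfolding lev_def using sym2[of x "cmul \<i> x"] by simp

lemma lev_real: "lev x x = of_real (Re (lev x x))"
  using Im_lev by (simp add: complex_eq_iff)

lemma D3_split: "D3 x x x / 6 = Re (c30 x x x) / 3 + Re (c21 x x x)"
proof -
  let ?j = "cmul \<i> x"
  have "D3 ?j x ?j = D3 ?j ?j x" "D3 x ?j ?j = D3 ?j ?j x" using sym3 by metis+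
  then show ?thesis unfolding c30_def c21_def by (simp add: field_simps)
qed

text \<open>\<open>Rh\<close> and \<open>Kh\<close> are the parts of bidegree (2,1) and (3,0) of the cubic form that is left once the terms
  of weight two, and those of weight three that contain the real part of \<open>w\<close>, have been removed
  (\<open>cubic_identity\<close> below).\<close>

definition mu where "mu x = Complex (D2 (cmul \<i> x) \<tau>) (D2 x \<tau>)"

definition Rh where
  "Rh x y z = c21 x y z / 2 - \<i> * (lev x \<tau> * lev y z + lev y \<tau> * lev x z) + \<i> * csym x y * lev \<tau> z"

definition Kh where "Kh x = c30 x x x / 3 + 2 * \<i> * csym x x * csym x \<tau>"

lemma mu_clin: "clin mu"
  unfolding clin_def mu_def
  by (intro conjI allI linearI; simp add: complex_eq_iff D_simps ii cmul_add_right field_simps del: cmul_simps(4))+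

text \<open>Three groupings of one sum: each keeps the argument that varies in the last factor,
  where \<open>clin_cmult\<close> and \<open>alin_cmult\<close> expect it.\<close>

lemma Rh_eq: "Rh x y z = (1/2) * c21 x y z + (- \<i> * lev y z) * lev x \<tau> + (- \<i> * lev y \<tau>) * lev x z + (\<i> * lev \<tau> z) * csym x y"
  "Rh x y z = (1/2) * c21 x y z + (- \<i> * lev x \<tau>) * lev y z + (- \<i> * lev x z) * lev y \<tau> + (\<i> * lev \<tau> z) * csym x y"
  "Rh x y z = (1/2) * c21 x y z + (- \<i> * lev x \<tau>) * lev y z + (- \<i> * lev y \<tau>) * lev x z + (\<i> * csym x y) * lev \<tau> z"
  by (auto simp: Rh_def algebra_simps)

lemma Rh_clin: "clin (\<lambda>x. Rh x y z)" "clin (\<lambda>y. Rh x y z)"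
  unfolding Rh_eq(1) 
  subgoal by (intro clin_add clin_cmult lev_clin csym_clin c21_clin)
  unfolding Rh_eq(1)[symmetric] Rh_eq(2)
  by (intro clin_add clin_cmult lev_clin csym_clin c21_clin)

lemma Rh_alin: "alin (\<lambda>z. Rh x y z)"
  unfolding Rh_eq(3) by (intro alin_add alin_cmult lev_alin c21_alin)

lemma Rh_commute: "Rh y x z = Rh x y z"
  unfolding Rh_def by (simp add: c21_commute csym_commute[of y] algebra_simps)

lemma D1_tau: "D1 (cmul c \<tau>) = - Im c"
  by (subst cmul_decompose) (simp add: D_simps tau)

text \<open>In the application \<open>a\<close> is r Re w, the first coefficient of
  \<open>\<tau>\<close> is the one that makes the quadratic part of the equation vanish, and the
  term with \<open>mu\<close> is the correction made by the change of coordinates. It removes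
  everything linear in \<open>a\<close>; since \<open>lev x x\<close> is real, the rest splits into
  a pluriharmonic part and twice the real part of a (2,1) form.\<close>

lemma cubic_identity:
  "D3 x x x / 6 + D2 x (cmul (of_real a + \<i> * (lev x x + csym x x)) \<tau>) - Im (mu x * (of_real a + \<i> * lev x x))
   = Re (Kh x) + 2 * Re (Rh x x x)"
proof -
  define l where "l = Re (lev x x)"
  have l: "lev x x = of_real l" using lev_real by (simp add: l_def)
  have e1: "D2 x (cmul (of_real a + \<i> * (lev x x + csym x x)) \<tau>)
     = a * D2 x \<tau> + l * D2 x (cmul \<i> \<tau>) + D2 x (cmul (\<i> * csym x x) \<tau>)"
  proof -
    have "cmul (of_real a + \<i> * (lev x x + csym x x)) \<tau> = a *\<^sub>R \<tau> + l *\<^sub>R cmul \<i> \<tau> + cmul (\<i> * csym x x) \<tau>"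
      unfolding l by (simp add: cmul_add_left distrib_left cmul_of_real flip: cmul_simps(4))
        (simp add: mult.commute flip: cmul_of_real)
    then show ?thesis by (simp add: D_simps)
  qed
  have e2: "D2 x (cmul (\<i> * csym x x) \<tau>) = 2 * Re (\<i> * csym x x * lev \<tau> x) + 2 * Re (\<i> * csym x x * csym x \<tau>)"
    unfolding D2_split[of x] clinD(2)[OF csym_clin(2)] alinD(2)[OF lev_alin]
    using lev_cnj[of \<tau> x] by simp
  have e3: "Im (mu x * (of_real a + \<i> * lev x x)) = a * D2 x \<tau> + l * D2 (cmul \<i> x) \<tau>"
    unfolding l by (simp add: mu_def algebra_simps)
  \<comment> \<open>For a form complex bilinear in both arguments this difference would vanish; only
    the Levi part of \<open>D2\<close> is left.\<close>
  have e4: "D2 x (cmul \<i> \<tau>) - D2 (cmul \<i> x) \<tau> = 4 * Im (lev x \<tau>)" by (simp add: lev_def)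
  have "D2 x (cmul (of_real a + \<i> * (lev x x + csym x x)) \<tau>) - Im (mu x * (of_real a + \<i> * lev x x))
     = l * (D2 x (cmul \<i> \<tau>) - D2 (cmul \<i> x) \<tau>) + D2 x (cmul (\<i> * csym x x) \<tau>)"
    unfolding e1 e3 by (simp add: algebra_simps)
  also have "\<dots> = 4 * l * Im (lev x \<tau>) + 2 * Re (\<i> * csym x x * lev \<tau> x) + 2 * Re (\<i> * csym x x * csym x \<tau>)"
    unfolding e2 e4 by simp
  finally have *: "D2 x (cmul (of_real a + \<i> * (lev x x + csym x x)) \<tau>) - Im (mu x * (of_real a + \<i> * lev x x)) = \<dots>" .
  have "Re (Kh x) = Re (c30 x x x) / 3 + 2 * Re (\<i> * csym x x * csym x \<tau>)" by (simp add: Kh_def)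
  moreover have "2 * Re (Rh x x x) = Re (c21 x x x) + 4 * l * Im (lev x \<tau>) + 2 * Re (\<i> * csym x x * lev \<tau> x)"
    unfolding Rh_def l by simp
  ultimately show ?thesis using * D3_split[of x] by linarith
qed

end

section \<open>The polynomial change of coordinates attached to a frame\<close>

lemma jet3_exact4:
  assumes "\<And>t. f t = c0 + t *\<^sub>R c1 + t^2 *\<^sub>R c2 + t^3 *\<^sub>R c3 + t^4 *\<^sub>R c4"
  shows "jet3 f c0 c1 c2 c3"
  unfolding jet3_def
proof (intro exI[of _ "\<lambda>t. t *\<^sub>R c4"] conjI)
  show "((\<lambda>t. t *\<^sub>R c4) \<longlongrightarrow> 0) (at_right 0)"
    by (auto intro!: tendsto_eq_intros)
qed (simp add: assms eval_nat_numeral)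

text \<open>\<open>b\<close> becomes the coordinate frame of the complex tangent space, with
  \<open>b \<nu>\<close> in the Levi kernel. The other vectors have a common Levi length
  \<open>r\<close> instead of 1; rescaling w by \<open>r\<close> restores the model quadric, and the
  choice of \<open>r\<close> remains available to normalise the cubic part.\<close>

locale cubic_frame = cubic_jet D1 D2 D3 \<tau> for D1 :: "(complex^'n) \<times> complex \<Rightarrow> real" and D2 D3 \<tau> +
  fixes b :: "'n \<Rightarrow> (complex^'n) \<times> complex" and r :: real and \<nu> :: 'n
  assumes r: "r > 0" and bH: "\<And>j. D1 (b j) = 0" "\<And>j. D1 (cmul \<i> (b j)) = 0"
    and blev: "\<And>j k. lev (b j) (b k) = (if j = k \<and> j \<noteq> \<nu> then of_real r else 0)"
    and bnz: "b \<nu> \<noteq> 0"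
begin

text \<open>In \<open>Theta\<close>, \<open>csym\<close> cancels the pluriharmonic quadratic terms, \<open>mu\<close> the terms linear in both \<open>z\<close> and
  the real part of \<open>w\<close>, \<open>Kp\<close> the pluriharmonic cubic terms, and \<open>Lq\<close> the terms of bidegree (2,1)
  that contain a conjugate coordinate other than the one indexed by \<open>\<nu>\<close>.\<close>

definition L where "L z = (\<Sum>j\<in>UNIV. cmul (z $ j) (b j))"
definition qk where "qk z k = - Rh (L z) (L z) (b k) / of_real r"
definition Lq where "Lq z = (\<Sum>k\<in>UNIV - {\<nu>}. cmul (qk z k) (b k))"
definition Kp where "Kp z = Kh (L z) + 2 * csym (L z) (Lq z)"
definition Q where "Q z = Rh (L z) (L z) (b \<nu>) / of_real r"
definition P where "P z = (\<Sum>j\<in>UNIV - {\<nu>}. (cmod (z $ j))^2) + 2 * Re (cnj (z $ \<nu>) * Q z)"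
definition Theta where
  "Theta p q = p + L (fst q) + Lq (fst q)
     + cmul (of_real r * snd q + \<i> * csym (L (fst q)) (L (fst q)) + \<i> * Kp (fst q) + of_real r * mu (L (fst q)) * snd q) \<tau>"

lemma L_linear: "linear L"
  unfolding L_def by (intro linearI)
    (simp_all add: cmul_add_left sum.distrib scaleR_sum_right cmul_scaleR)

lemma L_scaleR: "L (t *\<^sub>R z) = t *\<^sub>R L z" and L_0: "L 0 = 0"
  using L_linear by (auto simp: linear_cmul linear_0)

lemma b_H: "D1 (cmul c (b j)) = 0"
  by (subst cmul_decompose) (simp add: D_simps bH)

lemma L_H: "D1 (L z) = 0" "D1 (Lq z) = 0"
  unfolding L_def Lq_def linear_sum[OF lin1] b_H by simp_all

lemma lev_L: "lev (\<Sum>k\<in>UNIV - {\<nu>}. cmul (c k) (b k)) (L z) = of_real r * (\<Sum>k\<in>UNIV - {\<nu>}. c k * cnj (z $ k))"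
proof -
  have "lev (b k) (L z) = of_real r * cnj (z $ k)" if "k \<noteq> \<nu>" for k
  proof -
    have "lev (b k) (L z) = (\<Sum>j\<in>UNIV. cnj (z $ j) * lev (b k) (b j))"
      unfolding L_def by (simp add: alinD[OF lev_alin])
    also have "\<dots> = (\<Sum>j\<in>UNIV. if j = k then of_real r * cnj (z $ k) else 0)"
      using that by (intro sum.cong) (auto simp: blev)
    finally show ?thesis by simp
  qed
  then show ?thesis by (simp add: clinD[OF lev_clin] sum_distrib_left mult.left_commute)
qed

lemma lev_b\<nu>: "lev (b \<nu>) (L z) = 0"
  unfolding L_def by (simp add: alinD[OF lev_alin] blev)

lemma L_split: "L z = cmul (z $ \<nu>) (b \<nu>) + (\<Sum>k\<in>UNIV - {\<nu>}. cmul (z $ k) (b k))"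
  unfolding L_def by (rule sum.remove) auto

lemma lev_LL: "lev (L z) (L z) = of_real (r * (\<Sum>k\<in>UNIV - {\<nu>}. (cmod (z $ k))^2))"
proof -
  have "lev (L z) (L z) = of_real r * (\<Sum>k\<in>UNIV - {\<nu>}. z $ k * cnj (z $ k))"
    by (subst (1) L_split) (simp add: clinD(1,2)[OF lev_clin] lev_b\<nu> lev_L)
  then show ?thesis by (simp add: complex_norm_square flip: of_real_power)
qed

text \<open>\<open>Rh\<close> is expanded in its antilinear slot along the frame. The summand of
  \<open>b k\<close> is cancelled by \<open>qk\<close> for k other than \<open>\<nu>\<close>; the
  summand of \<open>b \<nu>\<close> has no counterpart, because \<open>b \<nu>\<close> is Levi
  orthogonal to everything in the frame.\<close>

lemma lev_LqL: "lev (Lq z) (L z) + Rh (L z) (L z) (L z) = of_real r * (cnj (z $ \<nu>) * Q z)"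
proof -
  have "Rh (L z) (L z) (L z) = (\<Sum>j\<in>UNIV. cnj (z $ j) * Rh (L z) (L z) (b j))"
    unfolding L_def[of z] by (rule trans[OF alinD(7)[OF Rh_alin]]) (simp add: alinD(2)[OF Rh_alin])
  also have "\<dots> = cnj (z $ \<nu>) * Rh (L z) (L z) (b \<nu>) + (\<Sum>j\<in>UNIV - {\<nu>}. cnj (z $ j) * Rh (L z) (L z) (b j))"
    by (rule sum.remove) auto
  finally show ?thesis
    using r unfolding Lq_def lev_L qk_def Q_def by (simp add: sum_distrib_left sum_negf mult.commute)
qed

lemma Rh_scale: "Rh (t *\<^sub>R x) (t *\<^sub>R x) y = of_real (t^2) * Rh x x y"
  by (simp add: clinD(6)[OF Rh_clin(1)] clinD(6)[OF Rh_clin(2)] power2_eq_square)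

lemma csym_scale: "csym (t *\<^sub>R x) (u *\<^sub>R y) = of_real (t * u) * csym x y"
  by (simp add: clinD(6)[OF csym_clin(1)] clinD(6)[OF csym_clin(2)])

lemma Q_scale: "Q (t *\<^sub>R z) = of_real (t^2) * Q z"
  by (simp add: Q_def L_scaleR Rh_scale)

lemma Lq_scale: "Lq (t *\<^sub>R z) = t^2 *\<^sub>R Lq z"
proof -
  have "qk (t *\<^sub>R z) k = t^2 *\<^sub>R qk z k" for k
    by (simp add: qk_def L_scaleR Rh_scale scaleR_conv_of_real[where 'a=complex])
  then show ?thesis unfolding Lq_def by (simp add: cmul_scaleR scaleR_sum_right)
qed

lemma Kp_scale: "Kp (t *\<^sub>R z) = of_real (t^3) * Kp z"
proof -
  have "c30 (t *\<^sub>R x) (t *\<^sub>R x) (t *\<^sub>R x) = of_real (t^3) * c30 x x x" for x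
    by (simp add: clinD(6)[OF c30_clin(1)] clinD(6)[OF c30_clin(2)] clinD(6)[OF c30_clin(3)] power3_eq_cube)
  then show ?thesis
    by (simp add: Kp_def Kh_def L_scaleR Lq_scale clinD(6)[OF csym_clin(1)] clinD(6)[OF csym_clin(2)] power2_eq_square power3_eq_cube algebra_simps)
qed

lemma P_scale: "P (t *\<^sub>R z) = t^2 * (\<Sum>j\<in>UNIV - {\<nu>}. (cmod (z $ j))^2) + t^3 * (2 * Re (cnj (z $ \<nu>) * Q z))"
proof -
  have "cnj ((t *\<^sub>R z) $ \<nu>) * Q (t *\<^sub>R z) = of_real (t^3) * (cnj (z $ \<nu>) * Q z)"
    by (simp add: Q_scale scaleR_conv_of_real[where 'a=complex] power2_eq_square power3_eq_cube)
  moreover have "Re (of_real a * c) = a * Re c" for a c by simp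
  ultimately have "Re (cnj ((t *\<^sub>R z) $ \<nu>) * Q (t *\<^sub>R z)) = t^3 * Re (cnj (z $ \<nu>) * Q z)"
    by (simp only:)
  moreover have "(\<Sum>j\<in>UNIV - {\<nu>}. (cmod ((t *\<^sub>R z) $ j))^2) = t^2 * (\<Sum>j\<in>UNIV - {\<nu>}. (cmod (z $ j))^2)"
    by (simp add: power_mult_distrib sum_distrib_left)
  ultimately show ?thesis unfolding P_def by simp
qed

lemma L_chol:
  fixes v x :: "(complex^'n) \<times> complex"
  shows "cholE (\<lambda>q. L (fst q))" "ddir v (\<lambda>q. L (fst q)) x = L (fst v)"
proof -
  have bl: "bounded_linear (\<lambda>q::(complex^'n) \<times> complex. L (fst q))"
    using bounded_linear_compose[OF linear_conv_bounded_linear[THEN iffD1, OF L_linear] bounded_linear_fst] .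
  have d: "ddir v (\<lambda>q::(complex^'n) \<times> complex. L (fst q)) x = L (fst v)" for v x
    by (rule ddir_eqI[OF bounded_linear_imp_has_derivative[OF bl]])
  show "ddir v (\<lambda>q. L (fst q)) x = L (fst v)" by (rule d)
  have "L (fst (cmul \<i> v)) = cmul \<i> (L (fst v))" for v :: "(complex^'n) \<times> complex"
    unfolding L_def by (simp add: cmul_sum_right) (simp add: cmul_def)
  then show "cholE (\<lambda>q. L (fst q))" unfolding cholE_def d using Ck_linear[OF bl] by auto
qed

lemma coord_clin: "clin (\<lambda>q. fst q $ j)" "clin snd"
  unfolding clin_def by (auto simp: cmul_def intro!: linearI)

lemma qk_chol:
  fixes v :: "(complex^'n) \<times> complex"
  shows "chol (\<lambda>q. qk (fst q) k)" "ddir v (\<lambda>q. qk (fst q) k) 0 = 0"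
proof -
  have eq: "qk (fst q) k = (- 1 / of_real r) * Rh (L (fst q)) (L (fst q)) (b k)" for q :: "(complex^'n) \<times> complex"
    by (simp add: qk_def)
  note 1 = chol_bilinear[OF Rh_clin(1)[where z = "b k"] Rh_clin(2)[where z = "b k"] L_chol(1) L_chol(1)]
  show "chol (\<lambda>q. qk (fst q) k)" unfolding eq by (rule chol_mult(1)[OF chol_const 1(1)])
  show "ddir v (\<lambda>q. qk (fst q) k) 0 = 0" unfolding eq chol_mult(2)[OF chol_const 1(1)]
    by (simp add: 1(2) L_0 clinD(3)[OF Rh_clin(1)] clinD(3)[OF Rh_clin(2)] ddir_eqI[OF has_derivative_const])
qed

lemma Lq_chol:
  fixes v :: "(complex^'n) \<times> complex"
  shows "cholE (\<lambda>q. Lq (fst q))" "ddir v (\<lambda>q. Lq (fst q)) 0 = 0"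
  unfolding Lq_def cholE_sum(2)[OF cholE_cmul(1)[OF qk_chol(1)]] cholE_cmul(2)[OF qk_chol(1)] qk_chol(2)
  by (simp_all add: cholE_sum cholE_cmul qk_chol)

lemma Lq_0: "Lq 0 = 0" using Lq_scale[of 0 0] by simp

lemma Kp_chol:
  fixes v :: "(complex^'n) \<times> complex"
  shows "chol (\<lambda>q. Kp (fst q))" "ddir v (\<lambda>q. Kp (fst q)) 0 = 0"
proof -
  let ?L = "\<lambda>q. L (fst q) :: (complex^'n) \<times> complex"
  \<comment> \<open>One slot is written in coordinates, so that the cubic term becomes a sum of
    products of a linear and a bilinear function, to which the product rule applies.\<close>
  have c30L: "c30 (L z) x y = (\<Sum>j\<in>UNIV. z $ j * c30 (b j) x y)" for z x y
    unfolding L_def by (simp add: clinD(7)[OF c30_clin(1)] clinD(2)[OF c30_clin(1)])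
  have eq: "Kp (fst q) = ((\<Sum>j\<in>UNIV. fst q $ j * c30 (b j) (?L q) (?L q)) * (1/3)
     + csym (?L q) (?L q) * ((2 * \<i>) * csym (?L q) \<tau>)) + csym (?L q) (Lq (fst q)) * 2" for q :: "(complex^'n) \<times> complex"
    by (simp add: Kp_def Kh_def c30L)
  note 1 = chol_bilinear[OF c30_clin(2) c30_clin(3) L_chol(1) L_chol(1)]
  note 2 = chol_bilinear[OF csym_clin(1) csym_clin(2) L_chol(1) L_chol(1)]
  note 3 = chol_bilinear[OF csym_clin(1) csym_clin(2) L_chol(1) cholE_const(1)[of \<tau>]]
  note 4 = chol_bilinear[OF csym_clin(1) csym_clin(2) L_chol(1) Lq_chol(1)]
  note A = chol_sum[OF chol_mult(1)[OF chol_clin[OF coord_clin(1)] 1(1)], where I = UNIV]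
  note A2 = chol_mult[OF A(1) chol_const[of "1/3"]]
  note B = chol_mult[OF 2(1) chol_mult(1)[OF chol_const[of "2 * \<i>"] 3(1)]]
  note C = chol_mult[OF 4(1) chol_const[of 2]]
  note zz = L_0 Lq_0 clinD(3)[OF csym_clin(1)] clinD(3)[OF csym_clin(2)] clinD(3)[OF c30_clin(2)] clinD(3)[OF c30_clin(3)]
    ddir_eqI[OF has_derivative_const]
  have A0: "ddir v (\<lambda>q. (\<Sum>j\<in>UNIV. fst q $ j * c30 (b j) (?L q) (?L q)) * (1/3)) 0 = 0"
    unfolding A2(2) A(2) chol_mult(2)[OF chol_clin[OF coord_clin(1)] 1(1)] 1(2) by (simp add: zz)
  have B0: "ddir v (\<lambda>q. csym (?L q) (?L q) * ((2 * \<i>) * csym (?L q) \<tau>)) 0 = 0"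
    unfolding B(2) by (simp add: 2(2) zz)
  have C0: "ddir v (\<lambda>q. csym (?L q) (Lq (fst q)) * 2) 0 = 0"
    unfolding C(2) by (simp add: 4(2) zz Lq_chol(2))
  show "chol (\<lambda>q. Kp (fst q))" unfolding eq by (intro chol_add A2(1) B(1) C(1))
  show "ddir v (\<lambda>q. Kp (fst q)) 0 = 0" unfolding eq
    unfolding chol_add(2)[OF chol_add(1)[OF A2(1) B(1)] C(1)] chol_add(2)[OF A2(1) B(1)] A0 B0 C0 by simp
qed

lemma Kp_0: "Kp 0 = 0" using Kp_scale[of 0 0] by simp

lemma Theta_chol: "cholE (Theta p)" "ddir v (Theta p) 0 = L (fst v) + cmul (of_real r * snd v) \<tau>"
proof -
  let ?L = "\<lambda>q. L (fst q) :: (complex^'n) \<times> complex"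
  note 2 = chol_bilinear[OF csym_clin(1) csym_clin(2) L_chol(1) L_chol(1)]
  note w = chol_mult[OF chol_const[of "complex_of_real r"] chol_clin[OF coord_clin(2)]]
  note s = chol_mult[OF chol_const[of \<i>] 2(1)]
  note K = chol_mult[OF chol_const[of \<i>] Kp_chol(1)]
  have ml: "clin (\<lambda>q. mu (?L q))"
    using L_chol unfolding clin_def cholE_def
    by (auto simp: clinD[OF mu_clin] L_linear linear_add linear_cmul scaleR_conv_of_real[where 'a=complex] intro!: linearI)
  note mm = chol_mult[OF chol_mult(1)[OF chol_const[of "complex_of_real r"] chol_clin[OF ml]] chol_clin[OF coord_clin(2)]]
  note c = chol_add[OF chol_add(1)[OF chol_add(1)[OF w(1) s(1)] K(1)] mm(1)]
  note t = cholE_add[OF cholE_add(1)[OF cholE_add(1)[OF cholE_const(1)[of p] L_chol(1)] Lq_chol(1)] cholE_cmul(1)[OF c(1), of \<tau>]]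
  show "cholE (Theta p)" unfolding Theta_def[abs_def] by (rule t(1))
  have sndd: "ddir v snd (0 :: (complex^'n) \<times> complex) = snd v"
    by (rule ddir_eqI[OF bounded_linear_imp_has_derivative[OF bounded_linear_snd]])
  have "ddir v (Theta p) 0 = L (fst v) + cmul (of_real r * snd v) \<tau>"
    unfolding Theta_def[abs_def] t(2)
      cholE_add(2)[OF cholE_add(1)[OF cholE_const(1)[of p] L_chol(1)] Lq_chol(1)]
      cholE_add(2)[OF cholE_const(1)[of p] L_chol(1)] cholE_const(2) L_chol(2) Lq_chol(2) cholE_cmul(2)[OF c(1)]
      c(2) chol_add(2)[OF chol_add(1)[OF w(1) s(1)] K(1)] chol_add(2)[OF w(1) s(1)] w(2) s(2) K(2) mm(2)
    by (simp add: 2(2) L_0 clinD(3)[OF csym_clin(1)] clinD(3)[OF csym_clin(2)] Kp_chol(2) clinD(3)[OF mu_clin]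
      ddir_eqI[OF has_derivative_const] sndd)
  then show "ddir v (Theta p) 0 = L (fst v) + cmul (of_real r * snd v) \<tau>" .
qed

lemma Theta_0: "Theta p 0 = p"
  by (simp add: Theta_def L_0 Lq_0 Kp_0 clinD(3)[OF csym_clin(1)])

text \<open>The Levi form of \<open>L z\<close> controls all coordinates but the one of the kernel,
  and that one is recovered from \<open>b \<nu>\<close> being nonzero.\<close>

lemma L_inj: "L z = 0 \<Longrightarrow> z = 0"
proof -
  assume *: "L z = 0"
  have "lev (L z) (L z) = 0" using * by (simp add: clinD(3)[OF lev_clin])
  then have "(\<Sum>k\<in>UNIV - {\<nu>}. (cmod (z $ k))^2) = 0" using r unfolding lev_LL by (simp del: of_real_sum)
  then have z: "z $ k = 0" if "k \<noteq> \<nu>" for k using that by (simp add: sum_nonneg_eq_0_iff)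
  then have "L z = cmul (z $ \<nu>) (b \<nu>)" by (subst L_split) simp
  then have "z $ \<nu> = 0" using * bnz by (simp add: cmul_eq_0_iff)
  then have "z $ k = 0" for k using z by (cases "k = \<nu>") auto
  then show "z = 0" by (simp add: vec_eq_iff)
qed

lemma Theta_inj: "inj (\<lambda>v. ddir v (Theta p) 0)"
proof -
  have l: "linear (\<lambda>v. ddir v (Theta p) 0)"
    using cholE_derivative[OF Theta_chol(1)] has_derivative_linear by blast
  have "v = 0" if v: "ddir v (Theta p) 0 = 0" for v
  proof -
    have e: "L (fst v) + cmul (of_real r * snd v) \<tau> = 0" using v by (simp add: Theta_chol(2))
    \<comment> \<open>The frame is complex tangent, so \<open>D1\<close> sees only the coefficient
      of \<open>\<tau>\<close>: its imaginary part here, its real part after multiplication by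
      i.\<close>
    have "D1 (L (fst v) + cmul (of_real r * snd v) \<tau>) = 0" unfolding e by (simp add: D_simps)
    then have 1: "Im (snd v) = 0" using r by (simp add: D_simps L_H D1_tau)
    have LI: "D1 (cmul \<i> (L z)) = 0" for z
      unfolding L_def cmul_sum_right linear_sum[OF lin1] cmul_simps(4) b_H by simp
    have "D1 (cmul \<i> (L (fst v) + cmul (of_real r * snd v) \<tau>)) = 0" unfolding e by (simp add: D_simps)
    then have 2: "Re (snd v) = 0" using r by (simp add: cmul_add_right D_simps LI D1_tau)
    have s: "snd v = 0" using 1 2 by (simp add: complex_eq_iff)
    then have "fst v = 0" using e L_inj by simp
    with s show "v = 0" by (simp add: prod_eq_iff)
  qed
  then show ?thesis using l linear_injective_0 by blast
qed

lemma P_smooth: "smooth_on UNIV P"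
proof -
  have c: "Ck k UNIV (\<lambda>z::complex^'n. z $ j)" for k j by (rule Ck_linear[OF bounded_linear_vec_nth])
  note mult = Ck_bilinear[OF bounded_bilinear_mult open_UNIV]
  note Re = Ck_linear_comp[OF bounded_linear_Re open_UNIV] and cnj = Ck_linear_comp[OF bounded_linear_cnj open_UNIV]
  have Lk: "Ck k UNIV L" for k using Ck_linear linear_conv_bounded_linear L_linear by blast
  have Qk: "Ck k UNIV Q" for k
    unfolding Q_def[abs_def] divide_inverse
    by (rule mult[OF Ck_bilinear[OF clin_bounded_bilinear[OF Rh_clin(1) Rh_clin(2)] open_UNIV Lk Lk] Ck_const])
  have sq: "(cmod c)^2 = Re (c * cnj c)" for c unfolding cmod_power2 by (simp add: power2_eq_square)
  show ?thesis unfolding smooth_on_iff_Ck P_def[abs_def] sq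
    by (intro allI Ck_add[OF open_UNIV Ck_sum[OF open_UNIV Re[OF mult[OF c cnj[OF c]]]]
          mult[OF Ck_const Re[OF mult[OF cnj[OF c] Qk]]]])
qed

text \<open>Here w = t^2 (u + i N) + i c t^3, where N is the model quadric and c the cubic part of
  \<open>P\<close>. The single term beyond the third order is \<open>mu\<close> times the cubic part
  of w, of order t^4.\<close>

lemma Theta_jet:
  "jet3 (\<lambda>t. Theta p (t *\<^sub>R z, Complex (t^2 * u) (P (t *\<^sub>R z))) - p) 0 (L z)
     (Lq z + cmul (of_real r * Complex u (\<Sum>j\<in>UNIV - {\<nu>}. (cmod (z $ j))^2) + \<i> * csym (L z) (L z)) \<tau>)
     (cmul (of_real r * (\<i> * of_real (2 * Re (cnj (z $ \<nu>) * Q z))) + \<i> * Kp z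
        + of_real r * mu (L z) * Complex u (\<Sum>j\<in>UNIV - {\<nu>}. (cmod (z $ j))^2)) \<tau>)"
proof -
  define N where "N = (\<Sum>j\<in>UNIV - {\<nu>}. (cmod (z $ j))^2)"
  define c where "c = 2 * Re (cnj (z $ \<nu>) * Q z)"
  have w: "Complex (t^2 * u) (P (t *\<^sub>R z)) = t^2 *\<^sub>R Complex u N + t^3 *\<^sub>R (\<i> * of_real c)" for t
    unfolding P_scale N_def[symmetric] c_def[symmetric] by (simp add: complex_eq_iff)
  show ?thesis unfolding N_def[symmetric] c_def[symmetric]
  proof (rule jet3_exact4[where ?c4.0 = "cmul (of_real r * mu (L z) * (\<i> * of_real c)) \<tau>"])
    fix t :: real
    have m: "mu (t *\<^sub>R L z) = t *\<^sub>R mu (L z)" by (simp add: clinD[OF mu_clin] scaleR_conv_of_real)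
    have coef: "of_real r * (t^2 *\<^sub>R \<omega> + t^3 *\<^sub>R v) + \<i> * (of_real (t * t) * s) + \<i> * (of_real (t^3) * K)
        + of_real r * (t *\<^sub>R m) * (t^2 *\<^sub>R \<omega> + t^3 *\<^sub>R v)
      = t^2 *\<^sub>R (of_real r * \<omega> + \<i> * s) + t^3 *\<^sub>R (of_real r * v + \<i> * K + of_real r * m * \<omega>) + t^4 *\<^sub>R (of_real r * m * v)"
      for \<omega> v s K m by (simp add: scaleR_conv_of_real algebra_simps eval_nat_numeral)
    show "Theta p (t *\<^sub>R z, Complex (t\<^sup>2 * u) (P (t *\<^sub>R z))) - p = 0 + t *\<^sub>R L z
      + t^2 *\<^sub>R (Lq z + cmul (of_real r * Complex u N + \<i> * csym (L z) (L z)) \<tau>)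
      + t^3 *\<^sub>R cmul (of_real r * (\<i> * of_real c) + \<i> * Kp z + of_real r * mu (L z) * Complex u N) \<tau>
      + t^4 *\<^sub>R cmul (of_real r * mu (L z) * (\<i> * of_real c)) \<tau>"
      unfolding Theta_def fst_conv snd_conv w L_scaleR Lq_scale Kp_scale csym_scale m coef cmul_add_left[of "_ *\<^sub>R _ + _"]
        cmul_add_left[of "_ *\<^sub>R _"] cmul_scaleR
      by (simp add: scaleR_add_right)
  qed
qed

lemma coefficient2:
  "D1 (Lq z + cmul (of_real r * Complex u (\<Sum>j\<in>UNIV - {\<nu>}. (cmod (z $ j))^2) + \<i> * csym (L z) (L z)) \<tau>)
    + D2 (L z) (L z) / 2 = 0"
proof -
  define N where "N = (\<Sum>j\<in>UNIV - {\<nu>}. (cmod (z $ j))^2)"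
  have "D2 (L z) (L z) = 2 * (r * N) + 2 * Re (csym (L z) (L z))"
    unfolding D2_split[of "L z" "L z"] lev_LL N_def[symmetric] by simp
  moreover have "D1 (Lq z + cmul (of_real r * Complex u N + \<i> * csym (L z) (L z)) \<tau>) = - (r * N) - Re (csym (L z) (L z))"
    unfolding linear_add[OF lin1] D1_tau L_H by simp
  ultimately show ?thesis unfolding N_def[symmetric] by linarith
qed

text \<open>The order t^3 of the pulled-back defining function. The Levi pairing of
  \<open>Lq\<close> with \<open>L\<close> and the (2,1) form \<open>Rh\<close> add up to the cubic
  part of \<open>P\<close>, by \<open>lev_LqL\<close>, and are balanced by the cubic part of Im w.
  \<open>Kp\<close> takes care of \<open>Kh\<close> and of the product of \<open>L\<close> with
  \<open>Lq\<close> in \<open>csym\<close>, and \<open>mu\<close> of the terms with Re w.\<close>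

lemma coefficient3:
  "D1 (cmul (of_real r * (\<i> * of_real (2 * Re (cnj (z $ \<nu>) * Q z))) + \<i> * Kp z
        + of_real r * mu (L z) * Complex u (\<Sum>j\<in>UNIV - {\<nu>}. (cmod (z $ j))^2)) \<tau>)
   + D2 (L z) (Lq z + cmul (of_real r * Complex u (\<Sum>j\<in>UNIV - {\<nu>}. (cmod (z $ j))^2) + \<i> * csym (L z) (L z)) \<tau>)
   + D3 (L z) (L z) (L z) / 6 = 0"
proof -
  define N where "N = (\<Sum>j\<in>UNIV - {\<nu>}. (cmod (z $ j))^2)"
  define c where "c = 2 * Re (cnj (z $ \<nu>) * Q z)"
  let ?X = "L z"
  have om: "of_real r * Complex u N = of_real (r * u) + \<i> * lev ?X ?X"
    unfolding lev_LL N_def[symmetric] by (simp add: complex_eq_iff)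
  have 1: "D1 (cmul (of_real r * (\<i> * of_real c) + \<i> * Kp z + of_real r * mu ?X * Complex u N) \<tau>)
     = - r * c - Re (Kh ?X) - 2 * Re (csym ?X (Lq z)) - Im (mu ?X * (of_real (r * u) + \<i> * lev ?X ?X))"
  proof -
    have *: "of_real r * mu ?X * Complex u N = mu ?X * (of_real (r * u) + \<i> * lev ?X ?X)"
      unfolding om[symmetric] by simp
    show ?thesis unfolding D1_tau * by (simp add: Kp_def)
  qed
  have 2: "D2 ?X (Lq z + cmul (of_real r * Complex u N + \<i> * csym ?X ?X) \<tau>)
    = 2 * Re (lev (Lq z) ?X) + 2 * Re (csym ?X (Lq z))
      + D2 ?X (cmul (of_real (r * u) + \<i> * (lev ?X ?X + csym ?X ?X)) \<tau>)"
    unfolding linear_add[OF lin2'] om using D2_split[of ?X "Lq z"] lev_cnj[of "Lq z" ?X] by (simp add: distrib_left add.assoc)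
  have "2 * Re (lev (Lq z) ?X) + 2 * Re (Rh ?X ?X ?X) = r * c"
    using arg_cong[OF lev_LqL[of z], of Re] by (simp add: c_def algebra_simps)
  then show ?thesis
    unfolding N_def[symmetric] c_def[symmetric] 1 2 using cubic_identity[of ?X "r * u"] by simp
qed

end

section \<open>Frames adapted to the Levi form\<close>

lemma zidx_bij: "bij_betw (zidx :: nat \<Rightarrow> 'n::finite) {1..CARD('n)} UNIV"
proof -
  have "\<exists>e. bij_betw e {1..CARD('n)} (UNIV :: 'n set)"
    using ex_bij_betw_nat_finite_1[of "UNIV :: 'n set"] by auto
  then show ?thesis unfolding zidx_def by (rule someI_ex)
qed

lemma sum_zidx: "(\<Sum>j\<in>UNIV. f (j::'n::finite)) = (\<Sum>k=1..CARD('n). f (zidx k))"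
  using sum.reindex_bij_betw[OF zidx_bij, of f] by simp

lemma sum_zidx_but_last:
  "(\<Sum>j\<in>UNIV - {zidx CARD('n)}. f (j::'n::finite)) = (\<Sum>k=1..CARD('n) - 1. f (zidx k))"
proof -
  have inj: "inj_on (zidx :: nat \<Rightarrow> 'n) {1..CARD('n)}" and im: "(zidx :: nat \<Rightarrow> 'n) ` {1..CARD('n)} = UNIV"
    using zidx_bij[where 'n = 'n] unfolding bij_betw_def by simp_all
  have c: "CARD('n) \<in> {1..CARD('n)}" by (simp add: Suc_leI)
  have "UNIV - {zidx CARD('n)} = (zidx :: nat \<Rightarrow> 'n) ` ({1..CARD('n)} - {CARD('n)})"
    using inj_on_image_set_diff[OF inj, of "{1..CARD('n)}" "{CARD('n)}"] im c by auto
  also have "{1..CARD('n)} - {CARD('n)} = {1..CARD('n) - 1}" using c by (auto simp del: One_nat_def)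
  finally have e: "UNIV - {zidx CARD('n)} = (zidx :: nat \<Rightarrow> 'n) ` {1..CARD('n) - 1}" .
  have "inj_on (zidx :: nat \<Rightarrow> 'n) {1..CARD('n) - 1}" by (rule inj_on_subset[OF inj]) auto
  then show ?thesis unfolding e by (simp add: sum.reindex)
qed

lemma zidx_inject:
  "k \<in> {1..CARD('n)} \<Longrightarrow> l \<in> {1..CARD('n)} \<Longrightarrow> (zidx k :: 'n::finite) = zidx l \<longleftrightarrow> k = l"
  by (rule inj_on_eq_iff[OF bij_betw_imp_inj_on[OF zidx_bij]])

lemma zidx_cases: obtains k where "k \<in> {1..CARD('n)}" "j = (zidx k :: 'n::finite)"
  using zidx_bij by (metis UNIV_I bij_betw_imp_surj_on imageE)

section \<open>From a frame to the normal form\<close>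

lemma jet_of_defining_function:
  assumes "smooth_on U \<rho>" "open U" "p \<in> U" "ddir \<tau> \<rho> p = 0" "ddir (cmul \<i> \<tau>) \<rho> p = - 1"
  shows "cubic_jet (\<lambda>v. ddir v \<rho> p) (\<lambda>u v. ddir u (ddir v \<rho>) p) (\<lambda>u v w. ddir u (ddir v (ddir w \<rho>)) p) \<tau>"
proof (rule cubic_jet.intro)
  note sm = assms(1-3)
  show "linear (\<lambda>v. ddir v \<rho> p)" by (rule ddir_linear[OF smooth_on_differentiable[OF sm]])
  show "linear (\<lambda>x. ddir x (ddir y \<rho>) p)" for y by (rule ddir2_linear[OF sm])
  show "ddir x (ddir y \<rho>) p = ddir y (ddir x \<rho>) p" for x y by (rule ddir_commute[OF sm])
  show "linear (\<lambda>x. ddir x (ddir y (ddir z \<rho>)) p)" for y z by (rule ddir3_linear[OF sm])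
  show "ddir x (ddir y (ddir z \<rho>)) p = ddir y (ddir x (ddir z \<rho>)) p" for x y z
    by (rule ddir_commute[OF smooth_on_ddir[OF sm(1,2)] sm(2,3)])
  show "ddir x (ddir y (ddir z \<rho>)) p = ddir x (ddir z (ddir y \<rho>)) p" for x y z by (rule ddir3_commute[OF sm])
qed (fact assms(4,5))+

text \<open>A nonzero real functional is the real part of a complex linear one, and the latter takes
  the value i; both conditions on \<open>\<tau>\<close> say exactly this.\<close>

lemma transversal_exists:
  fixes D1 :: "(complex^'n) \<times> complex \<Rightarrow> real"
  assumes l: "linear D1" and nz: "D1 x \<noteq> 0"
  shows "\<exists>\<tau>. D1 \<tau> = 0 \<and> D1 (cmul \<i> \<tau>) = - 1"
proof -
  define f where "f y = Complex (D1 y) (- D1 (cmul \<i> y))" for y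
  have f: "clin f"
    unfolding f_def
    by (intro clinI linearI)
     (simp_all add: linear_add[OF l] linear_cmul[OF l] cmul_add_right cmul_scaleR complex_eq_iff cmul_minus_left linear_neg[OF l])
  have fx: "f x \<noteq> 0" using nz by (simp add: f_def complex_eq_iff)
  have "f (cmul (\<i> / f x) x) = \<i>" using fx by (simp add: clinD(2)[OF f])
  then show ?thesis unfolding f_def by (intro exI[of _ "cmul (\<i> / f x) x"]) (simp add: f_def complex_eq_iff)
qed

lemma frame_normal_form:
  fixes M :: "((complex^'n) \<times> complex) set"
  assumes def: "local_defining_fn M p0 U \<rho>" and p0: "p0 \<in> M"
    and fr: "cubic_frame (\<lambda>v. ddir v \<rho> p0) (\<lambda>u v. ddir u (ddir v \<rho>) p0) (\<lambda>u v w. ddir u (ddir v (ddir w \<rho>)) p0) \<tau> b r (zidx CARD('n))"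
    and Q: "\<And>z. cubic_frame.Q (\<lambda>u v. ddir u (ddir v \<rho>) p0) (\<lambda>u v w. ddir u (ddir v (ddir w \<rho>)) p0) \<tau> b r (zidx CARD('n)) z
        = nf_rhs CARD('n) c lam z"
  shows "has_normal_form M p0 c lam"
proof -
  interpret cubic_frame "\<lambda>v. ddir v \<rho> p0" "\<lambda>u v. ddir u (ddir v \<rho>) p0" "\<lambda>u v w. ddir u (ddir v (ddir w \<rho>)) p0" \<tau> b r "zidx CARD('n)"
    by (rule fr)
  have U: "open U" "p0 \<in> U" "smooth_on U \<rho>" "M \<inter> U = {q\<in>U. \<rho> q = 0}" using def by (auto simp: local_defining_fn_def)
  have \<rho>0: "\<rho> p0 = 0" using U p0 by auto
  have 1: "smooth_on UNIV (Theta p0)" "ddir (cmul \<i> v) (Theta p0) q = cmul \<i> (ddir v (Theta p0) q)" for q v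
    using Theta_chol(1)[of p0] unfolding cholE_def smooth_on_iff_Ck by blast+
  have 2: "ddir (ddir (0, \<i>) (Theta p0) 0) \<rho> p0 \<noteq> 0"
    using r by (simp add: Theta_chol(2) L_0 D1_tau)
  have 3: "P 0 = 0" using P_scale[of 0 0] by simp
  have 4: "jet3 (\<lambda>t. \<rho> (Theta p0 (t *\<^sub>R z, Complex (t^2 * u) (P (t *\<^sub>R z))))) 0 0 0 0" for z u
  proof -
    have "jet3 (\<lambda>t. \<rho> (p0 + (Theta p0 (t *\<^sub>R z, Complex (t^2 * u) (P (t *\<^sub>R z))) - p0))) 0 0 0 0"
      by (rule jet3_eqs[OF jet3_smooth[OF U(3,1,2) Theta_jet]])
        (rule \<rho>0 L_H coefficient2 coefficient3)+
    then show ?thesis by simp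
  qed
  have P: "P z = (\<Sum>k=1..CARD('n)-1. (cmod (zc z k))^2) + 2 * Re (cnj (zc z CARD('n)) * nf_rhs CARD('n) c lam z)" for z
    unfolding P_def Q sum_zidx_but_last zc_def ..
  from normal_form_of_jets[OF U(1-4) \<rho>0 1 Theta_inj Theta_0 2 P_smooth 3 4]
  show ?thesis unfolding has_normal_form_def normal_form_eq_def P by blast
qed

section \<open>Complex subspaces and their real dimension\<close>

definition csub :: "((complex^'n) \<times> complex) set \<Rightarrow> bool" where
  "csub V \<longleftrightarrow> subspace V \<and> (\<forall>x\<in>V. cmul \<i> x \<in> V)"

lemma csubD:
  assumes "csub V"
  shows "x \<in> V \<Longrightarrow> y \<in> V \<Longrightarrow> x + y \<in> V" "x \<in> V \<Longrightarrow> cmul c x \<in> V" "0 \<in> V" "x \<in> V \<Longrightarrow> y \<in> V \<Longrightarrow> x - y \<in> V"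
    "x \<in> V \<Longrightarrow> t *\<^sub>R x \<in> V"
proof -
  have s: "subspace V" and i: "\<And>x. x \<in> V \<Longrightarrow> cmul \<i> x \<in> V" using assms unfolding csub_def by blast+
  show "x \<in> V \<Longrightarrow> y \<in> V \<Longrightarrow> x + y \<in> V" "0 \<in> V" "x \<in> V \<Longrightarrow> y \<in> V \<Longrightarrow> x - y \<in> V" "x \<in> V \<Longrightarrow> t *\<^sub>R x \<in> V"
    using s by (auto simp: subspace_add subspace_0 subspace_diff subspace_scale)
  show "x \<in> V \<Longrightarrow> cmul c x \<in> V" by (subst cmul_decompose) (simp add: subspace_add[OF s] subspace_scale[OF s] i)
qed

lemma dim_kernel_ge:
  fixes g :: "'a::euclidean_space \<Rightarrow> real"
  assumes V: "subspace V" and g: "linear g"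
  shows "subspace (V \<inter> {x. g x = 0})" "dim V \<le> dim (V \<inter> {x. g x = 0}) + 1"
proof -
  show s: "subspace (V \<inter> {x. g x = 0})"
    using V linear_subspace_kernel[OF g] by (intro subspace_inter)
  show "dim V \<le> dim (V \<inter> {x. g x = 0}) + 1"
  proof (cases "V \<subseteq> {x. g x = 0}")
    case True
    then have "V \<inter> {x. g x = 0} = V" by auto
    then show ?thesis by simp
  next
    case False
    then obtain v where v: "v \<in> V" "g v \<noteq> 0" by auto
    have "V \<subseteq> span (insert v (V \<inter> {x. g x = 0}))"
    proof
      fix x assume x: "x \<in> V"
      let ?y = "x - (g x / g v) *\<^sub>R v"
      have "?y \<in> V" using V v x by (simp add: subspace_diff subspace_scale)
      moreover have "g ?y = 0" using v by (simp add: linear_diff[OF g] linear_cmul[OF g])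
      ultimately have "?y \<in> span (insert v (V \<inter> {x. g x = 0}))" by (intro span_base) auto
      moreover have "(g x / g v) *\<^sub>R v \<in> span (insert v (V \<inter> {x. g x = 0}))" by (intro span_scale span_base) auto
      ultimately show "x \<in> span (insert v (V \<inter> {x. g x = 0}))" using span_add by fastforce
    qed
    then have "dim V \<le> dim (insert v (V \<inter> {x. g x = 0}))" by (metis dim_span dim_subset)
    also have "\<dots> \<le> dim (V \<inter> {x. g x = 0}) + 1" by (simp add: dim_insert)
    finally show ?thesis .
  qed
qed

lemma csub_kernel:
  assumes V: "csub V" and f: "clin f"
  shows "csub (V \<inter> {x. f x = 0})" "dim V \<le> dim (V \<inter> {x. f x = 0}) + 2"
proof -
  have s: "subspace V" using V by (simp add: csub_def)
  have lR: "linear (\<lambda>x. Re (f x))" and lI: "linear (\<lambda>x. Im (f x))"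
    by (intro linearI; simp add: clinD[OF f])+
  have e: "V \<inter> {x. f x = 0} = (V \<inter> {x. Re (f x) = 0}) \<inter> {x. Im (f x) = 0}" by (auto simp: complex_eq_iff)
  note k1 = dim_kernel_ge[OF s lR]
  note k2 = dim_kernel_ge[OF k1(1) lI]
  show "dim V \<le> dim (V \<inter> {x. f x = 0}) + 2" unfolding e using k1(2) k2(2) by linarith
  show "csub (V \<inter> {x. f x = 0})" using k2(1) V unfolding csub_def e[symmetric] by (auto simp: clinD[OF f])
qed

section \<open>The complex tangent space and Takagi's factorisation relative to the Levi
  form\<close>

context cubic_jet
begin

definition H where "H = {v. D1 v = 0 \<and> D1 (cmul \<i> v) = 0}"

lemma lev_scale: "lev (cmul c x) (cmul d y) = c * cnj d * lev x y"
  by (simp add: clinD(2)[OF lev_clin] alinD(2)[OF lev_alin])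

lemma tangent_functional: "clin (\<lambda>x. Complex (D1 x) (- D1 (cmul \<i> x)))"
  by (intro clinI linearI)
    (simp_all add: D_simps cmul_add_right cmul_scaleR complex_eq_iff cmul_minus_left)

lemma H_kernel: "H = UNIV \<inter> {x. Complex (D1 x) (- D1 (cmul \<i> x)) = 0}"
  by (auto simp: H_def complex_eq_iff)

lemma csub_UNIV: "csub UNIV" by (simp add: csub_def)

lemma H_csub: "csub H"
  unfolding H_kernel by (rule csub_kernel(1)[OF csub_UNIV tangent_functional])

lemma dim_E: "dim (UNIV :: ((complex^'n) \<times> complex) set) = 2 * CARD('n) + 2"
  by (simp add: dim_UNIV)

text \<open>From below: \<open>H\<close> is the kernel of one complex functional. From above:
  \<open>\<tau>\<close> and i \<open>\<tau>\<close> are real independent modulo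
  \<open>H\<close>.\<close>

lemma dim_H: "dim H = 2 * CARD('n)"
proof (rule antisym)
  show "2 * CARD('n) \<le> dim H"
    using csub_kernel(2)[OF csub_UNIV tangent_functional] unfolding H_kernel[symmetric] dim_E by simp
  have t: "\<tau> \<notin> H" using tau by (simp add: H_def)
  have sH: "span H = H" using H_csub by (simp add: csub_def span_eq_iff)
  have it: "cmul \<i> \<tau> \<notin> span (insert \<tau> H)"
  proof
    assume "cmul \<i> \<tau> \<in> span (insert \<tau> H)"
    then obtain c where "cmul \<i> \<tau> - c *\<^sub>R \<tau> \<in> H" using sH by (auto simp: span_insert)
    then have "D1 (cmul \<i> \<tau> + - (c *\<^sub>R \<tau>)) = 0" by (simp add: H_def)
    then show False by (simp add: D_simps tau del: add_uminus_conv_diff)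
  qed
  have "dim (insert (cmul \<i> \<tau>) (insert \<tau> H)) = dim H + 2"
    using it t unfolding dim_insert sH by simp
  moreover have "dim (insert (cmul \<i> \<tau>) (insert \<tau> H)) \<le> 2 * CARD('n) + 2"
    using dim_subset_UNIV[of "insert (cmul \<i> \<tau>) (insert \<tau> H)"] by simp
  ultimately show "dim H \<le> 2 * CARD('n)" by simp
qed

text \<open>The variational start of Takagi's factorisation. The quotient of
  \<open>Re (S x x)\<close> by the Levi form attains a maximum \<open>\<mu>\<close>. Rotating x by a
  phase turns the real part into the modulus, which gives the bound and makes \<open>S e e\<close>
  real; the first variation at \<open>e\<close> gives the orthogonality.\<close>

lemma maximiser:
  assumes V: "csub V" "dim V \<ge> 1" and pd: "\<And>x. x \<in> V \<Longrightarrow> x \<noteq> 0 \<Longrightarrow> Re (lev x x) > 0"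
    and S: "\<And>y. clin (\<lambda>x. S x y)" "\<And>x. clin (S x)" "\<And>x y. S x y = S y x"
  shows "\<exists>e \<mu>. e \<in> V \<and> lev e e = 1 \<and> \<mu> \<ge> 0 \<and> S e e = of_real \<mu> \<and>
     (\<forall>x\<in>V. cmod (S x x) \<le> \<mu> * Re (lev x x)) \<and> (\<forall>x\<in>V. lev x e = 0 \<longrightarrow> S e x = 0)"
proof -
  have sub: "subspace V" using V(1) by (simp add: csub_def)
  \<comment> \<open>The quotient is invariant under real scaling, so that the Euclidean sphere,
    compact at once, can replace the Levi sphere.\<close>
  let ?K = "V \<inter> sphere 0 1"
  have comp: "compact ?K" by (intro closed_Int_compact closed_subspace sub compact_sphere)
  have "\<exists>x\<in>V. x \<noteq> 0" using V(2) by (metis dim_eq_0 not_one_le_zero subset_iff singletonI)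
  then obtain x0 where x0: "x0 \<in> V" "x0 \<noteq> 0" by blast
  have "x0 /\<^sub>R norm x0 \<in> ?K" using x0 csubD(5)[OF V(1)] by simp
  then have ne: "?K \<noteq> {}" by blast
  have bS: "bounded_bilinear S" by (rule clin_bounded_bilinear[OF S(1,2)])
  have bl: "bounded_bilinear lev"
    by (rule bilinear_conv_bounded_bilinear[THEN iffD1]) (use lev_clin lev_alin in \<open>auto simp: bilinear_def clin_def alin_def\<close>)
  have cS: "continuous_on ?K (\<lambda>x. Re (S x x))"
    by (intro continuous_intros bounded_bilinear.continuous_on[OF bS])
  have cl: "continuous_on ?K (\<lambda>x. Re (lev x x))"
    by (intro continuous_intros bounded_bilinear.continuous_on[OF bl])
  have "continuous_on ?K (\<lambda>x. Re (S x x) / Re (lev x x))"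
    by (intro continuous_on_divide cS cl) (use pd in force)
  then obtain e0 where e0: "e0 \<in> ?K" and mx: "\<And>x. x \<in> ?K \<Longrightarrow> Re (S x x) / Re (lev x x) \<le> Re (S e0 e0) / Re (lev e0 e0)"
    using continuous_attains_sup[OF comp ne] by blast
  define \<mu> where "\<mu> = Re (S e0 e0) / Re (lev e0 e0)"
  have e0V: "e0 \<in> V" "e0 \<noteq> 0" using e0 by auto
  have Ssc: "S (cmul c x) (cmul d y) = c * d * S x y" for c d x y
    by (simp add: clinD(2)[OF S(1)] clinD(2)[OF S(2)])
  have le: "Re (S x x) \<le> \<mu> * Re (lev x x)" if x: "x \<in> V" for x
  proof (cases "x = 0")
    case True then show ?thesis by (simp add: clinD(3)[OF S(1)] clinD(3)[OF lev_clin])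
  next
    case False
    let ?n = "inverse (norm x)"
    have n: "?n > 0" using False by simp
    have "?n *\<^sub>R x \<in> ?K" using x False csubD(5)[OF V(1)] by simp
    from mx[OF this] have "Re (S (?n *\<^sub>R x) (?n *\<^sub>R x)) / Re (lev (?n *\<^sub>R x) (?n *\<^sub>R x)) \<le> \<mu>" by (simp add: \<mu>_def)
    moreover have "Re (S (?n *\<^sub>R x) (?n *\<^sub>R x)) = ?n^2 * Re (S x x)" "Re (lev (?n *\<^sub>R x) (?n *\<^sub>R x)) = ?n^2 * Re (lev x x)"
      unfolding cmul_of_real[symmetric] Ssc lev_scale by (simp_all add: power2_eq_square del: of_real_inverse)
    ultimately have "Re (S x x) / Re (lev x x) \<le> \<mu>" using n by simp
    then show ?thesis using pd[OF x False] by (simp add: field_simps)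
  qed
  define c where "c = complex_of_real (1 / sqrt (Re (lev e0 e0)))"
  define e where "e = cmul c e0"
  have eV: "e \<in> V" unfolding e_def by (rule csubD(2)[OF V(1) e0V(1)])
  have l0: "Re (lev e0 e0) > 0" using pd e0V by blast
  have cc: "c * c = of_real (1 / Re (lev e0 e0))" using l0 by (simp add: c_def flip: of_real_mult)
  have le1: "lev e e = 1"
  proof -
    have "lev e e = of_real (1 / Re (lev e0 e0)) * lev e0 e0"
      unfolding e_def lev_scale cc[symmetric] by (simp add: c_def)
    then show ?thesis using l0 lev_real[of e0] by (simp add: complex_eq_iff)
  qed
  have ReS: "Re (S e e) = \<mu>" unfolding e_def Ssc cc \<mu>_def by simp
  \<comment> \<open>Multiplication by i changes the sign of S and preserves the Levi form, so that -
    \<open>\<mu>\<close> is also a value below the maximum.\<close>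
  have lpos: "\<mu> \<ge> 0"
  proof -
    have "Re (S (cmul \<i> e) (cmul \<i> e)) \<le> \<mu> * Re (lev (cmul \<i> e) (cmul \<i> e))" by (rule le[OF csubD(2)[OF V(1) eV]])
    then show ?thesis unfolding Ssc lev_scale le1 using ReS by simp
  qed
  have cm: "cmod (S x x) \<le> \<mu> * Re (lev x x)" if x: "x \<in> V" for x
  proof (cases "S x x = 0")
    case True
    then show ?thesis using lpos pd[OF x] by (cases "x = 0") (auto simp: clinD(3)[OF lev_clin])
  next
    case False
    \<comment> \<open>A phase whose square rotates \<open>S x x\<close> to the positive real
      axis.\<close>
    define d where "d = csqrt (cnj (S x x) / of_real (cmod (S x x)))"
    have d2: "d * d = cnj (S x x) / of_real (cmod (S x x))" unfolding d_def by (metis power2_csqrt power2_eq_square)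
    have "(cmod d)^2 = cmod (d * d)" by (simp add: norm_mult power2_eq_square)
    then have "(cmod d)^2 = 1" unfolding d2 using False by (simp add: norm_divide)
    then have dd: "d * cnj d = 1" by (simp add: complex_norm_square[symmetric] flip: of_real_power)
    have "Re (S (cmul d x) (cmul d x)) \<le> \<mu> * Re (lev (cmul d x) (cmul d x))" by (rule le[OF csubD(2)[OF V(1) x]])
    moreover have "d * d * S x x = of_real (cmod (S x x))"
      unfolding d2 using False by (simp add: mult.commute[of "cnj _"] complex_norm_square[symmetric] power2_eq_square)
    ultimately show ?thesis unfolding Ssc lev_scale dd by simp
  qed
  have See: "S e e = of_real \<mu>"
  proof -
    have "cmod (S e e) \<le> \<mu>" using cm[OF eV] le1 by simp
    then have "(Re (S e e))^2 + (Im (S e e))^2 \<le> \<mu>^2"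
      using lpos by (metis cmod_power2 norm_ge_zero power_mono)
    then have "Im (S e e) = 0" using ReS by simp
    then show ?thesis using ReS by (simp add: complex_eq_iff)
  qed
  have orth: "Re (S e x) = 0" if x: "x \<in> V" and o: "lev x e = 0" for x
  proof -
    have o': "lev e x = 0" using o lev_cnj[of e x] by simp
    have ineq: "2 * t * Re (S e x) \<le> t^2 * (\<mu> * Re (lev x x) - Re (S x x))" for t
    proof -
      have "e + cmul (of_real t) x \<in> V" using csubD[OF V(1)] eV x by blast
      from le[OF this] show ?thesis
        by (simp add: clinD(1,2)[OF S(1)] clinD(1,2)[OF S(2)] S(3)[of x e] clinD(1,2)[OF lev_clin] alinD(1,2)[OF lev_alin]
            o o' le1 See power2_eq_square algebra_simps)
    qed
    define a where "a = Re (S e x)"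
    \<comment> \<open>At t = a / m the left side of \<open>ineq\<close> is 2 a^2 / m and the right
      side at most a^2 / m, which forces a = 0. The summand 1 keeps \<open>m\<close>
      positive.\<close>
    define m where "m = \<bar>\<mu> * Re (lev x x) - Re (S x x)\<bar> + 1"
    have m: "m > 0" by (simp add: m_def add_nonneg_pos)
    have "2 * (a / m) * a \<le> (a / m)^2 * (\<mu> * Re (lev x x) - Re (S x x))" using ineq[of "a / m"] by (simp add: a_def)
    also have "\<dots> \<le> (a / m)^2 * m" by (intro mult_left_mono) (auto simp: m_def)
    also have "\<dots> = a^2 / m" using m by (simp add: power2_eq_square)
    finally have "2 * a^2 / m \<le> a^2 / m" by (simp add: power2_eq_square)
    then have "a^2 \<le> 0" using m by (simp add: divide_le_cancel)
    then show ?thesis by (simp add: a_def)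
  qed
  have "S e x = 0" if x: "x \<in> V" and o: "lev x e = 0" for x
  proof -
    have "Re (S e (cmul \<i> x)) = 0"
      by (rule orth[OF csubD(2)[OF V(1) x]]) (simp add: clinD(2)[OF lev_clin] o)
    then have "Im (S e x) = 0" by (simp add: clinD(2)[OF S(2)])
    then show ?thesis using orth[OF x o] by (simp add: complex_eq_iff)
  qed
  then show ?thesis using eV le1 lpos See cm by blast
qed

text \<open>The maximiser is split off and the induction continues on its Levi orthogonal
  complement, where S does not couple to it. The maximality bound persists there, which makes the
  values decrease. Dimensions are real, whence the factor 2.\<close>

lemma takagi:
  assumes "csub V" "dim V \<ge> 2 * m" and pd: "\<And>x. x \<in> V \<Longrightarrow> x \<noteq> 0 \<Longrightarrow> Re (lev x x) > 0"
    and S: "\<And>y. clin (\<lambda>x. S x y)" "\<And>x. clin (S x)" "\<And>x y. S x y = S y x"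
  shows "\<exists>e lam. (\<forall>i<m. e i \<in> V) \<and> (\<forall>i<m. \<forall>j<m. lev (e i) (e j) = (if i = j then 1 else 0)) \<and>
    (\<forall>i<m. \<forall>j<m. S (e i) (e j) = (if i = j then of_real (lam i) else 0)) \<and>
    (\<forall>i<m. lam i \<ge> 0) \<and> (\<forall>i<m. \<forall>j\<le>i. lam i \<le> lam (j::nat))"
  using assms(1-3)
proof (induction m arbitrary: V)
  case 0
  then show ?case by simp
next
  case (Suc m)
  obtain e0 \<mu>0 where e0: "e0 \<in> V" "lev e0 e0 = 1" "\<mu>0 \<ge> 0" "S e0 e0 = of_real \<mu>0"
    "\<And>x. x \<in> V \<Longrightarrow> cmod (S x x) \<le> \<mu>0 * Re (lev x x)" "\<And>x. x \<in> V \<Longrightarrow> lev x e0 = 0 \<Longrightarrow> S e0 x = 0"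
  proof -
    have "dim V \<ge> 1" using Suc.prems(2) by simp
    from maximiser[OF Suc.prems(1) this Suc.prems(3) S] show ?thesis using that by blast
  qed
  let ?V = "V \<inter> {x. lev x e0 = 0}"
  have "csub ?V" "dim ?V \<ge> 2 * m"
    using csub_kernel[OF Suc.prems(1) lev_clin, of e0] Suc.prems(2) by auto
  then obtain e lam where IH: "\<forall>i<m. e i \<in> ?V" "\<forall>i<m. \<forall>j<m. lev (e i) (e j) = (if i = j then 1 else 0)"
    "\<forall>i<m. \<forall>j<m. S (e i) (e j) = (if i = j then of_real (lam i) else 0)" "\<forall>i<m. lam i \<ge> 0" "\<forall>i<m. \<forall>j\<le>i. lam i \<le> lam (j::nat)"
    using Suc.IH[of ?V] Suc.prems(3) by auto
  let ?e = "\<lambda>i. case i of 0 \<Rightarrow> e0 | Suc i \<Rightarrow> e i" and ?l = "\<lambda>i. case i of 0 \<Rightarrow> \<mu>0 | Suc i \<Rightarrow> lam i"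
  have lam_le: "lam i \<le> \<mu>0" if "i < m" for i
  proof -
    have "cmod (S (e i) (e i)) \<le> \<mu>0 * Re (lev (e i) (e i))" using e0(5) IH(1) that by auto
    then show ?thesis using IH that by simp
  qed
  have l1: "lev (e i) e0 = 0" "lev e0 (e i) = 0" "S e0 (e i) = 0" "S (e i) e0 = 0" if "i < m" for i
    using IH(1) that lev_cnj[of e0 "e i"] e0(6)[of "e i"] S(3)[of "e i" e0] by auto
  show ?case
    by (intro exI[of _ ?e] exI[of _ ?l] conjI)
      (use IH e0 l1 lam_le in \<open>auto split: nat.split simp: less_Suc_eq_0_disj\<close>)
qed

end

section \<open>The quadratic forms of the three cases as symmetric matrices\<close>

definition nf_mat :: "nat \<Rightarrow> nf_case \<Rightarrow> (nat \<Rightarrow> real) \<Rightarrow> nat \<Rightarrow> nat \<Rightarrow> complex" where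
  "nf_mat n c lam k l = (if k = l \<and> k < n then of_real (lam k) else 0) +
     (case c of Case_i \<Rightarrow> (if k = n - 1 \<and> l = n then 1 else 0) + (if k = n \<and> l = n - 1 then 1 else 0)
        | Case_ii \<Rightarrow> 0 | Case_iii \<Rightarrow> (if k = n \<and> l = n then 1 else 0))"

lemma sum_delta2:
  assumes "finite A" "finite B" "a \<in> A" "b \<in> B"
  shows "(\<Sum>k\<in>A. \<Sum>l\<in>B. (if k = a \<and> l = b then 1 else 0) * f k l) = (f a b :: complex)"
proof -
  have "(\<Sum>k\<in>A. \<Sum>l\<in>B. (if k = a \<and> l = b then 1 else 0) * f k l) = (\<Sum>k\<in>A. if k = a then f a b else 0)"
  proof (rule sum.cong)
    fix k assume "k \<in> A"
    have "(\<Sum>l\<in>B. (if k = a \<and> l = b then 1 else 0) * f k l) = (\<Sum>l\<in>B. if l = b then (if k = a then f a b else 0) else 0)"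
      by (rule sum.cong) auto
    then show "(\<Sum>l\<in>B. (if k = a \<and> l = b then 1 else 0) * f k l) = (if k = a then f a b else 0)"
      using assms by simp
  qed simp
  then show ?thesis using assms by simp
qed

text \<open>The polar form of \<open>nf_rhs\<close>; on the diagonal the two agree
  (\<open>nf_rhs_nfb\<close>).\<close>

definition nfb :: "nat \<Rightarrow> nf_case \<Rightarrow> (nat \<Rightarrow> real) \<Rightarrow> complex^'n \<Rightarrow> complex^'n \<Rightarrow> complex" where
  "nfb n c lam z z' = (\<Sum>k=1..n. \<Sum>l=1..n. nf_mat n c lam k l * (zc z k * zc z' l))"

lemma nfb_eq:
  assumes n: "n \<ge> 2"
  shows "nfb n c lam z z' = (\<Sum>k=1..n-1. of_real (lam k) * zc z k * zc z' k) +
     (case c of Case_i \<Rightarrow> zc z (n-1) * zc z' n + zc z n * zc z' (n-1)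
              | Case_ii \<Rightarrow> 0
              | Case_iii \<Rightarrow> zc z n * zc z' n)"
proof -
  let ?D = "\<Sum>k=1..n. \<Sum>l=1..n. (if k = l \<and> k < n then of_real (lam k) else 0) * (zc z k * zc z' l)"
  have "?D = (\<Sum>k=1..n. if k < n then of_real (lam k) * zc z k * zc z' k else 0)"
  proof (rule sum.cong)
    fix k assume k: "k \<in> {1..n}"
    have "(\<Sum>l=1..n. (if k = l \<and> k < n then of_real (lam k) else 0) * (zc z k * zc z' l))
      = (\<Sum>l=1..n. if l = k then (if k < n then of_real (lam k) * zc z k * zc z' k else 0) else 0)"
      by (rule sum.cong) auto
    then show "(\<Sum>l=1..n. (if k = l \<and> k < n then of_real (lam k) else 0) * (zc z k * zc z' l))
      = (if k < n then of_real (lam k) * zc z k * zc z' k else 0)" using k by simp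
  qed simp
  also have "\<dots> = (\<Sum>k=1..n-1. of_real (lam k) * zc z k * zc z' k)"
    by (rule sum.mono_neutral_cong_right) (use n in auto)
  finally have D: "?D = (\<Sum>k=1..n-1. of_real (lam k) * zc z k * zc z' k)" .
  have mem: "n \<in> {1..n}" "n - 1 \<in> {1..n}" using n by auto
  note d = sum_delta2[OF finite_atLeastAtMost finite_atLeastAtMost]
  show ?thesis
  proof (cases c)
    case Case_i
    then have nf: "nf_mat n c lam k l = (if k = l \<and> k < n then of_real (lam k) else 0)
      + ((if k = n - 1 \<and> l = n then 1 else 0) + (if k = n \<and> l = n - 1 then 1 else 0))" for k l
      by (simp add: nf_mat_def)
    show ?thesis
      unfolding nfb_def nf distrib_right sum.distrib D d[OF mem(2,1)] d[OF mem(1,2)] by (simp add: Case_i)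
  next
    case Case_ii
    then have nf: "nf_mat n c lam k l = (if k = l \<and> k < n then of_real (lam k) else 0)" for k l
      by (simp add: nf_mat_def)
    show ?thesis unfolding nfb_def nf D by (simp add: Case_ii)
  next
    case Case_iii
    then have nf: "nf_mat n c lam k l = (if k = l \<and> k < n then of_real (lam k) else 0) + (if k = n \<and> l = n then 1 else 0)" for k l
      by (simp add: nf_mat_def)
    show ?thesis
      unfolding nfb_def nf distrib_right sum.distrib D d[OF mem(1,1)] by (simp add: Case_iii)
  qed
qed

lemma nf_rhs_nfb: "n \<ge> 2 \<Longrightarrow> nf_rhs n c lam z = nfb n c lam z z"
  unfolding nfb_eq nf_rhs_def by (cases c) (simp_all add: power2_eq_square mult.assoc)

text \<open>\<open>\<mu>\<close> is numbered from 0 and the admissible list from 1. Division by the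
  largest value makes the first entry 1; if that value is 0, monotonicity makes all entries 0. In
  \<open>Case_i\<close> the bound n - 2 leaves the last entry 0.\<close>

lemma admissible_scaling:
  fixes \<mu> :: "nat \<Rightarrow> real"
  assumes n: "n \<ge> 2" and m: "m \<le> n - 1" "c = Case_i \<Longrightarrow> m \<le> n - 2"
    and pos: "\<And>i. i < m \<Longrightarrow> \<mu> i \<ge> 0" and anti: "\<And>i j. i < m \<Longrightarrow> j \<le> i \<Longrightarrow> \<mu> i \<le> \<mu> j"
  shows "\<exists>\<alpha>>0. admissible n c (\<lambda>k. if 1 \<le> k \<and> k \<le> m then \<alpha> * \<mu> (k - 1) else 0)"
proof (cases "m = 0 \<or> \<mu> 0 = 0")
  case True
  have "(\<lambda>k. if 1 \<le> k \<and> k \<le> m then 1 * \<mu> (k - 1) else 0) = (\<lambda>k. 0)"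
  proof
    fix k
    have "\<mu> (k - 1) = 0" if "1 \<le> k" "k \<le> m"
    proof -
      have lt: "k - 1 < m" and "\<mu> 0 = 0" using that True by auto
      then show ?thesis using pos[OF lt] anti[OF lt, of 0] by simp
    qed
    then show "(if 1 \<le> k \<and> k \<le> m then 1 * \<mu> (k - 1) else 0) = 0" by simp
  qed
  then show ?thesis by (intro exI[of _ 1]) (simp only: admissible_def, simp)
next
  case False
  then have p: "\<mu> 0 > 0" using pos[of 0] by auto
  let ?l = "\<lambda>k. if 1 \<le> k \<and> k \<le> m then 1 / \<mu> 0 * \<mu> (k - 1) else 0"
  have "?l k \<le> ?l j" if "1 \<le> j" "j \<le> k" for j k
    using that p anti[of "k - 1" "j - 1"] pos[of "j - 1"] by (auto simp: divide_right_mono)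
  moreover have "?l (n - 1) \<ge> 0" using pos[of "n - 1 - 1"] p by auto
  moreover have "?l 1 = 1" using False p by auto
  moreover have "c = Case_i \<longrightarrow> ?l (n - 1) = 0" using m n by auto
  moreover have "?l k = 0" if "k \<notin> {1..n - 1}" for k using that m by auto
  ultimately have "admissible n c ?l" unfolding admissible_def by blast
  then show ?thesis using p by (intro exI[of _ "1 / \<mu> 0"]) simp
qed

lemma clin_nonvanishing:
  fixes x :: "(complex^'n) \<times> complex"
  assumes "x \<noteq> 0" shows "\<exists>f. clin f \<and> f x \<noteq> 0"
proof -
  have "(\<exists>j. fst x $ j \<noteq> 0) \<or> snd x \<noteq> 0" using assms by (auto simp: prod_eq_iff vec_eq_iff)
  moreover have "clin (\<lambda>q::(complex^'n) \<times> complex. fst q $ j)" "clin (snd :: (complex^'n) \<times> complex \<Rightarrow> _)" for j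
    by (auto simp: clin_def cmul_def intro!: linearI)
  ultimately show ?thesis by blast
qed

section \<open>Choice of the frame in the three cases\<close>

context cubic_jet
begin

text \<open>The frame is numbered from 1 to n as in the normal form, its last vector lying in the
  Levi kernel. The last condition expresses that \<open>cubic_frame.Q\<close> equals
  \<open>nf_rhs\<close>; the factor \<open>r\<close> compensates the division by \<open>r\<close> in
  \<open>Q\<close>.\<close>

definition good_frame :: "nf_case \<Rightarrow> (nat \<Rightarrow> real) \<Rightarrow> (nat \<Rightarrow> (complex^'n) \<times> complex) \<Rightarrow> real \<Rightarrow> bool" where
  "good_frame c lam B r \<longleftrightarrow> r > 0 \<and> (\<forall>k\<in>{1..CARD('n)}. B k \<in> H) \<and>
     (\<forall>k\<in>{1..CARD('n)}. \<forall>l\<in>{1..CARD('n)}. lev (B k) (B l) = (if k = l \<and> k < CARD('n) then of_real r else 0)) \<and> B CARD('n) \<noteq> 0 \<and>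
     (\<forall>k\<in>{1..CARD('n)}. \<forall>l\<in>{1..CARD('n)}. Rh (B k) (B l) (B CARD('n)) = of_real r * nf_mat CARD('n) c lam k l)"

lemma good_frame_cubic_frame:
  assumes n: "CARD('n) \<ge> 2" and g: "good_frame c lam B r"
  shows "\<exists>b. cubic_frame D1 D2 D3 \<tau> b r (zidx CARD('n)) \<and>
    (\<forall>z. cubic_frame.Q D2 D3 \<tau> b r (zidx CARD('n)) z = nf_rhs CARD('n) c lam z)"
proof -
  define b where "b j = B (inv_into {1..CARD('n)} zidx j)" for j :: 'n
  have bz: "b (zidx k) = B k" if "k \<in> {1..CARD('n)}" for k
    using inv_into_f_f[OF bij_betw_imp_inj_on[OF zidx_bij] that] by (simp add: b_def)
  have nn: "CARD('n) \<in> {1..CARD('n)}" using n by simp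
  have fr: "cubic_frame D1 D2 D3 \<tau> b r (zidx CARD('n))"
  proof (unfold_locales)
    show "r > 0" using g by (simp add: good_frame_def)
    fix j :: 'n
    obtain k where k: "k \<in> {1..CARD('n)}" "j = zidx k" using zidx_cases .
    have "b j \<in> H" using g k bz unfolding good_frame_def by metis
    then show "D1 (b j) = 0" "D1 (cmul \<i> (b j)) = 0" by (simp_all add: H_def)
    fix j' :: 'n
    obtain l where l: "l \<in> {1..CARD('n)}" "j' = zidx l" using zidx_cases .
    have "lev (B k) (B l) = (if k = l \<and> k < CARD('n) then of_real r else 0)"
      using g k l unfolding good_frame_def by blast
    moreover have "k < CARD('n) \<longleftrightarrow> k \<noteq> CARD('n)" using k by auto
    ultimately show "lev (b j) (b j') = (if j = j' \<and> j \<noteq> zidx CARD('n) then of_real r else 0)"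
      unfolding k l bz[OF k(1)] bz[OF l(1)] using zidx_inject[OF k(1) l(1)] zidx_inject[OF k(1) nn] by simp
  next
    show "b (zidx CARD('n)) \<noteq> 0" using g bz[OF nn] by (simp add: good_frame_def)
  qed
  interpret cubic_frame D1 D2 D3 \<tau> b r "zidx CARD('n)" by (rule fr)
  have "Q z = nf_rhs CARD('n) c lam z" for z
  proof -
    have L: "L z = (\<Sum>k=1..CARD('n). cmul (zc z k) (B k))"
      unfolding L_def sum_zidx zc_def by (intro sum.cong) (auto simp: bz)
    have "Rh (L z) (L z) (B CARD('n)) = (\<Sum>k=1..CARD('n). \<Sum>l=1..CARD('n). zc z k * (zc z l * Rh (B k) (B l) (B CARD('n))))"
    proof -
      have R1: "Rh (L z) y w = (\<Sum>k=1..CARD('n). zc z k * Rh (B k) y w)" for y w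
        unfolding L by (simp add: clinD(7)[OF Rh_clin(1)] clinD(2)[OF Rh_clin(1)])
      have R2: "Rh y (L z) w = (\<Sum>k=1..CARD('n). zc z k * Rh y (B k) w)" for y w
        unfolding L by (simp add: clinD(7)[OF Rh_clin(2)] clinD(2)[OF Rh_clin(2)])
      show ?thesis by (subst R1, subst R2) (simp add: sum_distrib_left)
    qed
    also have "\<dots> = (\<Sum>k=1..CARD('n). \<Sum>l=1..CARD('n). of_real r * (nf_mat CARD('n) c lam k l * (zc z k * zc z l)))"
      using g unfolding good_frame_def by (intro sum.cong) auto
    also have "\<dots> = of_real r * nf_rhs CARD('n) c lam z"
      unfolding nf_rhs_nfb[OF n] nfb_def by (simp add: sum_distrib_left)
    finally show ?thesis unfolding Q_def bz[OF nn] using r by simp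
  qed
  then show ?thesis using fr by blast
qed

lemma Rh_cmul: "Rh (cmul a x) (cmul b y) (cmul d z) = a * b * cnj d * Rh x y z"
  by (simp add: clinD(2)[OF Rh_clin(1)] clinD(2)[OF Rh_clin(2)] alinD(2)[OF Rh_alin])

context
  fixes k0
  assumes n: "CARD('n) \<ge> 2" and psd: "\<And>x. x \<in> H \<Longrightarrow> Re (lev x x) \<ge> 0"
    and k0: "k0 \<in> H" "k0 \<noteq> 0" "\<And>u. u \<in> H \<Longrightarrow> lev k0 u = 0"
    and only: "\<And>x. x \<in> H \<Longrightarrow> (\<And>u. u \<in> H \<Longrightarrow> lev x u = 0) \<Longrightarrow> \<exists>c. x = cmul c k0"
begin

lemma k0_right: "u \<in> H \<Longrightarrow> lev u k0 = 0"
  using k0(3) lev_cnj[of u k0] by simp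

text \<open>The equality case of the Cauchy-Schwarz inequality. If x is a null vector, the Levi form
  along u - t conj(a) x, with a = lev x u, is affine in t and becomes negative unless a = 0.\<close>

lemma null_vector:
  assumes x: "x \<in> H" "Re (lev x x) = 0" and u: "u \<in> H"
  shows "lev x u = 0"
proof (rule ccontr)
  assume ne: "lev x u \<noteq> 0"
  define a where "a = lev x u"
  define s where "s = (cmod a)^2"
  have s: "s > 0" using ne by (simp add: s_def a_def)
  \<comment> \<open>With this t the Levi form takes the value -1.\<close>
  define t where "t = (Re (lev u u) + 1) / (2 * s)"
  have s_eq: "s = Re a * Re a + Im a * Im a" unfolding s_def cmod_power2 by (simp add: power2_eq_square)
  have xx: "lev x x = 0" using x(2) Im_lev by (simp add: complex_eq_iff)
  have ux: "lev u x = cnj a" using lev_cnj[of u x] by (simp add: a_def)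
  have "u + cmul (- of_real t * cnj a) x \<in> H" using csubD[OF H_csub] x u by blast
  from psd[OF this] have "Re (lev u u) - 2 * t * s \<ge> 0"
    by (simp add: clinD(1,2)[OF lev_clin] alinD(1,2)[OF lev_alin] xx ux a_def[symmetric] s_eq algebra_simps)
  then show False using s by (simp add: t_def)
qed

lemma posdef:
  assumes V: "csub V" "V \<subseteq> H" "k0 \<notin> V" and x: "x \<in> V" "x \<noteq> 0"
  shows "Re (lev x x) > 0"
proof (rule ccontr)
  assume "\<not> Re (lev x x) > 0"
  then have "Re (lev x x) = 0" using psd[of x] V x by force
  then obtain c where c: "x = cmul c k0" using only[of x] null_vector[of x] V x by blast
  then have "c \<noteq> 0" using x by auto
  then have "k0 = cmul (1 / c) x" using c by simp
  then show False using V(3) csubD(2)[OF V(1) x(1)] by simp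
qed

text \<open>\<open>V\<close> is a complement of the kernel that has no cross terms with
  \<open>k0\<close>, so \<open>takagi\<close> on \<open>V\<close> diagonalises the whole form. Since
  \<open>k0\<close> also fills the conjugated slot, scaling it by \<open>\<alpha>\<close> multiplies
  every singular value by \<open>\<alpha>\<close>, which sets the largest to 1; scaling the other
  vectors by the square root of \<open>r\<close> only contributes the factor \<open>r\<close> of
  \<open>good_frame\<close>.\<close>

lemma frame_no_cross_term:
  assumes V: "csub V" "V \<subseteq> H" "k0 \<notin> V" "dim V \<ge> 2 * (CARD('n) - 1)" and cr: "\<And>x. x \<in> V \<Longrightarrow> Rh x k0 k0 = 0"
    and d: "Rh k0 k0 k0 = of_real d" "c = Case_ii \<and> d = 0 \<or> c = Case_iii \<and> d > 0"
  shows "\<exists>lam B r. admissible CARD('n) c lam \<and> good_frame c lam B r"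
proof -
  have "\<exists>e lam. (\<forall>i<CARD('n) - 1. e i \<in> V) \<and> (\<forall>i<CARD('n) - 1. \<forall>j<CARD('n) - 1. lev (e i) (e j) = (if i = j then 1 else 0)) \<and>
    (\<forall>i<CARD('n) - 1. \<forall>j<CARD('n) - 1. Rh (e i) (e j) k0 = (if i = j then of_real (lam i) else 0)) \<and>
    (\<forall>i<CARD('n) - 1. lam i \<ge> 0) \<and> (\<forall>i<CARD('n) - 1. \<forall>j\<le>i. lam i \<le> lam (j::nat))"
    by (rule takagi[where S = "\<lambda>x y. Rh x y k0", OF V(1,4) _ Rh_clin(1) Rh_clin(2) Rh_commute]) (rule posdef[OF V(1-3)])
  then obtain e \<mu> where e': "\<forall>i<CARD('n) - 1. e i \<in> V" "\<forall>i<CARD('n) - 1. \<forall>j<CARD('n) - 1. lev (e i) (e j) = (if i = j then 1 else 0)"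
    "\<forall>i<CARD('n) - 1. \<forall>j<CARD('n) - 1. Rh (e i) (e j) k0 = (if i = j then of_real (\<mu> i) else 0)"
    "\<forall>i<CARD('n) - 1. \<mu> i \<ge> 0" "\<forall>i<CARD('n) - 1. \<forall>j\<le>i. \<mu> i \<le> \<mu> j"
    by (elim exE conjE) (rule that)
  note e = e'[rule_format]
  obtain \<alpha> where \<alpha>: "\<alpha> > 0" "admissible CARD('n) c (\<lambda>k. if 1 \<le> k \<and> k \<le> CARD('n) - 1 then \<alpha> * \<mu> (k - 1) else 0)"
    using admissible_scaling[OF n le_refl, of c \<mu>] e(4,5) d(2) by auto
  define lam where "lam = (\<lambda>k. if 1 \<le> k \<and> k \<le> CARD('n) - 1 then \<alpha> * \<mu> (k - 1) else 0)"
  \<comment> \<open>For \<open>\<alpha>\<close> times \<open>k0\<close> in all three slots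
    \<open>Rh\<close> is \<open>\<alpha>\<close>^3 d, and this must be \<open>r\<close> times the
    coefficient 1 of the square of z^n. In \<open>Case_ii\<close> there is no such
    condition.\<close>
  define r where "r = (if c = Case_iii then \<alpha>^3 * d else 1)"
  have r: "r > 0" using d(2) \<alpha> by (auto simp: r_def)
  have rd: "of_real \<alpha> * of_real \<alpha> * of_real \<alpha> * of_real d = (if c = Case_iii then of_real r else (0::complex))"
    using d(2) by (auto simp: r_def power3_eq_cube)
  define s where "s = complex_of_real (sqrt r)"
  have ss: "s * s = of_real r" "cnj s = s" using r by (auto simp: s_def simp flip: of_real_mult)
  define B where "B j = (if j = CARD('n) then cmul (of_real \<alpha>) k0 else cmul s (e (j - 1)))" for j
  have Bn: "B CARD('n) = cmul (of_real \<alpha>) k0" by (simp add: B_def)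
  have Bj: "B j = cmul s (e (j - 1))" "j - 1 < CARD('n) - 1" if "j \<in> {1..CARD('n)}" "j \<noteq> CARD('n)" for j
    using that by (auto simp: B_def)
  have eH: "e i \<in> H" if "i < CARD('n) - 1" for i using e(1)[OF that] V(2) by blast
  have "good_frame c lam B r"
    unfolding good_frame_def
  proof (intro conjI ballI r)
    show "B CARD('n) \<noteq> 0" unfolding Bn using \<alpha> k0 by (simp add: cmul_eq_0_iff)
    fix j assume j: "j \<in> {1..CARD('n)}"
    show "B j \<in> H"
      using Bj[OF j] eH k0(1) csubD(2)[OF H_csub] by (cases "j = CARD('n)") (auto simp: Bn)
    fix l assume l: "l \<in> {1..CARD('n)}"
    have jl: "j < CARD('n) \<longleftrightarrow> j \<noteq> CARD('n)" "l < CARD('n) \<longleftrightarrow> l \<noteq> CARD('n)" using j l by auto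
    have idx: "j - 1 = l - 1 \<longleftrightarrow> j = l" using j l by auto
    have nf: "nf_mat CARD('n) c lam j l = (if j = l \<and> j \<noteq> CARD('n) then of_real (\<alpha> * \<mu> (j - 1)) else 0) +
        (if j = CARD('n) \<and> l = CARD('n) \<and> c = Case_iii then 1 else 0)"
    proof -
      have lamj: "lam j = \<alpha> * \<mu> (j - 1)" if "j \<noteq> CARD('n)" using that j by (auto simp: lam_def)
      then have lamj': "l \<noteq> CARD('n) \<and> j = l \<Longrightarrow> lam l = \<alpha> * \<mu> (l - 1)" by simp
      from d(2) show ?thesis by (elim disjE conjE) (simp_all add: nf_mat_def jl(1) lamj' del: One_nat_def)
    qed
    consider "j = CARD('n)" "l = CARD('n)" | "j = CARD('n)" "l \<noteq> CARD('n)" | "j \<noteq> CARD('n)" "l = CARD('n)" | "j \<noteq> CARD('n)" "l \<noteq> CARD('n)" by blast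
    then show "lev (B j) (B l) = (if j = l \<and> j < CARD('n) then of_real r else 0)"
    proof cases
      case 1 then show ?thesis by (simp add: Bn lev_scale k0)
    next
      case 2 then show ?thesis using Bj[OF l] eH by (simp add: Bn lev_scale k0)
    next
      case 3 then show ?thesis using Bj[OF j] eH by (simp add: Bn lev_scale k0_right)
    next
      case 4
      then show ?thesis unfolding Bj(1)[OF j 4(1)] Bj(1)[OF l 4(2)] lev_scale e(2)[OF Bj(2)[OF j 4(1)] Bj(2)[OF l 4(2)]]
        using idx jl by (simp add: ss)
    qed
    have crs: "Rh k0 x k0 = 0" if "x \<in> V" for x using cr[OF that] Rh_commute by simp
    consider "j = CARD('n)" "l = CARD('n)" | "j = CARD('n)" "l \<noteq> CARD('n)" | "j \<noteq> CARD('n)" "l = CARD('n)" | "j \<noteq> CARD('n)" "l \<noteq> CARD('n)" by blast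
    then show "Rh (B j) (B l) (B CARD('n)) = of_real r * nf_mat CARD('n) c lam j l"
    proof cases
      case 1
      then show ?thesis unfolding nf using rd by (simp add: Bn Rh_cmul d(1))
    next
      case 2 then show ?thesis unfolding nf using Bj[OF l] e(1) crs by (simp add: Bn Rh_cmul)
    next
      case 3 then show ?thesis unfolding nf using Bj[OF j] e(1) cr by (simp add: Bn Rh_cmul)
    next
      case 4
      then show ?thesis
        unfolding nf Bn Bj(1)[OF j 4(1)] Bj(1)[OF l 4(2)] Rh_cmul e(3)[OF Bj(2)[OF j 4(1)] Bj(2)[OF l 4(2)]] ss
        using idx jl by simp
    qed
  qed
  then show ?thesis using \<alpha>(2) unfolding lam_def[symmetric] by blast
qed

text \<open>The functional g(x) = \<open>Rh x k0 k0\<close> is nonzero but vanishes at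
  \<open>k0\<close>. The frame vector n - 1 is the Levi dual direction of g, corrected along
  \<open>k0\<close> so that its own square disappears. The vectors without cross terms with these
  two have real dimension at least 2 (n - 2), and \<open>takagi\<close> applies to them.\<close>

lemma frame_cross_term:
  assumes d: "Rh k0 k0 k0 = 0" and x1: "x1 \<in> H" "Rh x1 k0 k0 \<noteq> 0"
  shows "\<exists>lam B r. admissible CARD('n) Case_i lam \<and> good_frame Case_i lam B r"
proof -
  define g where "g x = Rh x k0 k0" for x
  have g: "clin g" unfolding g_def[abs_def] by (rule Rh_clin(1))
  have gk: "g k0 = 0" by (simp add: g_def d)
  obtain f where f: "clin f" "f k0 \<noteq> 0" using clin_nonvanishing[OF k0(2)] by blast
  let ?V0 = "H \<inter> {x. f x = 0}"
  have V0: "csub ?V0" "?V0 \<subseteq> H" "k0 \<notin> ?V0" "dim ?V0 \<ge> 1"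
    using csub_kernel[OF H_csub f(1)] f(2) dim_H n by auto
  have proj: "x - cmul (f x / f k0) k0 \<in> ?V0" if "x \<in> H" for x
    using that k0 csubD[OF H_csub] f(2) by (auto simp: clinD[OF f(1)])
  \<comment> \<open>The maximiser of this rank-one form is the unit vector that is Levi orthogonal
    to the kernel of g inside the complement of \<open>k0\<close>.\<close>
  have S: "clin (\<lambda>x. g x * g y)" "clin (\<lambda>y. g x * g y)" for x y
    using clin_cmult[OF g, of "g y"] clin_cmult[OF g, of "g x"] by (simp_all only: mult.commute)
  obtain e0 \<mu>0 where e0: "e0 \<in> ?V0" "lev e0 e0 = 1" "\<mu>0 \<ge> 0" "g e0 * g e0 = of_real \<mu>0"
    "\<And>x. x \<in> ?V0 \<Longrightarrow> cmod (g x * g x) \<le> \<mu>0 * Re (lev x x)" "\<And>x. x \<in> ?V0 \<Longrightarrow> lev x e0 = 0 \<Longrightarrow> g e0 * g x = 0"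
  proof -
    have "\<exists>e \<mu>. e \<in> ?V0 \<and> lev e e = 1 \<and> \<mu> \<ge> 0 \<and> g e * g e = of_real \<mu> \<and>
     (\<forall>x\<in>?V0. cmod (g x * g x) \<le> \<mu> * Re (lev x x)) \<and> (\<forall>x\<in>?V0. lev x e = 0 \<longrightarrow> g e * g x = 0)"
      by (rule maximiser[where S = "\<lambda>x y. g x * g y", OF V0(1,4) _ S mult.commute]) (rule posdef[OF V0(1-3)])
    then show ?thesis using that by blast
  qed
  have ge0: "g e0 \<noteq> 0"
  proof
    assume "g e0 = 0"
    then have "\<mu>0 = 0" using e0(4) by simp
    then have "g (x1 - cmul (f x1 / f k0) k0) = 0" using e0(5)[OF proj[OF x1(1)]] by simp
    then show False using x1(2) gk by (simp add: clinD[OF g]) (simp add: g_def)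
  qed
  define \<gamma> where "\<gamma> = cmod (g e0)"
  have \<gamma>: "\<gamma> > 0" using ge0 by (simp add: \<gamma>_def)
  \<comment> \<open>A phase factor that makes g positive at \<open>e1\<close>.\<close>
  define e1 where "e1 = cmul (of_real \<gamma> / g e0) e0"
  have e0H: "e0 \<in> H" using e0 by auto
  have e1H: "e1 \<in> H" unfolding e1_def by (rule csubD(2)[OF H_csub e0H])
  have ge1: "g e1 = of_real \<gamma>" using ge0 by (simp add: e1_def clinD[OF g])
  have le1: "lev e1 e1 = 1"
  proof -
    have "(of_real \<gamma> / g e0) * cnj (of_real \<gamma> / g e0) = 1"
      using ge0 unfolding complex_norm_square[symmetric] by (simp add: norm_divide \<gamma>_def)
    then show ?thesis unfolding e1_def lev_scale e0(2) by simp
  qed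
  have orth: "lev x e1 = 0" if x: "x \<in> H" "g x = 0" for x
  proof -
    let ?x = "x - cmul (f x / f k0) k0"
    have xV: "?x \<in> ?V0" by (rule proj[OF x(1)])
    have gx: "g ?x = 0" using x gk by (simp add: clinD[OF g])
    define a where "a = lev ?x e0"
    have y: "?x - cmul a e0 \<in> ?V0" using xV e0(1) csubD[OF V0(1)] by blast
    have "lev (?x - cmul a e0) e0 = 0" by (simp add: clinD(5,2)[OF lev_clin] e0(2) a_def)
    from e0(6)[OF y this] have "g (?x - cmul a e0) = 0" using ge0 by simp
    then have "a * g e0 = 0" using gx by (simp add: clinD(5,2)[OF g])
    then have "a = 0" using ge0 by simp
    then have "lev x e0 = 0" using k0(3)[OF e0H] by (simp add: a_def clinD(5,2)[OF lev_clin])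
    then show ?thesis by (simp add: e1_def alinD(2)[OF lev_alin])
  qed
  \<comment> \<open>Completion of the square: as \<open>Rh k0 k0 k0\<close> is 0, a shift by c
    \<open>k0\<close> changes \<open>Rh e1 e1 k0\<close> by 2 c \<open>\<gamma>\<close>, and it
    leaves the Levi form unchanged.\<close>
  define e' where "e' = e1 + cmul (- Rh e1 e1 k0 / (2 * of_real \<gamma>)) k0"
  have e'H: "e' \<in> H" unfolding e'_def using csubD[OF H_csub] e1H k0 by blast
  have ge': "g e' = of_real \<gamma>" unfolding e'_def by (simp add: clinD(1,2)[OF g] gk ge1)
  have lev_e': "lev x e' = lev x e1" if "x \<in> H" for x
    using k0_right[OF that] by (simp add: e'_def alinD(1,2)[OF lev_alin])
  have le': "lev e' e' = 1"
    unfolding lev_e'[OF e'H] by (simp add: e'_def clinD(1,2)[OF lev_clin] le1 k0(3)[OF e1H])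
  have Re': "Rh e' e' k0 = 0"
  proof -
    have "Rh e1 k0 k0 = of_real \<gamma>" using ge1 by (simp add: g_def)
    moreover have "Rh k0 e1 k0 = of_real \<gamma>" using calculation Rh_commute by simp
    ultimately show ?thesis using \<gamma> d
      by (simp add: e'_def clinD(1,2)[OF Rh_clin(1)] clinD(1,2)[OF Rh_clin(2)] field_simps)
  qed
  \<comment> \<open>Each of the two complex conditions costs at most two real dimensions, and
    \<open>k0\<close> is excluded because \<open>Rh k0 e' k0\<close> is
    \<open>\<gamma>\<close>.\<close>
  let ?V = "(H \<inter> {x. g x = 0}) \<inter> {x. Rh x e' k0 = 0}"
  note V1 = csub_kernel[OF H_csub g]
  note V2 = csub_kernel[OF V1(1) Rh_clin(1), of e' k0]
  have Vd: "dim ?V \<ge> 2 * (CARD('n) - 2)" using V1(2) V2(2) dim_H by simp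
  have VH: "?V \<subseteq> H" by blast
  have kV: "k0 \<notin> ?V"
  proof
    assume "k0 \<in> ?V"
    then have "Rh k0 e' k0 = 0" by simp
    then have "g e' = 0" using Rh_commute by (simp add: g_def)
    then show False using ge' \<gamma> by simp
  qed
  have "\<exists>e lam. (\<forall>i<CARD('n) - 2. e i \<in> ?V) \<and> (\<forall>i<CARD('n) - 2. \<forall>j<CARD('n) - 2. lev (e i) (e j) = (if i = j then 1 else 0)) \<and>
    (\<forall>i<CARD('n) - 2. \<forall>j<CARD('n) - 2. Rh (e i) (e j) k0 = (if i = j then of_real (lam i) else 0)) \<and>
    (\<forall>i<CARD('n) - 2. lam i \<ge> 0) \<and> (\<forall>i<CARD('n) - 2. \<forall>j\<le>i. lam i \<le> lam (j::nat))"
    by (rule takagi[where S = "\<lambda>x y. Rh x y k0", OF V2(1) Vd _ Rh_clin(1) Rh_clin(2) Rh_commute]) (rule posdef[OF V2(1) VH kV])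
  then obtain e \<mu> where e': "\<forall>i<CARD('n) - 2. e i \<in> ?V" "\<forall>i<CARD('n) - 2. \<forall>j<CARD('n) - 2. lev (e i) (e j) = (if i = j then 1 else 0)"
    "\<forall>i<CARD('n) - 2. \<forall>j<CARD('n) - 2. Rh (e i) (e j) k0 = (if i = j then of_real (\<mu> i) else 0)"
    "\<forall>i<CARD('n) - 2. \<mu> i \<ge> 0" "\<forall>i<CARD('n) - 2. \<forall>j\<le>i. \<mu> i \<le> \<mu> j"
    by (elim exE conjE) (rule that)
  note e = e'[rule_format]
  obtain \<alpha> where \<alpha>: "\<alpha> > 0" "admissible CARD('n) Case_i (\<lambda>k. if 1 \<le> k \<and> k \<le> CARD('n) - 2 then \<alpha> * \<mu> (k - 1) else 0)"
  proof -
    have "\<exists>\<alpha>>0. admissible CARD('n) Case_i (\<lambda>k. if 1 \<le> k \<and> k \<le> CARD('n) - 2 then \<alpha> * \<mu> (k - 1) else 0)"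
      by (rule admissible_scaling[OF n]) (simp, simp, fact e(4), fact e(5))
    then show ?thesis using that by blast
  qed
  define lam where "lam = (\<lambda>k. if 1 \<le> k \<and> k \<le> CARD('n) - 2 then \<alpha> * \<mu> (k - 1) else 0)"
  \<comment> \<open>The cross term of s e' with \<open>\<alpha>\<close> \<open>k0\<close> is s
    \<open>\<alpha>\<close>^2 \<open>\<gamma>\<close> and has to equal r = s^2.\<close>
  define s where "s = complex_of_real (\<alpha>^2 * \<gamma>)"
  define r where "r = (\<alpha>^2 * \<gamma>)^2"
  have r: "r > 0" using \<alpha> \<gamma> by (simp add: r_def)
  have ss: "s * s = of_real r" "cnj s = s" by (auto simp: s_def r_def power2_eq_square)
  define B where "B j = (if j = CARD('n) then cmul (of_real \<alpha>) k0 else if j = CARD('n) - 1 then cmul s e' else cmul s (e (j - 1)))" for j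
  have Bn: "B CARD('n) = cmul (of_real \<alpha>) k0" and Bm: "B (CARD('n) - 1) = cmul s e'" using n by (auto simp: B_def)
  have Bj: "B j = cmul s (e (j - 1))" "j - 1 < CARD('n) - 2" if "j \<in> {1..CARD('n)}" "j \<noteq> CARD('n)" "j \<noteq> CARD('n) - 1" for j
    using that by (auto simp: B_def)
  have eH: "e i \<in> H" "Rh (e i) k0 k0 = 0" "Rh k0 (e i) k0 = 0" "Rh (e i) e' k0 = 0" "Rh e' (e i) k0 = 0" "lev (e i) e' = 0" "lev e' (e i) = 0"
    if "i < CARD('n) - 2" for i
  proof -
    have a: "e i \<in> H" "g (e i) = 0" "Rh (e i) e' k0 = 0" using e(1)[OF that] by auto
    then show "e i \<in> H" "Rh (e i) k0 k0 = 0" "Rh k0 (e i) k0 = 0" "Rh (e i) e' k0 = 0" "Rh e' (e i) k0 = 0" "lev (e i) e' = 0"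
      using Rh_commute lev_e' orth by (simp_all add: g_def)
    then show "lev e' (e i) = 0" using lev_cnj[of e' "e i"] by simp
  qed
  have Rek: "Rh e' k0 k0 = of_real \<gamma>" "Rh k0 e' k0 = of_real \<gamma>" using ge' Rh_commute by (simp_all add: g_def)
  have sr: "s * of_real \<alpha> * of_real \<alpha> * of_real \<gamma> = of_real r" by (simp add: s_def r_def power2_eq_square)
  have "good_frame Case_i lam B r"
    unfolding good_frame_def
  proof (intro conjI ballI r)
    show "B CARD('n) \<noteq> 0" unfolding Bn using \<alpha> k0 by (simp add: cmul_eq_0_iff)
    fix j assume j: "j \<in> {1..CARD('n)}"
    show "B j \<in> H"
      using Bj[OF j] eH(1) k0(1) e'H csubD(2)[OF H_csub] Bm Bn by (cases "j = CARD('n)"; cases "j = CARD('n) - 1") auto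
    fix l assume l: "l \<in> {1..CARD('n)}"
    have idx: "j - 1 = l - 1 \<longleftrightarrow> j = l" using j l by auto
    have jc: "j = CARD('n) \<or> j = CARD('n) - 1 \<or> (j \<noteq> CARD('n) \<and> j \<noteq> CARD('n) - 1)" and lc: "l = CARD('n) \<or> l = CARD('n) - 1 \<or> (l \<noteq> CARD('n) \<and> l \<noteq> CARD('n) - 1)" by auto
    have n1: "CARD('n) - 1 \<noteq> CARD('n)" "CARD('n) \<noteq> CARD('n) - 1" "CARD('n) - 1 < CARD('n)" using n by auto
    have jlt: "j < CARD('n) \<longleftrightarrow> j \<noteq> CARD('n)" using j by auto
    have nf: "nf_mat CARD('n) Case_i lam j l = (if j = l \<and> j \<noteq> CARD('n) \<and> j \<noteq> CARD('n) - 1 then of_real (\<alpha> * \<mu> (j - 1)) else 0) +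
        ((if j = CARD('n) - 1 \<and> l = CARD('n) then 1 else 0) + (if j = CARD('n) \<and> l = CARD('n) - 1 then 1 else 0))"
    proof -
      have lamj: "lam j = \<alpha> * \<mu> (j - 1)" if "j \<noteq> CARD('n)" "j \<noteq> CARD('n) - 1" using that j by (auto simp: lam_def)
      have lamj': "lam (CARD('n) - 1) = 0" using n by (auto simp: lam_def)
      from lamj have "l \<noteq> CARD('n) \<and> l \<noteq> CARD('n) - 1 \<and> j = l \<Longrightarrow> lam l = \<alpha> * \<mu> (l - 1)" by simp
      then show ?thesis by (cases "j = CARD('n) - 1") (use lamj' in \<open>auto simp: nf_mat_def jlt lamj n1 simp del: One_nat_def\<close>)
    qed
    show "lev (B j) (B l) = (if j = l \<and> j < CARD('n) then of_real r else 0)"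
      using jc
    proof (elim disjE)
      assume a: "j = CARD('n)"
      have "B l \<in> H" using Bj[OF l] eH(1) k0(1) e'H csubD(2)[OF H_csub] Bm Bn by (cases "l = CARD('n)"; cases "l = CARD('n) - 1") auto
      then show ?thesis unfolding a Bn by (simp add: clinD(2)[OF lev_clin] k0(3))
    next
      assume a: "j = CARD('n) - 1"
      show ?thesis using lc
      proof (elim disjE)
        assume "l = CARD('n)" then show ?thesis unfolding a Bm using n1 by (simp add: Bn lev_scale k0_right[OF e'H])
      next
        assume b: "l = CARD('n) - 1" then show ?thesis unfolding a b Bm using n1 by (simp add: lev_scale le' ss)
      next
        assume b: "l \<noteq> CARD('n) \<and> l \<noteq> CARD('n) - 1"
        then show ?thesis unfolding a Bm using Bj[OF l] eH by (simp add: lev_scale)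
      qed
    next
      assume a: "j \<noteq> CARD('n) \<and> j \<noteq> CARD('n) - 1"
      show ?thesis using lc
      proof (elim disjE)
        assume "l = CARD('n)" then show ?thesis using a Bj[OF j] eH(1) by (simp add: Bn lev_scale k0_right)
      next
        assume "l = CARD('n) - 1" then show ?thesis using a Bj[OF j] eH by (simp add: Bm[simplified] lev_scale)
      next
        assume b: "l \<noteq> CARD('n) \<and> l \<noteq> CARD('n) - 1"
        have j': "j - 1 < CARD('n) - 2" and l': "l - 1 < CARD('n) - 2" using Bj(2) j l a b by auto
        show ?thesis using a b Bj(1)[OF j] Bj(1)[OF l] e(2)[OF j' l'] idx jlt by (simp add: lev_scale ss)
      qed
    qed
    show "Rh (B j) (B l) (B CARD('n)) = of_real r * nf_mat CARD('n) Case_i lam j l"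
      using jc
    proof (elim disjE)
      assume a: "j = CARD('n)"
      show ?thesis using lc
      proof (elim disjE)
        assume "l = CARD('n)" then show ?thesis unfolding nf unfolding a using n1 by (simp add: Bn Rh_cmul d)
      next
        assume b: "l = CARD('n) - 1" then show ?thesis unfolding nf unfolding a b Bn Bm Rh_cmul Rek using n1 sr by (simp add: mult_ac)
      next
        assume b: "l \<noteq> CARD('n) \<and> l \<noteq> CARD('n) - 1"
        then show ?thesis unfolding nf unfolding a using Bj[OF l] eH by (simp add: Bn Rh_cmul)
      qed
    next
      assume a: "j = CARD('n) - 1"
      show ?thesis using lc
      proof (elim disjE)
        assume b: "l = CARD('n)" then show ?thesis unfolding nf unfolding a b Bn Bm Rh_cmul Rek using n1 sr by (simp add: mult_ac)
      next
        assume b: "l = CARD('n) - 1" then show ?thesis unfolding nf unfolding a b Bm Bn Rh_cmul Re' using n1 by simp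
      next
        assume b: "l \<noteq> CARD('n) \<and> l \<noteq> CARD('n) - 1"
        then show ?thesis unfolding nf unfolding a using Bj[OF l] eH by (simp add: Bm[simplified] Bn Rh_cmul)
      qed
    next
      assume a: "j \<noteq> CARD('n) \<and> j \<noteq> CARD('n) - 1"
      show ?thesis using lc
      proof (elim disjE)
        assume "l = CARD('n)" then show ?thesis unfolding nf using a Bj[OF j] eH by (simp add: Bn Rh_cmul)
      next
        assume "l = CARD('n) - 1" then show ?thesis unfolding nf using a Bj[OF j] eH by (simp add: Bm[simplified] Bn Rh_cmul)
      next
        assume b: "l \<noteq> CARD('n) \<and> l \<noteq> CARD('n) - 1"
        have j': "j - 1 < CARD('n) - 2" and l': "l - 1 < CARD('n) - 2" using Bj(2) j l a b by auto
        show ?thesis unfolding nf Bn using a b Bj(1)[OF j] Bj(1)[OF l] e(3)[OF j' l'] idx by (simp add: Rh_cmul ss)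
      qed
    qed
  qed
  then show ?thesis using \<alpha>(2) unfolding lam_def[symmetric] by blast
qed

end

text \<open>The three cases: the form restricted to the Levi kernel is nonzero (iii); it is zero
  there but the kernel has a cross term with some tangent vector (i); the kernel lies in the radical
  of the form (ii).\<close>

lemma good_frame_exists:
  assumes n: "CARD('n) \<ge> 2" and psd: "\<And>x. x \<in> H \<Longrightarrow> Re (lev x x) \<ge> 0"
    and k0: "k0 \<in> H" "k0 \<noteq> 0" "\<And>u. u \<in> H \<Longrightarrow> lev k0 u = 0"
    and only: "\<And>x. x \<in> H \<Longrightarrow> (\<And>u. u \<in> H \<Longrightarrow> lev x u = 0) \<Longrightarrow> \<exists>c. x = cmul c k0"
  shows "\<exists>c lam B r. admissible CARD('n) c lam \<and> good_frame c lam B r"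
proof (cases "Rh k0 k0 k0 = 0")
  case False
  define d where "d = Rh k0 k0 k0"
  \<comment> \<open>For k = c \<open>k0\<close> the value \<open>Rh k k k\<close> is c^2 conj(c) d,
    and c = conj(d) makes it |d|^4.\<close>
  define k where "k = cmul (cnj d) k0"
  have d: "d \<noteq> 0" using False by (simp add: d_def)
  have kH: "k \<in> H" "k \<noteq> 0" unfolding k_def using csubD(2)[OF H_csub k0(1)] d k0 by (auto simp: cmul_eq_0_iff)
  have kl: "lev k u = 0" if "u \<in> H" for u by (simp add: k_def clinD(2)[OF lev_clin] k0(3)[OF that])
  have ko: "\<exists>c. x = cmul c k" if x: "x \<in> H" "\<And>u. u \<in> H \<Longrightarrow> lev x u = 0" for x
  proof -
    obtain c where "x = cmul c k0" using only[OF x] by blast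
    then have "x = cmul (c / cnj d) k" using d by (simp add: k_def)
    then show ?thesis by blast
  qed
  have kkk: "Rh k k k = of_real ((cmod d)^4)"
  proof -
    have "Rh k k k = (d * cnj d) * (d * cnj d)" unfolding k_def Rh_cmul d_def[symmetric] by simp
    also have "\<dots> = of_real ((cmod d)^4)" unfolding complex_norm_square[symmetric] by (simp add: eval_nat_numeral)
    finally show ?thesis .
  qed
  \<comment> \<open>This complement has no cross terms with \<open>k\<close> by definition, which
    amounts to completing the square in z^n.\<close>
  let ?V = "H \<inter> {x. Rh x k k = 0}"
  have 1: "csub ?V" "dim ?V \<ge> 2 * (CARD('n) - 1)"
    using csub_kernel[OF H_csub Rh_clin(1), of k k] dim_H by auto
  have 2: "k \<notin> ?V" using kkk d by simp
  have "\<exists>lam B r. admissible CARD('n) Case_iii lam \<and> good_frame Case_iii lam B r"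
    by (rule frame_no_cross_term[OF n _ kH(1,2) _ _ 1(1) _ 2 1(2) _ kkk]) (fact psd kl ko | use d in force)+
  then show ?thesis by blast
next
  case True
  show ?thesis
  proof (cases "\<exists>x\<in>H. Rh x k0 k0 \<noteq> 0")
    case c: True
    then obtain x1 where x1: "x1 \<in> H" "Rh x1 k0 k0 \<noteq> 0" by blast
    have "\<exists>lam B r. admissible CARD('n) Case_i lam \<and> good_frame Case_i lam B r"
      by (rule frame_cross_term[OF n _ k0(1,2) _ _ True x1]) (fact psd k0 only)+
    then show ?thesis by blast
  next
    case False
    obtain f where f: "clin f" "f k0 \<noteq> 0" using clin_nonvanishing[OF k0(2)] by blast
    let ?V = "H \<inter> {x. f x = 0}"
    have 1: "csub ?V" "dim ?V \<ge> 2 * (CARD('n) - 1)"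
      using csub_kernel[OF H_csub f(1)] dim_H by auto
    have 2: "k0 \<notin> ?V" using f by simp
    have "\<exists>lam B r. admissible CARD('n) Case_ii lam \<and> good_frame Case_ii lam B r"
      by (rule frame_no_cross_term[OF n _ k0(1,2) _ _ 1(1) _ 2 1(2), of 0]) (fact psd k0 only | use True False in force)+
    then show ?thesis by blast
  qed
qed

end

section \<open>Existence of a normal form\<close>

lemma existence_posdef:
  fixes M :: "((complex^'n) \<times> complex) set"
  assumes n: "CARD('n) \<ge> 2" and def: "local_defining_fn M p0 U \<rho>" and p0: "p0 \<in> M"
    and rank: "levi_rank \<rho> p0 = CARD('n) - 1" and psd: "\<And>v. v \<in> cplx_tangent \<rho> p0 \<Longrightarrow> Re (levi_form \<rho> p0 v v) \<ge> 0"
  shows "\<exists>c lam. admissible CARD('n) c lam \<and> has_normal_form M p0 c lam"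
proof -
  let ?D1 = "\<lambda>v. ddir v \<rho> p0" and ?D2 = "\<lambda>u v. ddir u (ddir v \<rho>) p0"
    and ?D3 = "\<lambda>u v w. ddir u (ddir v (ddir w \<rho>)) p0"
  have U: "open U" "p0 \<in> U" "smooth_on U \<rho>" "frechet_derivative \<rho> (at p0) \<noteq> (\<lambda>v. 0)"
    using def by (auto simp: local_defining_fn_def)
  have l1: "linear ?D1" by (rule ddir_linear[OF smooth_on_differentiable[OF U(3,1,2)]])
  obtain x where "?D1 x \<noteq> 0" using U(4) unfolding ddir_def by (meson ext)
  then obtain \<tau> where \<tau>: "?D1 \<tau> = 0" "?D1 (cmul \<i> \<tau>) = - 1" using transversal_exists[OF l1] by blast
  interpret cubic_jet ?D1 ?D2 ?D3 \<tau> by (rule jet_of_defining_function[OF U(3,1,2) \<tau>])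
  have HT: "cplx_tangent \<rho> p0 = H" 
  proof -
    have "cplx_tangent \<rho> p0 = {v. ?D1 v = 0 \<and> ?D1 (cmul \<i> v) = 0}" by (simp add: cplx_tangent_def ddir_def)
    then show ?thesis unfolding H_def .
  qed
  have hs: "hess \<rho> p0 u v = ?D2 u v" for u v by (simp add: hess_def ddir_def[abs_def])
  have lf: "levi_form \<rho> p0 v u = lev v u" for v u unfolding levi_form_def lev_def hs ..
  define K where "K = {v\<in>H. \<forall>u\<in>H. lev v u = 0}"
  have Ks: "subspace K" "\<And>c x. x \<in> K \<Longrightarrow> cmul c x \<in> K"
  proof -
    show "cmul c x \<in> K" if "x \<in> K" for c x
      using that csubD(2)[OF H_csub] by (auto simp: K_def clinD(2)[OF lev_clin])
    then show "subspace K"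
      using csubD[OF H_csub] by (auto simp: K_def subspace_def clinD[OF lev_clin])
  qed
  \<comment> \<open>Division rounds down, so the rank only yields that the real dimension of
    \<open>K\<close> is 1 or 2. Stability under i then identifies \<open>K\<close> as a complex
    line.\<close>
  have "(2 * CARD('n) - dim K) div 2 = CARD('n) - 1"
    using rank unfolding levi_rank_def HT lf Let_def K_def[symmetric] dim_H .
  then have dK: "dim K \<noteq> 0" "dim K \<le> 2" using n by (auto simp del: dim_eq_0)
  obtain k0 where k0: "k0 \<in> K" "k0 \<noteq> 0" using dK(1) by (metis dim_eq_0 subset_iff singletonI)
  have ik0: "cmul \<i> k0 \<notin> span {k0}"
  proof
    assume "cmul \<i> k0 \<in> span {k0}"
    then obtain t where "cmul \<i> k0 = t *\<^sub>R k0" by (auto simp: span_singleton)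
    then have "cmul (\<i> - of_real t) k0 = 0" by (simp add: cmul_diff_left cmul_of_real)
    then show False using k0 by (auto simp: cmul_eq_0_iff complex_eq_iff)
  qed
  have only: "\<exists>c. x = cmul c k0" if x: "x \<in> K" for x
  proof -
    \<comment> \<open>\<open>k0\<close> and i \<open>k0\<close> are real independent, so a further
      independent vector would make the dimension 3.\<close>
    have "x \<in> span {cmul \<i> k0, k0}"
    proof (rule ccontr)
      assume "x \<notin> span {cmul \<i> k0, k0}"
      then have "dim {x, cmul \<i> k0, k0} = 3" using ik0 k0 by (simp add: dim_insert)
      moreover have "dim {x, cmul \<i> k0, k0} \<le> dim K" by (rule dim_subset) (use x k0 Ks in auto)
      ultimately show False using dK by simp
    qed
    then obtain a b where "x - a *\<^sub>R cmul \<i> k0 = b *\<^sub>R k0" by (auto simp: span_insert span_singleton)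
    then have "x = a *\<^sub>R cmul \<i> k0 + b *\<^sub>R k0" by (simp add: algebra_simps)
    then have "x = cmul (Complex b a) k0" by (subst cmul_decompose) simp
    then show ?thesis by blast
  qed
  obtain c lam B r where g: "admissible CARD('n) c lam" "good_frame c lam B r"
    using good_frame_exists[OF n, of k0] psd k0 only unfolding HT lf K_def by blast
  obtain b where b: "cubic_frame ?D1 ?D2 ?D3 \<tau> b r (zidx CARD('n))"
    "\<And>z. cubic_frame.Q ?D2 ?D3 \<tau> b r (zidx CARD('n)) z = nf_rhs CARD('n) c lam z"
    using good_frame_cubic_frame[OF n g(2)] by blast
  show ?thesis using frame_normal_form[OF def p0 b] g(1) by blast
qed

text \<open>In the negative semidefinite case \<open>\<rho>\<close> is replaced by its negative,
  which defines the same hypersurface with the same tangent space and rank and the opposite Levi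
  form.\<close>

lemma existence:
  fixes M :: "((complex^'n) \<times> complex) set"
  assumes n: "CARD('n) \<ge> 2" and def: "local_defining_fn M p0 U \<rho>" and p0: "p0 \<in> M"
    and rank: "levi_rank \<rho> p0 = CARD('n) - 1" and sd: "levi_semidefinite \<rho> p0"
  shows "\<exists>c lam. admissible CARD('n) c lam \<and> has_normal_form M p0 c lam"
proof (cases "\<forall>v\<in>cplx_tangent \<rho> p0. Re (levi_form \<rho> p0 v v) \<ge> 0")
  case True
  then show ?thesis using existence_posdef[OF n def p0 rank] by blast
next
  case False
  then have neg: "\<forall>v\<in>cplx_tangent \<rho> p0. Re (levi_form \<rho> p0 v v) \<le> 0" using sd by (auto simp: levi_semidefinite_def)
  let ?r = "\<lambda>q. - \<rho> q"
  have U: "open U" "p0 \<in> U" "smooth_on U \<rho>" "M \<inter> U = {q\<in>U. \<rho> q = 0}"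
    "\<And>q. q \<in> U \<Longrightarrow> frechet_derivative \<rho> (at q) \<noteq> (\<lambda>v. 0)"
    using def by (auto simp: local_defining_fn_def)
  have dd: "ddir v ?r q = - ddir v \<rho> q" if "q \<in> U" for q v
    by (rule ddir_eqI) (intro has_derivative_minus has_derivative_ddir smooth_on_differentiable[OF U(3,1) that])
  have dd2: "ddir u (ddir v ?r) p0 = - ddir u (ddir v \<rho>) p0" for u v
  proof -
    have "ddir u (ddir v ?r) p0 = ddir u (\<lambda>q. - ddir v \<rho> q) p0" by (rule ddir_cong[OF U(1,2) dd])
    also have "\<dots> = - ddir u (ddir v \<rho>) p0"
      by (rule ddir_eqI) (intro has_derivative_minus has_derivative_ddir smooth_on_differentiable[OF smooth_on_ddir[OF U(3,1)] U(1,2)])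
    finally show ?thesis .
  qed
  have sm: "smooth_on U ?r"
    using U(3) unfolding smooth_on_iff_Ck
    by (intro allI Ck_linear_comp[OF bounded_linear_minus[OF bounded_linear_ident] U(1)]) auto
  have "frechet_derivative ?r (at q) \<noteq> (\<lambda>v. 0)" if "q \<in> U" for q
    using U(5)[OF that] dd[OF that] unfolding ddir_def by (metis (no_types) ext minus_equation_iff minus_zero)
  then have def': "local_defining_fn M p0 U ?r" using U sm by (auto simp: local_defining_fn_def)
  have T: "cplx_tangent ?r p0 = cplx_tangent \<rho> p0"
    using dd[OF U(2)] by (simp add: cplx_tangent_def ddir_def)
  have hs: "hess ?r p0 u v = - hess \<rho> p0 u v" for u v
    using dd2[of u v] by (simp add: hess_def ddir_def[abs_def])
  have lf: "levi_form ?r p0 v u = - levi_form \<rho> p0 v u" for v u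
    unfolding levi_form_def hs by (simp add: complex_eq_iff field_simps)
  have "levi_rank ?r p0 = CARD('n) - 1" using rank by (simp add: levi_rank_def T lf)
  then show ?thesis using existence_posdef[OF n def' p0] neg by (simp add: T lf)
qed

section \<open>Holomorphic functions along complex lines\<close>

text \<open>Taylor's formula on the half ball, the last derivative being bounded by Cauchy's
  inequality on discs of radius d/4, which stay inside the ball of radius d.\<close>

lemma holomorphic_Taylor_bound:
  fixes f :: "complex \<Rightarrow> complex"
  assumes d: "d > 0" and hol: "f holomorphic_on ball 0 d" and B: "\<And>z. z \<in> ball 0 d \<Longrightarrow> cmod (f z) \<le> B"
    and z: "z \<in> ball 0 (d/2)"
  shows "cmod (f z - (\<Sum>i\<le>n. (deriv ^^ i) f 0 * z ^ i / fact i)) \<le> (fact (Suc n) * B / (d/4)^Suc n / fact n) * cmod z ^ Suc n"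
proof -
  have "cmod ((deriv ^^ 0) f z - (\<Sum>i\<le>n. (deriv ^^ i) f 0 * (z - 0) ^ i / fact i))
      \<le> (fact (Suc n) * B / (d/4)^Suc n) * cmod (z - 0) ^ Suc n / fact n"
  proof (rule complex_Taylor[where S = "ball 0 (d/2)" and f = "\<lambda>i. (deriv ^^ i) f"])
    fix i x assume x: "x \<in> ball (0::complex) (d/2)" and "i \<le> n"
    have "(deriv ^^ i) f holomorphic_on ball 0 d" by (intro holomorphic_higher_deriv hol open_ball)
    then have "((deriv ^^ i) f has_field_derivative deriv ((deriv ^^ i) f) x) (at x)"
      using x d by (intro holomorphic_derivI[OF _ open_ball]) auto
    then show "((deriv ^^ i) f has_field_derivative (deriv ^^ Suc i) f x) (at x within ball 0 (d/2))"
      by (simp add: has_field_derivative_at_within)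
  next
    fix x assume x: "x \<in> ball (0::complex) (d/2)"
    have sub: "cball x (d/4) \<subseteq> ball 0 d"
    proof
      fix y assume "y \<in> cball x (d/4)"
      then have "norm y \<le> norm x + d/4" using norm_triangle_ineq[of x "y - x"] by (simp add: dist_norm norm_minus_commute)
      then show "y \<in> ball 0 d" using x d by simp
    qed
    show "cmod ((deriv ^^ Suc n) f x) \<le> fact (Suc n) * B / (d/4)^Suc n"
    proof (rule Cauchy_inequality)
      show "f holomorphic_on ball x (d/4)" using hol sub ball_subset_cball holomorphic_on_subset by blast
      show "continuous_on (cball x (d/4)) f" using hol sub holomorphic_on_imp_continuous_on continuous_on_subset by blast
      show "0 < d/4" using d by simp
      show "cmod (f y) \<le> B" if "cmod (x - y) = d/4" for y
        using B[of y] sub that by (auto simp: dist_norm subset_iff)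
    qed
  qed (use z d in auto)
  then show ?thesis by (simp add: mult.commute)
qed

text \<open>The Taylor bound in the second variable is uniform in the first. Hence the difference
  quotients, holomorphic in the first variable, converge uniformly to the partial derivative, which
  inherits holomorphy.\<close>

lemma partial_derivative_holomorphic:
  fixes h :: "complex \<Rightarrow> complex \<Rightarrow> complex"
  assumes d: "d > 0" and h1: "\<And>\<zeta>. \<zeta> \<in> ball 0 d \<Longrightarrow> h \<zeta> holomorphic_on ball 0 d"
    and h2: "\<And>\<omega>. \<omega> \<in> ball 0 d \<Longrightarrow> (\<lambda>\<zeta>. h \<zeta> \<omega>) holomorphic_on ball 0 d"
    and B: "\<And>\<zeta> \<omega>. \<zeta> \<in> ball 0 d \<Longrightarrow> \<omega> \<in> ball 0 d \<Longrightarrow> cmod (h \<zeta> \<omega>) \<le> B"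
  obtains C where "C \<ge> 0" "(\<lambda>\<zeta>. deriv (h \<zeta>) 0) holomorphic_on ball 0 d"
    "\<And>\<zeta> \<omega>. \<zeta> \<in> ball 0 d \<Longrightarrow> \<omega> \<in> ball 0 (d/2) \<Longrightarrow> cmod (h \<zeta> \<omega> - h \<zeta> 0 - \<omega> * deriv (h \<zeta>) 0) \<le> C * (cmod \<omega>)^2"
proof -
  define C where "C = (2 * B / (d/4)^2)"
  have "B \<ge> 0" using B[of 0 0] d by (metis centre_in_ball norm_ge_zero order_trans)
  then have C: "C \<ge> 0" by (simp add: C_def)
  have rem: "cmod (h \<zeta> \<omega> - h \<zeta> 0 - \<omega> * deriv (h \<zeta>) 0) \<le> C * (cmod \<omega>)^2"
    if \<zeta>: "\<zeta> \<in> ball 0 d" and \<omega>: "\<omega> \<in> ball 0 (d/2)" for \<zeta> \<omega>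
    using holomorphic_Taylor_bound[OF d h1[OF \<zeta>] B[OF \<zeta>] \<omega>, of 1]
    by (simp add: C_def power2_eq_square mult.commute diff_diff_eq eval_nat_numeral)
  have "(\<lambda>\<zeta>. deriv (h \<zeta>) 0) holomorphic_on ball 0 d"
  proof (rule holomorphic_uniform_sequence[OF open_ball])
    \<comment> \<open>Nonzero steps that tend to 0; the offset 2 puts already the first one strictly
      inside the half ball.\<close>
    define w where "w n = complex_of_real (d / (2 * (real n + 2)))" for n
    have wd: "w n \<noteq> 0" "w n \<in> ball 0 (d/2)" for n
    proof -
      have "0 < d / (2 * (real n + 2))" "d / (2 * (real n + 2)) < d / 2"
        using d by (simp, intro divide_strict_left_mono) auto
      then show "w n \<noteq> 0" "w n \<in> ball 0 (d/2)" unfolding w_def mem_ball_0 norm_of_real of_real_eq_0_iff by linarith+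
    qed
    show "(\<lambda>\<zeta>. (h \<zeta> (w n) - h \<zeta> 0) / w n) holomorphic_on ball 0 d" for n
    proof -
      have "w n \<in> ball 0 d" using wd(2)[of n] d by auto
      then show ?thesis using wd(1) d by (intro holomorphic_intros h2) auto
    qed
    fix x :: complex assume x: "x \<in> ball 0 d"
    obtain e where e: "e > 0" "cball x e \<subseteq> ball 0 d" using open_contains_cball[of "ball (0::complex) d"] x by blast
    have "uniform_limit (cball x e) (\<lambda>n \<zeta>. (h \<zeta> (w n) - h \<zeta> 0) / w n) (\<lambda>\<zeta>. deriv (h \<zeta>) 0) sequentially"
    proof (rule uniform_limitI)
      fix \<epsilon> :: real assume \<epsilon>: "\<epsilon> > 0"
      have lim: "(\<lambda>n. C * cmod (w n)) \<longlonglongrightarrow> 0"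
      proof -
        have "(\<lambda>n. d / (2 * (real n + 2))) \<longlonglongrightarrow> 0" by real_asymp
        from tendsto_of_real[OF this, where 'a = complex] have "(\<lambda>n. w n) \<longlonglongrightarrow> 0"
          unfolding w_def of_real_0 .
        then show ?thesis by (auto intro!: tendsto_eq_intros)
      qed
      have "\<forall>\<^sub>F n in sequentially. C * cmod (w n) < \<epsilon>" using order_tendstoD(2)[OF lim \<epsilon>] .
      then show "\<forall>\<^sub>F n in sequentially. \<forall>\<zeta>\<in>cball x e. dist ((h \<zeta> (w n) - h \<zeta> 0) / w n) (deriv (h \<zeta>) 0) < \<epsilon>"
      proof eventually_elim
        case (elim n)
        show ?case
        proof
          fix \<zeta> assume "\<zeta> \<in> cball x e"
          then have \<zeta>: "\<zeta> \<in> ball 0 d" using e by blast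
          have "dist ((h \<zeta> (w n) - h \<zeta> 0) / w n) (deriv (h \<zeta>) 0) = cmod (h \<zeta> (w n) - h \<zeta> 0 - w n * deriv (h \<zeta>) 0) / cmod (w n)"
            using wd(1)[of n] by (simp add: dist_norm norm_divide[symmetric] diff_divide_distrib)
          also have "\<dots> \<le> C * (cmod (w n))^2 / cmod (w n)" by (intro divide_right_mono rem \<zeta> wd) auto
          also have "\<dots> = C * cmod (w n)" using wd(1)[of n] by (simp add: power2_eq_square)
          also have "\<dots> < \<epsilon>" by (rule elim)
          finally show "dist ((h \<zeta> (w n) - h \<zeta> 0) / w n) (deriv (h \<zeta>) 0) < \<epsilon>" .
        qed
      qed
    qed
    then show "\<exists>d'>0. cball x d' \<subseteq> ball 0 d \<and>
        uniform_limit (cball x d') (\<lambda>n \<zeta>. (h \<zeta> (w n) - h \<zeta> 0) / w n) (\<lambda>\<zeta>. deriv (h \<zeta>) 0) sequentially"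
      using e by blast
  qed
  then show ?thesis using that C rem by blast
qed

text \<open>The scalar version of \<open>holo_on\<close>. In contrast to \<open>chol\<close> it
  contains no smoothness; the expansions below are obtained on one-variable slices.\<close>

definition cdiff :: "((complex^'n) \<times> complex) set \<Rightarrow> ((complex^'n) \<times> complex \<Rightarrow> complex) \<Rightarrow> bool" where
  "cdiff V \<phi> \<longleftrightarrow> (\<forall>x\<in>V. \<exists>D. (\<phi> has_derivative D) (at x) \<and> (\<forall>v. D (cmul \<i> v) = \<i> * D v))"

lemma cdiff_derivative:
  assumes "cdiff V \<phi>" "x \<in> V"
  shows "(\<phi> has_derivative (\<lambda>v. ddir v \<phi> x)) (at x)" "clin (\<lambda>v. ddir v \<phi> x)"
proof -
  obtain D where D: "(\<phi> has_derivative D) (at x)" "\<And>v. D (cmul \<i> v) = \<i> * D v"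
    using assms unfolding cdiff_def by blast
  have e: "(\<lambda>v. ddir v \<phi> x) = D" using ddir_eqI[OF D(1)] by blast
  show "(\<phi> has_derivative (\<lambda>v. ddir v \<phi> x)) (at x)" unfolding e by (rule D(1))
  show "clin (\<lambda>v. ddir v \<phi> x)" unfolding e by (rule clinI[OF has_derivative_linear[OF D(1)] D(2)])
qed

lemma cdiff_line:
  assumes "cdiff V \<phi>" "a + cmul \<zeta> v \<in> V"
  shows "((\<lambda>\<zeta>. \<phi> (a + cmul \<zeta> v)) has_field_derivative ddir v \<phi> (a + cmul \<zeta> v)) (at \<zeta>)"
proof -
  interpret c: bounded_bilinear "cmul :: complex \<Rightarrow> (complex^'n) \<times> complex \<Rightarrow> _" by (rule bounded_bilinear_cmul)
  have "((\<lambda>\<zeta>. a + cmul \<zeta> v) has_derivative (\<lambda>h. cmul h v)) (at \<zeta>)"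
    using has_derivative_add[OF has_derivative_const bounded_linear_imp_has_derivative[OF c.bounded_linear_left]] by simp
  from diff_chain_at[OF this cdiff_derivative(1)[OF assms]]
  have "((\<lambda>\<zeta>. \<phi> (a + cmul \<zeta> v)) has_derivative (\<lambda>h. ddir (cmul h v) \<phi> (a + cmul \<zeta> v))) (at \<zeta>)"
    by (simp add: o_def)
  then show ?thesis
    unfolding has_field_derivative_def clinD(2)[OF cdiff_derivative(2)[OF assms]]
    by (rule has_derivative_eq_rhs) (auto simp: mult.commute)
qed

lemma cdiff_box:
  fixes v y :: "(complex^'n) \<times> complex"
  assumes \<phi>: "cdiff V \<phi>" and V: "open V" "0 \<in> V"
  obtains d where "d > 0" "\<And>\<zeta> \<omega>. \<zeta> \<in> ball 0 d \<Longrightarrow> \<omega> \<in> ball 0 d \<Longrightarrow> cmul \<zeta> v + cmul \<omega> y \<in> V"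
    "\<And>\<zeta> \<omega>. \<zeta> \<in> ball 0 d \<Longrightarrow> \<omega> \<in> ball 0 d \<Longrightarrow> cmod (\<phi> (cmul \<zeta> v + cmul \<omega> y)) \<le> cmod (\<phi> 0) + 1"
proof -
  have "continuous_on V \<phi>"
    using cdiff_derivative(1)[OF \<phi>] has_derivative_continuous continuous_at_imp_continuous_on by blast
  then have "open (V \<inter> \<phi> -` ball (\<phi> 0) 1)" by (intro continuous_open_preimage V(1)) auto
  then obtain e where e: "e > 0" "ball 0 e \<subseteq> V \<inter> \<phi> -` ball (\<phi> 0) 1"
    using V(2) open_contains_ball by (metis IntI centre_in_ball vimageI zero_less_one)
  obtain K where K: "K > 0" "\<And>a (b :: (complex^'n) \<times> complex). norm (cmul a b) \<le> norm a * norm b * K"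
    using bounded_bilinear.pos_bounded[OF bounded_bilinear_cmul] by blast
  define d where "d = e / (K * (norm v + norm y) + 1)"
  have pos: "K * (norm v + norm y) + 1 > 0" using K by (simp add: add_nonneg_pos)
  have d: "d > 0" using e pos by (simp add: d_def)
  have inb: "cmul \<zeta> v + cmul \<omega> y \<in> ball 0 e" if "\<zeta> \<in> ball 0 d" "\<omega> \<in> ball 0 d" for \<zeta> \<omega>
  proof -
    have "norm (cmul \<zeta> v + cmul \<omega> y) \<le> norm \<zeta> * norm v * K + norm \<omega> * norm y * K"
      by (intro order_trans[OF norm_triangle_ineq] add_mono K(2))
    also have "\<dots> \<le> d * norm v * K + d * norm y * K" using that K by (intro add_mono mult_right_mono) auto
    also have "\<dots> = d * (K * (norm v + norm y))" by (simp add: algebra_simps)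
    also have "\<dots> < d * (K * (norm v + norm y) + 1)" using d by simp
    also have "\<dots> = e" using pos by (simp add: d_def)
    finally show ?thesis by simp
  qed
  show ?thesis
  proof (rule that[OF d])
    fix \<zeta> \<omega> :: complex assume "\<zeta> \<in> ball 0 d" "\<omega> \<in> ball 0 d"
    then have *: "cmul \<zeta> v + cmul \<omega> y \<in> V" "\<phi> (cmul \<zeta> v + cmul \<omega> y) \<in> ball (\<phi> 0) 1" using inb e(2) by blast+
    then show "cmul \<zeta> v + cmul \<omega> y \<in> V" by simp
    show "cmod (\<phi> (cmul \<zeta> v + cmul \<omega> y)) \<le> cmod (\<phi> 0) + 1"
      using *(2) norm_triangle_ineq[of "\<phi> 0" "\<phi> (cmul \<zeta> v + cmul \<omega> y) - \<phi> 0"] by (simp add: dist_norm norm_minus_commute)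
  qed
qed

text \<open>The homogeneous part of degree i of the Taylor series at 0, evaluated at
  \<open>v\<close> and read off on the complex line through \<open>v\<close>. Of its dependence on
  \<open>v\<close> only homogeneity (\<open>lc_scale\<close>) and, for i = 2, a directional
  derivative (\<open>lc2_derivative\<close>) are established.\<close>

definition lc :: "nat \<Rightarrow> ((complex^'n) \<times> complex \<Rightarrow> complex) \<Rightarrow> (complex^'n) \<times> complex \<Rightarrow> complex" where
  "lc i \<phi> v = (deriv ^^ i) (\<lambda>\<zeta>. \<phi> (cmul \<zeta> v)) 0 / fact i"

text \<open>The coefficient of zeta omega in the expansion of phi at zeta v + omega y.\<close>

definition mixed :: "((complex^'n) \<times> complex \<Rightarrow> complex) \<Rightarrow> (complex^'n) \<times> complex \<Rightarrow> (complex^'n) \<times> complex \<Rightarrow> complex" where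
  "mixed \<phi> y v = deriv (\<lambda>\<zeta>. deriv (\<lambda>\<omega>. \<phi> (cmul \<zeta> v + cmul \<omega> y)) 0) 0"

text \<open>On the plane spanned by \<open>v\<close> and \<open>y\<close> all three estimates are
  one-variable Taylor bounds: in zeta for the function and for its omega derivative, in omega for
  the function with zeta as a parameter.\<close>

lemma cdiff_expansion:
  fixes v y :: "(complex^'n) \<times> complex"
  assumes \<phi>: "cdiff V \<phi>" and V: "open V" "0 \<in> V"
  obtains d C where "d > 0" "C \<ge> 0"
    "\<And>\<zeta>. \<zeta> \<in> ball 0 d \<Longrightarrow> cmod (\<phi> (cmul \<zeta> v) - (\<phi> 0 + \<zeta> * ddir v \<phi> 0 + \<zeta>^2 * lc 2 \<phi> v + \<zeta>^3 * lc 3 \<phi> v)) \<le> C * cmod \<zeta> ^ 4"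
    "\<And>\<zeta>. \<zeta> \<in> ball 0 d \<Longrightarrow> cmod (deriv (\<lambda>\<omega>. \<phi> (cmul \<zeta> v + cmul \<omega> y)) 0 - (ddir y \<phi> 0 + \<zeta> * mixed \<phi> y v)) \<le> C * cmod \<zeta> ^ 2"
    "\<And>\<zeta> \<omega>. \<zeta> \<in> ball 0 d \<Longrightarrow> \<omega> \<in> ball 0 d \<Longrightarrow>
      cmod (\<phi> (cmul \<zeta> v + cmul \<omega> y) - \<phi> (cmul \<zeta> v) - \<omega> * deriv (\<lambda>\<omega>. \<phi> (cmul \<zeta> v + cmul \<omega> y)) 0) \<le> C * (cmod \<omega>)^2"
    "(\<lambda>\<zeta>. \<phi> (cmul \<zeta> v)) holomorphic_on ball 0 d" "(\<lambda>\<zeta>. deriv (\<lambda>\<omega>. \<phi> (cmul \<zeta> v + cmul \<omega> y)) 0) holomorphic_on ball 0 d"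
proof -
  obtain d where d: "d > 0" and inV: "\<And>\<zeta> \<omega>. \<zeta> \<in> ball 0 d \<Longrightarrow> \<omega> \<in> ball 0 d \<Longrightarrow> cmul \<zeta> v + cmul \<omega> y \<in> V"
    and bd: "\<And>\<zeta> \<omega>. \<zeta> \<in> ball 0 d \<Longrightarrow> \<omega> \<in> ball 0 d \<Longrightarrow> cmod (\<phi> (cmul \<zeta> v + cmul \<omega> y)) \<le> cmod (\<phi> 0) + 1"
    using cdiff_box[OF \<phi> V, of v y] by blast
  define h where "h \<zeta> \<omega> = \<phi> (cmul \<zeta> v + cmul \<omega> y)" for \<zeta> \<omega>
  have h1: "h \<zeta> holomorphic_on ball 0 d" if "\<zeta> \<in> ball 0 d" for \<zeta>
    unfolding holomorphic_on_open[OF open_ball] h_def using cdiff_line[OF \<phi> inV[OF that]] by blast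
  have h2: "(\<lambda>\<zeta>. h \<zeta> \<omega>) holomorphic_on ball 0 d" if "\<omega> \<in> ball 0 d" for \<omega>
    unfolding holomorphic_on_open[OF open_ball] h_def
    using cdiff_line[OF \<phi>, of "cmul \<omega> y" _ v] inV[OF _ that] by (fastforce simp: add.commute)
  define B where "B = cmod (\<phi> 0) + 1"
  have hB: "cmod (h \<zeta> \<omega>) \<le> B" if "\<zeta> \<in> ball 0 d" "\<omega> \<in> ball 0 d" for \<zeta> \<omega>
    using bd that by (simp add: h_def B_def)
  obtain C1 where C1: "C1 \<ge> 0" "(\<lambda>\<zeta>. deriv (h \<zeta>) 0) holomorphic_on ball 0 d"
    "\<And>\<zeta> \<omega>. \<zeta> \<in> ball 0 d \<Longrightarrow> \<omega> \<in> ball 0 (d/2) \<Longrightarrow> cmod (h \<zeta> \<omega> - h \<zeta> 0 - \<omega> * deriv (h \<zeta>) 0) \<le> C1 * (cmod \<omega>)^2"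
    using partial_derivative_holomorphic[OF d h1 h2 hB] by blast
  have z0: "0 \<in> ball (0::complex) d" using d by simp
  have f: "(\<lambda>\<zeta>. \<phi> (cmul \<zeta> v)) holomorphic_on ball 0 d" using h2[OF z0] by (simp add: h_def)
  have fB: "cmod (\<phi> (cmul \<zeta> v)) \<le> B" if "\<zeta> \<in> ball 0 d" for \<zeta> using hB[OF that z0] by (simp add: h_def)
  define C2 where "C2 = fact 4 * B / (d/4)^4 / fact 3"
  have d1: "deriv (\<lambda>\<zeta>. \<phi> (cmul \<zeta> v)) 0 = ddir v \<phi> 0" "deriv (\<lambda>\<omega>. \<phi> (cmul \<omega> y)) 0 = ddir y \<phi> 0"
    using cdiff_line[OF \<phi>, of 0 0] V(2) DERIV_imp_deriv by fastforce+
  have e1: "cmod (\<phi> (cmul \<zeta> v) - (\<phi> 0 + \<zeta> * ddir v \<phi> 0 + \<zeta>^2 * lc 2 \<phi> v + \<zeta>^3 * lc 3 \<phi> v)) \<le> C2 * cmod \<zeta> ^ 4"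
    if "\<zeta> \<in> ball 0 (d/2)" for \<zeta>
    using holomorphic_Taylor_bound[OF d f fB that, of 3]
    by (simp add: C2_def lc_def eval_nat_numeral d1 algebra_simps)
  define K where "K \<zeta> = deriv (h \<zeta>) 0" for \<zeta>
  have Khol: "K holomorphic_on ball 0 d" unfolding K_def by (rule C1(2))
  have "compact (cball (0::complex) (d/2))" "continuous_on (cball 0 (d/2)) K"
    using Khol d holomorphic_on_imp_continuous_on continuous_on_subset[of "ball 0 d" K "cball 0 (d/2)"]
    by (auto simp: subset_iff)
  then obtain BK where BK: "\<And>\<zeta>. \<zeta> \<in> cball 0 (d/2) \<Longrightarrow> cmod (K \<zeta>) \<le> BK"
    using compact_imp_bounded[OF compact_continuous_image, of "cball 0 (d/2)" K] unfolding bounded_iff by blast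
  have BK0: "BK \<ge> 0" by (rule order_trans[OF norm_ge_zero BK[of 0]]) (use d in simp)
  define C3 where "C3 = fact 2 * BK / ((d/2)/4)^2 / fact 1"
  have K0: "K 0 = ddir y \<phi> 0" and K1: "deriv K 0 = mixed \<phi> y v"
    by (simp_all add: K_def[abs_def] h_def[abs_def] d1(2) mixed_def)
  have e2: "cmod (K \<zeta> - (ddir y \<phi> 0 + \<zeta> * mixed \<phi> y v)) \<le> C3 * cmod \<zeta> ^ 2" if "\<zeta> \<in> ball 0 (d/4)" for \<zeta>
  proof -
    have "K holomorphic_on ball 0 (d/2)" by (rule holomorphic_on_subset[OF Khol]) (use d in auto)
    from holomorphic_Taylor_bound[OF _ this, of BK \<zeta> 1] that d BK show ?thesis
      by (simp add: C3_def K0 K1 eval_nat_numeral algebra_simps)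
  qed
  define C where "C = C1 + C2 + C3"
  have B0: "B \<ge> 0" by (simp add: B_def)
  have C23: "C2 \<ge> 0" "C3 \<ge> 0" using B0 BK0 d by (auto simp: C2_def C3_def)
  have hol: "(\<lambda>\<zeta>. \<phi> (cmul \<zeta> v)) holomorphic_on ball 0 (d/4)" "K holomorphic_on ball 0 (d/4)"
    using f Khol d by (auto intro: holomorphic_on_subset)
  have le: "C1 \<le> C" "C2 \<le> C" "C3 \<le> C" using C1(1) C23 by (auto simp: C_def)
  show ?thesis
  proof (rule that[of "d/4" C])
    show "d/4 > 0" "C \<ge> 0" using d C1 C23 by (auto simp: C_def)
    show "cmod (\<phi> (cmul \<zeta> v) - (\<phi> 0 + \<zeta> * ddir v \<phi> 0 + \<zeta>^2 * lc 2 \<phi> v + \<zeta>^3 * lc 3 \<phi> v)) \<le> C * cmod \<zeta> ^ 4"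
      if "\<zeta> \<in> ball 0 (d/4)" for \<zeta>
      using e1[of \<zeta>] that d mult_right_mono[OF le(2), of "cmod \<zeta> ^ 4"] by simp
    show "cmod (deriv (\<lambda>\<omega>. \<phi> (cmul \<zeta> v + cmul \<omega> y)) 0 - (ddir y \<phi> 0 + \<zeta> * mixed \<phi> y v)) \<le> C * cmod \<zeta> ^ 2"
      if "\<zeta> \<in> ball 0 (d/4)" for \<zeta>
      using e2[OF that] mult_right_mono[OF le(3), of "cmod \<zeta> ^ 2"] by (simp add: K_def h_def[abs_def])
    show "cmod (\<phi> (cmul \<zeta> v + cmul \<omega> y) - \<phi> (cmul \<zeta> v) - \<omega> * deriv (\<lambda>\<omega>. \<phi> (cmul \<zeta> v + cmul \<omega> y)) 0) \<le> C * (cmod \<omega>)^2"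
      if "\<zeta> \<in> ball 0 (d/4)" "\<omega> \<in> ball 0 (d/4)" for \<zeta> \<omega>
      using C1(3)[of \<zeta> \<omega>] that d mult_right_mono[OF le(1), of "cmod \<omega> ^ 2"] by (simp add: h_def[abs_def])
    show "(\<lambda>\<zeta>. \<phi> (cmul \<zeta> v)) holomorphic_on ball 0 (d/4)" by (rule hol)
    show "(\<lambda>\<zeta>. deriv (\<lambda>\<omega>. \<phi> (cmul \<zeta> v + cmul \<omega> y)) 0) holomorphic_on ball 0 (d/4)"
      using hol(2) by (simp add: K_def[abs_def] h_def[abs_def])
  qed
qed

lemma lc_scale:
  fixes v :: "(complex^'n) \<times> complex"
  assumes \<phi>: "cdiff V \<phi>" and V: "open V" "0 \<in> V"
  shows "lc i \<phi> (cmul \<eta> v) = \<eta>^i * lc i \<phi> v" "mixed \<phi> y (cmul \<eta> v) = \<eta> * mixed \<phi> y v"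
proof -
  obtain d where d: "d > 0" and hol: "(\<lambda>\<zeta>. \<phi> (cmul \<zeta> v)) holomorphic_on ball 0 d"
    "(\<lambda>\<zeta>. deriv (\<lambda>\<omega>. \<phi> (cmul \<zeta> v + cmul \<omega> y)) 0) holomorphic_on ball 0 d"
    using cdiff_expansion[OF \<phi> V, of v y] by metis
  define S where "S = (\<lambda>w. \<eta> * w) -` ball 0 d"
  have S: "open S" "0 \<in> S" unfolding S_def using d by (auto intro!: open_vimage continuous_intros)
  have *: "(deriv ^^ n) (\<lambda>w. f (\<eta> * w)) 0 = \<eta>^n * (deriv ^^ n) f 0" if "f holomorphic_on ball 0 d" for f n
    using higher_deriv_compose_linear[OF that S(1) open_ball S(2), of \<eta> n] by (simp add: S_def)
  show "lc i \<phi> (cmul \<eta> v) = \<eta>^i * lc i \<phi> v"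
    using *[OF hol(1), of i] by (simp add: lc_def mult.commute)
  show "mixed \<phi> y (cmul \<eta> v) = \<eta> * mixed \<phi> y v"
    using *[OF hol(2), of 1] by (simp add: mixed_def mult.commute)
qed

text \<open>The value of phi at t (v + s y) is expanded along v + s y, and also along v with
  increment t s in the direction y. Comparison at order t^2 gives the difference of the quadratic
  parts up to O(s^2).\<close>

lemma lc2_derivative:
  fixes v y :: "(complex^'n) \<times> complex"
  assumes \<phi>: "cdiff V \<phi>" and V: "open V" "0 \<in> V"
  shows "((\<lambda>s. lc 2 \<phi> (v + cmul s y)) has_field_derivative mixed \<phi> y v) (at 0)"
proof -
  obtain d C where d: "d > 0" and C: "C \<ge> 0" and
    e1: "\<And>\<zeta>. \<zeta> \<in> ball 0 d \<Longrightarrow> cmod (\<phi> (cmul \<zeta> v) - (\<phi> 0 + \<zeta> * ddir v \<phi> 0 + \<zeta>^2 * lc 2 \<phi> v + \<zeta>^3 * lc 3 \<phi> v)) \<le> C * cmod \<zeta> ^ 4" and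
    e2: "\<And>\<zeta>. \<zeta> \<in> ball 0 d \<Longrightarrow> cmod (deriv (\<lambda>\<omega>. \<phi> (cmul \<zeta> v + cmul \<omega> y)) 0 - (ddir y \<phi> 0 + \<zeta> * mixed \<phi> y v)) \<le> C * cmod \<zeta> ^ 2" and
    e3: "\<And>\<zeta> \<omega>. \<zeta> \<in> ball 0 d \<Longrightarrow> \<omega> \<in> ball 0 d \<Longrightarrow>
      cmod (\<phi> (cmul \<zeta> v + cmul \<omega> y) - \<phi> (cmul \<zeta> v) - \<omega> * deriv (\<lambda>\<omega>. \<phi> (cmul \<zeta> v + cmul \<omega> y)) 0) \<le> C * (cmod \<omega>)^2"
    using cdiff_expansion[OF \<phi> V, of v y] by metis
  note lin = clinD[OF cdiff_derivative(2)[OF \<phi> V(2)]]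
  have bound: "cmod (lc 2 \<phi> (v + cmul s y) - lc 2 \<phi> v - s * mixed \<phi> y v) \<le> C * (cmod s)^2" if s: "cmod s < 1" for s
  proof -
    \<comment> \<open>These constants depend on s. They disappear because t tends to 0 with s fixed;
      the bound that remains contains only \<open>C\<close>, which is independent of s.\<close>
    obtain d' C' where d': "d' > 0" and C': "C' \<ge> 0" and
      e1': "\<And>\<zeta>. \<zeta> \<in> ball 0 d' \<Longrightarrow> cmod (\<phi> (cmul \<zeta> (v + cmul s y)) - (\<phi> 0 + \<zeta> * ddir (v + cmul s y) \<phi> 0
         + \<zeta>^2 * lc 2 \<phi> (v + cmul s y) + \<zeta>^3 * lc 3 \<phi> (v + cmul s y))) \<le> C' * cmod \<zeta> ^ 4"
      using cdiff_expansion[OF \<phi> V, of "v + cmul s y" y] by metis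
    let ?A = "lc 2 \<phi> (v + cmul s y) - lc 2 \<phi> v - s * mixed \<phi> y v"
    let ?l3 = "lc 3 \<phi> (v + cmul s y) - lc 3 \<phi> v"
    define c where "c = C' + C + C + cmod ?l3"
    have est: "cmod ?A \<le> C * (cmod s)^2 + c * t" if t: "0 < t" "t < d" "t < d'" "t < 1" for t
    proof -
      let ?z = "complex_of_real t"
      have zb: "?z \<in> ball 0 d" "?z \<in> ball 0 d'" using t by auto
      have "t * cmod s \<le> t * 1" using t s by (intro mult_left_mono) auto
      then have "t * cmod s < d" using t by linarith
      then have sb: "?z * s \<in> ball 0 d" using t by (simp add: norm_mult)
      define x1 where "x1 = \<phi> (cmul ?z (v + cmul s y)) - (\<phi> 0 + ?z * ddir (v + cmul s y) \<phi> 0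
         + ?z^2 * lc 2 \<phi> (v + cmul s y) + ?z^3 * lc 3 \<phi> (v + cmul s y))"
      define x2 where "x2 = \<phi> (cmul ?z v) - (\<phi> 0 + ?z * ddir v \<phi> 0 + ?z^2 * lc 2 \<phi> v + ?z^3 * lc 3 \<phi> v)"
      define K where "K = deriv (\<lambda>\<omega>. \<phi> (cmul ?z v + cmul \<omega> y)) 0"
      define x3 where "x3 = K - (ddir y \<phi> 0 + ?z * mixed \<phi> y v)"
      define x4 where "x4 = \<phi> (cmul ?z v + cmul (?z * s) y) - \<phi> (cmul ?z v) - (?z * s) * K"
      have n1: "cmod x1 \<le> C' * t^4" using e1'[OF zb(2)] t by (simp add: x1_def)
      have n2: "cmod x2 \<le> C * t^4" using e1[OF zb(1)] t by (simp add: x2_def)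
      have n3: "cmod x3 \<le> C * t^2" using e2[OF zb(1)] t by (simp add: x3_def K_def)
      have n4: "cmod x4 \<le> C * (t * cmod s)^2" using e3[OF zb(1) sb] t by (simp add: x4_def K_def norm_mult)
      have arg: "cmul ?z (v + cmul s y) = cmul ?z v + cmul (?z * s) y" by (simp add: cmul_add_right)
      have "x4 = x1 - x2 + ?z^2 * ?A + ?z^3 * ?l3 - ?z * s * x3"
        unfolding x1_def x2_def x3_def x4_def arg lin(1,2) by (simp add: algebra_simps power2_eq_square)
      then have "?z^2 * ?A = x4 - x1 + x2 - ?z^3 * ?l3 + ?z * s * x3" by (simp add: algebra_simps)
      then have "t^2 * cmod ?A = cmod (x4 - x1 + x2 - ?z^3 * ?l3 + ?z * s * x3)"
        using t by (metis abs_of_pos norm_mult norm_of_real norm_power)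
      also have "\<dots> \<le> cmod x4 + cmod x1 + cmod x2 + cmod (?z^3 * ?l3) + cmod (?z * s * x3)"
        by (intro norm_triangle_le norm_triangle_le_diff add_mono order_refl)
      also have "\<dots> \<le> C * (t * cmod s)^2 + C' * t^4 + C * t^4 + t^3 * cmod ?l3 + t * 1 * (C * t^2)"
      proof (intro add_mono n1 n2 n4)
        show "cmod (?z^3 * ?l3) \<le> t^3 * cmod ?l3" using t by (simp add: norm_mult norm_power)
        show "cmod (?z * s * x3) \<le> t * 1 * (C * t^2)"
          unfolding norm_mult using t s n3 C by (intro mult_mono) auto
      qed
      also have "\<dots> \<le> C * (t * cmod s)^2 + C' * t^3 + C * t^3 + t^3 * cmod ?l3 + C * t^3"
      proof -
        have "t^4 \<le> t^3" using t by (intro power_decreasing) auto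
        then have "C' * t^4 \<le> C' * t^3" "C * t^4 \<le> C * t^3" using C C' by (auto intro: mult_left_mono)
        moreover have "t * 1 * (C * t^2) = C * t^3" by (simp add: eval_nat_numeral)
        ultimately show ?thesis by linarith
      qed
      also have "\<dots> = t^2 * (C * (cmod s)^2 + c * t)" by (simp add: c_def algebra_simps eval_nat_numeral)
      finally show ?thesis using t by simp
    qed
    have c: "c \<ge> 0" using C C' by (simp add: c_def)
    have "((\<lambda>t. C * (cmod s)^2 + c * t) \<longlongrightarrow> C * (cmod s)^2 + c * 0) (at_right 0)" by (intro tendsto_intros)
    moreover have "\<forall>\<^sub>F t in at_right 0. cmod ?A \<le> C * (cmod s)^2 + c * t"
    proof -
      have "min d (min d' 1) > 0" using d d' by simp
      then show ?thesis unfolding eventually_at_right[OF zero_less_one] using est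
        by (intro exI[of _ "min d (min d' 1)"]) auto
    qed
    ultimately show ?thesis using tendsto_lowerbound[of _ _ "at_right (0::real)"] by (simp add: trivial_limit_at_right_real)
  qed
  have "((\<lambda>s. (lc 2 \<phi> (v + cmul s y) - lc 2 \<phi> v) / s) \<longlongrightarrow> mixed \<phi> y v) (at 0)"
  proof (rule Lim_transform2[OF tendsto_const], rule Lim_null_comparison)
    show "\<forall>\<^sub>F s in at 0. norm (mixed \<phi> y v - (lc 2 \<phi> (v + cmul s y) - lc 2 \<phi> v) / s) \<le> C * cmod s"
      unfolding eventually_at
    proof (intro exI[of _ 1] conjI ballI impI)
      fix s :: complex assume s: "s \<noteq> 0 \<and> dist s 0 < 1"
      have "mixed \<phi> y v - (lc 2 \<phi> (v + cmul s y) - lc 2 \<phi> v) / s = - (lc 2 \<phi> (v + cmul s y) - lc 2 \<phi> v - s * mixed \<phi> y v) / s"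
        using s by (simp add: field_simps)
      then have "norm (mixed \<phi> y v - (lc 2 \<phi> (v + cmul s y) - lc 2 \<phi> v) / s)
         = cmod (lc 2 \<phi> (v + cmul s y) - lc 2 \<phi> v - s * mixed \<phi> y v) / cmod s" by (simp only: norm_divide norm_minus_cancel)
      also have "\<dots> \<le> C * (cmod s)^2 / cmod s" using bound[of s] s by (intro divide_right_mono) auto
      also have "\<dots> = C * cmod s" using s by (simp add: power2_eq_square)
      finally show "norm (mixed \<phi> y v - (lc 2 \<phi> (v + cmul s y) - lc 2 \<phi> v) / s) \<le> C * cmod s" .
    qed simp
    show "((\<lambda>s. C * cmod s) \<longlongrightarrow> 0) (at 0)" by (auto intro!: tendsto_eq_intros)
  qed
  then show ?thesis by (simp add: has_field_derivative_iff)
qed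

text \<open>As w is O(t^2), the quadratic error in the direction \<open>y\<close> is O(t^4), and so
  is w times the O(t^2) error of the omega derivative. A first-order expansion in that direction
  therefore suffices.\<close>

lemma jet3_cdiff:
  fixes v y :: "(complex^'n) \<times> complex"
  assumes \<phi>: "cdiff V \<phi>" and V: "open V" "0 \<in> V" and w: "jet3 w 0 0 w2 w3"
  shows "jet3 (\<lambda>t. \<phi> (t *\<^sub>R v + cmul (w t) y)) (\<phi> 0) (ddir v \<phi> 0) (lc 2 \<phi> v + w2 * ddir y \<phi> 0)
     (lc 3 \<phi> v + w3 * ddir y \<phi> 0 + w2 * mixed \<phi> y v)"
proof -
  obtain d C where d: "d > 0" and C: "C \<ge> 0" and
    e1: "\<And>\<zeta>. \<zeta> \<in> ball 0 d \<Longrightarrow> cmod (\<phi> (cmul \<zeta> v) - (\<phi> 0 + \<zeta> * ddir v \<phi> 0 + \<zeta>^2 * lc 2 \<phi> v + \<zeta>^3 * lc 3 \<phi> v)) \<le> C * cmod \<zeta> ^ 4" and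
    e2: "\<And>\<zeta>. \<zeta> \<in> ball 0 d \<Longrightarrow> cmod (deriv (\<lambda>\<omega>. \<phi> (cmul \<zeta> v + cmul \<omega> y)) 0 - (ddir y \<phi> 0 + \<zeta> * mixed \<phi> y v)) \<le> C * cmod \<zeta> ^ 2" and
    e3: "\<And>\<zeta> \<omega>. \<zeta> \<in> ball 0 d \<Longrightarrow> \<omega> \<in> ball 0 d \<Longrightarrow>
      cmod (\<phi> (cmul \<zeta> v + cmul \<omega> y) - \<phi> (cmul \<zeta> v) - \<omega> * deriv (\<lambda>\<omega>. \<phi> (cmul \<zeta> v + cmul \<omega> y)) 0) \<le> C * (cmod \<omega>)^2"
    using cdiff_expansion[OF \<phi> V, of v y] by metis
  obtain Cw where Cw: "Cw \<ge> 0" "\<forall>\<^sub>F t in at_right 0. cmod (w t) \<le> Cw * t^2"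
  proof -
    obtain r where r: "(r \<longlongrightarrow> 0) (at_right 0)"
      "\<forall>\<^sub>F t in at_right 0. w t = t^2 *\<^sub>R w2 + t^3 *\<^sub>R w3 + t^3 *\<^sub>R r t"
      using w unfolding jet3_def by auto
    have "((\<lambda>t. w2 + t *\<^sub>R w3 + t *\<^sub>R r t) \<longlongrightarrow> w2 + 0 *\<^sub>R w3 + 0 *\<^sub>R 0) (at_right 0)"
      by (intro tendsto_intros r(1))
    then have "((\<lambda>t. norm (w2 + t *\<^sub>R w3 + t *\<^sub>R r t)) \<longlongrightarrow> norm w2) (at_right 0)"
      using tendsto_norm by fastforce
    then have ev: "\<forall>\<^sub>F t in at_right 0. norm (w2 + t *\<^sub>R w3 + t *\<^sub>R r t) < norm w2 + 1"
      by (rule order_tendstoD) simp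
    have "\<forall>\<^sub>F t in at_right 0. cmod (w t) \<le> (norm w2 + 1) * t^2"
      using ev r(2)
    proof eventually_elim
      case (elim t)
      have "w t = t^2 *\<^sub>R (w2 + t *\<^sub>R w3 + t *\<^sub>R r t)"
        using elim(2) by (simp add: algebra_simps eval_nat_numeral)
      then have "norm (w t) = t^2 * norm (w2 + t *\<^sub>R w3 + t *\<^sub>R r t)" by simp
      also have "\<dots> \<le> t^2 * (norm w2 + 1)" using elim(1) by (intro mult_left_mono) auto
      finally show ?case by (simp add: mult.commute)
    qed
    then show ?thesis using that[of "norm w2 + 1"] by simp
  qed
  let ?K = "\<lambda>t. deriv (\<lambda>\<omega>. \<phi> (cmul (of_real t) v + cmul \<omega> y)) 0"
  let ?x1 = "\<lambda>t. \<phi> (cmul (of_real t) v) - (\<phi> 0 + of_real t * ddir v \<phi> 0 + (of_real t)^2 * lc 2 \<phi> v + (of_real t)^3 * lc 3 \<phi> v)"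
  let ?x2 = "\<lambda>t. ?K t - (ddir y \<phi> 0 + of_real t * mixed \<phi> y v)"
  let ?x3 = "\<lambda>t. \<phi> (cmul (of_real t) v + cmul (w t) y) - \<phi> (cmul (of_real t) v) - w t * ?K t"
  have small: "\<forall>\<^sub>F t in at_right 0. (0::real) < t \<and> t < d"
    unfolding eventually_at_right[OF zero_less_one] using d by (intro exI[of _ d]) auto
  have wsmall: "\<forall>\<^sub>F t in at_right 0. cmod (w t) < d"
    using tendsto_norm[OF jet3_tendsto[OF w]] d by (intro order_tendstoD(2)) auto
  have j1: "jet3 ?x1 0 0 0 0"
  proof (rule jet3_bigo[OF C])
    show "\<forall>\<^sub>F t in at_right 0. cmod (?x1 t) \<le> C * t^4" using small
    proof eventually_elim
      case (elim t) then show ?case using e1[of "of_real t"] by simp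
    qed
  qed
  have j2: "jet3 (\<lambda>t. w t * ?x2 t) 0 0 0 0"
  proof (rule jet3_bigo[of "Cw * C"])
    show "\<forall>\<^sub>F t in at_right 0. cmod (w t * ?x2 t) \<le> Cw * C * t^4" using small Cw(2)
    proof eventually_elim
      case (elim t)
      have "cmod (?x2 t) \<le> C * t^2" using e2[of "of_real t"] elim by simp
      then have "cmod (w t) * cmod (?x2 t) \<le> (Cw * t^2) * (C * t^2)" using elim Cw C by (intro mult_mono) auto
      then show ?case by (simp add: norm_mult eval_nat_numeral mult_ac)
    qed
  qed (use Cw C in simp)
  have j3: "jet3 ?x3 0 0 0 0"
  proof (rule jet3_bigo[of "C * Cw^2"])
    show "\<forall>\<^sub>F t in at_right 0. cmod (?x3 t) \<le> C * Cw^2 * t^4" using small Cw(2) wsmall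
    proof eventually_elim
      case (elim t)
      have "cmod (?x3 t) \<le> C * (cmod (w t))^2" using e3[of "of_real t" "w t"] elim by simp
      also have "\<dots> \<le> C * (Cw * t^2)^2" using elim C by (intro mult_left_mono power_mono) auto
      finally show ?case by (simp add: power_mult_distrib mult.assoc)
    qed
  qed (use Cw C in simp)
  have jp: "jet3 (\<lambda>t. \<phi> 0 + of_real t * ddir v \<phi> 0 + (of_real t)^2 * lc 2 \<phi> v + (of_real t)^3 * lc 3 \<phi> v)
      (\<phi> 0) (ddir v \<phi> 0) (lc 2 \<phi> v) (lc 3 \<phi> v)"
    by (rule jet3_exact) (simp add: scaleR_conv_of_real)
  have jk: "jet3 (\<lambda>t. ddir y \<phi> 0 + of_real t * mixed \<phi> y v) (ddir y \<phi> 0) (mixed \<phi> y v) 0 0"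
    by (rule jet3_exact) (simp add: scaleR_conv_of_real)
  have "jet3 (\<lambda>t. (?x1 t + (\<phi> 0 + of_real t * ddir v \<phi> 0 + (of_real t)^2 * lc 2 \<phi> v + (of_real t)^3 * lc 3 \<phi> v))
     + (?x3 t + (w t * ?x2 t + w t * (ddir y \<phi> 0 + of_real t * mixed \<phi> y v))))
     (\<phi> 0) (ddir v \<phi> 0) (lc 2 \<phi> v + w2 * ddir y \<phi> 0) (lc 3 \<phi> v + w3 * ddir y \<phi> 0 + w2 * mixed \<phi> y v)"
    by (rule jet3_eqs[OF jet3_add[OF jet3_add[OF j1 jp] jet3_add[OF j3 jet3_add[OF j2 jet3_mult[OF w jk]]]]]) simp_all
  moreover have "(?x1 t + (\<phi> 0 + of_real t * ddir v \<phi> 0 + (of_real t)^2 * lc 2 \<phi> v + (of_real t)^3 * lc 3 \<phi> v))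
     + (?x3 t + (w t * ?x2 t + w t * (ddir y \<phi> 0 + of_real t * mixed \<phi> y v))) = \<phi> (t *\<^sub>R v + cmul (w t) y)" for t
    by (simp add: cmul_of_real algebra_simps)
  ultimately show ?thesis by simp
qed

section \<open>Uniqueness of singular values\<close>

lemma homogeneous_system:
  fixes c :: "'k \<Rightarrow> 'j \<Rightarrow> 'a::field"
  assumes "finite K" "finite J" "card K < card J"
  shows "\<exists>x. (\<exists>j\<in>J. x j \<noteq> 0) \<and> (\<forall>j. j \<notin> J \<longrightarrow> x j = 0) \<and> (\<forall>k\<in>K. (\<Sum>j\<in>J. c k j * x j) = 0)"
  using assms
proof (induction K arbitrary: J c rule: finite_induct)
  case empty
  then obtain j where j: "j \<in> J" by fastforce
  then show ?case by (intro exI[of _ "\<lambda>i. if i = j then 1 else 0"]) auto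
next
  case (insert k K)
  show ?case
  proof (cases "\<forall>j\<in>J. c k j = 0")
    case True
    obtain x where "\<exists>j\<in>J. x j \<noteq> 0" "\<forall>j. j \<notin> J \<longrightarrow> x j = 0" "\<forall>k\<in>K. (\<Sum>j\<in>J. c k j * x j) = 0"
      using insert.IH[of J c] insert.prems insert.hyps by auto
    then show ?thesis using True by (intro exI[of _ x]) auto
  next
    case False
    then obtain j0 where j0: "j0 \<in> J" "c k j0 \<noteq> 0" by blast
    let ?J = "J - {j0}"
    \<comment> \<open>The coefficients after the unknown \<open>j0\<close> has been eliminated by
      means of equation \<open>k\<close>.\<close>
    let ?c = "\<lambda>k' j. c k' j - c k' j0 * c k j / c k j0"
    have "card K < card ?J" using insert.prems insert.hyps j0 by (simp add: card_Diff_singleton)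
    then obtain x where x: "\<exists>j\<in>?J. x j \<noteq> 0" "\<forall>j. j \<notin> ?J \<longrightarrow> x j = 0" "\<forall>k\<in>K. (\<Sum>j\<in>?J. ?c k j * x j) = 0"
      using insert.IH[of ?J ?c] insert.prems by auto
    define s where "s = (\<Sum>j\<in>?J. c k j * x j)"
    let ?x = "x(j0 := - s / c k j0)"
    have sum: "(\<Sum>j\<in>J. c k' j * ?x j) = c k' j0 * (- s / c k j0) + (\<Sum>j\<in>?J. c k' j * x j)" for k'
      by (subst sum.remove[OF insert.prems(1) j0(1)]) (auto intro!: sum.cong)
    have "(\<Sum>j\<in>J. c k j * ?x j) = 0" unfolding sum using j0 by (simp add: s_def)
    moreover have "(\<Sum>j\<in>J. c k' j * ?x j) = 0" if "k' \<in> K" for k'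
    proof -
      have "(\<Sum>j\<in>?J. ?c k' j * x j) = (\<Sum>j\<in>?J. c k' j * x j) - c k' j0 / c k j0 * s"
        unfolding s_def by (simp add: left_diff_distrib sum_subtractf sum_distrib_left mult.assoc)
      then show ?thesis unfolding sum using x(3) that by simp
    qed
    ultimately show ?thesis using x j0 by (intro exI[of _ ?x]) auto
  qed
qed

text \<open>The right-hand side is multiplied by an extra unknown numbered 0. The homogeneous system
  then has a nonzero solution; its entry 0 cannot vanish, by injectivity, and dividing by it solves
  the original system.\<close>

lemma injective_system_solvable:
  fixes a :: "nat \<Rightarrow> nat \<Rightarrow> complex"
  assumes inj: "\<And>x. (\<And>k. k \<in> {1..m} \<Longrightarrow> (\<Sum>l=1..m. a k l * x l) = 0) \<Longrightarrow> (\<forall>l\<in>{1..m}. x l = 0)"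
  shows "\<exists>x. \<forall>k\<in>{1..m}. (\<Sum>l=1..m. a k l * x l) = y k"
proof -
  let ?c = "\<lambda>k l. if l = 0 then - y k else a k l"
  obtain x where x: "\<exists>j\<in>{0..m}. x j \<noteq> 0" "\<forall>k\<in>{1..m}. (\<Sum>l\<in>{0..m}. ?c k l * x l) = 0"
    using homogeneous_system[of "{1..m}" "{0..m}" ?c] by auto
  have eq: "(\<Sum>l=1..m. a k l * x l) = y k * x 0" if "k \<in> {1..m}" for k
  proof -
    have "(\<Sum>l\<in>{0..m}. ?c k l * x l) = - y k * x 0 + (\<Sum>l=1..m. a k l * x l)"
      by (subst sum.atLeast_Suc_atMost) auto
    then show ?thesis using x(2) that by (simp add: eq_neg_iff_add_eq_0 add.commute)
  qed
  have "x 0 \<noteq> 0"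
  proof
    assume 0: "x 0 = 0"
    then have "\<forall>l\<in>{1..m}. x l = 0" using inj[of x] eq by simp
    then have "\<forall>j\<in>{0..m}. x j = 0" using 0 by (metis One_nat_def Suc_leI atLeastAtMost_iff neq0_conv)
    then show False using x(1) by blast
  qed
  then have "\<forall>k\<in>{1..m}. (\<Sum>l=1..m. a k l * (x l / x 0)) = y k"
    using eq by (simp add: sum_divide_distrib[symmetric] flip: times_divide_eq_right)
      (simp add: times_divide_eq_right sum_divide_distrib[symmetric])
  then show ?thesis by (intro exI[of _ "\<lambda>l. x l / x 0"])
qed

text \<open>A minimax argument in the manner of Courant and Fischer. A dimension count yields a
  vector on which the weights \<open>lam1\<close> are at least \<open>lam1 j\<close> while only
  weights \<open>lam2\<close> at most \<open>lam2 j\<close> see its image; the dual choice of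
  supports gives the reverse inequality. Since A is a multiple of an isometry, norms on both sides
  can be compared.\<close>

lemma singular_values_unique:
  fixes a :: "nat \<Rightarrow> nat \<Rightarrow> complex" and lam1 lam2 :: "nat \<Rightarrow> real" and m :: nat
  defines "A \<equiv> (\<lambda>x k. \<Sum>l=1..m. a k l * x l)"
  assumes r: "r > 0"
    and iso: "\<And>x. (\<Sum>k=1..m. (cmod (A x k))^2) = r * (\<Sum>k=1..m. (cmod (x k))^2)"
    and form: "\<And>x y. of_real r * (\<Sum>k=1..m. of_real (lam1 k) * x k * y k)
        = cnj \<alpha> * (\<Sum>k=1..m. of_real (lam2 k) * A x k * A y k)"
    and pos: "\<And>k. k \<in> {1..m} \<Longrightarrow> lam1 k \<ge> 0" "\<And>k. k \<in> {1..m} \<Longrightarrow> lam2 k \<ge> 0"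
    and dec: "\<And>j k. 1 \<le> j \<Longrightarrow> j \<le> k \<Longrightarrow> k \<le> m \<Longrightarrow> lam1 k \<le> lam1 j" "\<And>j k. 1 \<le> j \<Longrightarrow> j \<le> k \<Longrightarrow> k \<le> m \<Longrightarrow> lam2 k \<le> lam2 j"
    and j: "j \<in> {1..m}"
  shows "lam1 j = cmod \<alpha> * lam2 j"
proof -
  define nn where "nn x = L2_set (\<lambda>k. cmod (x k)) {1..m}" for x :: "nat \<Rightarrow> complex"
  have nn2: "(nn x)^2 = (\<Sum>k=1..m. (cmod (x k))^2)" for x unfolding nn_def L2_set_def by (simp add: sum_nonneg)
  have nn0: "nn x \<ge> 0" for x by (simp add: nn_def)
  have nnA: "nn (A x) = sqrt r * nn x" for x
  proof -
    have "(nn (A x))^2 = (sqrt r * nn x)^2" unfolding nn2 iso power_mult_distrib using r by simp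
    then show ?thesis using nn0 r by (metis mult_nonneg_nonneg power2_eq_iff_nonneg real_sqrt_ge_zero less_imp_le)
  qed
  have nnpos: "nn x > 0" if "k \<in> {1..m}" "x k \<noteq> 0" for x k
  proof -
    have "(nn x)^2 \<ge> (cmod (x k))^2" unfolding nn2 using that by (intro member_le_sum) auto
    then have "(nn x)^2 > 0" using that by (smt (verit) zero_less_norm_iff zero_less_power)
    then show ?thesis using nn0[of x] by (simp add: power2_eq_square zero_less_mult_iff)
  qed
  have cs: "cmod (\<Sum>k=1..m. of_real (l k) * x k * y k) \<le> L * (nn x * nn y)"
    if "\<And>k. k \<in> {1..m} \<Longrightarrow> x k \<noteq> 0 \<Longrightarrow> \<bar>l k\<bar> \<le> L" "L \<ge> 0" for l L x y
  proof -
    have "cmod (\<Sum>k=1..m. of_real (l k) * x k * y k) \<le> (\<Sum>k=1..m. cmod (of_real (l k) * x k * y k))" by (rule norm_sum)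
    also have "\<dots> \<le> (\<Sum>k=1..m. L * (\<bar>cmod (x k)\<bar> * \<bar>cmod (y k)\<bar>))"
    proof (rule sum_mono)
      fix k assume k: "k \<in> {1..m}"
      show "cmod (of_real (l k) * x k * y k) \<le> L * (\<bar>cmod (x k)\<bar> * \<bar>cmod (y k)\<bar>)"
      proof (cases "x k = 0")
        case False
        then have "\<bar>l k\<bar> * (cmod (x k) * cmod (y k)) \<le> L * (cmod (x k) * cmod (y k))"
          using that(1)[OF k] by (intro mult_right_mono) auto
        then show ?thesis by (simp add: norm_mult mult.assoc)
      qed simp
    qed
    also have "\<dots> \<le> L * (nn x * nn y)"
      unfolding sum_distrib_left[symmetric] nn_def by (intro mult_left_mono L2_set_mult_ineq that(2))
    finally show ?thesis .
  qed
  have weighted: "(\<Sum>k=1..m. of_real (l k) * x k * (of_real (l k) * cnj (x k))) = complex_of_real ((nn (\<lambda>k. of_real (l k) * cnj (x k)))^2)" for l x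
  proof -
    have "of_real (l k) * x k * (of_real (l k) * cnj (x k)) = complex_of_real ((cmod (of_real (l k) * cnj (x k)))^2)" for k
    proof -
      have "of_real (l k) * x k * (of_real (l k) * cnj (x k)) = (of_real (l k) * cnj (x k)) * cnj (of_real (l k) * cnj (x k))" by simp
      then show ?thesis by (simp only: complex_norm_square)
    qed
    then show ?thesis unfolding nn2 by simp
  qed
  have lower: "nn (\<lambda>k. of_real (l k) * cnj (x k)) \<ge> L * nn x"
    if "\<And>k. k \<in> {1..m} \<Longrightarrow> x k \<noteq> 0 \<Longrightarrow> \<bar>l k\<bar> \<ge> L" "L \<ge> 0" for l L x
  proof -
    have "(L * nn x)^2 \<le> (nn (\<lambda>k. of_real (l k) * cnj (x k)))^2"
      unfolding power_mult_distrib nn2 sum_distrib_left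
    proof (rule sum_mono)
      fix k assume k: "k \<in> {1..m}"
      show "L^2 * (cmod (x k))^2 \<le> (cmod (of_real (l k) * cnj (x k)))^2"
      proof (cases "x k = 0")
        case False
        then have "L * cmod (x k) \<le> \<bar>l k\<bar> * cmod (x k)" using that(1)[OF k] by (intro mult_right_mono) auto
        then have "(L * cmod (x k))^2 \<le> (\<bar>l k\<bar> * cmod (x k))^2" using that(2) by (intro power_mono) auto
        then show ?thesis by (simp add: norm_mult power_mult_distrib)
      qed simp
    qed
    then show ?thesis using nn0 power2_le_imp_le by blast
  qed
  have le1: "lam1 j \<le> cmod \<alpha> * lam2 j"
  proof -
    \<comment> \<open>There are j unknowns and j - 1 equations.\<close>
    obtain x where x: "\<exists>i\<in>{1..j}. x i \<noteq> 0" "\<forall>i. i \<notin> {1..j} \<longrightarrow> x i = 0" "\<forall>k\<in>{1..j-1}. (\<Sum>l\<in>{1..j}. a k l * x l) = 0"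
      using homogeneous_system[of "{1..j-1}" "{1..j}" a] j by auto
    have A0: "A x k = 0" if "k \<in> {1..j-1}" for k
    proof -
      have "A x k = (\<Sum>l\<in>{1..j}. a k l * x l)" unfolding A_def
        by (rule sum.mono_neutral_right) (use j x(2) in auto)
      then show ?thesis using x(3) that by simp
    qed
    obtain i where i: "i \<in> {1..j}" "x i \<noteq> 0" using x(1) by blast
    have xp: "nn x > 0" by (rule nnpos[of i x]) (use i j in auto)
    \<comment> \<open>Pairing \<open>x\<close> with this vector in the first form gives the square
      of its own norm, so a bound on the form becomes a bound on \<open>nn y\<close>.\<close>
    define y where "y k = of_real (lam1 k) * cnj (x k)" for k
    have "of_real r * of_real ((nn y)^2) = cnj \<alpha> * (\<Sum>k=1..m. of_real (lam2 k) * A x k * A y k)"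
      using form[of x y] weighted[of lam1 x] by (simp add: y_def[abs_def])
    then have "r * (nn y)^2 = cmod \<alpha> * cmod (\<Sum>k=1..m. of_real (lam2 k) * A x k * A y k)"
      using r by (metis abs_of_nonneg complex_mod_cnj less_imp_le mult_nonneg_nonneg norm_mult norm_of_real of_real_mult zero_le_power2)
    also have "\<dots> \<le> cmod \<alpha> * (lam2 j * (nn (A x) * nn (A y)))"
    proof (intro mult_left_mono cs)
      fix k assume k: "k \<in> {1..m}" "A x k \<noteq> 0"
      then have "k \<notin> {1..j-1}" using A0 by auto
      then have "j \<le> k" using k by auto
      then show "\<bar>lam2 k\<bar> \<le> lam2 j" using dec(2)[of j k] pos(2)[OF k(1)] k j by auto
    qed (use pos(2)[OF j] in auto)
    also have "\<dots> = r * (cmod \<alpha> * lam2 j * (nn x * nn y))"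
      unfolding nnA using r real_sqrt_mult_self[of r] by (simp add: algebra_simps)
    finally have *: "(nn y)^2 \<le> cmod \<alpha> * lam2 j * (nn x * nn y)" using r by simp
    have yl: "lam1 j * nn x \<le> nn y"
      unfolding y_def[abs_def]
    proof (rule lower)
      fix k assume k: "k \<in> {1..m}" "x k \<noteq> 0"
      then have "k \<le> j" using x(2) by auto
      then show "lam1 j \<le> \<bar>lam1 k\<bar>" using dec(1)[of k j] k j by auto
    qed (use pos(1)[OF j] in auto)
    show ?thesis
    proof (cases "nn y = 0")
      case True
      then have "lam1 j * nn x \<le> 0" using yl by simp
      then have "lam1 j \<le> 0" using xp by (simp add: mult_le_0_iff)
      then show ?thesis using pos(2)[OF j] by (meson mult_nonneg_nonneg norm_ge_zero order_trans)
    next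
      case False
      then have "nn y > 0" using nn0[of y] by simp
      then have "nn y \<le> cmod \<alpha> * lam2 j * nn x" using * by (simp add: power2_eq_square mult.assoc[symmetric])
      then have "lam1 j * nn x \<le> cmod \<alpha> * lam2 j * nn x" using yl by linarith
      then show ?thesis using xp by simp
    qed
  qed
  have le2: "cmod \<alpha> * lam2 j \<le> lam1 j"
  proof -
    \<comment> \<open>The dual choice: unknowns j to m, with the image vanishing beyond j.\<close>
    obtain x where x: "\<exists>i\<in>{j..m}. x i \<noteq> 0" "\<forall>i. i \<notin> {j..m} \<longrightarrow> x i = 0" "\<forall>k\<in>{j+1..m}. (\<Sum>l\<in>{j..m}. a k l * x l) = 0"
    proof -
      have "card {j+1..m} < card {j..m}" using j by auto
      from homogeneous_system[OF _ _ this, of a] show ?thesis using that by auto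
    qed
    have A0: "A x k = 0" if "k \<in> {j+1..m}" for k
    proof -
      have "A x k = (\<Sum>l\<in>{j..m}. a k l * x l)" unfolding A_def
        by (rule sum.mono_neutral_right) (use j x(2) in auto)
      then show ?thesis using x(3) that by simp
    qed
    obtain i where i: "i \<in> {j..m}" "x i \<noteq> 0" using x(1) by blast
    have xp: "nn x > 0" by (rule nnpos[of i x]) (use i j in auto)
    \<comment> \<open>The same device on the image side; since A is injective, hence onto,
      \<open>w\<close> is the image of some \<open>y\<close>.\<close>
    define w where "w k = of_real (lam2 k) * cnj (A x k)" for k
    have "\<exists>y. \<forall>k\<in>{1..m}. (\<Sum>l=1..m. a k l * y l) = w k"
    proof (rule injective_system_solvable)
      fix x assume "\<And>k. k \<in> {1..m} \<Longrightarrow> (\<Sum>l=1..m. a k l * x l) = 0"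
      then have "(\<Sum>k=1..m. (cmod (A x k))^2) = 0" unfolding A_def by simp
      then have "(\<Sum>k=1..m. (cmod (x k))^2) = 0" using iso[of x] r by simp
      then show "\<forall>l\<in>{1..m}. x l = 0" by (simp add: sum_nonneg_eq_0_iff)
    qed
    then obtain y where y: "\<And>k. k \<in> {1..m} \<Longrightarrow> A y k = w k" unfolding A_def by blast
    have nny: "nn (A y) = nn w" unfolding nn_def L2_set_def using y by simp
    have "of_real r * (\<Sum>k=1..m. of_real (lam1 k) * x k * y k) = cnj \<alpha> * of_real ((nn w)^2)"
      using form[of x y] weighted[of lam2 "A x"] y by (simp add: w_def[abs_def])
    then have "cmod \<alpha> * (nn w)^2 = r * cmod (\<Sum>k=1..m. of_real (lam1 k) * x k * y k)"
      using r by (metis abs_of_nonneg complex_mod_cnj less_imp_le norm_mult norm_of_real zero_le_power2)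
    also have "\<dots> \<le> r * (lam1 j * (nn x * nn y))"
    proof (intro mult_left_mono cs)
      fix k assume k: "k \<in> {1..m}" "x k \<noteq> 0"
      then have "j \<le> k" using x(2) by auto
      then show "\<bar>lam1 k\<bar> \<le> lam1 j" using dec(1)[of j k] pos(1)[OF k(1)] k j by auto
    qed (use pos(1)[OF j] r in auto)
    also have "\<dots> = lam1 j * (nn (A x) * nn w)"
      unfolding nny[symmetric] nnA using r real_sqrt_mult_self[of r] by (simp add: algebra_simps)
    finally have *: "cmod \<alpha> * (nn w)^2 \<le> lam1 j * (nn (A x) * nn w)" .
    have wl: "lam2 j * nn (A x) \<le> nn w"
      unfolding w_def[abs_def]
    proof (rule lower)
      fix k assume k: "k \<in> {1..m}" "A x k \<noteq> 0"
      then have "k \<notin> {j+1..m}" using A0 by auto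
      then have "k \<le> j" using k by auto
      then show "lam2 j \<le> \<bar>lam2 k\<bar>" using dec(2)[of k j] k j by auto
    qed (use pos(2)[OF j] in auto)
    have Axp: "nn (A x) > 0" unfolding nnA using r xp by simp
    show ?thesis
    proof (cases "nn w = 0")
      case True
      then have "lam2 j * nn (A x) \<le> 0" using wl by simp
      then have "lam2 j \<le> 0" using Axp by (simp add: mult_le_0_iff)
      then have "lam2 j = 0" using pos(2)[OF j] by simp
      then show ?thesis using pos(1)[OF j] by simp
    next
      case False
      then have "nn w > 0" using nn0[of w] by simp
      then have "cmod \<alpha> * nn w \<le> lam1 j * nn (A x)" using * by (simp add: power2_eq_square mult.assoc[symmetric])
      moreover have "cmod \<alpha> * (lam2 j * nn (A x)) \<le> cmod \<alpha> * nn w" using wl by (intro mult_left_mono) auto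
      ultimately have "cmod \<alpha> * lam2 j * nn (A x) \<le> lam1 j * nn (A x)" by (simp add: mult.assoc)
      then show ?thesis using Axp by simp
    qed
  qed
  show ?thesis using le1 le2 by simp
qed

section \<open>Transition maps between normal forms\<close>

lemma jet3_vec:
  fixes x :: "real \<Rightarrow> complex^'n"
  assumes "\<And>j. jet3 (\<lambda>t. x t $ j) (a j) (b j) (c j) (d j)"
  shows "jet3 x (\<chi> j. a j) (\<chi> j. b j) (\<chi> j. c j) (\<chi> j. d j)"
proof -
  have bl: "bounded_linear (axis j :: complex \<Rightarrow> complex^'n)" for j
    by (rule linear_conv_bounded_linear[THEN iffD1], rule linearI)
      (auto simp: axis_def vec_eq_iff)
  have e: "z = (\<Sum>j\<in>UNIV. axis j (z $ j))" for z :: "complex^'n"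
    by (simp add: vec_eq_iff axis_def if_distrib cong: if_cong)
  have "jet3 (\<lambda>t. \<Sum>j\<in>UNIV. axis j (x t $ j)) (\<Sum>j\<in>UNIV. axis j (a j)) (\<Sum>j\<in>UNIV. axis j (b j))
      (\<Sum>j\<in>UNIV. axis j (c j)) (\<Sum>j\<in>UNIV. axis j (d j))"
    by (intro jet3_sum jet3_linear[OF bl] assms)
  moreover have "(\<Sum>j\<in>UNIV. axis j (f j)) = (\<chi> j. f j)" for f :: "'n \<Rightarrow> complex"
    using e[of "\<chi> j. f j"] by simp
  ultimately show ?thesis using e by simp
qed

lemma jet3_Pair:
  assumes "jet3 x a b c d" "jet3 y a' b' c' d'"
  shows "jet3 (\<lambda>t. (x t, y t)) (a, a') (b, b') (c, c') (d, d')"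
  using jet3_add[OF jet3_linear[OF bounded_linear_Pair[OF bounded_linear_ident bounded_linear_zero] assms(1)]
      jet3_linear[OF bounded_linear_Pair[OF bounded_linear_zero bounded_linear_ident] assms(2)]] by simp

lemma nfb_add: "nfb n c lam (x + y) z = nfb n c lam x z + nfb n c lam y z"
  "nfb n c lam z (x + y) = nfb n c lam z x + nfb n c lam z y"
  unfolding nfb_def zc_def by (simp_all add: algebra_simps sum.distrib)

lemma nfb_scale: "nfb n c lam (a *s x) z = a * nfb n c lam x z"
  "nfb n c lam z (a *s x) = a * nfb n c lam z x"
  unfolding nfb_def zc_def by (simp_all add: sum_distrib_left mult_ac)

lemma nf_mat_sym: "nf_mat n c lam k l = nf_mat n c lam l k"
proof (cases "k = l")
  case False
  have "(k = a \<and> l = b) = (l = b \<and> k = a)" for a b by blast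
  with False show ?thesis unfolding nf_mat_def by (cases c) (simp_all only: add.commute nf_case.case if_False simp_thms eq_commute[of l k])
qed simp

lemma nfb_commute: "nfb n c lam x y = nfb n c lam y x"
  unfolding nfb_def
proof (subst sum.swap, intro sum.cong refl)
  show "nf_mat n c lam k l * (zc x k * zc y l) = nf_mat n c lam l k * (zc y l * zc x k)" for k l
    by (subst nf_mat_sym) simp
qed

text \<open>What is kept of a coordinate change between two normal forms: one inclusion of the
  hypersurfaces and an injective differential at 0. The opposite inclusion appears as a second
  instance with the roles exchanged.\<close>

locale transition =
  fixes V :: "((complex^'n) \<times> complex) set" and T :: "(complex^'n) \<times> complex \<Rightarrow> (complex^'n) \<times> complex"
    and c1 c2 :: nf_case and l1 l2 :: "nat \<Rightarrow> real" and F1 F2 :: "(complex^'n) \<times> real \<Rightarrow> real" and W1 W2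
  assumes n2: "CARD('n) \<ge> 2" and V: "open V" "0 \<in> V" and hol: "holo_on V T" and T0: "T 0 = 0"
    and inj: "\<And>v. ddir v T 0 = 0 \<Longrightarrow> v = 0"
    and F1: "weighted_order_ge4 F1" "smooth_on W1 F1" "open W1" "0 \<in> W1"
    and F2: "weighted_order_ge4 F2" "smooth_on W2 F2" "open W2" "0 \<in> W2"
    and eq: "\<And>q. q \<in> V \<Longrightarrow> normal_form_eq CARD('n) c1 l1 F1 q \<Longrightarrow> normal_form_eq CARD('n) c2 l2 F2 (T q)"
begin

abbreviation (input) e\<^sub>y :: "(complex^'n) \<times> complex" where "e\<^sub>y \<equiv> (0, 1)"
abbreviation (input) \<nu> :: 'n where "\<nu> \<equiv> zidx CARD('n)"

definition f where "f j q = fst (T q) $ j" for j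
definition g where "g q = snd (T q)"
definition A where "A z = (\<chi> j. ddir (z, 0) (f j) 0)"
definition N where "N z = (\<Sum>j\<in>UNIV - {\<nu>}. (cmod (z $ j))^2)" for z :: "complex^'n"
abbreviation (input) Q1 where "Q1 \<equiv> nf_rhs CARD('n) c1 l1 :: complex^'n \<Rightarrow> complex"
abbreviation (input) Q2 where "Q2 \<equiv> nf_rhs CARD('n) c2 l2 :: complex^'n \<Rightarrow> complex"
definition c3 where "c3 z = 2 * Re (cnj (z $ \<nu>) * Q1 z)"

lemma T_derivative:
  assumes "x \<in> V"
  shows "(T has_derivative (\<lambda>v. ddir v T x)) (at x)" "ddir (cmul \<i> v) T x = cmul \<i> (ddir v T x)"
proof -
  obtain D where D: "(T has_derivative D) (at x)" "\<And>v. D (cmul \<i> v) = cmul \<i> (D v)"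
    using hol assms unfolding holo_on_def by blast
  have e: "(\<lambda>v. ddir v T x) = D" using ddir_eqI[OF D(1)] by blast
  show "(T has_derivative (\<lambda>v. ddir v T x)) (at x)" unfolding e by (rule D(1))
  show "ddir (cmul \<i> v) T x = cmul \<i> (ddir v T x)" using D(2) fun_cong[OF e] by simp
qed

lemma f_derivative: assumes "x \<in> V"
  shows "(f j has_derivative (\<lambda>v. fst (ddir v T x) $ j)) (at x)" "(g has_derivative (\<lambda>v. snd (ddir v T x))) (at x)"
  unfolding f_def[abs_def] g_def[abs_def]
  by (intro bounded_linear.has_derivative[OF bounded_linear_compose[OF bounded_linear_vec_nth bounded_linear_fst]]
      bounded_linear.has_derivative[OF bounded_linear_snd] T_derivative(1)[OF assms])+

lemma f_cdiff: "cdiff V (f j)" and g_cdiff: "cdiff V g"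
proof -
  have "fst (ddir (cmul \<i> v) T x) $ j = \<i> * fst (ddir v T x) $ j" "snd (ddir (cmul \<i> v) T x) = \<i> * snd (ddir v T x)"
    if "x \<in> V" for x v unfolding T_derivative(2)[OF that] by (simp_all add: cmul_def)
  then show "cdiff V (f j)" "cdiff V g" unfolding cdiff_def using f_derivative by blast+
qed

lemma f0: "f j 0 = 0" and g0: "g 0 = 0" by (simp_all add: f_def g_def T0)

lemma dT: "ddir v T 0 = ((\<chi> j. ddir v (f j) 0), ddir v g 0)"
  using ddir_eqI[OF f_derivative(1)[OF V(2)]] ddir_eqI[OF f_derivative(2)[OF V(2)]]
  by (simp add: prod_eq_iff vec_eq_iff)

lemma vec_scale: "(a *s z, 0) = cmul a (z, 0)" by (simp add: cmul_def vec_eq_iff)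

lemma A_add: "A (x + y) = A x + A y" and A_scale: "A (a *s z) = a *s A z"
proof -
  note l = clinD[OF cdiff_derivative(2)[OF f_cdiff V(2)]]
  have "ddir (x + y, 0) (f j) 0 = ddir (x, 0) (f j) 0 + ddir (y, 0) (f j) 0" for j
    using l(1)[where x = "(x, 0)" and y = "(y, 0)"] by simp
  then show "A (x + y) = A x + A y" unfolding A_def by (simp add: vec_eq_iff)
  show "A (a *s z) = a *s A z" unfolding A_def vec_scale by (simp add: vec_eq_iff l(2))
qed

lemma nf_rhs_scale: "nf_rhs CARD('n) c lam (a *s z) = a^2 * nf_rhs CARD('n) c lam (z :: complex^'n)"
  unfolding nf_rhs_nfb[OF n2] nfb_scale by (simp add: power2_eq_square)

lemma N_scale: "N (a *s z) = (cmod a)^2 * N z"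
  unfolding N_def by (simp add: norm_mult power_mult_distrib sum_distrib_left)

lemma real_scale: "(t::real) *\<^sub>R z = complex_of_real t *s (z :: complex^'n)"
  by (simp add: vec_eq_iff scaleR_conv_of_real[where 'a=complex])

text \<open>The w coordinate of the curve inside the first hypersurface that lies over the point t z
  with real part t^2 u.\<close>

definition wc where
  "wc z u t = Complex (t^2 * u) (N (t *\<^sub>R z) + 2 * Re (cnj ((t *\<^sub>R z) $ \<nu>) * Q1 (t *\<^sub>R z)) + F1 (t *\<^sub>R z, t^2 * u))"

definition qc where "qc z u t = t *\<^sub>R (z, 0) + cmul (wc z u t) e\<^sub>y"

lemma qc_eq: "qc z u t = (t *\<^sub>R z, wc z u t)"
  by (simp add: qc_def cmul_def zero_prod_def vec_eq_iff)

lemma qc_normal_form: "normal_form_eq CARD('n) c1 l1 F1 (qc z u t)"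
  unfolding normal_form_eq_def qc_eq wc_def N_def sum_zidx_but_last zc_def by simp

lemma wc_jet: "jet3 (wc z u) 0 0 (Complex u (N z)) (\<i> * of_real (c3 z))"
proof -
  have x: "jet3 (\<lambda>t. (t *\<^sub>R z, t^2 * u)) 0 (z, 0) (0, u) 0"
    by (rule jet3_exact) (simp add: zero_prod_def)
  have jF: "jet3 (\<lambda>t. F1 (t *\<^sub>R z, t^2 * u)) 0 0 0 0" by (rule jet3_weighted_order_ge4[OF F1 x])
  have "2 * Re (cnj ((t *\<^sub>R z) $ \<nu>) * Q1 (t *\<^sub>R z)) = t^3 * c3 z" for t
  proof -
    have "cnj ((t *\<^sub>R z) $ \<nu>) * Q1 (t *\<^sub>R z) = of_real (t^3) * (cnj (z $ \<nu>) * Q1 z)"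
      unfolding real_scale nf_rhs_scale by (simp add: power2_eq_square power3_eq_cube)
    moreover have "Re (of_real a * b) = a * Re b" for a b by simp
    ultimately show ?thesis unfolding c3_def by (simp only:)
  qed
  then have w: "wc z u = (\<lambda>t. (t^2 *\<^sub>R Complex u (N z) + t^3 *\<^sub>R (\<i> * of_real (c3 z))) + F1 (t *\<^sub>R z, t^2 * u) *\<^sub>R \<i>)"
    unfolding wc_def real_scale N_scale by (auto simp: fun_eq_iff complex_eq_iff)
  have p: "jet3 (\<lambda>t. t^2 *\<^sub>R Complex u (N z) + t^3 *\<^sub>R (\<i> * of_real (c3 z))) 0 0 (Complex u (N z)) (\<i> * of_real (c3 z))"
    by (rule jet3_exact) simp
  show ?thesis unfolding w
    by (rule jet3_eqs[OF jet3_add[OF p jet3_linear[OF bounded_linear_scaleR_left jF]]]) simp_all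
qed

lemma qc_eventually: "\<forall>\<^sub>F t in at_right 0. qc z u t \<in> V"
proof -
  have "((\<lambda>t. (t *\<^sub>R z, wc z u t)) \<longlongrightarrow> (0 *\<^sub>R z, 0)) (at_right 0)"
    by (intro tendsto_intros jet3_tendsto[OF wc_jet])
  then have "(qc z u \<longlongrightarrow> 0) (at_right 0)" unfolding qc_eq[abs_def] by (simp add: zero_prod_def)
  then show ?thesis by (rule topological_tendstoD[OF _ V])
qed

definition G1 where "G1 z = ddir (z, 0) g 0"
definition G2 where "G2 z = lc 2 g (z, 0)"
definition G3 where "G3 z = lc 3 g (z, 0)"
definition K0 where "K0 = ddir e\<^sub>y g 0"
definition K1 where "K1 z = mixed g e\<^sub>y (z, 0)"
definition B2 where "B2 j z = lc 2 (f j) (z, 0)"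
definition kap where "kap j = ddir e\<^sub>y (f j) 0"

lemma g_jet: "jet3 (\<lambda>t. g (qc z u t)) 0 (G1 z) (G2 z + Complex u (N z) * K0)
    (G3 z + \<i> * of_real (c3 z) * K0 + Complex u (N z) * K1 z)"
  unfolding qc_def G1_def G2_def G3_def K0_def K1_def
  using jet3_cdiff[OF g_cdiff V wc_jet] unfolding g0 .

lemma f_jet: "\<exists>d. jet3 (\<lambda>t. f j (qc z u t)) 0 (A z $ j) (B2 j z + Complex u (N z) * kap j) d"
  unfolding qc_def A_def B2_def kap_def vec_lambda_beta
  using jet3_cdiff[OF f_cdiff[of j] V wc_jet] unfolding f0 by blast

lemma nf_eventually: "\<forall>\<^sub>F t in at_right 0. Im (g (qc z u t)) =
    (\<Sum>j\<in>UNIV - {\<nu>}. Re (f j (qc z u t) * cnj (f j (qc z u t))))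
     + 2 * Re (cnj (f \<nu> (qc z u t)) * (\<Sum>k=1..CARD('n). \<Sum>l=1..CARD('n). nf_mat CARD('n) c2 l2 k l * (f (zidx k) (qc z u t) * f (zidx l) (qc z u t))))
     + F2 (fst (T (qc z u t)), Re (g (qc z u t)))"
  using qc_eventually[of z u]
proof eventually_elim
  case (elim t)
  have sq: "(cmod c)^2 = Re (c * cnj c)" for c unfolding cmod_power2 by (simp add: power2_eq_square)
  show ?case
    using eq[OF elim qc_normal_form] unfolding normal_form_eq_def sum_zidx_but_last nf_rhs_nfb[OF n2] nfb_def zc_def f_def g_def sq .
qed

text \<open>The coefficients of t, t^2 and t^3 in the second equation along the curve. The order of
  \<open>F2\<close> can be used only if the real part of the image of w starts at t^2, whence the
  hypothesis on \<open>G1\<close>; the first relation needs only that the first derivative of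
  \<open>F2\<close> vanishes in every direction.\<close>

lemma order_relations:
  "Im (G1 z) = 0"
  "G1 z = 0 \<Longrightarrow> Im (G2 z + Complex u (N z) * K0) = (\<Sum>j\<in>UNIV - {\<nu>}. (cmod (A z $ j))^2)"
  "G1 z = 0 \<Longrightarrow> Im (G3 z + \<i> * of_real (c3 z) * K0 + Complex u (N z) * K1 z)
     = (\<Sum>j\<in>UNIV - {\<nu>}. 2 * Re (cnj (A z $ j) * (B2 j z + Complex u (N z) * kap j))) + 2 * Re (cnj (A z $ \<nu>) * Q2 (A z))"
proof -
  obtain d where fj: "\<And>j. jet3 (\<lambda>t. f j (qc z u t)) 0 (A z $ j) (B2 j z + Complex u (N z) * kap j) (d j)"
  proof -
    have "\<forall>j. \<exists>d. jet3 (\<lambda>t. f j (qc z u t)) 0 (A z $ j) (B2 j z + Complex u (N z) * kap j) d" using f_jet by blast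
    then show ?thesis using that by (elim choice[THEN exE]) blast
  qed
  have sq: "(cmod c)^2 = Re (c * cnj c)" for c unfolding cmod_power2 by (simp add: power2_eq_square)
  note Imj = jet3_linear[OF bounded_linear_Im g_jet[of z u]]
  have s1: "jet3 (\<lambda>t. Re (f j (qc z u t) * cnj (f j (qc z u t)))) 0 0 ((cmod (A z $ j))^2)
     (2 * Re (cnj (A z $ j) * (B2 j z + Complex u (N z) * kap j)))" for j
    by (rule jet3_eqs[OF jet3_linear[OF bounded_linear_Re jet3_mult[OF fj jet3_linear[OF bounded_linear_cnj fj]]]])
      (simp_all add: sq algebra_simps)
  note S1 = jet3_sum[OF s1, where I = "UNIV - {\<nu>}"]
  have s2: "jet3 (\<lambda>t. nf_mat CARD('n) c2 l2 k l * (f (zidx k) (qc z u t) * f (zidx l) (qc z u t))) 0 0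
     (nf_mat CARD('n) c2 l2 k l * (A z $ zidx k * A z $ zidx l))
     (nf_mat CARD('n) c2 l2 k l * (A z $ zidx k * (B2 (zidx l) z + Complex u (N z) * kap (zidx l)) + (B2 (zidx k) z + Complex u (N z) * kap (zidx k)) * A z $ zidx l))" for k l
    by (rule jet3_eqs[OF jet3_mult[OF jet3_const jet3_mult[OF fj fj]]]) simp_all
  note S2 = jet3_sum[OF jet3_sum[OF s2, where I = "{1..CARD('n)}"], where I = "{1..CARD('n)}"]
  have S3: "jet3 (\<lambda>t. 2 * Re (cnj (f \<nu> (qc z u t)) * (\<Sum>k=1..CARD('n). \<Sum>l=1..CARD('n). nf_mat CARD('n) c2 l2 k l * (f (zidx k) (qc z u t) * f (zidx l) (qc z u t)))))
      0 0 0 (2 * Re (cnj (A z $ \<nu>) * Q2 (A z)))"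
    unfolding nf_rhs_nfb[OF n2] nfb_def zc_def
    by (rule jet3_eqs[OF jet3_mult[OF jet3_const jet3_linear[OF bounded_linear_Re
        jet3_mult[OF jet3_linear[OF bounded_linear_cnj fj] S2]]]]) simp_all
  have "jet3 (\<lambda>t. fst (T (qc z u t))) (\<chi> j. 0) (\<chi> j. A z $ j) (\<chi> j. B2 j z + Complex u (N z) * kap j) (\<chi> j. d j)"
    by (rule jet3_vec) (use fj in \<open>simp add: f_def\<close>)
  moreover have "(\<chi> j. (0 :: complex)) = (0 :: complex^'n)" by (simp add: vec_eq_iff)
  ultimately have ft: "jet3 (\<lambda>t. fst (T (qc z u t))) 0 (A z) (\<chi> j. B2 j z + Complex u (N z) * kap j) (\<chi> j. d j)" by simp
  have x: "jet3 (\<lambda>t. (fst (T (qc z u t)), Re (g (qc z u t)))) 0 (A z, Re (G1 z))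
     (\<chi> j. B2 j z + Complex u (N z) * kap j, Re (G2 z + Complex u (N z) * K0))
     (\<chi> j. d j, Re (G3 z + \<i> * of_real (c3 z) * K0 + Complex u (N z) * K1 z))"
    by (rule jet3_eqs[OF jet3_Pair[OF ft jet3_linear[OF bounded_linear_Re g_jet]]]) (simp_all add: zero_prod_def)
  have fin: "Im (G1 z) = b1 \<and> Im (G2 z + Complex u (N z) * K0) = (\<Sum>j\<in>UNIV - {\<nu>}. (cmod (A z $ j))^2) + b2 \<and>
    Im (G3 z + \<i> * of_real (c3 z) * K0 + Complex u (N z) * K1 z)
     = (\<Sum>j\<in>UNIV - {\<nu>}. 2 * Re (cnj (A z $ j) * (B2 j z + Complex u (N z) * kap j))) + 2 * Re (cnj (A z $ \<nu>) * Q2 (A z)) + b3"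
    if "jet3 (\<lambda>t. F2 (fst (T (qc z u t)), Re (g (qc z u t)))) 0 b1 b2 b3" for b1 b2 b3
  proof -
    note R = jet3_add[OF jet3_add[OF S1 S3] that]
    have "jet3 (\<lambda>t. Im (g (qc z u t))) (Im 0) (Im (G1 z)) (Im (G2 z + Complex u (N z) * K0))
      (Im (G3 z + \<i> * of_real (c3 z) * K0 + Complex u (N z) * K1 z))" by (rule Imj)
    from jet3_unique[OF jet3_cong[OF this nf_eventually] R] show ?thesis by simp
  qed
  note jF = jet3_smooth[OF F2(2-4) x, unfolded add_0_left weighted_order_ge4D[OF F2]]
  show "Im (G1 z) = 0" using fin[OF jF] by simp
  assume "G1 z = 0"
  then have "jet3 (\<lambda>t. F2 (fst (T (qc z u t)), Re (g (qc z u t)))) 0 0 0 0"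
    using jet3_weighted_order_ge4[OF F2] x by simp
  from fin[OF this] show "Im (G2 z + Complex u (N z) * K0) = (\<Sum>j\<in>UNIV - {\<nu>}. (cmod (A z $ j))^2)"
   "Im (G3 z + \<i> * of_real (c3 z) * K0 + Complex u (N z) * K1 z)
     = (\<Sum>j\<in>UNIV - {\<nu>}. 2 * Re (cnj (A z $ j) * (B2 j z + Complex u (N z) * kap j))) + 2 * Re (cnj (A z $ \<nu>) * Q2 (A z))"
    by simp_all
qed

lemma scalings: "G2 (a *s z) = a^2 * G2 z" "G3 (a *s z) = a^3 * G3 z" "K1 (a *s z) = a * K1 z" "B2 j (a *s z) = a^2 * B2 j z"
  "G1 (a *s z) = a * G1 z"
  unfolding G2_def G3_def K1_def B2_def G1_def vec_scale
  using lc_scale[OF g_cdiff V] lc_scale[OF f_cdiff[of j] V] clinD(2)[OF cdiff_derivative(2)[OF g_cdiff V(2)]] by auto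

lemma c3_scale: "c3 (a *s z) = 2 * Re ((of_real (cmod a))^2 * a * (cnj (z $ \<nu>) * Q1 z))"
proof -
  have "cnj ((a *s z) $ \<nu>) * Q1 (a *s z) = (a * cnj a) * a * (cnj (z $ \<nu>) * Q1 z)"
    unfolding nf_rhs_scale by (simp add: power2_eq_square)
  then show ?thesis unfolding c3_def by (simp only: complex_norm_square[symmetric] of_real_power)
qed

text \<open>The imaginary part vanishes at z and at i z, and \<open>G1\<close> is complex
  linear.\<close>

lemma G1_0: "G1 z = 0"
proof -
  have "Im (G1 (\<i> *s z)) = 0" by (rule order_relations(1))
  then show ?thesis using order_relations(1)[of z] unfolding scalings by (simp add: complex_eq_iff)
qed

definition r where "r = Re K0"

lemma N_axis: assumes "j \<noteq> \<nu>" shows "N (axis j 1) = 1"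
proof -
  have "(\<Sum>i\<in>UNIV - {\<nu>}. (cmod (axis j 1 $ i))^2) = (\<Sum>i\<in>UNIV - {\<nu>}. if i = j then 1 else 0)"
    by (rule sum.cong) (auto simp: axis_def)
  then show ?thesis unfolding N_def using assms by simp
qed

lemma other_index: obtains j where "j \<noteq> \<nu>"
proof -
  have "1 \<in> {1..CARD('n)}" "CARD('n) \<in> {1..CARD('n)}" "1 \<noteq> CARD('n)" using n2 by auto
  then have "(zidx 1 :: 'n) \<noteq> \<nu>" using zidx_inject[of 1 "CARD('n)", where 'n = 'n] by blast
  then show ?thesis by (rule that)
qed

lemma K0_real: "K0 = of_real r"
proof -
  have "Im (G2 0 + Complex 1 (N 0) * K0) = Im (G2 0 + Complex 0 (N 0) * K0)"
    using order_relations(2)[OF G1_0, of 0 1] order_relations(2)[OF G1_0, of 0 0] by simp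
  then show ?thesis by (simp add: r_def complex_eq_iff)
qed

text \<open>Replacing z by i z changes the sign of \<open>G2\<close> and fixes the other two terms
  of the second-order relation, so the imaginary part of \<open>G2\<close> drops out.\<close>

lemma isometry: "(\<Sum>j\<in>UNIV - {\<nu>}. (cmod (A z $ j))^2) = r * N z"
proof -
  have 1: "Im (G2 z) + r * N z = (\<Sum>j\<in>UNIV - {\<nu>}. (cmod (A z $ j))^2)" for z
    using order_relations(2)[OF G1_0, of z 0] unfolding K0_real by (simp add: mult.commute)
  have "(\<Sum>j\<in>UNIV - {\<nu>}. (cmod (A (\<i> *s z) $ j))^2) = (\<Sum>j\<in>UNIV - {\<nu>}. (cmod (A z $ j))^2)"
    unfolding A_scale by (simp add: norm_mult)
  then show ?thesis using 1[of z] 1[of "\<i> *s z"] unfolding scalings N_scale by simp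
qed

lemma A_nu: "j \<noteq> \<nu> \<Longrightarrow> A (axis \<nu> 1) $ j = 0"
proof -
  assume j: "j \<noteq> \<nu>"
  have "N (axis \<nu> 1) = 0" unfolding N_def by (rule sum.neutral) (auto simp: axis_def)
  then have "(\<Sum>j\<in>UNIV - {\<nu>}. (cmod (A (axis \<nu> 1) $ j))^2) = 0" using isometry by simp
  then show ?thesis using j by (simp add: sum_nonneg_eq_0_iff)
qed

definition \<alpha> where "\<alpha> = A (axis \<nu> 1) $ \<nu>"

lemma A_nu_eq: "A (axis \<nu> 1) = \<alpha> *s axis \<nu> 1"
  using A_nu by (auto simp: vec_eq_iff axis_def \<alpha>_def)

lemma A_inj: "A z = 0 \<Longrightarrow> z = 0"
proof -
  assume "A z = 0"
  then have "ddir (z, 0) T 0 = 0" using G1_0[of z] unfolding dT by (simp add: A_def G1_def zero_prod_def)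
  from inj[OF this] show "z = 0" by (simp add: zero_prod_def)
qed

lemma alpha_nz: "\<alpha> \<noteq> 0"
proof
  assume "\<alpha> = 0"
  then have "A (axis \<nu> 1) = 0" unfolding A_nu_eq by simp
  from A_inj[OF this] show False by simp
qed

text \<open>If r were 0, the image of A would lie in the line of the kernel axis, which is already
  the image of that axis, against injectivity.\<close>

lemma r_pos: "r > 0"
proof -
  obtain j where j: "j \<noteq> \<nu>" by (rule other_index)
  have "r = (\<Sum>i\<in>UNIV - {\<nu>}. (cmod (A (axis j 1) $ i))^2)" unfolding isometry N_axis[OF j] by simp
  then have ge: "r \<ge> 0" by (simp add: sum_nonneg)
  have "r \<noteq> 0"
  proof
    assume "r = 0"
    then have "(\<Sum>i\<in>UNIV - {\<nu>}. (cmod (A (axis j 1) $ i))^2) = 0" using isometry by simp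
    then have z: "A (axis j 1) $ i = 0" if "i \<noteq> \<nu>" for i using that by (simp add: sum_nonneg_eq_0_iff)
    define \<beta> where "\<beta> = A (axis j 1) $ \<nu>"
    have "A (axis j 1 + (- \<beta> / \<alpha>) *s axis \<nu> 1) = 0"
      unfolding A_add A_scale A_nu_eq using z alpha_nz by (auto simp: vec_eq_iff axis_def \<beta>_def)
    from arg_cong[OF A_inj[OF this], of "\<lambda>z. z $ j"] show False using j by (simp add: axis_def)
  qed
  with ge show ?thesis by simp
qed

text \<open>The third-order relation at u = 1 minus that at u = 0 gives the imaginary part;
  replacing z by i z gives the real part.\<close>

lemma K1_eq: "K1 z = 2 * \<i> * (\<Sum>j\<in>UNIV - {\<nu>}. A z $ j * cnj (kap j))"
proof -
  have 1: "Im (K1 z) = (\<Sum>j\<in>UNIV - {\<nu>}. 2 * Re (cnj (A z $ j) * kap j))" for z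
  proof -
    have "Im (G3 z + \<i> * of_real (c3 z) * K0 + Complex 1 (N z) * K1 z) - Im (G3 z + \<i> * of_real (c3 z) * K0 + Complex 0 (N z) * K1 z)
      = (\<Sum>j\<in>UNIV - {\<nu>}. 2 * Re (cnj (A z $ j) * (B2 j z + Complex 1 (N z) * kap j)) - 2 * Re (cnj (A z $ j) * (B2 j z + Complex 0 (N z) * kap j)))"
      using order_relations(3)[OF G1_0, of z 1] order_relations(3)[OF G1_0, of z 0] by (simp add: sum_subtractf)
    moreover have "Im (G3 z + \<i> * of_real (c3 z) * K0 + Complex 1 (N z) * K1 z) - Im (G3 z + \<i> * of_real (c3 z) * K0 + Complex 0 (N z) * K1 z) = Im (K1 z)"
      by (simp add: algebra_simps)
    moreover have "2 * Re (cnj (A z $ j) * (B2 j z + Complex 1 (N z) * kap j)) - 2 * Re (cnj (A z $ j) * (B2 j z + Complex 0 (N z) * kap j))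
      = 2 * Re (cnj (A z $ j) * kap j)" for j by (simp add: algebra_simps)
    ultimately show ?thesis by simp
  qed
  have 2: "Re (K1 z) = (\<Sum>j\<in>UNIV - {\<nu>}. 2 * Re (cnj (\<i> * A z $ j) * kap j))"
    using 1[of "\<i> *s z"] unfolding scalings A_scale by simp
  show ?thesis
  proof (rule complex_eqI)
    show "Re (K1 z) = Re (2 * \<i> * (\<Sum>j\<in>UNIV - {\<nu>}. A z $ j * cnj (kap j)))"
      unfolding 2 by (simp add: sum_distrib_left sum_negf[symmetric])
    show "Im (K1 z) = Im (2 * \<i> * (\<Sum>j\<in>UNIV - {\<nu>}. A z $ j * cnj (kap j)))"
      unfolding 1 by (simp add: sum_distrib_left algebra_simps)
  qed
qed

text \<open>The terms that carry the derivative of T in the direction of w. One half comes from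
  \<open>kap\<close> directly and the other from \<open>K1\<close> by way of \<open>K1_eq\<close>.
  They depend on z only through \<open>N z\<close> and the components of \<open>A z\<close> other
  than the one of \<open>\<nu>\<close>.\<close>

definition rest where
  "rest z = of_real (N z) * (4 * \<i> * (\<Sum>j\<in>UNIV - {\<nu>}. A z $ j * cnj (kap j)))"

text \<open>At eta z the third-order relation reads Re (eta^3 a + |eta|^2 eta b) = 0 with
  \<open>G3\<close> contained in a and all (2,1) terms in b. Validity for all complex eta forces b =
  0.\<close>

lemma bidegree_relation:
  "2 * of_real r * (cnj (z $ \<nu>) * Q1 z) + rest z
     = 2 * (\<Sum>j\<in>UNIV - {\<nu>}. cnj (A z $ j) * B2 j z) + 2 * (cnj (A z $ \<nu>) * Q2 (A z))"
proof -
  define a where "a = - \<i> * G3 z"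
  define b where "b = 2 * of_real r * (cnj (z $ \<nu>) * Q1 z) + rest z
     - 2 * (\<Sum>j\<in>UNIV - {\<nu>}. cnj (A z $ j) * B2 j z) - 2 * (cnj (A z $ \<nu>) * Q2 (A z))"
  have rel: "Re (\<eta>^3 * a + (of_real (cmod \<eta>))^2 * \<eta> * b) = 0" for \<eta> :: complex
  proof -
    define m where "m = (of_real (cmod \<eta>))^2 * \<eta>"
    have mm: "m = \<eta> * cnj \<eta> * \<eta>" unfolding m_def complex_norm_square[symmetric] by simp
    have e: "Im (G3 (\<eta> *s z) + \<i> * of_real (c3 (\<eta> *s z)) * K0 + Complex 0 (N (\<eta> *s z)) * K1 (\<eta> *s z))
     = (\<Sum>j\<in>UNIV - {\<nu>}. 2 * Re (cnj (A (\<eta> *s z) $ j) * (B2 j (\<eta> *s z) + Complex 0 (N (\<eta> *s z)) * kap j)))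
       + 2 * Re (cnj (A (\<eta> *s z) $ \<nu>) * Q2 (A (\<eta> *s z)))"
      by (rule order_relations(3)[OF G1_0])
    have l1: "Im (G3 (\<eta> *s z)) = Re (\<eta>^3 * a)" unfolding scalings a_def by simp
    have l2: "Im (\<i> * of_real (c3 (\<eta> *s z)) * K0) = Re (m * (2 * of_real r * (cnj (z $ \<nu>) * Q1 z)))"
      unfolding K0_real c3_scale m_def[symmetric] by (simp add: algebra_simps)
    have l3: "Im (Complex 0 (N (\<eta> *s z)) * K1 (\<eta> *s z)) = Re (m * (of_real (N z) * (2 * \<i> * (\<Sum>j\<in>UNIV - {\<nu>}. A z $ j * cnj (kap j)))))"
    proof -
      define S where "S = (\<Sum>j\<in>UNIV - {\<nu>}. A z $ j * cnj (kap j))"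
      show ?thesis unfolding scalings(3) N_scale K1_eq[of z] m_def S_def[symmetric] by (simp add: algebra_simps flip: of_real_power)
    qed
    have r1: "2 * Re (cnj (A (\<eta> *s z) $ j) * (B2 j (\<eta> *s z) + Complex 0 (N (\<eta> *s z)) * kap j))
       = Re (m * (2 * (cnj (A z $ j) * B2 j z))) - Re (m * (of_real (N z) * (2 * \<i> * (A z $ j * cnj (kap j)))))" for j
    proof -
      have x1: "cnj (A (\<eta> *s z) $ j) * B2 j (\<eta> *s z) = m * (cnj (A z $ j) * B2 j z)"
        unfolding scalings A_scale mm by (simp add: power2_eq_square)
      have x2: "cnj (A (\<eta> *s z) $ j) * (Complex 0 (N (\<eta> *s z)) * kap j) = cnj (m * (of_real (N z) * (- \<i> * (A z $ j * cnj (kap j)))))"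
      proof -
        have "Complex 0 (N (\<eta> *s z)) = \<i> * (\<eta> * cnj \<eta>) * of_real (N z)"
          unfolding N_scale complex_norm_square[symmetric] by (simp add: complex_eq_iff flip: of_real_power)
        then show ?thesis unfolding A_scale mm by simp
      qed
      have "Re (cnj (A (\<eta> *s z) $ j) * (B2 j (\<eta> *s z) + Complex 0 (N (\<eta> *s z)) * kap j))
         = Re (m * (cnj (A z $ j) * B2 j z)) + Re (m * (of_real (N z) * (- \<i> * (A z $ j * cnj (kap j)))))"
      proof -
        have "Re (a + cnj b) = Re a + Re b" for a b by simp
        then show ?thesis unfolding distrib_left x1 x2 by (simp only:)
      qed
      moreover have "Re (m * (of_real (N z) * (2 * \<i> * w))) = - 2 * Re (m * (of_real (N z) * (- \<i> * w)))" for w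
        by (simp add: algebra_simps)
      moreover have "Re (m * (2 * w)) = 2 * Re (m * w)" for w by (simp add: algebra_simps)
      ultimately show ?thesis by (simp only:) simp
    qed
    have r2: "2 * Re (cnj (A (\<eta> *s z) $ \<nu>) * Q2 (A (\<eta> *s z))) = Re (m * (2 * (cnj (A z $ \<nu>) * Q2 (A z))))"
      unfolding A_scale nf_rhs_scale mm by (simp add: power2_eq_square algebra_simps)
    have r1s: "(\<Sum>j\<in>UNIV - {\<nu>}. 2 * Re (cnj (A (\<eta> *s z) $ j) * (B2 j (\<eta> *s z) + Complex 0 (N (\<eta> *s z)) * kap j)))
       = Re (m * (2 * (\<Sum>j\<in>UNIV - {\<nu>}. cnj (A z $ j) * B2 j z)))
         - Re (m * (of_real (N z) * (2 * \<i> * (\<Sum>j\<in>UNIV - {\<nu>}. A z $ j * cnj (kap j)))))"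
      unfolding r1 sum_subtractf Re_sum[symmetric] sum_distrib_left ..
    have dbl: "Re (m * rest z) = 2 * Re (m * (of_real (N z) * (2 * \<i> * (\<Sum>j\<in>UNIV - {\<nu>}. A z $ j * cnj (kap j)))))"
    proof -
      have "m * rest z = 2 * (m * (of_real (N z) * (2 * \<i> * (\<Sum>j\<in>UNIV - {\<nu>}. A z $ j * cnj (kap j)))))"
        unfolding rest_def by (simp add: mult_ac)
      moreover have "Re (2 * w) = 2 * Re w" for w by simp
      ultimately show ?thesis by (simp only:)
    qed
    have "Re (m * b) = Re (m * (2 * of_real r * (cnj (z $ \<nu>) * Q1 z))) + Re (m * rest z)
      - Re (m * (2 * (\<Sum>j\<in>UNIV - {\<nu>}. cnj (A z $ j) * B2 j z))) - Re (m * (2 * (cnj (A z $ \<nu>) * Q2 (A z))))"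
      unfolding b_def by (simp add: right_diff_distrib distrib_left)
    moreover have "Im (G3 (\<eta> *s z) + \<i> * of_real (c3 (\<eta> *s z)) * K0 + Complex 0 (N (\<eta> *s z)) * K1 (\<eta> *s z))
       = Re (\<eta>^3 * a) + Re (m * (2 * of_real r * (cnj (z $ \<nu>) * Q1 z)))
        + Re (m * (of_real (N z) * (2 * \<i> * (\<Sum>j\<in>UNIV - {\<nu>}. A z $ j * cnj (kap j)))))"
      unfolding l1[symmetric] l2[symmetric] l3[symmetric] by simp
    ultimately have "Re (\<eta>^3 * a) + Re (m * b) = 0" using e r1s r2 dbl by linarith
    then show ?thesis unfolding m_def by simp
  qed
  \<comment> \<open>Four values of eta give four real linear equations for the real and imaginary
    parts of a and b.\<close>
  have 1: "Re a + Re b = 0" using rel[of 1] by simp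
  have 2: "Im a - Im b = 0" using rel[of \<i>] by (simp add: power3_eq_cube)
  have p3: "(1 + \<i>)^3 = -2 + 2 * \<i>" "(1 - \<i>)^3 = -2 - 2 * \<i>" by (simp_all add: power3_eq_cube algebra_simps)
  have n: "(of_real (cmod (1 + \<i>)))^2 = (2::complex)" "(of_real (cmod (1 - \<i>)))^2 = (2::complex)"
    unfolding of_real_power[symmetric] cmod_power2 by simp_all
  have 3: "- Re a - Im a + Re b - Im b = 0" using rel[of "1 + \<i>"] unfolding p3 n by (simp add: algebra_simps)
  have 4: "- Re a + Im a + Re b + Im b = 0" using rel[of "1 - \<i>"] unfolding p3 n by (simp add: algebra_simps)
  have "Re b = 0" "Im b = 0" using 1 2 3 4 by linarith+
  then have "b = 0" by (simp add: complex_eq_iff)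
  moreover have "x + y - u - v = 0 \<Longrightarrow> x + y = u + v" for x y u v :: complex by (simp add: algebra_simps)
  ultimately show ?thesis unfolding b_def by blast
qed

text \<open>Differentiating the relation of bidegree (2,1) with respect to the conjugate of the last coordinate
  isolates the coefficient of that conjugate.\<close>

lemma quadratic_relation: "of_real r * Q1 z = cnj \<alpha> * Q2 (A z)"
proof -
  let ?z = "\<lambda>s. z + s *s axis \<nu> 1"
  have Az: "A (?z s) = A z + (s * \<alpha>) *s axis \<nu> 1" for s
    unfolding A_add A_scale A_nu_eq by (simp add: vec_eq_iff)
  have Aj: "A (?z s) $ j = A z $ j" if "j \<noteq> \<nu>" for s j unfolding Az using that by (simp add: axis_def)
  have A\<nu>: "A (?z s) $ \<nu> = A z $ \<nu> + s * \<alpha>" for s unfolding Az by (simp add: axis_def)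
  have Nz: "N (?z s) = N z" for s unfolding N_def by (rule sum.cong) (auto simp: axis_def)
  have restz: "rest (?z s) = rest z" for s unfolding rest_def Nz by (simp add: Aj cong: sum.cong_simp)
  have bil: "nf_rhs CARD('n) c lam (x + s *s y) = nf_rhs CARD('n) c lam x + s * (2 * nfb CARD('n) c lam x y) + s^2 * nf_rhs CARD('n) c lam y"
    for c lam s and x y :: "complex^'n"
    unfolding nf_rhs_nfb[OF n2] nfb_add nfb_scale by (simp add: nfb_commute[of _ _ _ y x] power2_eq_square algebra_simps)
  define q1 where "q1 = 2 * nfb CARD('n) c1 l1 z (axis \<nu> 1)"
  define q2 where "q2 = 2 * nfb CARD('n) c2 l2 (A z) (axis \<nu> 1)"
  define d where "d j = mixed (f j) (axis \<nu> 1, 0) (z, 0)" for j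
  have B2d: "((\<lambda>s. B2 j (?z s)) has_derivative (\<lambda>h. d j * h)) (at 0)" for j
  proof -
    have "(?z s, 0) = (z, 0) + cmul s (axis \<nu> 1, 0)" for s :: complex by (simp add: cmul_def vec_eq_iff)
    then show ?thesis using lc2_derivative[OF f_cdiff[of j] V, of "(z, 0)" "(axis \<nu> 1, 0)"]
      unfolding B2_def d_def has_field_derivative_def by simp
  qed
  have zn: "(?z s) $ \<nu> = z $ \<nu> + s" for s by (simp add: axis_def)
  have rel: "2 * of_real r * ((cnj (z $ \<nu>) + cnj s) * (Q1 z + s * q1 + s^2 * Q1 (axis \<nu> 1))) + rest z
     - (2 * (\<Sum>j\<in>UNIV - {\<nu>}. cnj (A z $ j) * B2 j (?z s))
     + 2 * ((cnj (A z $ \<nu>) + cnj s * cnj \<alpha>) * (Q2 (A z) + s * \<alpha> * q2 + (s * \<alpha>)^2 * Q2 (axis \<nu> 1)))) = 0" for s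
    using bidegree_relation[of "?z s"]
    unfolding restz zn A\<nu> unfolding Az bil unfolding q1_def[symmetric] q2_def[symmetric] Az[symmetric]
    by (simp add: Aj cong: sum.cong_simp)
  let ?F = "\<lambda>s. 2 * of_real r * ((cnj (z $ \<nu>) + cnj s) * (Q1 z + s * q1 + s^2 * Q1 (axis \<nu> 1))) + rest z
     - (2 * (\<Sum>j\<in>UNIV - {\<nu>}. cnj (A z $ j) * B2 j (?z s))
     + 2 * ((cnj (A z $ \<nu>) + cnj s * cnj \<alpha>) * (Q2 (A z) + s * \<alpha> * q2 + (s * \<alpha>)^2 * Q2 (axis \<nu> 1))))"
  \<comment> \<open>The real derivative at s = 0 is X h + Y conj(h). The unknown derivatives
    \<open>d j\<close> of \<open>B2\<close> enter only X, because the factors conj(A z) in front of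
    \<open>B2\<close> do not depend on s; hence Y = 0 is free of them.\<close>
  define X where "X = 2 * of_real r * (cnj (z $ \<nu>) * q1) - 2 * (\<Sum>j\<in>UNIV - {\<nu>}. cnj (A z $ j) * d j) - 2 * (cnj (A z $ \<nu>) * \<alpha> * q2)"
  define Y where "Y = 2 * of_real r * Q1 z - 2 * cnj \<alpha> * Q2 (A z)"
  have cn: "((\<lambda>s. cnj s) has_derivative (\<lambda>h. cnj h)) (at 0)"
    by (rule bounded_linear_imp_has_derivative[OF bounded_linear_cnj])
  have "(?F has_derivative (\<lambda>h. X * h + Y * cnj h)) (at 0)"
    by (rule derivative_eq_intros cn B2d refl | simp)+
      (simp add: fun_eq_iff X_def Y_def algebra_simps sum_distrib_left)
  moreover have "?F = (\<lambda>s. 0)" using rel by (intro ext)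
  ultimately have "((\<lambda>s. 0::complex) has_derivative (\<lambda>h. X * h + Y * cnj h)) (at 0)" by simp
  from has_derivative_unique[OF this has_derivative_const]
  have "X * h + Y * cnj h = 0" for h by (simp add: fun_eq_iff)
  from this[of 1] this[of \<i>] have "X + Y = 0" "\<i> * (X - Y) = 0" by (simp_all add: algebra_simps)
  then have "Y = 0" by simp
  then show ?thesis by (simp add: Y_def)
qed

end

section \<open>Comparison of the cases and of the parameters\<close>

lemma zc_axis:
  assumes "k \<in> {1..CARD('n)}" "l \<in> {1..CARD('n)}"
  shows "zc (axis (zidx l) 1 :: complex^'n) k = (if k = l then 1 else 0)"
  unfolding zc_def axis_def using zidx_inject[OF assms] by simp

lemma admissible_bounds:
  assumes "admissible n c lam" "1 \<le> j" "j \<le> k" "k \<le> n - 1"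
  shows "lam k \<le> lam j" "0 \<le> lam k"
proof -
  show "lam k \<le> lam j" using assms unfolding admissible_def by auto
  show "0 \<le> lam k" using assms unfolding admissible_def by (auto intro: order_trans)
qed

lemma (in transition) polar_relation:
  "of_real r * nfb CARD('n) c1 l1 z z' = cnj \<alpha> * nfb CARD('n) c2 l2 (A z) (A z')"
proof -
  have q: "of_real r * nfb CARD('n) c1 l1 z z = cnj \<alpha> * nfb CARD('n) c2 l2 (A z) (A z)" for z
    using quadratic_relation[of z] unfolding nf_rhs_nfb[OF n2] .
  have "of_real r * (2 * nfb CARD('n) c1 l1 z z') = cnj \<alpha> * (2 * nfb CARD('n) c2 l2 (A z) (A z'))"
    using q[of "z + z'"] q[of z] q[of z'] unfolding A_add nfb_add
    using nfb_commute[of _ c1 l1 z' z] nfb_commute[of _ c2 l2 "A z'" "A z"] by (simp add: algebra_simps)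
  then show ?thesis by simp
qed

text \<open>Pairing with the Levi kernel direction tells the cases apart: it is zero in
  \<open>Case_ii\<close>, nonzero on the kernel itself in \<open>Case_iii\<close>, and in
  \<open>Case_i\<close> nonzero but zero on the kernel.\<close>

lemma (in transition) nfb_nu:
  "nfb CARD('n) c lam (axis \<nu> 1) z = (case c of Case_i \<Rightarrow> zc z (CARD('n) - 1) | Case_ii \<Rightarrow> 0 | Case_iii \<Rightarrow> zc z CARD('n))"
proof -
  have nn: "CARD('n) \<in> {1..CARD('n)}" using n2 by simp
  have "zc (axis \<nu> 1 :: complex^'n) k = 0" if "k \<in> {1..CARD('n) - 1}" for k
    using zc_axis[OF _ nn, of k] that by auto
  moreover have "zc (axis \<nu> 1 :: complex^'n) CARD('n) = 1" using zc_axis[OF nn nn] by simp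
  moreover have "CARD('n) - 1 \<in> {1..CARD('n) - 1}" using n2 by simp
  ultimately show ?thesis unfolding nfb_eq[OF n2] by (cases c) simp_all
qed

lemma (in transition) nu_relation:
  "of_real r * nfb CARD('n) c1 l1 (axis \<nu> 1) z = of_real ((cmod \<alpha>)^2) * nfb CARD('n) c2 l2 (axis \<nu> 1) (A z)"
  using polar_relation[of "axis \<nu> 1" z] unfolding A_nu_eq nfb_scale
  unfolding complex_norm_square by (simp only: mult_ac)

text \<open>Both sides of \<open>nu_relation\<close> carry positive factors, so its vanishing
  behaviour is invariant. The second claim is one-sided; the transition in the opposite direction
  completes it in \<open>normal_form_unique\<close>.\<close>

lemma (in transition) case_relations:
  "c1 = Case_iii \<longleftrightarrow> c2 = Case_iii" "c1 = Case_i \<Longrightarrow> c2 \<noteq> Case_ii"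
proof -
  have nn: "CARD('n) \<in> {1..CARD('n)}" and mm: "CARD('n) - 1 \<in> {1..CARD('n)}" and ne: "CARD('n) - 1 \<noteq> CARD('n)" using n2 by auto
  have z1: "zc (axis \<nu> 1 :: complex^'n) CARD('n) = 1" "zc (axis \<nu> 1 :: complex^'n) (CARD('n) - 1) = 0"
    unfolding zc_axis[OF nn nn] zc_axis[OF mm nn] using ne by simp_all
  have "nfb CARD('n) c lam (axis \<nu> 1) (axis \<nu> 1 :: complex^'n) = (if c = Case_iii then 1 else 0)" for c lam
    unfolding nfb_nu using z1 by (cases c) simp_all
  then show "c1 = Case_iii \<longleftrightarrow> c2 = Case_iii"
    using nu_relation[of "axis \<nu> 1"] r_pos alpha_nz unfolding A_nu_eq nfb_scale by (auto split: if_splits)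
  assume c1: "c1 = Case_i"
  show "c2 \<noteq> Case_ii"
  proof
    assume c2: "c2 = Case_ii"
    have "zc (axis (zidx (CARD('n) - 1)) 1 :: complex^'n) (CARD('n) - 1) = 1" using zc_axis[OF mm mm] by simp
    then show False using nu_relation[of "axis (zidx (CARD('n) - 1)) 1"] r_pos unfolding nfb_nu c1 c2 by simp
  qed
qed

lemma (in transition) A_sum: "A (\<Sum>i\<in>I. h i) = (\<Sum>i\<in>I. A (h i))"
proof (induction I rule: infinite_finite_induct)
  case empty
  show ?case using A_scale[of 0 0] by simp
next
  case (infinite I)
  then show ?case using A_scale[of 0 0] by simp
qed (simp add: A_add)

text \<open>Both forms are restricted to the span of the first m axes. In \<open>Case_i\<close> and
  \<open>Case_iii\<close> \<open>nu_relation\<close> shows that A maps it to vectors whose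
  coordinate n - 1 or n vanishes, respectively. The terms in z^n that distinguish the cases then
  disappear, both forms are diagonal, and \<open>singular_values_unique\<close> applies.\<close>

lemma (in transition) lam_proportional:
  assumes c: "c1 = c" "c2 = c" and adm: "admissible CARD('n) c l1" "admissible CARD('n) c l2"
    and m: "m = (if c = Case_i then CARD('n) - 2 else CARD('n) - 1)" and j: "j \<in> {1..m}"
  shows "l1 j = cmod \<alpha> * l2 j"
proof -
  define a where "a k l = zc (A (axis (zidx l) 1)) k" for k l
  define Z where "Z x = (\<Sum>l=1..m. x l *s axis (zidx l) 1 :: complex^'n)" for x :: "nat \<Rightarrow> complex"
  have mn: "m \<le> CARD('n) - 1" "m < CARD('n)" using m n2 by auto
  have nn: "CARD('n) \<in> {1..CARD('n)}" using n2 by simp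
  have ZA: "zc (A (Z x)) k = (\<Sum>l=1..m. a k l * x l)" for x k
    unfolding Z_def A_sum A_scale a_def zc_def by (simp add: mult.commute)
  have Zx: "zc (Z x) k = (if k \<in> {1..m} then x k else 0)" if "k \<in> {1..CARD('n)}" for x k
  proof -
    have "zc (Z x) k = (\<Sum>l=1..m. x l * zc (axis (zidx l) 1 :: complex^'n) k)" unfolding Z_def zc_def by simp
    also have "\<dots> = (\<Sum>l=1..m. if l = k then x k else 0)"
      using that mn by (intro sum.cong) (auto simp: zc_axis)
    finally show ?thesis by simp
  qed
  have Zn: "zc (Z x) CARD('n) = 0" for x using Zx[OF nn] mn by simp
  have A_last: "zc (A (Z x)) CARD('n) = 0" if "c = Case_iii" for x
    using nu_relation[of "Z x"] alpha_nz unfolding nfb_nu c that by (simp add: Zn)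
  have A_pre: "zc (A (Z x)) (CARD('n) - 1) = 0" "m = CARD('n) - 2" if "c = Case_i" for x
  proof -
    show "m = CARD('n) - 2" using m that by simp
    then have "zc (Z x) (CARD('n) - 1) = 0" using Zx[of "CARD('n) - 1" x] n2 by simp
    then show "zc (A (Z x)) (CARD('n) - 1) = 0"
      using nu_relation[of "Z x"] alpha_nz unfolding nfb_nu c that by simp
  qed
  have shrink: "(\<Sum>k=1..CARD('n)-1. h k) = (\<Sum>k=1..m. h k)" if "c = Case_i \<Longrightarrow> h (CARD('n) - 1) = 0" for h :: "nat \<Rightarrow> 'b::comm_monoid_add"
  proof (rule sum.mono_neutral_right)
    show "\<forall>i\<in>{1..CARD('n)-1} - {1..m}. h i = 0"
    proof
      fix i assume i: "i \<in> {1..CARD('n)-1} - {1..m}"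
      then have "c = Case_i" "i = CARD('n) - 1" using m by (auto split: if_splits)
      then show "h i = 0" using that by simp
    qed
  qed (use mn in auto)
  have iso: "(\<Sum>k=1..m. (cmod (\<Sum>l=1..m. a k l * x l))^2) = s * (\<Sum>k=1..m. (cmod (x k))^2)" if "s = r" for x s
  proof -
    have "(\<Sum>k=1..CARD('n)-1. (cmod (zc (A (Z x)) k))^2) = r * (\<Sum>k=1..CARD('n)-1. (cmod (zc (Z x) k))^2)"
      using isometry[of "Z x"] unfolding N_def sum_zidx_but_last zc_def .
    moreover have "(\<Sum>k=1..CARD('n)-1. (cmod (zc (A (Z x)) k))^2) = (\<Sum>k=1..m. (cmod (zc (A (Z x)) k))^2)"
      by (rule shrink) (simp add: A_pre del: One_nat_def)
    moreover have "(\<Sum>k=1..CARD('n)-1. (cmod (zc (Z x) k))^2) = (\<Sum>k=1..m. (cmod (x k))^2)"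
      by (rule sum.mono_neutral_cong_right) (use mn in \<open>auto simp: Zx\<close>)
    ultimately show ?thesis unfolding ZA that by simp
  qed
  have form: "of_real r * (\<Sum>k=1..m. of_real (l1 k) * x k * y k)
      = cnj \<alpha> * (\<Sum>k=1..m. of_real (l2 k) * (\<Sum>l=1..m. a k l * x l) * (\<Sum>l=1..m. a k l * y l))" for x y
  proof -
    have "nfb CARD('n) c1 l1 (Z x) (Z y) = (\<Sum>k=1..CARD('n)-1. of_real (l1 k) * zc (Z x) k * zc (Z y) k)"
      unfolding nfb_eq[OF n2] by (cases c1) (simp_all add: Zn)
    also have "\<dots> = (\<Sum>k=1..m. of_real (l1 k) * x k * y k)"
      by (rule sum.mono_neutral_cong_right) (use mn in \<open>auto simp: Zx\<close>)
    finally have 1: "nfb CARD('n) c1 l1 (Z x) (Z y) = (\<Sum>k=1..m. of_real (l1 k) * x k * y k)" .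
    have "nfb CARD('n) c2 l2 (A (Z x)) (A (Z y)) = (\<Sum>k=1..CARD('n)-1. of_real (l2 k) * zc (A (Z x)) k * zc (A (Z y)) k)"
      unfolding nfb_eq[OF n2] c using A_last A_pre(1) by (cases c) simp_all
    also have "\<dots> = (\<Sum>k=1..m. of_real (l2 k) * zc (A (Z x)) k * zc (A (Z y)) k)"
      by (rule shrink) (simp add: A_pre del: One_nat_def)
    finally show ?thesis using polar_relation[of "Z x" "Z y"] unfolding 1 ZA by simp
  qed
  show ?thesis
  proof (rule singular_values_unique[where a = a and m = m and r = r, OF r_pos iso[OF refl] form _ _ _ _ j])
    show "0 \<le> l1 k" "0 \<le> l2 k" if "k \<in> {1..m}" for k
      using admissible_bounds(2)[OF adm(1), of 1 k] admissible_bounds(2)[OF adm(2), of 1 k] that mn by auto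
    show "l1 k \<le> l1 i" "l2 k \<le> l2 i" if "1 \<le> i" "i \<le> k" "k \<le> m" for i k
      using admissible_bounds(1)[OF adm(1), of i k] admissible_bounds(1)[OF adm(2), of i k] that mn by auto
  qed
qed

text \<open>Two nonzero lists both start with 1, which makes the proportionality factor 1; as the
  factor is positive, one list is zero only together with the other.\<close>

lemma (in transition) lam_unique:
  assumes c: "c1 = c2" and adm: "admissible CARD('n) c1 l1" "admissible CARD('n) c2 l2"
  shows "l1 = l2"
proof -
  define m where "m = (if c1 = Case_i then CARD('n) - 2 else CARD('n) - 1)"
  have p: "l1 j = cmod \<alpha> * l2 j" if "j \<in> {1..m}" for j
    using lam_proportional[OF refl c[symmetric] adm(1) _ m_def that] adm(2) c by simp
  have out: "l1 j = 0" "l2 j = 0" if "j \<notin> {1..m}" for j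
  proof -
    have z: "lam j = 0" if "admissible CARD('n) c1 lam" for lam
    proof (cases "j \<in> {1..CARD('n) - 1}")
      case True
      with \<open>j \<notin> {1..m}\<close> have "c1 = Case_i" "j = CARD('n) - 1" unfolding m_def by (auto split: if_splits)
      then show ?thesis using that unfolding admissible_def by (elim conjE disjE) simp_all
    next
      case False
      then show ?thesis using that unfolding admissible_def by blast
    qed
    show "l1 j = 0" "l2 j = 0" using z adm c by simp_all
  qed
  have a: "cmod \<alpha> > 0" using alpha_nz by simp
  have one: "1 \<in> {1..m}" if "l1 1 = 1 \<or> l2 1 = 1"
    using out[of 1] that by (cases "1 \<in> {1..m}") (simp_all only: zero_neq_one simp_thms)
  show ?thesis
  proof (cases "l1 = (\<lambda>k. 0) \<or> l2 = (\<lambda>k. 0)")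
    case True
    have "l1 k = l2 k" for k
    proof (cases "k \<in> {1..m}")
      case k: True
      then show ?thesis using p[OF k] a True by auto
    qed (simp add: out)
    then show ?thesis by auto
  next
    case False
    then have "l1 1 = 1" "l2 1 = 1" using adm unfolding admissible_def by auto
    then have "cmod \<alpha> = 1" using p[of 1] one by simp
    then have "l1 k = l2 k" for k using p[of k] out[of k] by (cases "k \<in> {1..m}") auto
    then show ?thesis by auto
  qed
qed

section \<open>The coordinate change between two normal forms, and the conclusion\<close>

lemma holo_on_continuous: assumes "holo_on U \<Phi>" shows "continuous_on U \<Phi>"
proof (rule continuous_at_imp_continuous_on, rule ballI)
  fix x assume "x \<in> U"
  then obtain D where "(\<Phi> has_derivative D) (at x)" using assms unfolding holo_on_def by blast
  then show "isCont \<Phi> x" by (rule has_derivative_continuous)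
qed

text \<open>T is the second chart after the inverse of the first, on the points of the first image
  whose preimages lie in the second chart domain.\<close>

lemma transition_exists:
  fixes M :: "((complex^'n) \<times> complex) set"
  assumes n: "CARD('n) \<ge> 2" and h1: "has_normal_form M p0 c1 l1" and h2: "has_normal_form M p0 c2 l2"
  shows "\<exists>V T F1 F2 W1 W2. transition V T c1 c2 l1 l2 F1 F2 W1 (W2 :: ((complex^'n) \<times> real) set)"
proof -
  obtain U1 V1 \<Phi>1 W1 F1 where 1: "p0 \<in> U1" "biholo \<Phi>1 U1 V1" "\<Phi>1 p0 = 0" "open W1" "0 \<in> W1" "smooth_on W1 F1"
    "weighted_order_ge4 F1" "\<Phi>1 ` (M \<inter> U1) = {q\<in>V1. normal_form_eq CARD('n) c1 l1 F1 q}"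
    using h1 unfolding has_normal_form_def by blast
  obtain U2 V2 \<Phi>2 W2 F2 where 2: "p0 \<in> U2" "biholo \<Phi>2 U2 V2" "\<Phi>2 p0 = 0" "open W2" "0 \<in> W2" "smooth_on W2 F2"
    "weighted_order_ge4 F2" "\<Phi>2 ` (M \<inter> U2) = {q\<in>V2. normal_form_eq CARD('n) c2 l2 F2 q}"
    using h2 unfolding has_normal_form_def by blast
  obtain \<Psi>1 where P1: "open U1" "open V1" "holo_on U1 \<Phi>1" "\<Phi>1 ` U1 = V1" "holo_on V1 \<Psi>1" "\<And>x. x \<in> U1 \<Longrightarrow> \<Psi>1 (\<Phi>1 x) = x"
    using 1(2) unfolding biholo_def by blast
  obtain \<Psi>2 where P2: "open U2" "open V2" "holo_on U2 \<Phi>2" "\<Phi>2 ` U2 = V2" "holo_on V2 \<Psi>2" "\<And>x. x \<in> U2 \<Longrightarrow> \<Psi>2 (\<Phi>2 x) = x"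
    using 2(2) unfolding biholo_def by blast
  define V where "V = V1 \<inter> \<Psi>1 -` U2"
  define T where "T q = \<Phi>2 (\<Psi>1 q)" for q
  have \<Psi>0: "\<Psi>1 0 = p0" "\<Psi>2 0 = p0" using P1(6)[OF 1(1)] P2(6)[OF 2(1)] 1(3) 2(3) by simp_all
  have V01: "0 \<in> V1" "0 \<in> V2" using P1(4) P2(4) 1(1,3) 2(1,3) by (metis imageI)+
  have V: "open V" "0 \<in> V"
    unfolding V_def using continuous_open_preimage[OF holo_on_continuous[OF P1(5)] P1(2) P2(1)] V01(1) \<Psi>0 2(1) by auto
  have hol: "holo_on V T"
    unfolding holo_on_def
  proof
    fix x assume x: "x \<in> V"
    obtain D where D: "(\<Psi>1 has_derivative D) (at x)" "\<And>v. D (cmul \<i> v) = cmul \<i> (D v)"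
      using P1(5) x unfolding holo_on_def V_def by blast
    obtain E where E: "(\<Phi>2 has_derivative E) (at (\<Psi>1 x))" "\<And>v. E (cmul \<i> v) = cmul \<i> (E v)"
      using P2(3) x unfolding holo_on_def V_def by blast
    have "(T has_derivative (\<lambda>v. E (D v))) (at x)" using diff_chain_at[OF D(1) E(1)] by (simp add: T_def[abs_def] o_def)
    then show "\<exists>D. (T has_derivative D) (at x) \<and> (\<forall>v. D (cmul \<i> v) = cmul \<i> (D v))" 
      by (intro exI[of _ "\<lambda>v. E (D v)"] conjI allI) (simp_all only: D(2) E(2))
  qed
  have T0: "T 0 = 0" by (simp add: T_def \<Psi>0 2(3))
  have inj: "v = 0" if v: "ddir v T 0 = 0" for v
  proof -
    obtain DT where DT: "(T has_derivative DT) (at 0)" using hol V(2) unfolding holo_on_def by blast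
    obtain D where D: "(\<Psi>2 has_derivative D) (at (T 0))" using P2(5) V01(2) T0 unfolding holo_on_def by auto
    obtain E where E: "(\<Phi>1 has_derivative E) (at (\<Psi>2 (T 0)))" using P1(3) 1(1) \<Psi>0 T0 unfolding holo_on_def by auto
    \<comment> \<open>\<open>\<Phi>1\<close> after \<open>\<Psi>2\<close> is a left inverse of T
      near 0, so the chain rule gives a left inverse of the differential.\<close>
    have "((\<lambda>q. \<Phi>1 (\<Psi>2 (T q))) has_derivative (\<lambda>v. E (D (DT v)))) (at 0)"
      using diff_chain_at[OF diff_chain_at[OF DT D]] E by (simp add: o_def)
    moreover have id: "\<Phi>1 (\<Psi>2 (T q)) = q" if qV: "q \<in> V" for q
    proof -
      have "q \<in> \<Phi>1 ` U1" using qV P1(4) by (simp add: V_def)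
      then obtain x where x: "x \<in> U1" "q = \<Phi>1 x" by blast
      then have "x \<in> U2" using qV P1(6) by (auto simp: V_def)
      then show ?thesis using x P1(6) P2(6) by (simp add: T_def)
    qed
    ultimately have "((\<lambda>q. q) has_derivative (\<lambda>v. E (D (DT v)))) (at 0)"
      using has_derivative_transform_within_open[OF _ V, of "\<lambda>q. \<Phi>1 (\<Psi>2 (T q))" _ UNIV "\<lambda>q. q"] by auto
    from has_derivative_unique[OF this has_derivative_ident] have "E (D (DT v)) = v" by (rule fun_cong)
    moreover have "DT v = 0" using v ddir_eqI[OF DT] by simp
    ultimately show ?thesis
      using linear_0[OF has_derivative_linear[OF D]] linear_0[OF has_derivative_linear[OF E]] by simp
  qed
  have eq: "normal_form_eq CARD('n) c2 l2 F2 (T q)" if q: "q \<in> V" "normal_form_eq CARD('n) c1 l1 F1 q" for q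
  proof -
    have "q \<in> \<Phi>1 ` (M \<inter> U1)" using q 1(8) by (auto simp: V_def)
    then obtain x where x: "x \<in> M" "x \<in> U1" "q = \<Phi>1 x" by auto
    then have "x \<in> U2" "T q = \<Phi>2 x" using q(1) P1(6) by (auto simp: V_def T_def)
    then have "T q \<in> \<Phi>2 ` (M \<inter> U2)" using x by auto
    then show ?thesis using 2(8) by auto
  qed
  have "transition V T c1 c2 l1 l2 F1 F2 W1 W2"
    by (rule transition.intro[OF n V hol T0]) (fact inj 1 2 eq)+
  then show ?thesis by blast
qed

lemma normal_form_unique:
  fixes M :: "((complex^'n) \<times> complex) set"
  assumes n: "CARD('n) \<ge> 2" and h1: "has_normal_form M p0 c1 l1" and h2: "has_normal_form M p0 c2 l2"
    and adm: "admissible CARD('n) c1 l1" "admissible CARD('n) c2 l2"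
  shows "c1 = c2 \<and> l1 = l2"
proof -
  obtain V T F1 F2 W1 W2 where t: "transition V T c1 c2 l1 l2 F1 F2 W1 (W2 :: ((complex^'n) \<times> real) set)"
    using transition_exists[OF n h1 h2] by blast
  obtain V' T' F1' F2' W1' W2' where t': "transition V' T' c2 c1 l2 l1 F1' F2' W1' (W2' :: ((complex^'n) \<times> real) set)"
    using transition_exists[OF n h2 h1] by blast
  have "c1 = c2"
    using transition.case_relations[OF t] transition.case_relations[OF t'] by (cases c1; cases c2) auto
  then show ?thesis using transition.lam_unique[OF t _ adm] by blast
qed

theorem theorem1p2p10:
  fixes M :: "((complex^'n) \<times> complex) set" and p0 :: "(complex^'n) \<times> complex"
  assumes "CARD('n) \<ge> 2"
    and "real_hypersurface M"
    and "p0 \<in> M"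
    and "\<exists>U \<rho>. local_defining_fn M p0 U \<rho> \<and> levi_rank \<rho> p0 = CARD('n) - 1 \<and> levi_semidefinite \<rho> p0"
  shows "\<exists>!cl :: nf_case \<times> (nat \<Rightarrow> real).
           admissible CARD('n) (fst cl) (snd cl) \<and> has_normal_form M p0 (fst cl) (snd cl)"
proof (rule ex_ex1I)
  obtain U \<rho> where "local_defining_fn M p0 U \<rho>" "levi_rank \<rho> p0 = CARD('n) - 1" "levi_semidefinite \<rho> p0"
    using assms(4) by blast
  then obtain c lam where "admissible CARD('n) c lam" "has_normal_form M p0 c lam"
    using existence[OF assms(1) _ assms(3)] by blast
  then show "\<exists>cl. admissible CARD('n) (fst cl) (snd cl) \<and> has_normal_form M p0 (fst cl) (snd cl)"
    by (intro exI[of _ "(c, lam)"]) simp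
next
  fix cl cl' :: "nf_case \<times> (nat \<Rightarrow> real)"
  assume "admissible CARD('n) (fst cl) (snd cl) \<and> has_normal_form M p0 (fst cl) (snd cl)"
    "admissible CARD('n) (fst cl') (snd cl') \<and> has_normal_form M p0 (fst cl') (snd cl')"
  then show "cl = cl'"
    using normal_form_unique[OF assms(1), of M p0 "fst cl" "snd cl" "fst cl'" "snd cl'"] prod_eqI by blast
qed

end
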